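(* Let $(N,\tau)$ be a sufficient pair of constants, and let $z=(z_1,\dots,z_n)\in(\mathbb C^* )^n$ be such that $\psi(z)=-\sum_{i=1}^n\log|z_i|\,\alpha_i$ is $\mathcal{FL}(\mathfrak A)_\tau$-regular. Then for any $F\in\mathcal{FL}(\mathfrak A,\psi(z))$ and any holomorphic function $\phi$ on $U(F,N)$, $$\sum_{u\in O(z,\mathfrak A)\cap U(F,N)}\phi(u)=\frac{\nu(F)}{(2\pi\sqrt{-1})^r}\sum_{\lambda\in\mathfrak a_{\mathbb Z}}\left(\int_{h(F)}\frac{\phi}{p_\lambda}\,\frac{dp_1}{p_1}\wedge\cdots\wedge\frac{dp_r}{p_r}\right)z^\lambda,$$ and the series on the right is absolutely convergent for all such $z$.
   Context: **Data.** $0\to\mathfrak a\to\mathfrak g\xrightarrow{\pi}\mathfrak t\to0$ is an exact sequence of real vector spaces of dimensions $r,n,d$; $\mathfrak g=\bigoplus_{i=1}^n\mathbb R\omega_i$ with lattice $\mathfrak g_{\mathbb Z}=\bigoplus\mathbb Z\omega_i$, $\mathfrak t_{\mathbb Z}=\pi(\mathfrak g_{\mathbb Z})$ a lattice of full rank, $\mathfrak a_{\mathbb Z}=\mathfrak a\cap\mathfrak g_{\mathbb Z}$. $\mathfrak A=[\alpha_1,\dots,\alpha_n]\subset\mathfrak a^*$, where $\alpha_i$ is the restriction of the $i$-th coordinate of $\mathfrak g$ to $\mathfrak a$; $\mathfrak A$ is projective, i.e. contained in an open half-space. $\kappa_{\mathfrak A}=\sum_i\alpha_i$. $U(\mathfrak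 A)=\{u\in\mathfrak a_{\mathbb C}:\alpha_i(u)\ne0\ \forall i\}$. For $\lambda\in\mathfrak a_{\mathbb Z}$: $p_\lambda(u)=\prod_i\alpha_i(u)^{\langle\alpha_i,\lambda\rangle}$, $z^\lambda=\prod_iz_i^{\langle\alpha_i,\lambda\rangle}$. $O(z,\mathfrak A)=\{u\in U(\mathfrak A):p_\lambda(u)=z^\lambda\ \forall\lambda\in\mathfrak a_{\mathbb Z}\}$. Fix an orientation of $\mathfrak a$ and an oriented $\mathbb Z$-basis $\boldsymbol\lambda=[\lambda_1,\dots,\lambda_r]$ of $\mathfrak a_{\mathbb Z}$; $p_j=p_{\lambda_j}$, $p_{\boldsymbol\lambda}=(p_1,\dots,p_r):U(\mathfrak A)\to(\mathbb C^* )^r$; $d\mathrm{vol}=d\gamma_1\wedge\dots\wedge d\gamma_r$ where $[\gamma_j]$ is the dual basis of $\boldsymbol\lambda$. $\Psi:U(\mathfrak A)\to\mathfrak a^*$, $\Psi(u)=-\sum_i\log|\alpha_i(u)|\,\alpha_i$; $Z(\xi)=\Psi^{-1}(\xi)$. **Flags.** $\mathcal{FL}(\mathfrak A)$ is the finite set of complete flags $F=[0=F_0\subset F_1\subset\dots\subset F_r=\mathfrak a^*]$, $\dim F_j=j$, such that the elements of $\mathfrak A$ in $F_j$ span $F_j$ for all $j$. $\kappa^F_j=\sum\{\alpha_i:\alpha_i\in F_j\}$. $F$ is proper if $\kappa^F_1,\dots,\kappa^F_r$ are linearly independent; then $\nu(F)=\pm1$ according to whether $[\kappa^F_1,\dots,\kappa^F_r]$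 is positively oriented or not. $\mathcal{FL}(\mathfrak A,\xi)$ is the set of $F$ with $\xi\in\sum_{j=1}^{r-1}\mathbb R^{\ge0}\kappa^F_j+\mathbb R\kappa_{\mathfrak A}$. For $\tau>0$, $\xi$ is $\mathcal{FL}(\mathfrak A)_\tau$-regular if for any $F\in\mathcal{FL}(\mathfrak A,\xi)$, in any expression $\xi=\sum_{j=1}^rm_j\kappa^F_j$ one has $\min_{1\le j\le r-1}m_j>\tau$ (then every flag in $\mathcal{FL}(\mathfrak A,\xi)$ is proper). $\mathfrak a^*_{[\tau]}$ is the set of such $\xi$. **Sets $U(F,N)$ and cycles.** For each $F$ fix an ordered basis $(\gamma^F_1,\dots,\gamma^F_r)$ of $\mathfrak a^*$ with $F_j=\bigoplus_{k\le j}\mathbb R\gamma^F_k$ and $d\gamma^F_1\wedge\dots\wedge d\gamma^F_r=d\mathrm{vol}$; write $u_j=\langle\gamma^F_j,u\rangle$. $U(F,N)=\{u\in\mathfrak a_{\mathbb C}:0<N|u_j|<|u_{j+1}|,\ j=1,\dots,r-1\}$ (with all $u_j\neq 0$). For $N$ large with $U(F,N)\subset U(\mathfrak A)$, $h(F)$ is the homology class of the torus $\{|u_j|=\epsilon_j,\ j=1,\dots,r\}\subset U(F,N)$ ($N\epsilon_j<\epsilon_{j+1}$), oriented by $d\arg u_1\wedge\dots\wedge d\arg u_r$; integrals of holomorphic $r$-forms over $h(F)$ mean integrals over this torus. **Sufficient pair.** $(N,\tau)$ is sufficient if: (a) the sets $U(F,N)$, $F\in\mathcal{FL}(\mathfrak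 A)$, are disjoint, contained in $U(\mathfrak A)$, and $\kappa_{\mathfrak A}$ does not vanish on them; (b) for each proper $F$, $p_{\boldsymbol\lambda}$ restricted to $U(F,N)$ is non-singular (invertible differential); (c) $\Psi^{-1}(K)$ is compact for every compact $K\subset\mathfrak a^*_{[\tau]}$; (d) $Z(\xi)\subset\bigcup_{F\in\mathcal{FL}(\mathfrak A,\xi)}U(F,N)$ for all $\xi\in\mathfrak a^*_{[\tau]}$. (For large $N$, and then $\tau$ large depending on $N$, the pair is sufficient.) *)

theory Defs
  imports "HOL-Analysis.Analysis"
begin

section \<open>Lattices and the exact sequence\<close>

definition short_exact :: "('a::real_vector \<Rightarrow> 'b::real_vector) \<Rightarrow> ('b \<Rightarrow> 'c::real_vector) \<Rightarrow> bool" where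
  "short_exact \<iota> pr \<longleftrightarrow>
     linear \<iota> \<and> inj \<iota> \<and> linear pr \<and> surj pr \<and> range \<iota> = {x. pr x = 0}"

definition std_lattice :: "(real ^ 'n) set" where
  "std_lattice = {x. \<forall>i. x $ i \<in> \<int>}"

definition full_rank_lattice :: "'t::real_vector set \<Rightarrow> bool" where
  "full_rank_lattice L \<longleftrightarrow>
     (\<exists>B. finite B \<and> independent B \<and> span B = UNIV \<and>
          L = {\<Sum>b\<in>B. of_int (m b) *\<^sub>R b | m :: 't \<Rightarrow> int. True})"

definition sublattice :: "('a::real_vector \<Rightarrow> real ^ 'n) \<Rightarrow> 'a set" where
  "sublattice \<iota> = {x. \<iota> x \<in> std_lattice}"

definition int_basis :: "nat \<Rightarrow> (nat \<Rightarrow> 'a::real_vector) \<Rightarrow> 'a set \<Rightarrow> bool" where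
  "int_basis r b L \<longleftrightarrow>
     bij_betw (\<lambda>m :: nat \<Rightarrow> int. \<Sum>j\<in>{1..r}. of_int (m j) *\<^sub>R b j) ({1..r} \<rightarrow>\<^sub>E UNIV) L"


section \<open>Dual space, complexification and exterior products\<close>

type_synonym 'a dual = "'a \<Rightarrow>\<^sub>L real"

text \<open>The pair \<open>(x, y)\<close> stands for the element \<open>x + \<i> y\<close> of the complexification.\<close>

type_synonym 'a cplx = "'a \<times> 'a"

definition mult_i :: "'a::real_vector cplx \<Rightarrow> 'a cplx" where
  "mult_i u = (- snd u, fst u)"

definition cpair :: "'a::real_normed_vector dual \<Rightarrow> 'a cplx \<Rightarrow> complex" where
  "cpair \<gamma> u = Complex (\<gamma> (fst u)) (\<gamma> (snd u))"

definition holomorphic_cplx ::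
    "('a::real_normed_vector cplx \<Rightarrow> complex) \<Rightarrow> 'a cplx set \<Rightarrow> bool" where
  "holomorphic_cplx f S \<longleftrightarrow>
     (\<forall>u\<in>S. \<exists>D. (f has_derivative D) (at u) \<and> (\<forall>v. D (mult_i v) = \<i> * D v))"

text \<open>\<open>wedge r \<eta> v\<close> is the value of \<open>\<eta>\<^sub>1 \<and> \<dots> \<and> \<eta>\<^sub>r\<close> on \<open>(v\<^sub>1, \<dots>, v\<^sub>r)\<close>.\<close>

definition wedge :: "nat \<Rightarrow> (nat \<Rightarrow> 'v \<Rightarrow> 'k::comm_ring_1) \<Rightarrow> (nat \<Rightarrow> 'v) \<Rightarrow> 'k" where
  "wedge r \<eta> v = (\<Sum>p | p permutes {1..r}. of_int (sign p) * (\<Prod>j\<in>{1..r}. \<eta> j (v (p j))))"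

text \<open>The coordinate functions \<open>representation\<close> of the basis \<open>lam\<close> are its dual basis.\<close>

definition dvol :: "(nat \<Rightarrow> 'a::euclidean_space) \<Rightarrow> (nat \<Rightarrow> 'a) \<Rightarrow> real" where
  "dvol lam = wedge DIM('a) (\<lambda>j x. representation (lam ` {1..DIM('a)}) x (lam j))"

text \<open>The dual space carries the orientation dual to the one in which \<open>lam\<close> is positive.\<close>

definition pos_oriented :: "(nat \<Rightarrow> 'a::euclidean_space) \<Rightarrow> (nat \<Rightarrow> 'a dual) \<Rightarrow> bool" where
  "pos_oriented lam \<gamma> \<longleftrightarrow>
     (\<exists>c>0. \<forall>v. wedge DIM('a) (\<lambda>j. blinfun_apply (\<gamma> j)) v = c * dvol lam v)"


section \<open>The arrangement and its flags\<close>

text \<open>The sequence \<open>\<AA>\<close> is an indexed family, so repeated vectors count with multiplicity.\<close>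

definition projective :: "('n::finite \<Rightarrow> 'a::euclidean_space dual) \<Rightarrow> bool" where
  "projective A \<longleftrightarrow> (\<exists>x. \<forall>i. A i x > 0)"

definition kappa_all :: "('n::finite \<Rightarrow> 'a::euclidean_space dual) \<Rightarrow> 'a dual" where
  "kappa_all A = (\<Sum>i\<in>UNIV. A i)"

definition U_set :: "('n::finite \<Rightarrow> 'a::euclidean_space dual) \<Rightarrow> 'a cplx set" where
  "U_set A = {u. \<forall>i. cpair (A i) u \<noteq> 0}"

text \<open>A flag \<open>F\<^sub>0, \<dots>, F\<^sub>r\<close> is a function fixed to be \<open>undefined\<close> beyond \<open>r\<close>, so that distinct
  functions are distinct flags.\<close>

definition flags :: "('n::finite \<Rightarrow> 'a::euclidean_space dual) \<Rightarrow> (nat \<Rightarrow> 'a dual set) set" where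
  "flags A = {F. F \<in> extensional {0..DIM('a)} \<and>
     F 0 = {0} \<and> F DIM('a) = UNIV \<and>
     (\<forall>j<DIM('a). F j \<subset> F (Suc j)) \<and>
     (\<forall>j\<le>DIM('a). subspace (F j) \<and> dim (F j) = j \<and> span (range A \<inter> F j) = F j)}"

definition kappa ::
    "('n::finite \<Rightarrow> 'a::euclidean_space dual) \<Rightarrow> (nat \<Rightarrow> 'a dual set) \<Rightarrow> nat \<Rightarrow> 'a dual" where
  "kappa A F j = (\<Sum>i | A i \<in> F j. A i)"

definition proper_flag ::
    "('n::finite \<Rightarrow> 'a::euclidean_space dual) \<Rightarrow> (nat \<Rightarrow> 'a dual set) \<Rightarrow> bool" where
  "proper_flag A F \<longleftrightarrow>
     inj_on (kappa A F) {1..DIM('a)} \<and> independent (kappa A F ` {1..DIM('a)})"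

text \<open>Only meaningful for proper flags.\<close>

definition nu ::
    "('n::finite \<Rightarrow> 'a::euclidean_space dual) \<Rightarrow> (nat \<Rightarrow> 'a) \<Rightarrow> (nat \<Rightarrow> 'a dual set) \<Rightarrow> int" where
  "nu A lam F = (if pos_oriented lam (kappa A F) then 1 else -1)"

definition flags_at ::
    "('n::finite \<Rightarrow> 'a::euclidean_space dual) \<Rightarrow> 'a dual \<Rightarrow> (nat \<Rightarrow> 'a dual set) set" where
  "flags_at A \<xi> = {F \<in> flags A. \<exists>(m :: nat \<Rightarrow> real) t.
     (\<forall>j\<in>{1..<DIM('a)}. m j \<ge> 0) \<and>
     \<xi> = (\<Sum>j\<in>{1..<DIM('a)}. m j *\<^sub>R kappa A F j) + t *\<^sub>R kappa_all A}"

definition tau_regular ::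
    "('n::finite \<Rightarrow> 'a::euclidean_space dual) \<Rightarrow> real \<Rightarrow> 'a dual \<Rightarrow> bool" where
  "tau_regular A \<tau> \<xi> \<longleftrightarrow>
     (\<forall>F\<in>flags_at A \<xi>. \<forall>m :: nat \<Rightarrow> real.
        \<xi> = (\<Sum>j\<in>{1..DIM('a)}. m j *\<^sub>R kappa A F j) \<longrightarrow> (\<forall>j\<in>{1..<DIM('a)}. m j > \<tau>))"


section \<open>The functions \<open>p\<^sub>\<lambda>\<close>, \<open>z\<^sup>\<lambda>\<close> and \<open>\<Psi>\<close>\<close>

text \<open>For lattice vectors \<open>l\<close> the values \<open>A i l\<close> are integers and the floor is the identity.\<close>

definition p_fun ::
    "('n::finite \<Rightarrow> 'a::euclidean_space dual) \<Rightarrow> 'a \<Rightarrow> 'a cplx \<Rightarrow> complex" where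
  "p_fun A l u = (\<Prod>i\<in>UNIV. cpair (A i) u powi \<lfloor>A i l\<rfloor>)"

definition z_pow ::
    "('n::finite \<Rightarrow> 'a::euclidean_space dual) \<Rightarrow> complex ^ 'n \<Rightarrow> 'a \<Rightarrow> complex" where
  "z_pow A z l = (\<Prod>i\<in>UNIV. (z $ i) powi \<lfloor>A i l\<rfloor>)"

definition O_set ::
    "('n::finite \<Rightarrow> 'a::euclidean_space dual) \<Rightarrow> 'a set \<Rightarrow> complex ^ 'n \<Rightarrow> 'a cplx set" where
  "O_set A L z = {u \<in> U_set A. \<forall>l\<in>L. p_fun A l u = z_pow A z l}"

definition psi :: "('n::finite \<Rightarrow> 'a::euclidean_space dual) \<Rightarrow> complex ^ 'n \<Rightarrow> 'a dual" where
  "psi A z = - (\<Sum>i\<in>UNIV. ln (norm (z $ i)) *\<^sub>R A i)"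

definition Psi :: "('n::finite \<Rightarrow> 'a::euclidean_space dual) \<Rightarrow> 'a cplx \<Rightarrow> 'a dual" where
  "Psi A u = - (\<Sum>i\<in>UNIV. ln (norm (cpair (A i) u)) *\<^sub>R A i)"

definition dp ::
    "('n::finite \<Rightarrow> 'a::euclidean_space dual) \<Rightarrow> 'a \<Rightarrow> 'a cplx \<Rightarrow> 'a cplx \<Rightarrow> complex" where
  "dp A l u = frechet_derivative (p_fun A l) (at u)"

text \<open>The form \<open>dp\<^sub>1/p\<^sub>1 \<and> \<dots> \<and> dp\<^sub>r/p\<^sub>r\<close> at the point \<open>u\<close>.\<close>

definition dlog_form ::
    "('n::finite \<Rightarrow> 'a::euclidean_space dual) \<Rightarrow> (nat \<Rightarrow> 'a) \<Rightarrow>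
      'a cplx \<Rightarrow> (nat \<Rightarrow> 'a cplx) \<Rightarrow> complex" where
  "dlog_form A lam u = wedge DIM('a) (\<lambda>j v. dp A (lam j) u v / p_fun A (lam j) u)"


section \<open>The sets \<open>U(F,N)\<close> and the cycles \<open>h(F)\<close>\<close>

definition flag_basis ::
    "(nat \<Rightarrow> 'a::euclidean_space) \<Rightarrow> (nat \<Rightarrow> 'a dual set) \<Rightarrow> (nat \<Rightarrow> 'a dual) \<Rightarrow> bool" where
  "flag_basis lam F \<gamma> \<longleftrightarrow>
     inj_on \<gamma> {1..DIM('a)} \<and> independent (\<gamma> ` {1..DIM('a)}) \<and>
     (\<forall>j\<le>DIM('a). F j = span (\<gamma> ` {1..j})) \<and>
     wedge DIM('a) (\<lambda>j. blinfun_apply (\<gamma> j)) = dvol lam"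

definition UFN :: "(nat \<Rightarrow> 'a::euclidean_space dual) \<Rightarrow> real \<Rightarrow> 'a cplx set" where
  "UFN \<gamma> N = {u. (\<forall>j\<in>{1..DIM('a)}. cpair (\<gamma> j) u \<noteq> 0) \<and>
     (\<forall>j\<in>{1..<DIM('a)}. 0 < N * norm (cpair (\<gamma> j) u) \<and>
        N * norm (cpair (\<gamma> j) u) < norm (cpair (\<gamma> (Suc j)) u))}"

definition radii :: "nat \<Rightarrow> real \<Rightarrow> (nat \<Rightarrow> real) \<Rightarrow> bool" where
  "radii r N \<epsilon> \<longleftrightarrow> (\<forall>j\<in>{1..r}. \<epsilon> j > 0) \<and> (\<forall>j\<in>{1..<r}. N * \<epsilon> j < \<epsilon> (Suc j))"

text \<open>The point of the complexification with coordinates \<open>u\<^sub>j = \<epsilon>\<^sub>j exp(\<i> \<theta>\<^sub>j)\<close> with respect to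
  the basis \<open>\<gamma>\<close> of the dual space.\<close>

definition torus_point ::
    "(nat \<Rightarrow> 'a::euclidean_space dual) \<Rightarrow> (nat \<Rightarrow> real) \<Rightarrow> (nat \<Rightarrow> real) \<Rightarrow> 'a cplx" where
  "torus_point \<gamma> \<epsilon> \<theta> =
     (THE u. \<forall>j\<in>{1..DIM('a)}. cpair (\<gamma> j) u = of_real (\<epsilon> j) * cis (\<theta> j))"

text \<open>Integral of an \<open>r\<close>-form over the torus \<open>\<bar>u\<^sub>j\<bar> = \<epsilon>\<^sub>j\<close>, oriented by
  \<open>d arg u\<^sub>1 \<and> \<dots> \<and> d arg u\<^sub>r\<close>: the form is evaluated on the partial derivatives of
  the parametrisation, in their natural order.\<close>

definition torus_integral ::
    "(nat \<Rightarrow> 'a::euclidean_space dual) \<Rightarrow> (nat \<Rightarrow> real) \<Rightarrow>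
      ('a cplx \<Rightarrow> (nat \<Rightarrow> 'a cplx) \<Rightarrow> complex) \<Rightarrow> complex" where
  "torus_integral \<gamma> \<epsilon> \<omega> =
     (LINT \<theta>:({1..DIM('a)} \<rightarrow>\<^sub>E {0..2*pi})|(Pi\<^sub>M {1..DIM('a)} (\<lambda>_. lborel)).
        \<omega> (torus_point \<gamma> \<epsilon> \<theta>)
          (\<lambda>k. vector_derivative (\<lambda>t. torus_point \<gamma> \<epsilon> (\<theta>(k := t))) (at (\<theta> k))))"


text \<open>The integral of \<open>\<phi>/p\<^sub>\<lambda> dp\<^sub>1/p\<^sub>1 \<and> \<dots> \<and> dp\<^sub>r/p\<^sub>r\<close> for \<open>\<lambda> = l\<close>.\<close>

definition torus_coeff ::
    "('n::finite \<Rightarrow> 'a::euclidean_space dual) \<Rightarrow> (nat \<Rightarrow> 'a) \<Rightarrow> (nat \<Rightarrow> 'a dual) \<Rightarrow>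
      (nat \<Rightarrow> real) \<Rightarrow> ('a cplx \<Rightarrow> complex) \<Rightarrow> 'a \<Rightarrow> complex" where
  "torus_coeff A lam \<gamma> \<epsilon> \<phi> l =
     torus_integral \<gamma> \<epsilon> (\<lambda>u v. \<phi> u / p_fun A l u * dlog_form A lam u v)"


section \<open>Sufficient pairs\<close>

definition sufficient_pair ::
    "('n::finite \<Rightarrow> 'a::euclidean_space dual) \<Rightarrow> (nat \<Rightarrow> 'a) \<Rightarrow>
      ((nat \<Rightarrow> 'a dual set) \<Rightarrow> nat \<Rightarrow> 'a dual) \<Rightarrow> real \<Rightarrow> real \<Rightarrow> bool" where
  "sufficient_pair A lam \<gamma> N \<tau> \<longleftrightarrow> N > 0 \<and> \<tau> > 0 \<and>
     (\<forall>F\<in>flags A. \<forall>G\<in>flags A. F \<noteq> G \<longrightarrow> UFN (\<gamma> F) N \<inter> UFN (\<gamma> G) N = {}) \<and>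
     (\<forall>F\<in>flags A. UFN (\<gamma> F) N \<subseteq> U_set A \<and>
        (\<forall>u\<in>UFN (\<gamma> F) N. cpair (kappa_all A) u \<noteq> 0)) \<and>
     (\<forall>F\<in>flags A. proper_flag A F \<longrightarrow>
        (\<forall>u\<in>UFN (\<gamma> F) N.
           bij_betw (\<lambda>v. \<lambda>j\<in>{1..DIM('a)}. dp A (lam j) u v) UNIV ({1..DIM('a)} \<rightarrow>\<^sub>E UNIV))) \<and>
     (\<forall>K. compact K \<and> K \<subseteq> {\<xi>. tau_regular A \<tau> \<xi>} \<longrightarrow> compact {u \<in> U_set A. Psi A u \<in> K}) \<and>
     (\<forall>\<xi>. tau_regular A \<tau> \<xi> \<longrightarrow>
        {u \<in> U_set A. Psi A u = \<xi>} \<subseteq> (\<Union>F\<in>flags_at A \<xi>. UFN (\<gamma> F) N))"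

end

theory Submission
  imports Defs "HOL-Complex_Analysis.Cauchy_Integral_Theorem"
begin

text \<open>The sum over the points of \<open>O(z, \<AA>)\<close> in the chamber \<open>U(F, N)\<close> is a trace. In the coordinates
  \<open>u\<^sub>j = \<langle>\<gamma>\<^sub>j, u\<rangle>\<close> given by the basis adapted to the flag, the chamber is a Reinhardt
  domain, and if \<open>z\<^sup>\<lambda> = exp w\<^sub>j\<close> for the \<open>j\<close>-th vector \<open>\<lambda> = \<lambda>\<^sub>j\<close> of the lattice basis, then
  these points form the fibre over \<open>exp w\<close> of the map \<open>p = (p\<^sub>1, \<dots>, p\<^sub>r)\<close> restricted to the
  chamber. The asserted series is the Fourier series of this trace as a function of \<open>w\<close>.

  The trace is periodic with periods \<open>2 \<pi> \<i>\<close>. The map \<open>p\<close> is a local biholomorphism on the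
  chamber, and it is proper over the real parts \<open>\<rho> = Re w\<close> that correspond to regular
  vectors, because \<open>\<Psi>(u)\<close> determines these real parts by \<open>log \<bar>p\<^sub>\<lambda>(u)\<bar> = - \<langle>\<Psi>(u), \<lambda>\<rangle>\<close>, and
  \<open>\<Psi>\<close> is proper over the regular set. Therefore the fibres are finite and the trace is
  holomorphic on a tube over an open convex set \<open>D\<close> of regular directions
  (\<open>trace_holomorphic\<close>), and so it is the sum of its absolutely convergent Fourier series
  (\<open>fourier_expansion\<close>). The coefficients are means over the imaginary torus \<open>Re w = \<rho>\<close>, and
  they are the same for all \<open>\<rho> \<in> D\<close> (\<open>torus_mean_independent\<close>).

  This freedom is what makes them computable. The regular set is open and stable under
  multiplication by \<open>c \<ge> 1\<close>, so \<open>D\<close> can be chosen to contain the ray through \<open>\<psi>(z)\<close>. Far out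
  on this ray all points of the fibre in the chamber of \<open>F\<close> lie deep in it: every quotient
  \<open>\<bar>u\<^sub>j\<^sub>+\<^sub>1\<bar> / \<bar>u\<^sub>j\<bar>\<close> is large (\<open>deep_fibers\<close>). To see this, order the forms greedily by
  their size at \<open>u\<close>; the resulting flag expresses \<open>\<Psi>(u)\<close>, up to a bounded error, as a
  combination of its vectors \<open>\<kappa>\<^sub>j\<close> with the logarithmic gaps as coefficients, and regularity
  makes these gaps larger than \<open>c \<tau>\<close>.

  Deep in the chamber each form is dominated by its last coordinate, so that \<open>log p\<close> is an
  affine map with an integral linear part \<open>B\<close>, up to a small perturbation. Unfolding the
  torus turns the mean of the trace into \<open>\<bar>det B\<bar>\<close> times a mean over a slightly deformed
  torus in the chamber (\<open>fiber_integral\<close>). A Fourier expansion in the deformed coordinates,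
  in which all nonconstant terms are exact forms, replaces the deformed torus by a straight
  one at the cost of the Jacobian of the coordinates (\<open>deform_torus_integral\<close>). Together
  these give the integral of \<open>\<phi> p\<^sub>\<lambda>\<^sup>-\<^sup>1 dp\<^sub>1/p\<^sub>1 \<and> \<dots> \<and> dp\<^sub>r/p\<^sub>r\<close> over a torus, with the sign
  of \<open>det B\<close> (\<open>deep_torus_identity\<close>). As \<open>\<kappa>\<^sub>k\<close> is the sum of the forms of level at most \<open>k\<close>,
  this sign is \<open>\<nu>(F)\<close> (\<open>nu_eq\<close>). Finally the integrand is holomorphic on the whole chamber,
  and the torus can be moved back to the given radii (\<open>trace_expansion\<close>).\<close>

hide_const (open) Polynomial.content

section \<open>Periodic functions and integrals over the torus\<close>

definition tcube :: "(real ^ 'k) set" where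
  "tcube = cbox 0 (\<chi> k. 2 * pi)"

text \<open>The half-open cube is a fundamental domain for the lattice of periods; gauge integrals
  of continuous functions are taken over its closure \<open>tcube\<close>.\<close>

definition fcube :: "(real ^ 'k) set" where
  "fcube = {\<theta>. \<forall>k. 0 \<le> \<theta> $ k \<and> \<theta> $ k < 2 * pi}"

definition period :: "int ^ 'k \<Rightarrow> real ^ 'k" where
  "period m = (\<chi> k. 2 * pi * of_int (m $ k))"

definition cvec :: "real ^ 'k \<Rightarrow> real ^ 'k \<Rightarrow> complex ^ 'k" where
  "cvec \<rho> \<theta> = (\<chi> k. Complex (\<rho> $ k) (\<theta> $ k))"

definition re_vec :: "complex ^ 'k \<Rightarrow> real ^ 'k" where
  "re_vec x = (\<chi> k. Re (x $ k))"

definition im_vec :: "complex ^ 'k \<Rightarrow> real ^ 'k" where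
  "im_vec x = (\<chi> k. Im (x $ k))"

definition tube :: "(real ^ 'k) set \<Rightarrow> (complex ^ 'k) set" where
  "tube D = {x. re_vec x \<in> D}"

text \<open>Holomorphy is real differentiability with a derivative that commutes with
  multiplication by \<open>\<i>\<close>.\<close>

definition vec_holo :: "(complex ^ 'k \<Rightarrow> complex) \<Rightarrow> (complex ^ 'k) set \<Rightarrow> bool" where
  "vec_holo f S \<longleftrightarrow>
     (\<forall>x\<in>S. \<exists>D. (f has_derivative D) (at x) \<and> (\<forall>v. D (\<i> *s v) = \<i> * D v))"

definition per_real :: "(real ^ 'k \<Rightarrow> complex) \<Rightarrow> bool" where
  "per_real f \<longleftrightarrow> (\<forall>m \<theta>. f (\<theta> + period m) = f \<theta>)"

definition per_on :: "(complex ^ 'k \<Rightarrow> complex) \<Rightarrow> (complex ^ 'k) set \<Rightarrow> bool" where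
  "per_on f S \<longleftrightarrow> (\<forall>m. \<forall>x\<in>S. f (x + cvec 0 (period m)) = f x)"

lemma cvec_nth [simp]: "cvec \<rho> \<theta> $ k = Complex (\<rho> $ k) (\<theta> $ k)"
  by (simp add: cvec_def)

lemma re_vec_nth [simp]: "re_vec x $ k = Re (x $ k)"
  by (simp add: re_vec_def)

lemma im_vec_nth [simp]: "im_vec x $ k = Im (x $ k)"
  by (simp add: im_vec_def)

lemma period_nth [simp]: "period m $ k = 2 * pi * of_int (m $ k)"
  by (simp add: period_def)

lemma re_cvec [simp]: "re_vec (cvec \<rho> \<theta>) = \<rho>" and im_cvec [simp]: "im_vec (cvec \<rho> \<theta>) = \<theta>"
  by (simp_all add: vec_eq_iff)

lemma cvec_re_im [simp]: "cvec (re_vec x) (im_vec x) = x"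
  by (simp add: vec_eq_iff)

lemma cvec_add: "cvec a b + cvec c d = cvec (a + c) (b + d)"
  by (simp add: vec_eq_iff complex_eq_iff)

lemma linear_re_vec: "bounded_linear (re_vec :: complex ^ 'k \<Rightarrow> real ^ 'k)"
  by (auto simp: re_vec_def vec_eq_iff intro!: linear_conv_bounded_linear[THEN iffD1] linearI)

lemma continuous_on_cvec [continuous_intros]:
  fixes f g :: "'b::topological_space \<Rightarrow> real ^ 'k"
  assumes "continuous_on S f" "continuous_on S g"
  shows "continuous_on S (\<lambda>x. cvec (f x) (g x))"
proof -
  have "continuous_on S (\<lambda>x. \<chi> k. complex_of_real (f x $ k) + \<i> * complex_of_real (g x $ k))"
    using assms by (intro continuous_intros)
  moreover have "(\<lambda>x. \<chi> k. complex_of_real (f x $ k) + \<i> * complex_of_real (g x $ k)) =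
      (\<lambda>x. cvec (f x) (g x))"
    by (simp add: fun_eq_iff vec_eq_iff complex_eq_iff)
  ultimately show ?thesis by (simp only:)
qed

lemma continuous_on_re_vec [continuous_intros]:
  "continuous_on S f \<Longrightarrow> continuous_on S (\<lambda>x. re_vec (f x))"
  using bounded_linear.continuous_on[OF linear_re_vec] by blast

lemma open_tube: "open D \<Longrightarrow> open (tube D)"
proof -
  assume "open D"
  then have "open (re_vec -` D)"
    by (intro open_vimage) (auto intro: continuous_intros)
  then show ?thesis by (simp add: tube_def vimage_def)
qed

lemma cvec_in_tube [simp]: "cvec \<rho> \<theta> \<in> tube D \<longleftrightarrow> \<rho> \<in> D"
  by (simp add: tube_def)

lemma vec_holo_continuous: "vec_holo f S \<Longrightarrow> continuous_on S f"
  unfolding vec_holo_def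
  by (meson continuous_at_imp_continuous_on has_derivative_continuous)

lemma complex_linear_scale:
  fixes D :: "complex ^ 'k \<Rightarrow> complex"
  assumes "linear D" and "\<And>v. D (\<i> *s v) = \<i> * D v"
  shows "D (c *s v) = c * D v"
proof -
  have "c *s v = Re c *\<^sub>R v + Im c *\<^sub>R (\<i> *s v)"
    by (simp add: vec_eq_iff complex_eq_iff)
  then have "D (c *s v) = Re c *\<^sub>R D v + Im c *\<^sub>R (\<i> * D v)"
    using assms by (simp add: linear_add linear_scale)
  also have "\<dots> = c * D v"
    by (simp add: complex_eq_iff)
  finally show ?thesis .
qed

lemma scalar_vec_bounded_linear: "bounded_linear (\<lambda>c. c *s (v :: complex ^ 'k))"
  by (rule linear_conv_bounded_linear[THEN iffD1], rule linearI)
     (simp_all add: vec_eq_iff complex_eq_iff algebra_simps)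

lemma vec_holo_along_line:
  fixes f :: "complex ^ 'k \<Rightarrow> complex"
  assumes "vec_holo f S" "x + \<zeta> *s v \<in> S"
  shows "(\<lambda>\<zeta>. f (x + \<zeta> *s v)) field_differentiable at \<zeta>"
proof -
  obtain D where D: "(f has_derivative D) (at (x + \<zeta> *s v))" "\<And>v. D (\<i> *s v) = \<i> * D v"
    using assms unfolding vec_holo_def by blast
  have "((\<lambda>\<zeta>. x + \<zeta> *s v) has_derivative (\<lambda>c. c *s v)) (at \<zeta>)"
    by (auto intro!: derivative_eq_intros bounded_linear_imp_has_derivative[OF scalar_vec_bounded_linear])
  from diff_chain_at[OF this D(1)]
  have "((\<lambda>\<zeta>. f (x + \<zeta> *s v)) has_derivative (\<lambda>c. D (c *s v))) (at \<zeta>)"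
    by (simp add: o_def)
  moreover have "D (c *s v) = D v * c" for c
    using complex_linear_scale[OF has_derivative_linear[OF D(1)] D(2)] by (simp add: mult.commute)
  ultimately have "((\<lambda>\<zeta>. f (x + \<zeta> *s v)) has_field_derivative D v) (at \<zeta>)"
    by (simp add: has_field_derivative_def)
  then show ?thesis
    by (auto simp: field_differentiable_def)
qed

lemma period_cell_exists:
  fixes \<theta> :: "real ^ 'k"
  shows "\<exists>!m. \<theta> + period m \<in> fcube"
proof
  let ?m = "\<chi> k. - \<lfloor>\<theta> $ k / (2 * pi)\<rfloor>"
  have *: "0 \<le> t + 2 * pi * of_int j \<and> t + 2 * pi * of_int j < 2 * pi \<longleftrightarrow> j = - \<lfloor>t / (2 * pi)\<rfloor>"
    for t :: real and j :: int
  proof -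
    have "0 \<le> t + 2 * pi * of_int j \<longleftrightarrow> - of_int j \<le> t / (2 * pi)"
      by (subst pos_le_divide_eq) (auto simp: algebra_simps)
    moreover have "t + 2 * pi * of_int j < 2 * pi \<longleftrightarrow> t / (2 * pi) < - of_int j + 1"
      by (subst pos_divide_less_eq) (auto simp: algebra_simps)
    ultimately show ?thesis
      using floor_eq_iff[of "t / (2 * pi)" "-j"] by auto
  qed
  show "\<theta> + period ?m \<in> fcube"
    by (simp only: fcube_def mem_Collect_eq vector_add_component period_nth * vec_lambda_beta) simp
  show "m = ?m" if "\<theta> + period m \<in> fcube" for m
    using that * by (simp add: fcube_def vec_eq_iff)
qed

lemma fcube_subset: "fcube \<subseteq> tcube"
  by (auto simp: fcube_def tcube_def mem_box_cart) (meson less_imp_le)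

lemma tcube_diff_fcube: "tcube - fcube \<subseteq> tcube - box 0 (\<chi> k. 2 * pi)"
  by (auto simp: fcube_def tcube_def mem_box_cart intro: less_imp_le)

lemma fcube_borel [measurable]: "fcube \<in> sets borel"
proof -
  have "fcube = (\<Inter>k. {\<theta> :: real ^ 'k. 0 \<le> \<theta> $ k \<and> \<theta> $ k < 2 * pi})"
    by (auto simp: fcube_def)
  also have "\<dots> \<in> sets borel"
    by (intro sets.finite_INT) auto
  finally show ?thesis .
qed

text \<open>The translates of the cell \<open>fcube\<close> by the periods tile the space, so that summing \<open>g\<close>
  over the translates of a point of the cell and integrating over the cell is the same as
  integrating \<open>g\<close> over the whole space. The finite set \<open>M\<close> contains all translates at which
  \<open>g\<close> does not vanish, which keeps the sum finite.\<close>

lemma unfolding_integral: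
  fixes g :: "real ^ 'k \<Rightarrow> complex"
  assumes int: "integrable lborel g" and fin: "finite M"
    and zero: "\<And>\<theta> m. \<theta> \<in> fcube \<Longrightarrow> m \<notin> M \<Longrightarrow> g (\<theta> + period m) = 0"
  shows "(LINT \<theta>|lborel. indicator fcube \<theta> *\<^sub>R (\<Sum>m\<in>M. g (\<theta> + period m))) = (LINT \<theta>|lborel. g \<theta>)"
proof -
  have [measurable]: "g \<in> borel_measurable borel"
    using borel_measurable_integrable[OF int] by simp
  have split: "g \<theta> = (\<Sum>m\<in>M. indicator fcube (\<theta> - period m) *\<^sub>R g \<theta>)" for \<theta>
  proof -
    obtain m0 where m0: "\<theta> + period m0 \<in> fcube" "\<And>m. \<theta> + period m \<in> fcube \<Longrightarrow> m = m0"
      using period_cell_exists[of \<theta>] by blast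
    have neg: "\<theta> - period m = \<theta> + period (- m)" for m
      by (simp add: vec_eq_iff)
    have ind: "indicator fcube (\<theta> - period m) = (if m = - m0 then 1 else (0::real))" for m
    proof -
      have "\<theta> + period (- m) \<in> fcube \<longleftrightarrow> m = - m0"
        by (metis m0 minus_minus)
      then show ?thesis by (simp add: neg indicator_def)
    qed
    show ?thesis
    proof (cases "- m0 \<in> M")
      case True
      then show ?thesis using fin by (simp add: ind if_distrib[of "\<lambda>c. c *\<^sub>R _"] sum.delta cong: if_cong)
    next
      case False
      have "g (\<theta> + period m0 + period (- m0)) = 0"
        by (rule zero[OF m0(1) False])
      moreover have "\<theta> + period m0 + period (- m0) = \<theta>"
        by (simp add: vec_eq_iff)
      ultimately have "g \<theta> = 0" by simp
      then show ?thesis by simp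
    qed
  qed
  have i1: "integrable lborel (\<lambda>\<theta>. indicator fcube (\<theta> - period m) *\<^sub>R g \<theta>)" for m
  proof (rule Bochner_Integration.integrable_bound[OF int])
    show "(\<lambda>\<theta>. indicator fcube (\<theta> - period m) *\<^sub>R g \<theta>) \<in> borel_measurable lborel"
      by measurable
  qed (auto simp: indicator_def)
  have shift: "integrable lborel (\<lambda>\<theta>. indicator fcube \<theta> *\<^sub>R g (\<theta> + period m))"
    "(LINT \<theta>|lborel. indicator fcube (\<theta> - period m) *\<^sub>R g \<theta>) =
     (LINT \<theta>|lborel. indicator fcube \<theta> *\<^sub>R g (\<theta> + period m))" for m
  proof -
    have d: "lborel = distr lborel borel ((+) (period m))"
      by (rule lborel_distr_plus[symmetric])
    show "integrable lborel (\<lambda>\<theta>. indicator fcube \<theta> *\<^sub>R g (\<theta> + period m))"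
      using i1[of m] by (subst (asm) d, subst (asm) integrable_distr_eq) (auto simp: add.commute)
    show "(LINT \<theta>|lborel. indicator fcube (\<theta> - period m) *\<^sub>R g \<theta>) =
     (LINT \<theta>|lborel. indicator fcube \<theta> *\<^sub>R g (\<theta> + period m))"
      by (subst d, subst integral_distr) (auto simp: add.commute)
  qed
  have "(LINT \<theta>|lborel. g \<theta>) = (LINT \<theta>|lborel. (\<Sum>m\<in>M. indicator fcube (\<theta> - period m) *\<^sub>R g \<theta>))"
    by (rule arg_cong[of _ _ "integral\<^sup>L lborel"]) (rule ext, rule split)
  also have "\<dots> = (\<Sum>m\<in>M. LINT \<theta>|lborel. indicator fcube (\<theta> - period m) *\<^sub>R g \<theta>)"
    by (rule Bochner_Integration.integral_sum) (rule i1)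
  also have "\<dots> = (\<Sum>m\<in>M. LINT \<theta>|lborel. indicator fcube \<theta> *\<^sub>R g (\<theta> + period m))"
    by (simp add: shift)
  also have "\<dots> = (LINT \<theta>|lborel. (\<Sum>m\<in>M. indicator fcube \<theta> *\<^sub>R g (\<theta> + period m)))"
    by (rule Bochner_Integration.integral_sum[symmetric]) (rule shift)
  also have "\<dots> = (LINT \<theta>|lborel. indicator fcube \<theta> *\<^sub>R (\<Sum>m\<in>M. g (\<theta> + period m)))"
    by (simp add: scaleR_sum_right)
  finally show ?thesis by simp
qed

lemma fcube_integral:
  fixes f :: "real ^ 'k \<Rightarrow> complex"
  assumes "continuous_on tcube f"
  shows "(LINT \<theta>|lborel. indicator fcube \<theta> *\<^sub>R f \<theta>) = integral tcube f"
    and "set_integrable lborel fcube f"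
proof -
  have i: "set_integrable lborel tcube f"
    using assms by (simp add: tcube_def borel_integrable_compact set_integrable_def)
  then show j: "set_integrable lborel fcube f"
    by (rule set_integrable_subset) (auto intro: subsetD[OF fcube_subset])
  have "(LINT \<theta>:fcube|lborel. f \<theta>) = integral fcube f"
    by (rule set_borel_integral_eq_integral(2)[OF j])
  also have "\<dots> = integral tcube f"
  proof (rule integral_spike_set)
    show "negligible {x \<in> fcube - tcube. f x \<noteq> 0}"
      using fcube_subset by (metis (mono_tags, lifting) Diff_eq_empty_iff empty_iff negligible_empty Collect_empty_eq)
    show "negligible {x \<in> tcube - fcube. f x \<noteq> 0}"
      using tcube_diff_fcube negligible_frontier_interval
      by (rule_tac negligible_subset[of "tcube - box 0 (\<chi> k. 2 * pi)"]) (auto simp: tcube_def)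
  qed
  finally show "(LINT \<theta>|lborel. indicator fcube \<theta> *\<^sub>R f \<theta>) = integral tcube f"
    by (simp add: set_lebesgue_integral_def)
qed

text \<open>Only finitely many translates of the cube meet a bounded set; this provides the index
  sets for \<open>unfolding_integral\<close>.\<close>

lemma bounded_period_finite:
  fixes E :: "(real ^ 'k) set"
  assumes "bounded E"
  shows "finite {m. \<exists>\<theta>\<in>tcube. \<theta> + period m \<in> E}"
proof -
  obtain C where C: "\<And>x. x \<in> E \<Longrightarrow> norm x \<le> C"
    using assms bounded_iff by blast
  obtain n :: int where n: "C + 2 * pi \<le> 2 * pi * of_int n"
    by (metis ex_le_of_int mult.commute pi_gt_zero pos_divide_le_eq zero_less_mult_iff zero_less_numeral)
  have "{m. \<exists>\<theta>\<in>tcube. \<theta> + period m \<in> E} \<subseteq> {m. \<forall>k. m $ k \<in> {-n..n}}"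
  proof safe
    fix m k and \<theta> :: "real ^ 'k" assume t: "\<theta> \<in> tcube" "\<theta> + period m \<in> E"
    have "\<bar>\<theta> $ k + 2 * pi * of_int (m $ k)\<bar> \<le> C"
      using C[OF t(2)] component_le_norm_cart[of "\<theta> + period m" k] by simp
    moreover have "0 \<le> \<theta> $ k" "\<theta> $ k \<le> 2 * pi"
      using t(1) by (auto simp: tcube_def mem_box_cart)
    ultimately have "\<bar>2 * pi * of_int (m $ k)\<bar> \<le> 2 * pi * of_int n"
      using n by linarith
    then have "\<bar>of_int (m $ k)\<bar> \<le> (of_int n :: real)"
      by (simp add: abs_mult)
    then show "m $ k \<in> {-n..n}"
      by (simp add: abs_le_iff)
  qed
  moreover have "finite {m :: int ^ 'k. \<forall>k. m $ k \<in> {-n..n}}"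
  proof (rule finite_subset)
    show "{m :: int ^ 'k. \<forall>k. m $ k \<in> {-n..n}} \<subseteq> vec_lambda ` (UNIV \<rightarrow>\<^sub>E {-n..n})"
    proof
      fix m :: "int ^ 'k" assume "m \<in> {m. \<forall>k. m $ k \<in> {-n..n}}"
      then have "m = vec_lambda (vec_nth m)" "vec_nth m \<in> UNIV \<rightarrow>\<^sub>E {-n..n}"
        by auto
      then show "m \<in> vec_lambda ` (UNIV \<rightarrow>\<^sub>E {-n..n})" by blast
    qed
    show "finite (vec_lambda ` (UNIV \<rightarrow>\<^sub>E {-n..n}) :: (int ^ 'k) set)"
      by (intro finite_imageI finite_PiE) auto
  qed
  ultimately show ?thesis
    by (rule finite_subset)
qed

lemma per_real_add: "per_real f \<Longrightarrow> f (\<theta> + period m) = f \<theta>"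
  by (simp add: per_real_def)

text \<open>The translated cube is another fundamental domain of the period lattice.\<close>

lemma torus_integral_translate:
  fixes f :: "real ^ 'k \<Rightarrow> complex"
  assumes cont: "continuous_on UNIV f" and per: "per_real f"
  shows "integral tcube (\<lambda>\<theta>. f (\<theta> + t)) = integral tcube f"
proof -
  let ?g = "\<lambda>\<theta>. indicator fcube (\<theta> - t) *\<^sub>R f \<theta>"
  let ?M = "{m. \<exists>\<theta>\<in>tcube. \<theta> + period m \<in> (\<lambda>\<theta>. t + \<theta>) ` (tcube :: (real ^ 'k) set)}"
  have [measurable]: "f \<in> borel_measurable borel"
    using cont by (simp add: borel_measurable_continuous_onI)
  have ct: "continuous_on tcube (\<lambda>\<theta>. f (\<theta> + t))"
    by (intro continuous_on_compose2[OF cont] continuous_intros) auto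
  have c0: "continuous_on tcube f"
    using cont continuous_on_subset by blast
  have d: "lborel = distr lborel borel ((+) t)"
    by (rule lborel_distr_plus[symmetric])
  have i0: "integrable lborel (\<lambda>\<theta>. indicator fcube \<theta> *\<^sub>R f (\<theta> + t))"
    using fcube_integral(2)[OF ct] by (simp add: set_integrable_def)
  have ig: "integrable lborel ?g"
    by (subst d, subst integrable_distr_eq) (use i0 in \<open>auto simp: add.commute\<close>)
  have eq: "(LINT \<theta>|lborel. ?g \<theta>) = (LINT \<theta>|lborel. indicator fcube \<theta> *\<^sub>R f (\<theta> + t))"
    by (subst d, subst integral_distr) (auto simp: add.commute)
  have fin: "finite ?M"
    by (rule bounded_period_finite) (auto intro!: bounded_translation simp: tcube_def)
  have zero: "?g (\<theta> + period m) = 0" if "\<theta> \<in> fcube" "m \<notin> ?M" for \<theta> m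
  proof -
    have "\<theta> + period m - t \<notin> fcube"
    proof
      assume "\<theta> + period m - t \<in> fcube"
      then have "\<theta> + period m \<in> (\<lambda>\<theta>. t + \<theta>) ` tcube"
        using fcube_subset by (intro image_eqI[of _ _ "\<theta> + period m - t"]) auto
      moreover have "\<theta> \<in> tcube" using that(1) fcube_subset by blast
      ultimately show False using that(2) by blast
    qed
    then show ?thesis by simp
  qed
  have sum: "(\<Sum>m\<in>?M. ?g (\<theta> + period m)) = f \<theta>" if "\<theta> \<in> fcube" for \<theta>
  proof -
    obtain m0 where m0: "(\<theta> - t) + period m0 \<in> fcube" "\<And>m. (\<theta> - t) + period m \<in> fcube \<Longrightarrow> m = m0"
      using period_cell_exists[of "\<theta> - t"] by blast
    have iff: "\<theta> + period m - t \<in> fcube \<longleftrightarrow> m = m0" for m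
      using m0 by (metis add_diff_eq add.commute add_diff_cancel_left' diff_add_eq)
    have "m0 \<in> ?M"
    proof (rule ccontr)
      assume "m0 \<notin> ?M"
      have "\<theta> + period m0 \<in> (\<lambda>\<theta>. t + \<theta>) ` tcube"
        using iff[of m0] fcube_subset by (intro image_eqI[of _ _ "\<theta> + period m0 - t"]) auto
      moreover have "\<theta> \<in> tcube" using that(1) fcube_subset by blast
      ultimately show False using \<open>m0 \<notin> ?M\<close> by blast
    qed
    have "(\<Sum>m\<in>?M. ?g (\<theta> + period m)) = (\<Sum>m\<in>?M. if m = m0 then f \<theta> else 0)"
      by (rule sum.cong) (auto simp: iff per_real_add[OF per] indicator_def)
    also have "\<dots> = f \<theta>"
      using \<open>m0 \<in> ?M\<close> fin by (simp add: sum.delta)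
    finally show ?thesis .
  qed
  have "integral tcube (\<lambda>\<theta>. f (\<theta> + t)) = (LINT \<theta>|lborel. ?g \<theta>)"
    by (simp add: fcube_integral(1)[OF ct, symmetric] eq)
  also have "\<dots> = (LINT \<theta>|lborel. indicator fcube \<theta> *\<^sub>R (\<Sum>m\<in>?M. ?g (\<theta> + period m)))"
    by (rule unfolding_integral[OF ig fin zero, symmetric])
  also have "\<dots> = (LINT \<theta>|lborel. indicator fcube \<theta> *\<^sub>R f \<theta>)"
  proof (rule Bochner_Integration.integral_cong[OF refl])
    fix \<theta>
    show "indicator fcube \<theta> *\<^sub>R (\<Sum>m\<in>?M. ?g (\<theta> + period m)) = indicator fcube \<theta> *\<^sub>R f \<theta>"
      using sum[of \<theta>] by (cases "\<theta> \<in> fcube") simp_all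
  qed
  also have "\<dots> = integral tcube f"
    by (rule fcube_integral(1)[OF c0])
  finally show ?thesis .
qed

text \<open>Fubini's theorem and translation invariance: averaging a function over segments in a
  fixed direction multiplies its integral over the torus by their length.\<close>

lemma torus_integral_swap:
  fixes f :: "real ^ 'k \<Rightarrow> complex"
  assumes cont: "continuous_on UNIV f" and per: "per_real f" and "0 \<le> T"
  shows "integral tcube (\<lambda>\<theta>. integral {0..T} (\<lambda>t. f (\<theta> + t *\<^sub>R v))) = of_real T * integral tcube f"
proof -
  have "integral tcube (\<lambda>\<theta>. integral {0..T} (\<lambda>t. f (\<theta> + t *\<^sub>R v))) =
      integral {0..T} (\<lambda>t. integral tcube (\<lambda>\<theta>. f (\<theta> + t *\<^sub>R v)))"
    unfolding tcube_def cbox_interval[symmetric]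
    by (rule integral_swap_continuous)
       (auto simp: case_prod_unfold intro!: continuous_on_compose2[OF cont] continuous_intros)
  also have "\<dots> = integral {0..T} (\<lambda>t. integral tcube f)"
    by (simp add: torus_integral_translate[OF cont per])
  finally show ?thesis using assms by (simp add: scaleR_conv_of_real)
qed

text \<open>Stokes' theorem on the torus: along each closed circle in direction \<open>b\<close> the derivative
  integrates to zero by the fundamental theorem of calculus, and the average over all these
  circles is the integral over the torus.\<close>

lemma torus_integral_deriv_zero:
  fixes H H' :: "real ^ 'k \<Rightarrow> complex"
  assumes per: "per_real H" and cont: "continuous_on UNIV H'" and per': "per_real H'"
    and contH: "continuous_on UNIV H"
    and der: "\<And>\<theta>. ((\<lambda>t. H (\<theta> + t *\<^sub>R axis b 1)) has_vector_derivative H' \<theta>) (at 0)"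
  shows "integral tcube H' = 0"
proof -
  let ?v = "axis b 1 :: real ^ 'k"
  have per2: "period (axis b 1) = (2 * pi) *\<^sub>R ?v"
    by (simp add: vec_eq_iff axis_def)
  have der': "((\<lambda>t. H (\<theta> + t *\<^sub>R ?v)) has_vector_derivative H' (\<theta> + t *\<^sub>R ?v)) (at t within S)" for \<theta> t S
  proof -
    have "((\<lambda>s. s - t) has_vector_derivative 1) (at t)"
      by (auto intro!: derivative_eq_intros)
    from vector_diff_chain_at[OF this, of "\<lambda>s. H ((\<theta> + t *\<^sub>R ?v) + s *\<^sub>R ?v)" "H' (\<theta> + t *\<^sub>R ?v)"]
    have "((\<lambda>s. H (\<theta> + s *\<^sub>R ?v)) has_vector_derivative H' (\<theta> + t *\<^sub>R ?v)) (at t)"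
      using der[of "\<theta> + t *\<^sub>R ?v"] by (simp add: o_def algebra_simps)
    then show ?thesis
      by (rule has_vector_derivative_at_within)
  qed
  have "integral {0..2*pi} (\<lambda>t. H' (\<theta> + t *\<^sub>R ?v)) = 0" for \<theta>
  proof -
    have "((\<lambda>t. H' (\<theta> + t *\<^sub>R ?v)) has_integral (H (\<theta> + (2*pi) *\<^sub>R ?v) - H (\<theta> + 0 *\<^sub>R ?v))) {0..2*pi}"
      by (rule fundamental_theorem_of_calculus) (auto intro: der')
    moreover have "H (\<theta> + (2*pi) *\<^sub>R ?v) = H \<theta>"
      using per_real_add[OF per, of \<theta> "axis b 1"] by (simp add: per2)
    ultimately show ?thesis by (simp add: integral_unique)
  qed
  then have "of_real (2 * pi) * integral tcube H' = 0"
    using torus_integral_swap[OF cont per', of "2*pi" ?v] by simp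
  then show ?thesis by simp
qed

text \<open>By periodicity it suffices to bound \<open>f\<close> where the imaginary parts lie in the compact
  cube.\<close>

lemma per_on_bounded:
  fixes f :: "complex ^ 'k \<Rightarrow> complex"
  assumes per: "per_on f (tube D)" and cont: "continuous_on (tube D) f" and K: "compact K" "K \<subseteq> D"
  obtains C where "C > 0" "\<And>x. re_vec x \<in> K \<Longrightarrow> norm (f x) \<le> C"
proof -
  let ?S = "(\<lambda>(\<rho>, \<theta>). cvec \<rho> \<theta>) ` (K \<times> (tcube :: (real ^ 'k) set))"
  have "compact ?S"
    using K(1) by (intro compact_continuous_image compact_Times)
      (auto simp: case_prod_unfold tcube_def intro!: continuous_intros)
  moreover have "?S \<subseteq> tube D" using K(2) by auto
  ultimately have "compact (f ` ?S)"
    using cont continuous_on_subset compact_continuous_image by blast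
  then obtain C where C: "\<And>y. y \<in> f ` ?S \<Longrightarrow> norm y \<le> C"
    using compact_imp_bounded bounded_iff by metis
  have "norm (f x) \<le> max C 1" if x: "re_vec x \<in> K" for x
  proof -
    obtain m where m: "im_vec x + period m \<in> fcube"
      using period_cell_exists by blast
    have "f (x + cvec 0 (period m)) = f x"
      using per x K(2) unfolding per_on_def tube_def by blast
    moreover have "x + cvec 0 (period m) = cvec (re_vec x) (im_vec x + period m)"
      by (simp add: vec_eq_iff complex_eq_iff)
    moreover have "cvec (re_vec x) (im_vec x + period m) \<in> ?S"
      using x m fcube_subset by force
    ultimately have "f x \<in> f ` ?S" by (metis image_eqI)
    then show ?thesis using C by fastforce
  qed
  then show thesis by (intro that[of "max C 1"]) auto
qed

lemma per_on_slice:
  assumes "per_on f (tube D)" "\<rho> \<in> D"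
  shows "per_real (\<lambda>\<theta>. f (cvec \<rho> \<theta>))"
  unfolding per_real_def
proof (intro allI)
  fix m \<theta>
  have "cvec \<rho> (\<theta> + period m) = cvec \<rho> \<theta> + cvec 0 (period m)"
    by (simp add: vec_eq_iff complex_eq_iff)
  then show "f (cvec \<rho> (\<theta> + period m)) = f (cvec \<rho> \<theta>)"
    using assms by (simp add: per_on_def)
qed

lemma slice_continuous:
  assumes "continuous_on (tube D) f" "\<rho> \<in> D"
  shows "continuous_on S (\<lambda>\<theta>. f (cvec \<rho> \<theta>))"
  by (rule continuous_on_compose2[OF assms(1)]) (use assms(2) in \<open>auto intro!: continuous_intros\<close>)

text \<open>The complex line through a point in the direction \<open>\<rho>' - \<rho>\<close> carries the problem into
  the plane: on the strip between the two real parts the restriction of \<open>H\<close> has a primitive,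
  so that its integrals over \<open>[0, T]\<close> along the two edges differ only by the contributions
  of the two short ends, which are bounded independently of \<open>T\<close>. Averaging over the torus
  turns these integrals into \<open>T\<close> times the two means (\<open>torus_integral_swap\<close>); hence the
  difference of the means is \<open>O(1/T)\<close>, and it vanishes. Long segments replace a closed
  contour because the direction is in general not a multiple of a period.\<close>

lemma torus_mean_independent:
  fixes H :: "complex ^ 'k \<Rightarrow> complex"
  assumes D: "open D" "convex D" and holo: "vec_holo H (tube D)" and per: "per_on H (tube D)"
    and r: "\<rho> \<in> D" "\<rho>' \<in> D"
  shows "integral tcube (\<lambda>\<theta>. H (cvec \<rho>' \<theta>)) = integral tcube (\<lambda>\<theta>. H (cvec \<rho> \<theta>))"
proof -
  define v where "v = \<rho>' - \<rho>"
  define cv where "cv = cvec v 0"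
  have cont: "continuous_on (tube D) H"
    using holo by (rule vec_holo_continuous)
  let ?K = "(\<lambda>s. \<rho> + s *\<^sub>R v) ` {0..1}"
  have seg: "\<rho> + s *\<^sub>R v \<in> D" if "0 \<le> s" "s \<le> 1" for s
    using convexD_alt[OF D(2) r that] by (simp add: v_def algebra_simps)
  have "compact ?K"
    by (intro compact_continuous_image continuous_intros) auto
  moreover have "?K \<subseteq> D" using seg by auto
  ultimately obtain C where C: "C > 0" "\<And>x. re_vec x \<in> ?K \<Longrightarrow> norm (H x) \<le> C"
    using per_on_bounded[OF per cont] by blast
  define S where "S = {\<zeta> :: complex. \<rho> + Re \<zeta> *\<^sub>R v \<in> D}"
  have S: "open S" "convex S"
  proof -
    have "open ((\<lambda>\<zeta>. \<rho> + Re \<zeta> *\<^sub>R v) -` D)"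
      by (rule open_vimage[OF D(1)]) (intro continuous_intros)
    then show "open S" by (simp add: S_def vimage_def)
    show "convex S"
    proof (rule convexI)
      fix x y :: complex and a b :: real assume *: "x \<in> S" "y \<in> S" "0 \<le> a" "0 \<le> b" "a + b = 1"
      have "a *\<^sub>R (\<rho> + Re x *\<^sub>R v) + b *\<^sub>R (\<rho> + Re y *\<^sub>R v) \<in> D"
        using convexD[OF D(2)] * by (simp add: S_def)
      moreover have "a *\<^sub>R (\<rho> + Re x *\<^sub>R v) + b *\<^sub>R (\<rho> + Re y *\<^sub>R v) =
          (a + b) *\<^sub>R \<rho> + Re (a *\<^sub>R x + b *\<^sub>R y) *\<^sub>R v"
        by (simp add: algebra_simps)
      ultimately show "a *\<^sub>R x + b *\<^sub>R y \<in> S"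
        using * by (simp add: S_def)
    qed
  qed
  have line: "cvec \<rho> \<theta> + \<zeta> *s cv = cvec (\<rho> + Re \<zeta> *\<^sub>R v) (\<theta> + Im \<zeta> *\<^sub>R v)" for \<theta> \<zeta>
    by (simp add: vec_eq_iff complex_eq_iff cv_def)
  have bnd: "norm (integral {0..T} (\<lambda>t. H (cvec \<rho>' (\<theta> + t *\<^sub>R v))) -
      integral {0..T} (\<lambda>t. H (cvec \<rho> (\<theta> + t *\<^sub>R v)))) \<le> 2 * C" if T: "0 \<le> T" for T \<theta>
  proof -
    let ?f = "\<lambda>\<zeta>. H (cvec \<rho> \<theta> + \<zeta> *s cv)"
    have "?f holomorphic_on S"
      unfolding holomorphic_on_def
    proof
      fix \<zeta> assume "\<zeta> \<in> S"
      then have "cvec \<rho> \<theta> + \<zeta> *s cv \<in> tube D" by (simp add: line S_def)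
      then show "?f field_differentiable at \<zeta> within S"
        using vec_holo_along_line[OF holo] field_differentiable_at_within by blast
    qed
    then obtain G where G: "\<And>\<zeta>. \<zeta> \<in> S \<Longrightarrow> (G has_field_derivative ?f \<zeta>) (at \<zeta> within S)"
      using holomorphic_convex_primitive'[OF S(2,1)] by blast
    have strip: "\<zeta> \<in> S" if "0 \<le> Re \<zeta>" "Re \<zeta> \<le> 1" for \<zeta>
      using seg that by (simp add: S_def)
    have fC: "norm (?f \<zeta>) \<le> C" if "0 \<le> Re \<zeta>" "Re \<zeta> \<le> 1" for \<zeta>
      using that by (intro C(2)) (auto simp: line)
    have int: "integral {0..T} (\<lambda>t. ?f (Complex s t)) = - \<i> * (G (Complex s T) - G (Complex s 0))"
      if s: "0 \<le> s" "s \<le> 1" for s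
    proof -
      have "((\<lambda>t. ?f (Complex s t)) has_integral (- \<i> * G (Complex s T) - (- \<i> * G (Complex s 0)))) {0..T}"
      proof (rule fundamental_theorem_of_calculus[OF T])
        fix t assume "t \<in> {0..T}"
        have 1: "((\<lambda>t. Complex s t) has_vector_derivative \<i>) (at t within {0..T})"
        proof -
          have "(\<lambda>t. Complex s t) = (\<lambda>t. of_real s + t *\<^sub>R \<i>)"
            by (simp add: fun_eq_iff complex_eq_iff)
          then show ?thesis
            by (auto intro!: derivative_eq_intros)
        qed
        have "(G has_field_derivative ?f (Complex s t)) (at (Complex s t))"
          using G[OF strip, of "Complex s t"] s at_within_open[OF _ S(1), of "Complex s t"] strip[of "Complex s t"]
          by simp
        from field_vector_diff_chain_within[OF 1 has_field_derivative_at_within[OF this]]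
        have "((\<lambda>t. G (Complex s t)) has_vector_derivative \<i> * ?f (Complex s t)) (at t within {0..T})"
          by (simp add: o_def)
        from has_vector_derivative_mult_right[OF this, of "- \<i>"]
        show "((\<lambda>t. - \<i> * G (Complex s t)) has_vector_derivative ?f (Complex s t)) (at t within {0..T})"
          by (simp add: mult.assoc[symmetric])
      qed
      then show ?thesis by (simp add: integral_unique algebra_simps)
    qed
    have edge: "norm (G (Complex 1 t) - G (Complex 0 t)) \<le> C" for t
    proof -
      have "norm (G (Complex 1 t) - G (Complex 0 t)) \<le> C * norm (Complex 1 t - Complex 0 t)"
      proof (rule field_differentiable_bound[where S = "closed_segment (Complex 0 t) (Complex 1 t)" and f' = ?f])
        fix z assume z: "z \<in> closed_segment (Complex 0 t) (Complex 1 t)"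
        then have "0 \<le> Re z" "Re z \<le> 1" by (auto simp: closed_segment_def)
        then show "norm (?f z) \<le> C" by (rule fC)
        have "z \<in> S" by (rule strip) fact+
        then have "(G has_field_derivative ?f z) (at z)"
          using G[of z] at_within_open[OF _ S(1), of z] by simp
        then show "(G has_field_derivative ?f z) (at z within closed_segment (Complex 0 t) (Complex 1 t))"
          by (rule has_field_derivative_at_within)
      qed auto
      moreover have "norm (Complex 1 t - Complex 0 t) = 1"
        by (simp add: complex_diff cmod_def)
      ultimately show ?thesis by simp
    qed
    have e1: "(\<lambda>t. H (cvec \<rho>' (\<theta> + t *\<^sub>R v))) = (\<lambda>t. ?f (Complex 1 t))"
      and e0: "(\<lambda>t. H (cvec \<rho> (\<theta> + t *\<^sub>R v))) = (\<lambda>t. ?f (Complex 0 t))"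
      by (simp_all add: line v_def)
    have "integral {0..T} (\<lambda>t. H (cvec \<rho>' (\<theta> + t *\<^sub>R v))) - integral {0..T} (\<lambda>t. H (cvec \<rho> (\<theta> + t *\<^sub>R v)))
        = - \<i> * ((G (Complex 1 T) - G (Complex 0 T)) - (G (Complex 1 0) - G (Complex 0 0)))"
      unfolding e1 e0 by (simp add: int algebra_simps)
    also have "norm \<dots> \<le> norm (G (Complex 1 T) - G (Complex 0 T)) + norm (G (Complex 1 0) - G (Complex 0 0))"
      by (simp add: norm_mult norm_triangle_ineq4)
    also have "\<dots> \<le> 2 * C" using edge[of T] edge[of 0] by simp
    finally show ?thesis .
  qed
  let ?I = "\<lambda>\<rho>. integral tcube (\<lambda>\<theta>. H (cvec \<rho> \<theta>))"
  have key: "T * norm (?I \<rho>' - ?I \<rho>) \<le> 2 * C * content (tcube :: (real ^ 'k) set)" if T: "0 \<le> T" for T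
  proof -
    let ?J = "\<lambda>\<rho> \<theta>. integral {0..T} (\<lambda>t. H (cvec \<rho> (\<theta> + t *\<^sub>R v)))"
    have sw: "integral tcube (?J \<rho>) = of_real T * ?I \<rho>" if "\<rho> \<in> D" for \<rho>
      by (rule torus_integral_swap[OF slice_continuous[OF cont that] per_on_slice[OF per that] T])
    have ci: "?J \<rho> integrable_on tcube" if "\<rho> \<in> D" for \<rho>
    proof -
      have "continuous_on (tcube \<times> cbox 0 T) (\<lambda>(\<theta>, t). H (cvec \<rho> (\<theta> + t *\<^sub>R v)))"
        by (auto simp: case_prod_unfold intro!: continuous_on_compose2[OF cont] continuous_intros that)
      then have "continuous_on tcube (\<lambda>\<theta>. integral (cbox 0 T) (\<lambda>t. H (cvec \<rho> (\<theta> + t *\<^sub>R v))))"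
        by (rule integral_continuous_on_param)
      then show ?thesis
        by (simp add: tcube_def integrable_continuous)
    qed
    have "of_real T * (?I \<rho>' - ?I \<rho>) = integral tcube (\<lambda>\<theta>. ?J \<rho>' \<theta> - ?J \<rho> \<theta>)"
      using sw[OF r(1)] sw[OF r(2)] by (simp add: Henstock_Kurzweil_Integration.integral_diff ci r algebra_simps)
    also have "norm \<dots> \<le> integral tcube (\<lambda>\<theta> :: real ^ 'k. 2 * C)"
      using bnd[OF T]
      by (intro integral_norm_bound_integral Henstock_Kurzweil_Integration.integrable_diff ci r)
         (auto simp: tcube_def integrable_const)
    also have "\<dots> = 2 * C * content (tcube :: (real ^ 'k) set)"
      by (simp add: tcube_def)
    finally show ?thesis using T by (simp add: norm_mult)
  qed
  have "norm (?I \<rho>' - ?I \<rho>) = 0"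
  proof (rule ccontr)
    let ?x = "norm (?I \<rho>' - ?I \<rho>)" and ?B = "2 * C * content (tcube :: (real ^ 'k) set)"
    assume "?x \<noteq> 0"
    then have x: "?x > 0" by simp
    have "?B \<ge> 0" using C(1) by simp
    then have "((?B + 1) / ?x) * ?x \<le> ?B"
      using x by (intro key) simp
    then show False using x by simp
  qed
  then show ?thesis by simp
qed

section \<open>Fourier series of periodic holomorphic functions on tubes\<close>

definition ndot :: "int ^ 'k \<Rightarrow> complex ^ 'k \<Rightarrow> complex" where
  "ndot m x = (\<Sum>k\<in>UNIV. of_int (m $ k) * x $ k)"

definition rdot :: "int ^ 'k \<Rightarrow> real ^ 'k \<Rightarrow> real" where
  "rdot m \<rho> = (\<Sum>k\<in>UNIV. of_int (m $ k) * \<rho> $ k)"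

lemma ndot_cvec: "ndot m (cvec \<rho> \<theta>) = Complex (rdot m \<rho>) (rdot m \<theta>)"
  by (simp add: ndot_def rdot_def complex_eq_iff)

lemma ndot_add: "ndot m (x + y) = ndot m x + ndot m y"
  by (simp add: ndot_def algebra_simps sum.distrib)

lemma ndot_scale: "ndot m (c *s x) = c * ndot m x"
  by (simp add: ndot_def sum_distrib_left algebra_simps)

lemma ndot_period: "exp (ndot m (cvec 0 (period j))) = 1"
proof -
  have "rdot m (period j) = of_int (2 * (\<Sum>k\<in>UNIV. m $ k * j $ k)) * pi"
    by (simp add: rdot_def sum_distrib_left algebra_simps)
  then show ?thesis
    unfolding ndot_cvec exp_eq_1 complex.sel
    by (intro conjI exI) (simp_all only: rdot_def zero_index mult_zero_right sum.neutral_const)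
qed

lemma ndot_linear: "bounded_linear (ndot m)"
  by (rule linear_conv_bounded_linear[THEN iffD1], rule linearI)
     (simp_all add: ndot_def sum.distrib algebra_simps scaleR_sum_right)

lemma continuous_on_ndot [continuous_intros]:
  "continuous_on S f \<Longrightarrow> continuous_on S (\<lambda>x. ndot m (f x))"
  using bounded_linear.continuous_on[OF ndot_linear] by blast

lemma continuous_on_rdot [continuous_intros]:
  "continuous_on S f \<Longrightarrow> continuous_on S (\<lambda>x. rdot m (f x))"
  by (simp add: rdot_def continuous_intros)

lemma vec_holo_exp_ndot: "vec_holo (\<lambda>x. exp (c * ndot m x)) S"
  unfolding vec_holo_def
proof (intro ballI exI conjI allI)
  fix x
  show "((\<lambda>x. exp (c * ndot m x)) has_derivative (\<lambda>v. exp (c * ndot m x) * (c * ndot m v))) (at x)"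
  proof -
    have "((\<lambda>x. c * ndot m x) has_derivative (\<lambda>v. c * ndot m v)) (at x)"
      by (intro has_derivative_mult_right bounded_linear_imp_has_derivative ndot_linear)
    moreover have "(exp has_derivative (\<lambda>h. exp z * h)) (at z)" for z :: complex
      using DERIV_exp by (simp add: has_field_derivative_def)
    ultimately show ?thesis by (rule has_derivative_compose)
  qed
  show "exp (c * ndot m x) * (c * ndot m (\<i> *s v)) = \<i> * (exp (c * ndot m x) * (c * ndot m v))" for v
    by (simp add: ndot_scale)
qed

lemma vec_holo_mult:
  assumes "vec_holo f S" "vec_holo g S"
  shows "vec_holo (\<lambda>x. f x * g x) S"
  unfolding vec_holo_def
proof
  fix x assume "x \<in> S"
  then obtain D E where *: "(f has_derivative D) (at x)" "\<And>v. D (\<i> *s v) = \<i> * D v"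
    "(g has_derivative E) (at x)" "\<And>v. E (\<i> *s v) = \<i> * E v"
    using assms unfolding vec_holo_def by meson
  show "\<exists>D. ((\<lambda>x. f x * g x) has_derivative D) (at x) \<and> (\<forall>v. D (\<i> *s v) = \<i> * D v)"
    by (rule exI[of _ "\<lambda>v. f x * E v + D v * g x"])
       (use has_derivative_mult[OF *(1) *(3)] in \<open>simp add: * algebra_simps\<close>)
qed

lemma per_on_mult: "per_on f S \<Longrightarrow> per_on g S \<Longrightarrow> per_on (\<lambda>x. f x * g x) S"
  by (simp add: per_on_def)

lemma per_on_exp_ndot: "per_on (\<lambda>x. exp (- ndot m x)) S" "per_on (\<lambda>x. exp (ndot m x)) S"
  by (simp_all add: per_on_def ndot_add exp_add exp_minus ndot_period)

lemma continuous_tcube_integrable: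
  fixes f :: "real ^ 'k \<Rightarrow> 'b::banach"
  shows "continuous_on UNIV f \<Longrightarrow> f integrable_on tcube"
  unfolding tcube_def by (rule integrable_continuous) (auto intro: continuous_on_subset)

lemma exp_i_rdot: "cis (rdot m \<theta>) = exp (ndot m (cvec 0 \<theta>))"
  by (simp add: ndot_cvec cis_conv_exp) (simp add: rdot_def Complex_eq)

lemma rdot_add: "rdot (m + m') \<theta> = rdot m \<theta> + rdot m' \<theta>"
  by (simp add: rdot_def algebra_simps sum.distrib)

lemma rdot_diff: "rdot (m - m') \<theta> = rdot m \<theta> - rdot m' \<theta>"
  by (simp add: rdot_def algebra_simps sum_subtractf)

lemma rdot_axis: "rdot (axis k 1) \<theta> = \<theta> $ k"
  by (simp add: rdot_def axis_def if_distrib[of of_int] if_distrib[of "\<lambda>c. c * _"] cong: if_cong)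

text \<open>The factor is a trigonometric polynomial, so multiplication by it only combines
  neighbouring Fourier coefficients.\<close>

lemma no_fourier_coeffs_factor:
  fixes g :: "real ^ 'k \<Rightarrow> complex"
  assumes cont: "continuous_on UNIV g"
    and zero: "\<And>m. integral tcube (\<lambda>\<theta>. g \<theta> * cis (rdot m \<theta>)) = 0"
  shows "integral tcube (\<lambda>\<theta>. g \<theta> * of_real ((1 - cos (\<theta> $ k)) / 2) * cis (rdot m \<theta>)) = 0"
proof -
  let ?e = "\<lambda>m \<theta>. g \<theta> * cis (rdot m \<theta>)"
  have int: "(\<lambda>\<theta>. c * ?e m \<theta>) integrable_on tcube" for m c
    by (intro continuous_tcube_integrable continuous_intros cont)
  have "g \<theta> * of_real ((1 - cos (\<theta> $ k)) / 2) * cis (rdot m \<theta>) =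
      (1/2) * ?e m \<theta> - ((1/4) * ?e (m + axis k 1) \<theta> + (1/4) * ?e (m - axis k 1) \<theta>)" for \<theta>
  proof -
    have e: "cis (\<theta> $ k) + cis (- (\<theta> $ k)) = 2 * of_real (cos (\<theta> $ k))"
      by (simp add: complex_eq_iff)
    have c: "of_real ((1 - cos (\<theta> $ k)) / 2) = (1/2 - (cis (\<theta> $ k) + cis (- (\<theta> $ k))) / 4 :: complex)"
      unfolding e by (simp add: field_simps)
    show ?thesis
      unfolding c rdot_add rdot_diff rdot_axis diff_conv_add_uminus[of "rdot m \<theta>"] cis_mult[symmetric]
      by (simp add: algebra_simps)
  qed
  then show ?thesis
    by (simp only: Henstock_Kurzweil_Integration.integral_diff Henstock_Kurzweil_Integration.integral_add
        Henstock_Kurzweil_Integration.integral_mult_right Henstock_Kurzweil_Integration.integrable_add int zero)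
       simp
qed

text \<open>The powers of \<open>q \<theta> = \<Prod>k. (1 - cos \<theta>\<^sub>k)/2\<close> concentrate at the centre of the cube, where
  \<open>q\<close> takes its maximum 1. They are trigonometric polynomials, so the integrals of
  \<open>f * q ^ n\<close> all vanish; if \<open>f\<close> did not vanish at the centre, these integrals would be
  dominated by a neighbourhood on which \<open>f\<close> is almost constant.\<close>

lemma no_fourier_coeffs_at_centre:
  fixes f :: "real ^ 'k \<Rightarrow> complex"
  assumes cont: "continuous_on UNIV f"
    and zero: "\<And>m. integral tcube (\<lambda>\<theta>. f \<theta> * cis (rdot m \<theta>)) = 0"
  shows "f (\<chi> k. pi) = 0"
proof (rule ccontr)
  define p :: "real ^ 'k" where "p = (\<chi> k. pi)"
  assume "f (\<chi> k. pi) \<noteq> 0"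
  then have fp: "f p \<noteq> 0" by (simp add: p_def)
  define q :: "real ^ 'k \<Rightarrow> real" where "q \<theta> = (\<Prod>k\<in>UNIV. (1 - cos (\<theta> $ k)) / 2)" for \<theta>
  define g where "g \<theta> = f \<theta> / f p" for \<theta>
  have contg: "continuous_on S g" for S
    using fp by (auto simp: g_def intro!: continuous_intros continuous_on_subset[OF cont])
  have contq: "continuous_on S q" for S
    unfolding q_def by (auto intro!: continuous_intros)
  have zg: "integral tcube (\<lambda>\<theta>. g \<theta> * cis (rdot m \<theta>)) = 0" for m
  proof -
    have "(\<lambda>\<theta>. g \<theta> * cis (rdot m \<theta>)) = (\<lambda>\<theta>. inverse (f p) * (f \<theta> * cis (rdot m \<theta>)))"
      by (simp add: g_def divide_inverse mult_ac)
    then show ?thesis using zero[of m] by simp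
  qed
  have prodS: "\<forall>m. integral tcube (\<lambda>\<theta>. h \<theta> * of_real (\<Prod>k\<in>S. (1 - cos (\<theta> $ k)) / 2) * cis (rdot m \<theta>)) = 0"
    if "finite S" "continuous_on UNIV h" "\<And>m. integral tcube (\<lambda>\<theta>. h \<theta> * cis (rdot m \<theta>)) = 0"
    for S :: "'k set" and h
    using that(1)
  proof (induction S)
    case empty
    then show ?case using that(3) by simp
  next
    case (insert k S)
    show ?case
    proof
      fix m
      let ?h = "\<lambda>\<theta>. h \<theta> * of_real (\<Prod>k\<in>S. (1 - cos (\<theta> $ k)) / 2)"
      have "integral tcube (\<lambda>\<theta>. ?h \<theta> * of_real ((1 - cos (\<theta> $ k)) / 2) * cis (rdot m \<theta>)) = 0"
        using insert.IH by (intro no_fourier_coeffs_factor continuous_intros that(2)) auto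
      then show "integral tcube (\<lambda>\<theta>. h \<theta> * of_real (\<Prod>k\<in>insert k S. (1 - cos (\<theta> $ k)) / 2) * cis (rdot m \<theta>)) = 0"
        using insert.hyps by (simp add: mult_ac)
    qed
  qed
  have pw: "\<forall>m. integral tcube (\<lambda>\<theta>. g \<theta> * of_real (q \<theta> ^ n) * cis (rdot m \<theta>)) = 0" for n
  proof (induction n)
    case 0
    then show ?case using zg by simp
  next
    case (Suc n)
    have "\<forall>m. integral tcube (\<lambda>\<theta>. (g \<theta> * of_real (q \<theta> ^ n)) * of_real (q \<theta>) * cis (rdot m \<theta>)) = 0"
      unfolding q_def
      by (rule prodS) (use Suc in \<open>auto simp: q_def intro!: continuous_intros contg\<close>)
    then show ?case by (simp add: mult_ac)
  qed
  have re0: "integral tcube (\<lambda>\<theta>. Re (g \<theta>) * q \<theta> ^ n) = 0" for n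
  proof -
    have "integral tcube (\<lambda>\<theta>. g \<theta> * of_real (q \<theta> ^ n)) = 0"
      using pw[of n, rule_format, of 0] by (simp add: rdot_def)
    moreover have "(\<lambda>\<theta>. g \<theta> * of_real (q \<theta> ^ n)) integrable_on tcube"
      by (intro continuous_tcube_integrable continuous_intros contg contq)
    ultimately have "integral tcube (\<lambda>\<theta>. Re (g \<theta> * of_real (q \<theta> ^ n))) = 0"
      using integral_linear[of "\<lambda>\<theta>. g \<theta> * of_real (q \<theta> ^ n)" tcube Re, OF _ bounded_linear_Re]
      by (simp add: o_def)
    then show ?thesis by simp
  qed
  have qnn: "q \<theta> \<ge> 0" for \<theta>
    unfolding q_def by (intro prod_nonneg) auto
  \<comment> \<open>\<open>g\<close> is normalised to be 1 at the centre, and outside the box of radius \<open>\<delta>\<close> all powers of \<open>q\<close> are bounded by those of \<open>a < 1\<close>\<close>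
  have "isCont g p" using contg[of UNIV] by (simp add: continuous_on_eq_continuous_at)
  moreover have "g p = 1" using fp by (simp add: g_def)
  ultimately obtain d0 where d0: "d0 > 0" "\<And>\<theta>. dist \<theta> p < d0 \<Longrightarrow> dist (g \<theta>) 1 < 1/2"
    unfolding continuous_at by (metis Lim_at continuous_at half_gt_zero_iff zero_less_one \<open>isCont g p\<close> \<open>g p = 1\<close> continuous_at_eps_delta)
  define \<delta> where "\<delta> = min 1 (d0 / (2 * real CARD('k)))"
  have \<delta>: "0 < \<delta>" "\<delta> \<le> 1" using d0(1) by (auto simp: \<delta>_def)
  have near: "Re (g \<theta>) \<ge> 1/2" if "\<And>k. \<bar>\<theta> $ k - pi\<bar> \<le> \<delta>" for \<theta>
  proof -
    have "norm (\<theta> - p) \<le> (\<Sum>k\<in>UNIV. \<bar>(\<theta> - p) $ k\<bar>)" by (rule norm_le_l1_cart)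
    also have "\<dots> \<le> (\<Sum>k\<in>(UNIV::'k set). \<delta>)"
      using that by (intro sum_mono) (simp add: p_def)
    also have "\<dots> = real CARD('k) * \<delta>" by simp
    also have "\<dots> \<le> real CARD('k) * (d0 / (2 * real CARD('k)))"
      by (intro mult_left_mono) (auto simp: \<delta>_def)
    also have "\<dots> < d0" using d0(1) by simp
    finally have "dist (g \<theta>) 1 < 1/2" by (intro d0(2)) (simp add: dist_norm)
    then have "\<bar>Re (g \<theta> - 1)\<bar> < 1/2"
      using abs_Re_le_cmod[of "g \<theta> - 1"] by (simp add: dist_norm)
    then show ?thesis unfolding abs_less_iff by simp
  qed
  define a where "a = (1 + cos \<delta>) / 2"
  have "cos \<delta> < cos 0"
    using \<delta> pi_gt3 by (intro cos_monotone_0_pi) auto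
  moreover have "cos \<delta> > 0" using \<delta> pi_gt3 by (intro cos_gt_zero) auto
  ultimately have a: "0 < a" "a < 1" by (auto simp: a_def)
  have q1: "(1 - cos t) / 2 \<le> (1::real)" "0 \<le> (1 - cos t) / 2" for t :: real
    by (auto simp: field_simps) (smt (verit) cos_ge_minus_one)
  have far: "q \<theta> \<le> a" if "\<theta> \<in> tcube" "\<not> \<bar>\<theta> $ k - pi\<bar> \<le> \<delta>" for \<theta> k
  proof -
    have "0 \<le> \<theta> $ k" "\<theta> $ k \<le> 2 * pi"
      using that(1) by (auto simp: tcube_def mem_box_cart)
    then have "cos \<bar>\<theta> $ k - pi\<bar> \<le> cos \<delta>"
      using that(2) \<delta> by (intro cos_monotone_0_pi_le) auto
    moreover have "cos \<bar>\<theta> $ k - pi\<bar> = - cos (\<theta> $ k)"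
      unfolding cos_abs_real cos_diff by simp
    ultimately have "(1 - cos (\<theta> $ k)) / 2 \<le> a" unfolding a_def by argo
    moreover have "q \<theta> = (1 - cos (\<theta> $ k)) / 2 * (\<Prod>k\<in>UNIV - {k}. (1 - cos (\<theta> $ k)) / 2)"
      unfolding q_def by (rule prod.remove) auto
    moreover have "(\<Prod>k\<in>UNIV - {k}. (1 - cos (\<theta> $ k)) / 2) \<le> 1"
      by (intro prod_le_1) (use q1 in auto)
    moreover have "(1 - cos (\<theta> $ k)) / 2 * (\<Prod>k\<in>UNIV - {k}. (1 - cos (\<theta> $ k)) / 2) \<le> (1 - cos (\<theta> $ k)) / 2 * 1"
      by (rule mult_left_mono) (use calculation q1 in auto)
    ultimately show ?thesis by linarith
  qed
  \<comment> \<open>the contribution of the box where \<open>q\<close> is at least \<open>b\<close> grows faster than the powers of \<open>a\<close>\<close>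
  define b where "b = (1 + a) / 2"
  have b: "a < b" "b < 1" "0 < b" using a by (auto simp: b_def)
  have "q p = 1" by (simp add: q_def p_def)
  moreover have "isCont q p" using contq[of UNIV] by (simp add: continuous_on_eq_continuous_at)
  ultimately obtain d1 where d1: "d1 > 0" "\<And>\<theta>. dist \<theta> p < d1 \<Longrightarrow> dist (q \<theta>) 1 < 1 - b"
    using b(2) by (metis continuous_at_eps_delta diff_gt_0_iff_gt)
  define \<epsilon> where "\<epsilon> = min \<delta> (d1 / (2 * real CARD('k)))"
  have \<epsilon>: "0 < \<epsilon>" "\<epsilon> \<le> \<delta>" using d1(1) \<delta> by (auto simp: \<epsilon>_def)
  define I :: "(real ^ 'k) set" where "I = cbox (\<chi> k. pi - \<epsilon>) (\<chi> k. pi + \<epsilon>)"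
  have Imem: "\<theta> \<in> I \<longleftrightarrow> (\<forall>k. \<bar>\<theta> $ k - pi\<bar> \<le> \<epsilon>)" for \<theta>
    by (auto simp: I_def mem_box_cart abs_le_iff) (smt (verit))+
  have qb: "q \<theta> \<ge> b" if "\<theta> \<in> I" for \<theta>
  proof -
    have "norm (\<theta> - p) \<le> (\<Sum>k\<in>UNIV. \<bar>(\<theta> - p) $ k\<bar>)" by (rule norm_le_l1_cart)
    also have "\<dots> \<le> (\<Sum>k\<in>(UNIV::'k set). \<epsilon>)"
      using that by (intro sum_mono) (simp add: p_def Imem)
    also have "\<dots> = real CARD('k) * \<epsilon>" by simp
    also have "\<dots> \<le> real CARD('k) * (d1 / (2 * real CARD('k)))"
      by (intro mult_left_mono) (auto simp: \<epsilon>_def)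
    also have "\<dots> < d1" using d1(1) by simp
    finally have "dist (q \<theta>) 1 < 1 - b" by (intro d1(2)) (simp add: dist_norm)
    then show ?thesis by (simp add: dist_real_def)
  qed
  have Isub: "I \<subseteq> tcube"
    using \<epsilon> \<delta> pi_gt3 by (auto simp: I_def tcube_def mem_box_cart) (smt (verit))+
  have vI: "content I > 0"
  proof -
    have "box (\<chi> k. pi - \<epsilon>) (\<chi> k. pi + \<epsilon>) \<noteq> ({} :: (real ^ 'k) set)"
      using \<epsilon> by (auto simp: interval_ne_empty_cart)
    then show ?thesis unfolding I_def
      by (simp add: content_pos_lt_eq box_ne_empty)
  qed
  have "compact (tcube :: (real ^ 'k) set)" by (simp add: tcube_def)
  then have "compact (g ` tcube)" using compact_continuous_image[OF contg] by blast
  then obtain C where C: "\<And>\<theta>. \<theta> \<in> tcube \<Longrightarrow> norm (g \<theta>) \<le> C" "C > 0"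
    using compact_imp_bounded bounded_pos by (metis image_eqI)
  have low: "Re (g \<theta>) * q \<theta> ^ n \<ge> - C * a ^ n + (if \<theta> \<in> I then b ^ n / 2 else 0)"
    if t: "\<theta> \<in> tcube" for \<theta> n
  proof (cases "\<forall>k. \<bar>\<theta> $ k - pi\<bar> \<le> \<delta>")
    case True
    then have g: "Re (g \<theta>) \<ge> 1/2" using near by blast
    have "(if \<theta> \<in> I then b ^ n / 2 else 0) \<le> Re (g \<theta>) * q \<theta> ^ n"
    proof (cases "\<theta> \<in> I")
      case True
      have "1/2 * b ^ n \<le> Re (g \<theta>) * q \<theta> ^ n"
        using g qb[OF True] b by (intro mult_mono power_mono) auto
      then show ?thesis using True by simp
    next
      case False
      then show ?thesis using g qnn[of \<theta>] by simp
    qed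
    moreover have "- C * a ^ n \<le> 0" using C(2) a by simp
    ultimately show ?thesis by linarith
  next
    case False
    then have "q \<theta> \<le> a" using far[OF t] by blast
    then have "q \<theta> ^ n \<le> a ^ n" using qnn by (intro power_mono) auto
    moreover have "\<bar>Re (g \<theta>)\<bar> \<le> C" using C(1)[OF t] abs_Re_le_cmod order_trans by blast
    ultimately have "\<bar>Re (g \<theta>) * q \<theta> ^ n\<bar> \<le> C * a ^ n"
      using qnn[of \<theta>] C(2) by (simp add: abs_mult mult_mono)
    moreover have "\<theta> \<notin> I" using False \<epsilon>(2) unfolding Imem by (meson order_trans)
    ultimately show ?thesis by simp
  qed
  have ineq: "b ^ n / 2 * content I \<le> C * a ^ n * content (tcube :: (real ^ 'k) set)" for n
  proof -
    have h1: "((\<lambda>\<theta>. if \<theta> \<in> I then b ^ n / 2 else 0) has_integral (b ^ n / 2 * content I)) tcube"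
      using has_integral_const[of "b ^ n / 2" "(\<chi> k. pi - \<epsilon>) :: real ^ 'k" "\<chi> k. pi + \<epsilon>"] Isub
      by (subst has_integral_restrict[OF Isub]) (simp add: I_def mult.commute)
    have h2: "((\<lambda>\<theta> :: real ^ 'k. - C * a ^ n) has_integral (- C * a ^ n * content (tcube :: (real ^ 'k) set))) tcube"
      using has_integral_const[of "- C * a ^ n" "0 :: real ^ 'k" "\<chi> k. 2 * pi"]
      by (simp add: tcube_def mult.commute)
    have h3: "((\<lambda>\<theta>. Re (g \<theta>) * q \<theta> ^ n) has_integral 0) tcube"
      using re0[of n] integrable_integral[of "\<lambda>\<theta>. Re (g \<theta>) * q \<theta> ^ n" tcube]
      by (simp add: continuous_tcube_integrable continuous_intros contg contq)
    have "- C * a ^ n * content (tcube :: (real ^ 'k) set) + b ^ n / 2 * content I \<le> 0"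
      by (rule has_integral_le[OF has_integral_add[OF h2 h1] h3]) (use low in auto)
    then show ?thesis by simp
  qed
  let ?R = "C * content (tcube :: (real ^ 'k) set) / (content I / 2)"
  have "(b / a) ^ n \<le> ?R" for n
  proof -
    have "b ^ n * (content I / 2) \<le> (C * content (tcube :: (real ^ 'k) set)) * a ^ n"
      using ineq[of n] by (simp add: mult_ac)
    then show ?thesis
      using vI a by (simp add: power_divide field_simps)
  qed
  moreover have "1 < b / a" using a b by simp
  ultimately show False
    by (metis real_arch_pow not_le)
qed

text \<open>A translation moves any given point to the centre of the cube and multiplies the
  Fourier coefficients by phases.\<close>

lemma continuous_fourier_unique:
  fixes f :: "real ^ 'k \<Rightarrow> complex"
  assumes cont: "continuous_on UNIV f" and per: "per_real f"
    and zero: "\<And>m. integral tcube (\<lambda>\<theta>. f \<theta> * cis (rdot m \<theta>)) = 0"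
  shows "f \<theta>0 = 0"
proof -
  let ?s = "\<theta>0 - (\<chi> k. pi)"
  let ?h = "\<lambda>\<theta>. f (\<theta> + ?s)"
  have ch: "continuous_on UNIV ?h"
    by (intro continuous_on_compose2[OF cont] continuous_intros) auto
  have "integral tcube (\<lambda>\<theta>. ?h \<theta> * cis (rdot m \<theta>)) = 0" for m
  proof -
    have rs: "rdot m \<theta> = rdot m (\<theta> + ?s) + (- rdot m ?s)" for \<theta>
      by (simp add: rdot_def algebra_simps sum.distrib sum_subtractf)
    have "(\<lambda>\<theta>. ?h \<theta> * cis (rdot m \<theta>)) = (\<lambda>\<theta>. cis (- rdot m ?s) * (f (\<theta> + ?s) * cis (rdot m (\<theta> + ?s))))"
      by (subst rs, subst cis_mult[symmetric]) (simp add: mult_ac)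
    then have "integral tcube (\<lambda>\<theta>. ?h \<theta> * cis (rdot m \<theta>)) =
        cis (- rdot m ?s) * integral tcube (\<lambda>\<theta>. f (\<theta> + ?s) * cis (rdot m (\<theta> + ?s)))"
      by simp
    also have "integral tcube (\<lambda>\<theta>. f (\<theta> + ?s) * cis (rdot m (\<theta> + ?s))) =
        integral tcube (\<lambda>\<theta>. f \<theta> * cis (rdot m \<theta>))"
    proof (rule torus_integral_translate)
      show "per_real (\<lambda>\<theta>. f \<theta> * cis (rdot m \<theta>))"
        unfolding per_real_def
      proof (intro allI)
        fix j :: "int ^ 'k" and \<theta>
        have "cvec 0 (\<theta> + period j) = cvec 0 \<theta> + cvec 0 (period j)"
          by (simp add: cvec_add)
        then show "f (\<theta> + period j) * cis (rdot m (\<theta> + period j)) = f \<theta> * cis (rdot m \<theta>)"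
          by (simp add: per_real_add[OF per] exp_i_rdot ndot_add exp_add ndot_period)
      qed
    qed (intro continuous_intros cont)
    finally show ?thesis using zero by simp
  qed
  from no_fourier_coeffs_at_centre[OF ch this] show ?thesis by simp
qed

lemma has_vector_derivative_exp:
  fixes f :: "real \<Rightarrow> complex"
  assumes "(f has_vector_derivative f') (at x)"
  shows "((\<lambda>t. exp (f t)) has_vector_derivative f' * exp (f x)) (at x)"
  using field_vector_diff_chain_at[OF assms DERIV_exp] by (simp add: o_def)

text \<open>The exponential contains the real part \<open>\<rho>\<close> as well, so that the coefficient does not
  depend on the slice on which it is computed (\<open>fcoeff_independent\<close>).\<close>

definition fcoeff :: "(complex ^ 'k \<Rightarrow> complex) \<Rightarrow> real ^ 'k \<Rightarrow> int ^ 'k \<Rightarrow> complex" where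
  "fcoeff F \<rho> m = integral tcube (\<lambda>\<theta>. F (cvec \<rho> \<theta>) * exp (- ndot m (cvec \<rho> \<theta>))) / of_real (2 * pi) ^ CARD('k)"

lemma fcoeff_independent:
  fixes F :: "complex ^ 'k \<Rightarrow> complex"
  assumes "open D" "convex D" "vec_holo F (tube D)" "per_on F (tube D)" "\<rho> \<in> D" "\<rho>' \<in> D"
  shows "fcoeff F \<rho>' m = fcoeff F \<rho> m"
proof -
  have "vec_holo (\<lambda>x. F x * exp (- ndot m x)) (tube D)"
    using vec_holo_mult[OF assms(3) vec_holo_exp_ndot[of "-1" m]] by simp
  moreover have "per_on (\<lambda>x. F x * exp (- ndot m x)) (tube D)"
    using assms(4) per_on_exp_ndot(1) by (rule per_on_mult)
  ultimately have "integral tcube (\<lambda>\<theta>. F (cvec \<rho>' \<theta>) * exp (- ndot m (cvec \<rho>' \<theta>))) =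
      integral tcube (\<lambda>\<theta>. F (cvec \<rho> \<theta>) * exp (- ndot m (cvec \<rho> \<theta>)))"
    by (rule torus_mean_independent[OF assms(1,2) _ _ assms(5,6)])
  then show ?thesis
    unfolding fcoeff_def by (rule arg_cong)
qed

lemma content_tcube: "content (tcube :: (real ^ 'k) set) = (2 * pi) ^ CARD('k)"
proof -
  have "cbox 0 (\<chi> k. 2 * pi) \<noteq> ({} :: (real ^ 'k) set)"
    by (auto simp: interval_ne_empty_cart)
  then show ?thesis
    unfolding tcube_def by (subst content_cbox_cart) auto
qed

lemma fcoeff_bound:
  fixes F :: "complex ^ 'k \<Rightarrow> complex"
  assumes "continuous_on (tube D) F" "\<rho> \<in> D" and C: "\<And>\<theta>. norm (F (cvec \<rho> \<theta>)) \<le> C"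
  shows "norm (fcoeff F \<rho> m) \<le> C * exp (- rdot m \<rho>)"
proof -
  have "norm (integral tcube (\<lambda>\<theta>. F (cvec \<rho> \<theta>) * exp (- ndot m (cvec \<rho> \<theta>))))
      \<le> integral tcube (\<lambda>\<theta> :: real ^ 'k. C * exp (- rdot m \<rho>))"
  proof (rule integral_norm_bound_integral)
    show "(\<lambda>\<theta>. F (cvec \<rho> \<theta>) * exp (- ndot m (cvec \<rho> \<theta>))) integrable_on tcube"
      by (intro continuous_tcube_integrable continuous_intros slice_continuous[OF assms(1,2)])
    show "norm (F (cvec \<rho> \<theta>) * exp (- ndot m (cvec \<rho> \<theta>))) \<le> C * exp (- rdot m \<rho>)" for \<theta>
      using C[of \<theta>] by (simp add: norm_mult norm_exp_eq_Re ndot_cvec)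
  qed (simp add: tcube_def integrable_const)
  also have "\<dots> = C * exp (- rdot m \<rho>) * (2 * pi) ^ CARD('k)"
    by (subst content_tcube[symmetric]) (simp add: tcube_def)
  finally show ?thesis
    by (simp add: fcoeff_def norm_divide norm_power norm_mult power_mult_distrib divide_le_eq)
qed

definition l1 :: "int ^ 'k \<Rightarrow> real" where
  "l1 m = (\<Sum>k\<in>UNIV. \<bar>of_int (m $ k)\<bar>)"

lemma summable_geometric_int:
  fixes \<delta> :: real
  assumes "\<delta> > 0"
  shows "Infinite_Set_Sum.abs_summable_on (\<lambda>j::int. exp (- \<delta> * \<bar>of_int j\<bar>)) (UNIV)"
proof -
  have nat: "Infinite_Set_Sum.abs_summable_on (\<lambda>n::nat. exp (- \<delta> * real n)) (UNIV)"
  proof -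
    have "summable (\<lambda>n. norm (exp (- \<delta>) ^ n))"
      using assms by (simp add: norm_power summable_geometric)
    then show ?thesis
      by (subst abs_summable_on_nat_iff') (simp add: exp_of_nat_mult[symmetric] mult.commute)
  qed
  have "Infinite_Set_Sum.abs_summable_on (\<lambda>j::int. exp (- \<delta> * \<bar>of_int j\<bar>)) (range int)"
    by (subst abs_summable_on_reindex_iff[symmetric, of int]) (use nat in auto)
  moreover have "Infinite_Set_Sum.abs_summable_on (\<lambda>j::int. exp (- \<delta> * \<bar>of_int j\<bar>)) (range (\<lambda>n. - int n))"
    by (subst abs_summable_on_reindex_iff[symmetric, of "\<lambda>n. - int n"]) (use nat in \<open>auto simp: inj_on_def\<close>)
  ultimately have "Infinite_Set_Sum.abs_summable_on (\<lambda>j::int. exp (- \<delta> * \<bar>of_int j\<bar>)) ((range int \<union> range (\<lambda>n. - int n)))"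
    by (rule abs_summable_on_union)
  moreover have "range int \<union> range (\<lambda>n. - int n) = UNIV"
    by (auto, metis int_cases2 rangeI)
  ultimately show ?thesis by simp
qed

text \<open>The sum is a product of two-sided geometric series, one for each coordinate.\<close>

lemma summable_exp_l1:
  fixes \<delta> :: real
  assumes "\<delta> > 0"
  shows "(\<lambda>m :: int ^ 'k. exp (- \<delta> * l1 m)) summable_on UNIV"
proof -
  have bij_vec: "bij_betw vec_lambda UNIV (UNIV :: (int ^ 'k) set)"
    by (rule bij_betwI[where g = vec_nth]) auto
  have "Infinite_Set_Sum.abs_summable_on (\<lambda>g :: 'k \<Rightarrow> int. \<Prod>k\<in>UNIV. exp (- \<delta> * \<bar>of_int (g k)\<bar>)) (PiE UNIV (\<lambda>_. UNIV))"
    by (rule abs_summable_on_prod_PiE) (use summable_geometric_int[OF assms] in auto)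
  then have "Infinite_Set_Sum.abs_summable_on (\<lambda>g :: 'k \<Rightarrow> int. exp (- \<delta> * l1 (vec_lambda g))) (UNIV)"
    by (simp add: l1_def exp_sum[symmetric] sum_distrib_left PiE_UNIV_domain)
  then have "Infinite_Set_Sum.abs_summable_on (\<lambda>m :: int ^ 'k. exp (- \<delta> * l1 m)) (UNIV)"
    by (subst (asm) abs_summable_on_reindex_bij_betw[of vec_lambda UNIV UNIV, OF bij_vec])
  then show ?thesis
    by (simp add: abs_summable_equivalent[symmetric])
qed

lemma rdot_diff_right: "rdot m (a - b) = rdot m a - rdot m b"
  by (simp add: rdot_def algebra_simps sum_subtractf)

lemma rdot_bound:
  fixes \<rho> :: "real ^ 'k"
  assumes "\<And>k. \<bar>\<rho> $ k\<bar> \<le> \<delta>"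
  shows "rdot m \<rho> \<le> \<delta> * l1 m"
  unfolding rdot_def l1_def sum_distrib_left
proof (rule sum_mono)
  fix k
  have "of_int (m $ k) * \<rho> $ k \<le> \<bar>of_int (m $ k)\<bar> * \<bar>\<rho> $ k\<bar>"
    by (metis abs_ge_self abs_mult)
  also have "\<dots> \<le> \<bar>of_int (m $ k)\<bar> * \<delta>" using assms by (intro mult_left_mono) auto
  finally show "of_int (m $ k) * \<rho> $ k \<le> \<delta> * \<bar>of_int (m $ k)\<bar>" by (simp add: mult.commute)
qed

text \<open>The coefficient may be computed on any nearby slice. Moving the real part by \<open>2 * \<delta>\<close>
  in each coordinate, in the direction of the sign of \<open>m\<close>, gains the factor
  \<open>exp (- 2 * \<delta> * l1 m)\<close>; half of it pays for the passage from \<open>\<rho>0\<close> to \<open>\<rho>\<close>.\<close>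

lemma fcoeff_decay:
  fixes F :: "complex ^ 'k \<Rightarrow> complex"
  assumes D: "open D" "convex D" and F: "vec_holo F (tube D)" "per_on F (tube D)" and \<rho>0: "\<rho>0 \<in> D"
    and \<delta>: "\<delta> \<ge> 0" and box: "\<And>\<rho>. (\<And>k. \<bar>\<rho> $ k - \<rho>0 $ k\<bar> \<le> 2 * \<delta>) \<Longrightarrow> \<rho> \<in> D"
  obtains C where "\<And>m \<rho>. (\<And>k. \<bar>\<rho> $ k - \<rho>0 $ k\<bar> \<le> \<delta>) \<Longrightarrow>
      norm (fcoeff F \<rho>0 m) * exp (rdot m \<rho>) \<le> C * exp (- \<delta> * l1 m)"
proof -
  let ?K = "cbox (\<rho>0 - (\<chi> k. 2 * \<delta>)) (\<rho>0 + (\<chi> k. 2 * \<delta>))"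
  have Kmem: "\<rho> \<in> ?K \<longleftrightarrow> (\<forall>k. \<bar>\<rho> $ k - \<rho>0 $ k\<bar> \<le> 2 * \<delta>)" for \<rho>
    by (simp add: mem_box_cart abs_le_iff) (smt (verit))
  have KD: "?K \<subseteq> D" using box Kmem by blast
  have cont: "continuous_on (tube D) F" using F(1) by (rule vec_holo_continuous)
  obtain C where C: "C > 0" "\<And>x. re_vec x \<in> ?K \<Longrightarrow> norm (F x) \<le> C"
    using per_on_bounded[OF F(2) cont compact_cbox KD] by blast
  have "norm (fcoeff F \<rho>0 m) * exp (rdot m \<rho>) \<le> C * exp (- \<delta> * l1 m)"
    if r: "\<And>k. \<bar>\<rho> $ k - \<rho>0 $ k\<bar> \<le> \<delta>" for m \<rho>
  proof -
    define \<rho>1 where "\<rho>1 = \<rho>0 + (\<chi> k. 2 * \<delta> * sgn (of_int (m $ k)))"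
    have "\<rho>1 \<in> ?K"
      unfolding Kmem using \<delta> by (simp add: \<rho>1_def abs_mult sgn_if)
    then have "\<rho>1 \<in> D" using KD by blast
    have "norm (fcoeff F \<rho>0 m) = norm (fcoeff F \<rho>1 m)"
      using fcoeff_independent[OF D F \<rho>0 \<open>\<rho>1 \<in> D\<close>] by simp
    also have "\<dots> \<le> C * exp (- rdot m \<rho>1)"
      using \<open>\<rho>1 \<in> ?K\<close> by (intro fcoeff_bound[OF cont \<open>\<rho>1 \<in> D\<close>] C) simp
    also have "rdot m \<rho>1 = rdot m \<rho>0 + 2 * \<delta> * l1 m"
      by (simp add: \<rho>1_def rdot_def l1_def sum.distrib sum_distrib_left algebra_simps abs_sgn)
    finally have "norm (fcoeff F \<rho>0 m) * exp (rdot m \<rho>) \<le> C * exp (- (rdot m \<rho>0 + 2 * \<delta> * l1 m)) * exp (rdot m \<rho>)"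
      by (intro mult_right_mono) auto
    also have "\<dots> = C * exp (rdot m (\<rho> - \<rho>0) - 2 * \<delta> * l1 m)"
      by (simp add: exp_add[symmetric] rdot_diff_right algebra_simps)
    also have "\<dots> \<le> C * exp (- \<delta> * l1 m)"
      using rdot_bound[of "\<rho> - \<rho>0" \<delta> m] r C(1) by simp
    finally show ?thesis .
  qed
  then show thesis by (rule that)
qed

lemma open_contains_box:
  fixes D :: "(real ^ 'k) set"
  assumes "open D" "\<rho>0 \<in> D"
  obtains \<delta> where "\<delta> > 0" "\<And>\<rho>. (\<And>k. \<bar>\<rho> $ k - \<rho>0 $ k\<bar> \<le> \<delta>) \<Longrightarrow> \<rho> \<in> D"
proof -
  obtain e where e: "e > 0" "ball \<rho>0 e \<subseteq> D" using assms open_contains_ball by blast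
  let ?d = "e / (2 * real CARD('k))"
  have "\<rho> \<in> D" if "\<And>k. \<bar>\<rho> $ k - \<rho>0 $ k\<bar> \<le> ?d" for \<rho>
  proof -
    have "norm (\<rho> - \<rho>0) \<le> (\<Sum>k\<in>UNIV. \<bar>(\<rho> - \<rho>0) $ k\<bar>)" by (rule norm_le_l1_cart)
    also have "\<dots> \<le> (\<Sum>k\<in>(UNIV :: 'k set). ?d)" using that by (intro sum_mono) simp
    also have "\<dots> < e" using e(1) by simp
    finally show ?thesis using e(2) by (auto simp: dist_norm norm_minus_commute)
  qed
  then show thesis using e(1) by (intro that[of ?d]) auto
qed

text \<open>By \<open>fcoeff_decay\<close> the series converges uniformly on the slice through \<open>x\<close>, to a
  continuous periodic function with the same Fourier coefficients as \<open>F\<close>; by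
  \<open>continuous_fourier_unique\<close> it is \<open>F\<close>.\<close>

theorem fourier_expansion:
  fixes F :: "complex ^ 'k \<Rightarrow> complex"
  assumes D: "open D" "convex D" and F: "vec_holo F (tube D)" "per_on F (tube D)" and \<rho>0: "\<rho>0 \<in> D"
    and x: "re_vec x \<in> D"
  shows "(\<lambda>m. norm (fcoeff F \<rho>0 m * exp (ndot m x))) summable_on UNIV"
    and "((\<lambda>m. fcoeff F \<rho>0 m * exp (ndot m x)) has_sum F x) UNIV"
proof -
  let ?\<rho> = "re_vec x"
  have coeq: "fcoeff F \<rho>0 = fcoeff F ?\<rho>"
    using fcoeff_independent[OF D F x \<rho>0] by (simp add: fun_eq_iff)
  have cont: "continuous_on (tube D) F" using F(1) by (rule vec_holo_continuous)
  obtain \<delta>' where "\<delta>' > 0" "\<And>\<rho>. (\<And>k. \<bar>\<rho> $ k - ?\<rho> $ k\<bar> \<le> \<delta>') \<Longrightarrow> \<rho> \<in> D"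
    using open_contains_box[OF D(1) x] by blast
  then obtain \<delta> where \<delta>: "\<delta> > 0" "\<And>\<rho>. (\<And>k. \<bar>\<rho> $ k - ?\<rho> $ k\<bar> \<le> 2 * \<delta>) \<Longrightarrow> \<rho> \<in> D"
    using that[of "\<delta>' / 2"] by (metis field_sum_of_halves half_gt_zero mult_2)
  obtain C where C: "\<And>m \<rho>. (\<And>k. \<bar>\<rho> $ k - ?\<rho> $ k\<bar> \<le> \<delta>) \<Longrightarrow>
      norm (fcoeff F ?\<rho> m) * exp (rdot m \<rho>) \<le> C * exp (- \<delta> * l1 m)"
    using fcoeff_decay[OF D F x _ \<delta>(2)] \<delta>(1) by (metis less_imp_le)
  let ?t = "\<lambda>m \<theta>. fcoeff F ?\<rho> m * exp (ndot m (cvec ?\<rho> \<theta>))"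
  have bt: "norm (?t m \<theta>) \<le> C * exp (- \<delta> * l1 m)" for m \<theta>
    using C[of ?\<rho> m] \<delta>(1) by (simp add: norm_mult norm_exp_eq_Re ndot_cvec)
  have sB: "(\<lambda>m :: int ^ 'k. C * exp (- \<delta> * l1 m)) summable_on UNIV"
    by (intro summable_on_cmult_right summable_exp_l1 \<delta>(1))
  have abs: "(\<lambda>m. norm (?t m \<theta>)) summable_on UNIV" for \<theta>
    by (rule summable_on_comparison_test[OF sB]) (use bt in auto)
  then show "(\<lambda>m. norm (fcoeff F \<rho>0 m * exp (ndot m x))) summable_on UNIV"
    using coeq by (metis cvec_re_im)
  define S where "S \<theta> = (\<Sum>\<^sub>\<infinity>m. ?t m \<theta>)" for \<theta>
  have hs: "((\<lambda>m. ?t m \<theta>) has_sum S \<theta>) UNIV" for \<theta>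
    unfolding S_def by (rule has_sum_infsum[OF abs_summable_summable[OF abs]])
  have unif: "uniform_limit UNIV (\<lambda>M \<theta>. \<Sum>m\<in>M. ?t m \<theta>) S (finite_subsets_at_top UNIV)"
    unfolding S_def by (rule Weierstrass_m_test_general'[OF _ hs[unfolded S_def] sB]) (use bt in auto)
  have cS: "continuous_on UNIV S"
    by (rule uniform_limit_theorem[OF _ unif])
       (auto intro!: eventuallyI continuous_intros simp: finite_subsets_at_top_neq_bot)
  have cf: "continuous_on UNIV (\<lambda>\<theta>. F (cvec ?\<rho> \<theta>))"
    by (rule slice_continuous[OF cont x])
  have pS: "per_real S"
    unfolding per_real_def S_def
  proof (intro allI infsum_cong)
    fix m j :: "int ^ 'k" and \<theta>
    have "cvec ?\<rho> (\<theta> + period j) = cvec ?\<rho> \<theta> + cvec 0 (period j)" by (simp add: cvec_add)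
    then show "?t m (\<theta> + period j) = ?t m \<theta>" by (simp add: ndot_add exp_add ndot_period)
  qed
  define d where "d \<theta> = F (cvec ?\<rho> \<theta>) - S \<theta>" for \<theta>
  have cd: "continuous_on UNIV d" unfolding d_def by (intro continuous_intros cf cS)
  have pd: "per_real d"
    using pS per_on_slice[OF F(2) x] by (simp add: per_real_def d_def)
  have zero: "integral tcube (\<lambda>\<theta>. d \<theta> * cis (rdot j \<theta>)) = 0" for j
  proof -
    have u2: "uniform_limit tcube (\<lambda>M \<theta>. (\<Sum>m\<in>M. ?t m \<theta>) * cis (rdot j \<theta>)) (\<lambda>\<theta>. S \<theta> * cis (rdot j \<theta>))
        (finite_subsets_at_top UNIV)"
    proof (rule uniform_limitI)
      fix e :: real assume "e > 0"
      from uniform_limitD[OF unif this]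
      show "\<forall>\<^sub>F M in finite_subsets_at_top UNIV. \<forall>\<theta>\<in>tcube.
          dist ((\<Sum>m\<in>M. ?t m \<theta>) * cis (rdot j \<theta>)) (S \<theta> * cis (rdot j \<theta>)) < e"
        by (rule eventually_mono) (auto simp: dist_norm left_diff_distrib[symmetric] norm_mult)
    qed
    have ti: "(\<lambda>\<theta>. ?t m \<theta> * cis (rdot j \<theta>)) integrable_on tcube" for m
      by (intro continuous_tcube_integrable continuous_intros)
    have tint: "integral tcube (\<lambda>\<theta>. ?t m \<theta> * cis (rdot j \<theta>)) =
        (if m = - j then integral tcube (\<lambda>\<theta>. F (cvec ?\<rho> \<theta>) * cis (rdot j \<theta>)) else 0)" for m
    proof (cases "m = - j")
      case True
      have r: "rdot (- j) \<theta> = - rdot j \<theta>" for \<theta> by (simp add: rdot_def sum_negf)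
      have n: "ndot (- j) y = - ndot j y" for y by (simp add: ndot_def sum_negf)
      have tc: "?t m \<theta> * cis (rdot j \<theta>) = fcoeff F ?\<rho> m * exp (- of_real (rdot j ?\<rho>))" for \<theta>
      proof -
        have "exp (ndot m (cvec ?\<rho> \<theta>)) * cis (rdot j \<theta>) = exp (- of_real (rdot j ?\<rho>))"
          unfolding cis_conv_exp exp_add[symmetric] True n ndot_cvec
          by (rule arg_cong[of _ _ exp]) (simp add: complex_eq_iff r)
        then show ?thesis by (simp add: mult.assoc)
      qed
      then have "integral tcube (\<lambda>\<theta>. ?t m \<theta> * cis (rdot j \<theta>)) =
          fcoeff F ?\<rho> m * exp (- of_real (rdot j ?\<rho>)) * of_real ((2 * pi) ^ CARD('k))"
        unfolding tc by (subst content_tcube[symmetric]) (simp add: tcube_def scaleR_conv_of_real)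
      also have "\<dots> = integral tcube (\<lambda>\<theta>. F (cvec ?\<rho> \<theta>) * exp (- ndot m (cvec ?\<rho> \<theta>))) * exp (- of_real (rdot j ?\<rho>))"
        by (simp add: fcoeff_def)
      also have "\<dots> = integral tcube (\<lambda>\<theta>. F (cvec ?\<rho> \<theta>) * exp (- ndot m (cvec ?\<rho> \<theta>)) * exp (- of_real (rdot j ?\<rho>)))"
        by (simp add: integral_mult_left)
      also have "\<dots> = integral tcube (\<lambda>\<theta>. F (cvec ?\<rho> \<theta>) * cis (rdot j \<theta>))"
      proof -
        have "exp (- ndot m (cvec ?\<rho> \<theta>)) * exp (- of_real (rdot j ?\<rho>)) = cis (rdot j \<theta>)" for \<theta>
          unfolding cis_conv_exp exp_add[symmetric] True n ndot_cvec
          by (rule arg_cong[of _ _ exp]) (simp add: complex_eq_iff r)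
        then show ?thesis by (simp add: mult.assoc)
      qed
      finally show ?thesis using True by simp
    next
      case False
      then obtain b where b: "(m + j) $ b \<noteq> 0"
        by (metis add.inverse_inverse add_eq_0_iff vec_eq_iff zero_index)
      let ?c = "fcoeff F ?\<rho> m * exp (of_real (rdot m ?\<rho>))"
      have te: "?t m \<theta> * cis (rdot j \<theta>) = ?c * cis (rdot (m + j) \<theta>)" for \<theta>
      proof -
        have "exp (ndot m (cvec ?\<rho> \<theta>)) * cis (rdot j \<theta>) = exp (of_real (rdot m ?\<rho>)) * cis (rdot (m + j) \<theta>)"
          unfolding cis_conv_exp exp_add[symmetric] ndot_cvec
          by (rule arg_cong[of _ _ exp]) (simp add: complex_eq_iff rdot_add)
        then show ?thesis by (simp add: mult.assoc)
      qed
      have "integral tcube (\<lambda>\<theta>. \<i> * of_int ((m + j) $ b) * cis (rdot (m + j) \<theta>)) = 0"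
      proof (rule torus_integral_deriv_zero[where b = b and H = "\<lambda>\<theta>. cis (rdot (m + j) \<theta>)"])
        have p: "per_real (\<lambda>\<theta>. cis (rdot (m + j) \<theta>))"
          by (auto simp: per_real_def exp_i_rdot ndot_add[symmetric] cvec_add)
             (metis (no_types) add.left_neutral cvec_add exp_add mult.right_neutral ndot_add ndot_period)
        then show "per_real (\<lambda>\<theta>. cis (rdot (m + j) \<theta>))"
          "per_real (\<lambda>\<theta>. \<i> * of_int ((m + j) $ b) * cis (rdot (m + j) \<theta>))"
          by (simp_all add: per_real_def)
        show "((\<lambda>t. cis (rdot (m + j) (\<theta> + t *\<^sub>R axis b 1))) has_vector_derivative
            \<i> * of_int ((m + j) $ b) * cis (rdot (m + j) \<theta>)) (at 0)" for \<theta>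
        proof -
          have ra: "rdot (m + j) (\<theta> + t *\<^sub>R axis b 1) = rdot (m + j) \<theta> + t * of_int ((m + j) $ b)" for t
            by (simp add: rdot_def axis_def algebra_simps sum.distrib if_distrib[of "\<lambda>c. c * _"]
                if_distrib[of "\<lambda>c. _ * c"] cong: if_cong)
          have "((\<lambda>t. \<i> * of_real (rdot (m + j) \<theta> + t * of_int ((m + j) $ b))) has_vector_derivative
              \<i> * of_int ((m + j) $ b)) (at 0)"
            by (auto intro!: derivative_eq_intros has_vector_derivative_of_real)
          from has_vector_derivative_exp[OF this] show ?thesis
            unfolding ra cis_conv_exp by simp
        qed
      qed (intro continuous_intros)+
      then have "integral tcube (\<lambda>\<theta>. cis (rdot (m + j) \<theta>)) = 0"
      proof -
        have "\<i> * of_int ((m + j) $ b) \<noteq> (0 :: complex)"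
          using b by (simp only: mult_eq_0_iff of_int_eq_0_iff) simp
        then show ?thesis
          using \<open>integral tcube (\<lambda>\<theta>. \<i> * of_int ((m + j) $ b) * cis (rdot (m + j) \<theta>)) = 0\<close>
          unfolding integral_mult_right mult_eq_0_iff by blast
      qed
      then show ?thesis using False by (simp add: te)
    qed
    have lim: "((\<lambda>M. integral tcube (\<lambda>\<theta>. (\<Sum>m\<in>M. ?t m \<theta>) * cis (rdot j \<theta>))) \<longlongrightarrow>
        integral tcube (\<lambda>\<theta>. S \<theta> * cis (rdot j \<theta>))) (finite_subsets_at_top UNIV)"
    proof -
      have cc: "continuous_on (cbox 0 (\<chi> k. 2 * pi)) (\<lambda>\<theta>. (\<Sum>m\<in>M. ?t m \<theta>) * cis (rdot j \<theta>))" for M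
        by (intro continuous_intros)
      obtain I J where IJ: "\<And>M. ((\<lambda>\<theta>. (\<Sum>m\<in>M. ?t m \<theta>) * cis (rdot j \<theta>)) has_integral I M) tcube"
        "((\<lambda>\<theta>. S \<theta> * cis (rdot j \<theta>)) has_integral J) tcube" "(I \<longlongrightarrow> J) (finite_subsets_at_top UNIV)"
        using uniform_limit_integral_cbox[OF u2[unfolded tcube_def] cc finite_subsets_at_top_neq_bot]
        unfolding tcube_def by blast
      then show ?thesis by (simp only: integral_unique[OF IJ(1)] integral_unique[OF IJ(2)])
    qed
    have ev: "\<forall>\<^sub>F M in finite_subsets_at_top UNIV. integral tcube (\<lambda>\<theta>. (\<Sum>m\<in>M. ?t m \<theta>) * cis (rdot j \<theta>)) =
        integral tcube (\<lambda>\<theta>. F (cvec ?\<rho> \<theta>) * cis (rdot j \<theta>))"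
      unfolding eventually_finite_subsets_at_top
    proof (intro exI[of _ "{- j}"] conjI allI impI)
      fix M assume M: "finite M \<and> {- j} \<subseteq> M \<and> M \<subseteq> (UNIV :: (int ^ 'k) set)"
      have "integral tcube (\<lambda>\<theta>. (\<Sum>m\<in>M. ?t m \<theta>) * cis (rdot j \<theta>)) =
          (\<Sum>m\<in>M. integral tcube (\<lambda>\<theta>. ?t m \<theta> * cis (rdot j \<theta>)))"
        using M ti by (simp add: sum_distrib_right Henstock_Kurzweil_Integration.integral_sum)
      then show "integral tcube (\<lambda>\<theta>. (\<Sum>m\<in>M. ?t m \<theta>) * cis (rdot j \<theta>)) =
        integral tcube (\<lambda>\<theta>. F (cvec ?\<rho> \<theta>) * cis (rdot j \<theta>))"
        using M by (simp add: tint sum.delta)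
    qed auto
    have "integral tcube (\<lambda>\<theta>. S \<theta> * cis (rdot j \<theta>)) = integral tcube (\<lambda>\<theta>. F (cvec ?\<rho> \<theta>) * cis (rdot j \<theta>))"
      by (rule tendsto_unique[OF finite_subsets_at_top_neq_bot lim tendsto_eventually[OF ev]])
    moreover have "(\<lambda>\<theta>. S \<theta> * cis (rdot j \<theta>)) integrable_on tcube" "(\<lambda>\<theta>. F (cvec ?\<rho> \<theta>) * cis (rdot j \<theta>)) integrable_on tcube"
      by (intro continuous_tcube_integrable continuous_intros cS cf)+
    ultimately show ?thesis
      by (simp add: d_def left_diff_distrib Henstock_Kurzweil_Integration.integral_diff)
  qed
  have "d (im_vec x) = 0"
    by (rule continuous_fourier_unique[OF cd pd zero])
  then have "S (im_vec x) = F x" by (simp add: d_def)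
  then show "((\<lambda>m. fcoeff F \<rho>0 m * exp (ndot m x)) has_sum F x) UNIV"
    using hs[of "im_vec x"] by (simp add: coeq)
qed

section \<open>Exact forms on the torus\<close>

text \<open>Exchanging the values of \<open>p\<close> at \<open>a\<close> and \<open>a0\<close> reverses the sign of \<open>p\<close> but, as \<open>T\<close> is
  symmetric, does not change the term multiplied by it.\<close>

lemma det_cofactor_row_cancel:
  fixes M :: "complex ^ 'k ^ 'k" and T :: "'k \<Rightarrow> 'k \<Rightarrow> 'k \<Rightarrow> complex"
  assumes sym: "\<And>a b c. T a b c = T a c b" and "a \<noteq> a0"
  shows "(\<Sum>p | p permutes (UNIV :: 'k set). of_int (sign p) *
      (T a (p a) (p a0) * (\<Prod>c\<in>UNIV - {a0} - {a}. M $ c $ p c))) = 0" (is "?S = 0")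
proof -
  let ?f = "\<lambda>p. of_int (sign p) * (T a (p a) (p a0) * (\<Prod>c\<in>UNIV - {a0} - {a}. M $ c $ p c)) :: complex"
  let ?q = "Transposition.transpose a a0"
  have q: "?q permutes (UNIV :: 'k set)" by (rule permutes_swap_id) auto
  have "?S = sum (\<lambda>p. ?f (p \<circ> ?q)) {p. p permutes UNIV}"
    by (rule sum_permutations_compose_right[OF q])
  also have "\<dots> = sum (\<lambda>p. - ?f p) {p. p permutes UNIV}"
  proof (rule sum.cong[OF refl])
    fix p :: "'k \<Rightarrow> 'k" assume "p \<in> {p. p permutes UNIV}"
    then have p: "p permutes UNIV" by simp
    have "permutation p" "permutation ?q"
      using p q permutation_permutes by (metis finite)+
    then have "sign (p \<circ> ?q) = - sign p"
      using \<open>a \<noteq> a0\<close> by (simp add: sign_compose sign_swap_id)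
    moreover have "(\<Prod>c\<in>UNIV - {a0} - {a}. M $ c $ (p \<circ> ?q) c) = (\<Prod>c\<in>UNIV - {a0} - {a}. M $ c $ p c)"
      by (rule prod.cong) (auto simp: Transposition.transpose_def)
    ultimately show "?f (p \<circ> ?q) = - ?f p"
      using sym[of a "p a0" "p a"] by simp
  qed
  also have "\<dots> = - ?S" by (simp add: sum_negf)
  finally show ?thesis by simp
qed

lemma det_row_combination:
  fixes M :: "complex ^ 'k ^ 'k"
  shows "m a0 * det M = det (\<chi> a. if a = a0 then (\<chi> b. \<Sum>c\<in>UNIV. m c * M $ c $ b) else M $ a)"
proof -
  have eq: "(\<chi> b. \<Sum>c\<in>UNIV. m c * M $ c $ b) = (\<Sum>c\<in>UNIV. m c *s M $ c)"
    by (simp add: vec_eq_iff)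
  have "det (\<chi> a. if a = a0 then (\<chi> b. \<Sum>c\<in>UNIV. m c * M $ c $ b) else M $ a) =
      (\<Sum>c\<in>UNIV. det (\<chi> a. if a = a0 then m c *s M $ c else M $ a))"
    unfolding eq using det_linear_row_sum[of UNIV a0 "\<lambda>_ c. m c *s M $ c" "\<lambda>a. M $ a"] by simp
  also have "\<dots> = (\<Sum>c\<in>UNIV. m c * det (\<chi> a. if a = a0 then M $ c else M $ a))"
    using det_row_mul[of a0 _ "\<lambda>_. M $ _" "\<lambda>a. M $ a"] by (intro sum.cong) auto
  also have "\<dots> = (\<Sum>c\<in>UNIV. if c = a0 then m a0 * det M else 0)"
  proof (rule sum.cong[OF refl])
    fix c
    show "m c * det (\<chi> a. if a = a0 then M $ c else M $ a) = (if c = a0 then m a0 * det M else 0)"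
    proof (cases "c = a0")
      case True
      have "(\<chi> a. if a = a0 then M $ c else M $ a) = M" using True by (simp add: vec_eq_iff)
      then show ?thesis using True by (simp only: if_True refl)
    next
      case False
      have "det (\<chi> a. if a = a0 then M $ c else M $ a) = 0"
        using False by (intro det_identical_rows[of a0 c]) (auto simp: row_def vec_eq_iff)
      then show ?thesis using False by simp
    qed
  qed
  also have "\<dots> = m a0 * det M" by simp
  finally show ?thesis by simp
qed

lemma has_vector_derivative_prod:
  fixes f :: "'i \<Rightarrow> real \<Rightarrow> complex"
  assumes "\<And>i. i \<in> I \<Longrightarrow> (f i has_vector_derivative f' i) (at x)"
  shows "((\<lambda>t. \<Prod>i\<in>I. f i t) has_vector_derivative (\<Sum>i\<in>I. f' i * (\<Prod>j\<in>I - {i}. f j x))) (at x)"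
  using has_derivative_prod[of I f "\<lambda>i t. t *\<^sub>R f' i" x UNIV] assms
  by (simp add: has_vector_derivative_def scaleR_sum_right)

text \<open>With \<open>M\<close> the Jacobian matrix of \<open>X\<close> and \<open>T\<close> its second derivatives, the form
  \<open>exp (m\<bullet>X) dX\<^sub>1 \<and> \<dots> \<and> dX\<^sub>k\<close> is exact as soon as some \<open>m\<^sub>a\<^sub>0 \<noteq> 0\<close>: up to sign and the
  factor \<open>m\<^sub>a\<^sub>0\<close> it is the derivative of \<open>exp (m\<bullet>X)\<close> times the product of the other \<open>dX\<^sub>a\<close>.
  The determinant is expanded over permutations, and for each of them the corresponding
  product is differentiated in the direction \<open>p a0\<close>. The terms \<open>Q p\<close>, where the exponential
  is differentiated, add up to the form; the terms \<open>E p\<close> with second derivatives cancel by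
  symmetry (the Piola identity).\<close>

lemma torus_exact_integral_zero:
  fixes X :: "real ^ 'k \<Rightarrow> complex ^ 'k" and M :: "real ^ 'k \<Rightarrow> complex ^ 'k ^ 'k"
    and T :: "real ^ 'k \<Rightarrow> 'k \<Rightarrow> 'k \<Rightarrow> 'k \<Rightarrow> complex"
  assumes dX: "\<And>\<theta> a b. ((\<lambda>t. X (\<theta> + t *\<^sub>R axis b 1) $ a) has_vector_derivative M \<theta> $ a $ b) (at 0)"
    and dM: "\<And>\<theta> a b c. ((\<lambda>t. M (\<theta> + t *\<^sub>R axis c 1) $ a $ b) has_vector_derivative T \<theta> a b c) (at 0)"
    and sym: "\<And>\<theta> a b c. T \<theta> a b c = T \<theta> a c b"
    and cX: "\<And>a. continuous_on UNIV (\<lambda>\<theta>. X \<theta> $ a)"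
    and cM: "\<And>a b. continuous_on UNIV (\<lambda>\<theta>. M \<theta> $ a $ b)"
    and cT: "\<And>a b c. continuous_on UNIV (\<lambda>\<theta>. T \<theta> a b c)"
    and pX: "\<And>\<theta> j. exp (ndot m (X (\<theta> + period j))) = exp (ndot m (X \<theta>))"
    and pM: "\<And>\<theta> j. M (\<theta> + period j) = M \<theta>"
    and pT: "\<And>\<theta> j. T (\<theta> + period j) = T \<theta>"
    and m: "m \<noteq> 0"
  shows "integral tcube (\<lambda>\<theta>. exp (ndot m (X \<theta>)) * det (M \<theta>)) = 0"
proof -
  obtain a0 where a0: "m $ a0 \<noteq> 0" using m by (metis vec_eq_iff zero_index)
  define G where "G \<theta> = exp (ndot m (X \<theta>))" for \<theta>
  define G' where "G' \<theta> b = G \<theta> * (\<Sum>c\<in>UNIV. of_int (m $ c) * M \<theta> $ c $ b)" for \<theta> b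
  have cG: "continuous_on UNIV G"
    unfolding G_def ndot_def by (intro continuous_intros cX)
  have cG': "continuous_on UNIV (\<lambda>\<theta>. G' \<theta> b)" for b
    unfolding G'_def by (intro continuous_intros cG cM)
  have pG: "G (\<theta> + period j) = G \<theta>" for \<theta> j
    using pX by (simp add: G_def)
  have pG': "G' (\<theta> + period j) = G' \<theta>" for \<theta> j
    by (simp add: G'_def fun_eq_iff pG pM)
  have dG: "((\<lambda>t. G (\<theta> + t *\<^sub>R axis b 1)) has_vector_derivative G' \<theta> b) (at 0)" for \<theta> b
  proof -
    have "((\<lambda>t. ndot m (X (\<theta> + t *\<^sub>R axis b 1))) has_vector_derivative
        (\<Sum>c\<in>UNIV. of_int (m $ c) * M \<theta> $ c $ b)) (at 0)"
      unfolding ndot_def by (intro has_vector_derivative_sum has_vector_derivative_mult_right dX)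
    from has_vector_derivative_exp[OF this] show ?thesis
      by (simp add: G_def G'_def mult.commute)
  qed
  define H where "H p \<theta> = G \<theta> * (\<Prod>a\<in>UNIV - {a0}. M \<theta> $ a $ p a)" for p \<theta>
  define Q where "Q p \<theta> = G' \<theta> (p a0) * (\<Prod>a\<in>UNIV - {a0}. M \<theta> $ a $ p a)" for p \<theta>
  define E where "E p \<theta> = G \<theta> * (\<Sum>a\<in>UNIV - {a0}. T \<theta> a (p a) (p a0) *
      (\<Prod>c\<in>UNIV - {a0} - {a}. M \<theta> $ c $ p c))" for p \<theta>
  have cQ: "continuous_on UNIV (Q p)" and cE: "continuous_on UNIV (E p)" and cH: "continuous_on UNIV (H p)" for p
    unfolding Q_def E_def H_def by (intro continuous_intros cG cG' cM cT)+
  have "integral tcube (\<lambda>\<theta>. Q p \<theta> + E p \<theta>) = 0" for p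
  proof (rule torus_integral_deriv_zero[where H = "H p" and b = "p a0"])
    show "per_real (H p)" "per_real (\<lambda>\<theta>. Q p \<theta> + E p \<theta>)"
      by (simp_all add: per_real_def H_def Q_def E_def pG pG' pM pT)
    show "continuous_on UNIV (\<lambda>\<theta>. Q p \<theta> + E p \<theta>)" by (intro continuous_intros cQ cE)
    show "((\<lambda>t. H p (\<theta> + t *\<^sub>R axis (p a0) 1)) has_vector_derivative Q p \<theta> + E p \<theta>) (at 0)" for \<theta>
      using has_vector_derivative_mult[OF dG[of \<theta> "p a0"]
          has_vector_derivative_prod[where I = "UNIV - {a0}" and x = 0 and
            f = "\<lambda>a t. M (\<theta> + t *\<^sub>R axis (p a0) 1) $ a $ p a" and f' = "\<lambda>a. T \<theta> a (p a) (p a0)", OF dM]]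
      by (simp add: H_def Q_def E_def add.commute)
  qed (rule cH)
  then have "integral tcube (Q p) = - integral tcube (E p)" for p
    using Henstock_Kurzweil_Integration.integral_add[OF continuous_tcube_integrable[OF cQ] continuous_tcube_integrable[OF cE], of p p]
    by (simp add: eq_neg_iff_add_eq_0)
  then have "(\<Sum>p | p permutes (UNIV :: 'k set). of_int (sign p) * integral tcube (Q p)) =
      - (\<Sum>p | p permutes (UNIV :: 'k set). of_int (sign p) * integral tcube (E p))"
    by (simp add: sum_negf)
  moreover have "(\<Sum>p | p permutes (UNIV :: 'k set). of_int (sign p) * integral tcube (E p)) =
      integral tcube (\<lambda>\<theta>. \<Sum>p | p permutes (UNIV :: 'k set). of_int (sign p) * E p \<theta>)"
    by (subst Henstock_Kurzweil_Integration.integral_sum)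
       (auto intro!: continuous_tcube_integrable continuous_intros cE finite_permutations)
  moreover have "(\<Sum>p | p permutes (UNIV :: 'k set). of_int (sign p) * E p \<theta>) = 0" for \<theta>
  proof -
    have "(\<Sum>p | p permutes (UNIV :: 'k set). of_int (sign p) * E p \<theta>) =
      G \<theta> * (\<Sum>a\<in>UNIV - {a0}. \<Sum>p | p permutes (UNIV :: 'k set). of_int (sign p) *
      (T \<theta> a (p a) (p a0) * (\<Prod>c\<in>UNIV - {a0} - {a}. M \<theta> $ c $ p c)))"
      by (subst sum.swap) (simp add: E_def sum_distrib_left mult_ac)
    also have "\<dots> = 0"
      using det_cofactor_row_cancel[of "T \<theta>", OF sym] by simp
    finally show ?thesis .
  qed
  moreover have "(\<Sum>p | p permutes (UNIV :: 'k set). of_int (sign p) * integral tcube (Q p)) =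
      integral tcube (\<lambda>\<theta>. \<Sum>p | p permutes (UNIV :: 'k set). of_int (sign p) * Q p \<theta>)"
    by (subst Henstock_Kurzweil_Integration.integral_sum)
       (auto intro!: continuous_tcube_integrable continuous_intros cQ finite_permutations)
  moreover have "(\<Sum>p | p permutes (UNIV :: 'k set). of_int (sign p) * Q p \<theta>) =
      of_int (m $ a0) * (exp (ndot m (X \<theta>)) * det (M \<theta>))" for \<theta>
  proof -
    have "of_int (m $ a0) * (exp (ndot m (X \<theta>)) * det (M \<theta>)) = G \<theta> * (of_int (m $ a0) * det (M \<theta>))"
      by (simp add: G_def)
    also have "\<dots> = G \<theta> * det (\<chi> a. if a = a0 then (\<chi> b. \<Sum>c\<in>UNIV. of_int (m $ c) * M \<theta> $ c $ b) else M \<theta> $ a)"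
      by (subst det_row_combination) simp
    also have "\<dots> = (\<Sum>p | p permutes (UNIV :: 'k set). of_int (sign p) * Q p \<theta>)"
      unfolding det_def sum_distrib_left
    proof (rule sum.cong[OF refl])
      fix p :: "'k \<Rightarrow> 'k"
      let ?N = "\<chi> a. if a = a0 then (\<chi> b. \<Sum>c\<in>UNIV. of_int (m $ c) * M \<theta> $ c $ b) else M \<theta> $ a"
      have "(\<Prod>a\<in>UNIV. ?N $ a $ p a) = ?N $ a0 $ p a0 * (\<Prod>a\<in>UNIV - {a0}. ?N $ a $ p a)"
        by (rule prod.remove) auto
      also have "(\<Prod>a\<in>UNIV - {a0}. ?N $ a $ p a) = (\<Prod>a\<in>UNIV - {a0}. M \<theta> $ a $ p a)"
        by (rule prod.cong) auto
      finally show "G \<theta> * (of_int (sign p) * (\<Prod>a\<in>UNIV. ?N $ a $ p a)) = of_int (sign p) * Q p \<theta>"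
        by (simp add: Q_def G'_def mult_ac)
    qed
    finally show ?thesis by simp
  qed
  ultimately have "integral tcube (\<lambda>\<theta>. of_int (m $ a0) * (exp (ndot m (X \<theta>)) * det (M \<theta>))) = 0"
    by simp
  then show ?thesis using a0 by simp
qed

section \<open>Products of linear forms deep in a chamber\<close>

definition form :: "('n \<Rightarrow> 'k::finite \<Rightarrow> real) \<Rightarrow> 'n \<Rightarrow> complex ^ 'k \<Rightarrow> complex" where
  "form a i u = (\<Sum>k\<in>UNIV. of_real (a i k) * u $ k)"

definition expv :: "complex ^ 'k \<Rightarrow> complex ^ 'k" where
  "expv x = (\<chi> k. exp (x $ k))"

definition logv :: "complex ^ 'k \<Rightarrow> real ^ 'k" where
  "logv u = (\<chi> k. ln (norm (u $ k)))"

definition log_domain :: "(real ^ 'k) set \<Rightarrow> (complex ^ 'k) set" where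
  "log_domain \<Omega> = {u. (\<forall>k. u $ k \<noteq> 0) \<and> logv u \<in> \<Omega>}"

definition prod_map :: "('n::finite \<Rightarrow> 'k::finite \<Rightarrow> real) \<Rightarrow> ('n \<Rightarrow> 'k \<Rightarrow> int) \<Rightarrow> complex ^ 'k \<Rightarrow> complex ^ 'k" where
  "prod_map a nn u = (\<chi> j. \<Prod>i\<in>UNIV. form a i u powi nn i j)"

text \<open>The Jacobian matrix of \<open>log p\<close> with respect to the logarithms of the coordinates \<open>u\<close>.\<close>

definition jac :: "('n::finite \<Rightarrow> 'k::finite \<Rightarrow> real) \<Rightarrow> ('n \<Rightarrow> 'k \<Rightarrow> int) \<Rightarrow> complex ^ 'k \<Rightarrow> complex ^ 'k ^ 'k" where
  "jac a nn u = (\<chi> j k. \<Sum>i\<in>UNIV. of_int (nn i j) * (of_real (a i k) * u $ k / form a i u))"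

text \<open>Vectors of logarithmic sizes in which each entry exceeds every earlier one by more
  than \<open>M\<close>. On the corresponding points a linear form is dominated by its last nonvanishing
  term when \<open>M\<close> is large.\<close>

definition deepset :: "real \<Rightarrow> (real ^ 'k::{finite,wellorder}) set" where
  "deepset M = {\<eta>. \<forall>k l. k < l \<longrightarrow> M < \<eta> $ l - \<eta> $ k}"

lemma expv_nth [simp]: "expv x $ k = exp (x $ k)"
  by (simp add: expv_def)

lemma logv_expv [simp]: "logv (expv x) = re_vec x"
  by (simp add: logv_def vec_eq_iff)

lemma expv_in_log_domain [simp]: "expv x \<in> log_domain \<Omega> \<longleftrightarrow> x \<in> tube \<Omega>"
  by (simp add: log_domain_def tube_def)

lemma expv_period [simp]: "expv (x + cvec 0 (period m)) = expv x"
proof -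
  have "exp (Complex 0 (2 * pi * real_of_int j)) = 1" for j
    unfolding exp_eq_1 by (auto intro!: exI[of _ j])
  then show ?thesis
    by (simp add: vec_eq_iff exp_add)
qed

lemma expv_surj:
  assumes "\<And>k. u $ k \<noteq> 0"
  obtains x where "expv x = u"
  using that[of "\<chi> k. Ln (u $ k)"] assms by (simp add: vec_eq_iff)

lemma expv_eq_imp_period:
  assumes "expv x = expv y"
  obtains m where "x = y + cvec 0 (period m)"
proof -
  have "\<exists>j::int. x $ k = y $ k + (of_int (2 * j) * pi) * \<i>" for k
    using assms by (simp add: vec_eq_iff exp_eq)
  then obtain j :: "'a \<Rightarrow> int" where "\<And>k. x $ k = y $ k + (of_int (2 * j k) * pi) * \<i>"
    by metis
  then have "x = y + cvec 0 (period (\<chi> k. j k))"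
    by (simp add: vec_eq_iff complex_eq_iff)
  then show thesis by (rule that)
qed

lemma deepset_mono: "M \<le> M' \<Longrightarrow> deepset M' \<subseteq> deepset M"
  by (auto simp: deepset_def) (meson le_less_trans)

lemma deepset_perturb:
  assumes "\<eta> \<in> deepset M" "\<And>k. \<bar>\<eta>' $ k - \<eta> $ k\<bar> \<le> \<delta>"
  shows "\<eta>' \<in> deepset (M - 2 * \<delta>)"
  unfolding deepset_def
proof (intro CollectI allI impI)
  fix k l :: 'a assume "k < l"
  then have "M < \<eta> $ l - \<eta> $ k" using assms(1) by (simp add: deepset_def)
  moreover have "\<bar>\<eta>' $ k - \<eta> $ k\<bar> \<le> \<delta>" "\<bar>\<eta>' $ l - \<eta> $ l\<bar> \<le> \<delta>" using assms(2) by auto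
  ultimately show "M - 2 * \<delta> < \<eta>' $ l - \<eta>' $ k" by linarith
qed

lemma deepset_open: "open (deepset M)"
proof -
  have "deepset M = (\<Inter>k. \<Inter>l. {\<eta> :: (real, 'a) vec. k < l \<longrightarrow> M < \<eta> $ l - \<eta> $ k})"
    by (auto simp: deepset_def)
  also have "open \<dots>"
    by (intro open_INT ballI finite_UNIV open_Collect_imp open_Collect_less continuous_intros) auto
  finally show ?thesis .
qed

lemma deepset_convex: "convex (deepset M)"
proof (rule convexI)
  fix x y :: "(real, 'a) vec" and s t :: real
  assume *: "x \<in> deepset M" "y \<in> deepset M" "0 \<le> s" "0 \<le> t" "s + t = 1"
  show "s *\<^sub>R x + t *\<^sub>R y \<in> deepset M"
    unfolding deepset_def
  proof (intro CollectI allI impI)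
    fix k l :: 'a assume "k < l"
    then have "M < x $ l - x $ k" "M < y $ l - y $ k" using * by (auto simp: deepset_def)
    then have "M < s * (x $ l - x $ k) + t * (y $ l - y $ k)"
      using *(3-5) convex_bound_lt[of "- (x $ l - x $ k)" "- M" "- (y $ l - y $ k)" s t] by linarith
    then show "M < (s *\<^sub>R x + t *\<^sub>R y) $ l - (s *\<^sub>R x + t *\<^sub>R y) $ k"
      by (simp add: algebra_simps)
  qed
qed

lemma norm_vec_le_sum: "norm (x :: complex ^ 'k) \<le> (\<Sum>k\<in>UNIV. norm (x $ k))"
  unfolding norm_vec_def by (rule L2_set_le_sum) simp

lemma norm_nth_le_vec: "norm (x $ k) \<le> norm (x :: complex ^ 'k)"
  unfolding norm_vec_def by (rule member_le_L2_set) auto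

text \<open>This is the chamber of a flag in coordinates adapted to the flag: \<open>\<Omega>\<close> is the set of
  logarithmic sizes of its points, and \<open>lead i\<close> is the level of the \<open>i\<close>-th form, which is
  its last coordinate with a nonzero coefficient. Deep in the chamber each form is close to
  its leading term, so that \<open>log p\<close> is close to an affine map with linear part \<open>B\<close> and
  constant part \<open>cst\<close> in the logarithms of the coordinates.\<close>

locale flag_chart =
  fixes a :: "'n::finite \<Rightarrow> 'k::{finite,wellorder} \<Rightarrow> real" and nn :: "'n \<Rightarrow> 'k \<Rightarrow> int"
    and lead :: "'n \<Rightarrow> 'k" and \<Omega> :: "((real, 'k) vec) set" and M0 :: real
  assumes lead_nz: "a i (lead i) \<noteq> 0"
    and above: "lead i < k \<Longrightarrow> a i k = 0"
    and open_\<Omega>: "open \<Omega>" and convex_\<Omega>: "convex \<Omega>"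
    and deep_\<Omega>: "deepset M0 \<subseteq> \<Omega>"
    and form_nz: "u \<in> log_domain \<Omega> \<Longrightarrow> form a i u \<noteq> 0"
begin

definition B :: "((real, 'k) vec, 'k) vec" where
  "B = (\<chi> j k. \<Sum>i | lead i = k. of_int (nn i j))"

definition cst :: "(complex, 'k) vec" where
  "cst = (\<chi> j. \<Sum>i\<in>UNIV. of_int (nn i j) * Ln (of_real (a i (lead i))))"

definition tail :: "'n \<Rightarrow> (complex, 'k) vec \<Rightarrow> complex" where
  "tail i x = (\<Sum>k\<in>UNIV - {lead i}. of_real (a i k / a i (lead i)) * exp (x $ k - x $ lead i))"

definition dlog :: "'n \<Rightarrow> 'k \<Rightarrow> (complex, 'k) vec \<Rightarrow> complex" where
  "dlog i k x = of_real (a i k) * exp (x $ k) / form a i (expv x)"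

text \<open>A bound for all the functions \<open>tail\<close> at once, up to the factor \<open>exp (- M)\<close>
  (\<open>tail_bound\<close>).\<close>

definition ratio_sum :: real where
  "ratio_sum = (\<Sum>i\<in>UNIV. \<Sum>k\<in>UNIV. \<bar>a i k / a i (lead i)\<bar>)"

lemma form_expv: "form a i (expv x) = of_real (a i (lead i)) * exp (x $ lead i) * (1 + tail i x)"
proof -
  have t: "of_real (a i (lead i)) * exp (x $ lead i) * (of_real (a i k / a i (lead i)) * exp (x $ k - x $ lead i))
      = of_real (a i k) * exp (x $ k)" for k
    using lead_nz[of i] by (simp add: exp_diff)
  have "form a i (expv x) = of_real (a i (lead i)) * exp (x $ lead i) +
      (\<Sum>k\<in>UNIV - {lead i}. of_real (a i k) * exp (x $ k))"
    unfolding form_def by (subst sum.remove[of _ "lead i"]) auto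
  then show ?thesis
    by (simp only: tail_def distrib_left sum_distrib_left t mult_1_right)
qed

lemma ratio_sum_nonneg: "ratio_sum \<ge> 0"
  by (simp add: ratio_sum_def sum_nonneg)

lemma ratio_le: "(\<Sum>k\<in>UNIV. \<bar>a i k / a i (lead i)\<bar>) \<le> ratio_sum"
  unfolding ratio_sum_def by (rule member_le_sum) (auto intro: sum_nonneg)

lemma ratio_term_le:
  assumes "x \<in> tube (deepset M)" "k \<noteq> lead i"
  shows "norm (of_real (a i k / a i (lead i)) * exp (x $ k - x $ lead i)) \<le> \<bar>a i k / a i (lead i)\<bar> * exp (- M)"
proof (cases "k < lead i")
  case True
  then have "M < Re (x $ lead i) - Re (x $ k)" using assms(1) by (simp add: tube_def deepset_def)
  then have "exp (Re (x $ k) - Re (x $ lead i)) \<le> exp (- M)" by simp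
  then have "\<bar>a i k / a i (lead i)\<bar> * exp (Re (x $ k) - Re (x $ lead i)) \<le> \<bar>a i k / a i (lead i)\<bar> * exp (- M)"
    by (intro mult_left_mono) auto
  then show ?thesis by (simp add: norm_mult norm_exp_eq_Re norm_divide)
next
  case False
  then have "lead i < k" using assms(2) by auto
  then show ?thesis by (simp add: above)
qed

lemma tail_bound:
  assumes "x \<in> tube (deepset M)"
  shows "norm (tail i x) \<le> ratio_sum * exp (- M)"
proof -
  have "norm (tail i x) \<le> (\<Sum>k\<in>UNIV - {lead i}. \<bar>a i k / a i (lead i)\<bar> * exp (- M))"
    unfolding tail_def by (rule order_trans[OF norm_sum sum_mono]) (use ratio_term_le[OF assms] in blast)
  also have "\<dots> \<le> (\<Sum>k\<in>UNIV. \<bar>a i k / a i (lead i)\<bar> * exp (- M))"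
    by (rule sum_mono2) auto
  also have "\<dots> \<le> ratio_sum * exp (- M)"
    unfolding sum_distrib_right[symmetric] by (intro mult_right_mono ratio_le) auto
  finally show ?thesis .
qed

lemma tail_half_imp:
  assumes "norm (tail i x) \<le> 1/2"
  shows "norm (1 + tail i x) \<ge> 1/2" "1 + tail i x \<notin> \<real>\<^sub>\<le>\<^sub>0" "1 + tail i x \<noteq> 0"
proof -
  have "norm (1 :: complex) \<le> norm (1 + tail i x) + norm (tail i x)"
    by (metis add_diff_cancel_right' norm_triangle_ineq4)
  then show n: "norm (1 + tail i x) \<ge> 1/2" using assms by simp
  then show "1 + tail i x \<noteq> 0" by auto
  have "Re (tail i x) \<ge> - 1/2"
    using assms abs_Re_le_cmod[of "tail i x"] by linarith
  then show "1 + tail i x \<notin> \<real>\<^sub>\<le>\<^sub>0" by (auto simp: complex_nonpos_Reals_iff)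
qed

lemma dlog_bound:
  assumes x: "x \<in> tube (deepset M)" and M: "ratio_sum * exp (- M) \<le> 1/2"
  shows "norm (dlog i k x - (if k = lead i then 1 else 0)) \<le> 2 * (ratio_sum * exp (- M))"
proof -
  have t: "norm (tail i x) \<le> ratio_sum * exp (- M)" by (rule tail_bound[OF x])
  then have t2: "norm (tail i x) \<le> 1/2" using M by linarith
  note h = tail_half_imp[OF t2]
  show ?thesis
  proof (cases "k = lead i")
    case True
    have "dlog i k x - 1 = - tail i x / (1 + tail i x)"
    proof -
      have "dlog i k x = 1 / (1 + tail i x)"
        using lead_nz[of i] True by (simp add: dlog_def form_expv)
      then show ?thesis using h(3) by (simp add: field_simps)
    qed
    then have "norm (dlog i k x - 1) = norm (tail i x) / norm (1 + tail i x)"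
      by (simp add: norm_divide)
    also have "\<dots> \<le> norm (tail i x) / (1/2)"
      using h(1) by (intro divide_left_mono) auto
    finally show ?thesis using t True by simp
  next
    case False
    have "dlog i k x = of_real (a i k / a i (lead i)) * exp (x $ k - x $ lead i) / (1 + tail i x)"
      using h(3) lead_nz[of i] by (simp add: dlog_def form_expv exp_diff)
    then have "norm (dlog i k x) = norm (of_real (a i k / a i (lead i)) * exp (x $ k - x $ lead i)) / norm (1 + tail i x)"
      by (simp add: norm_divide norm_mult)
    also have "\<dots> \<le> norm (of_real (a i k / a i (lead i)) * exp (x $ k - x $ lead i)) / (1/2)"
      using h(1) by (intro divide_left_mono) auto
    also have "\<dots> \<le> 2 * (\<bar>a i k / a i (lead i)\<bar> * exp (- M))"
      using ratio_term_le[OF x False] by simp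
    also have "\<bar>a i k / a i (lead i)\<bar> \<le> (\<Sum>k\<in>UNIV. \<bar>a i k / a i (lead i)\<bar>)"
      by (rule member_le_sum) auto
    also have "\<dots> \<le> ratio_sum" by (rule ratio_le)
    finally show ?thesis using False by simp
  qed
qed

lemma form_expv_has_derivative:
  "((\<lambda>x. form a i (expv x)) has_derivative (\<lambda>v. \<Sum>k\<in>UNIV. of_real (a i k) * exp (x $ k) * v $ k)) (at x)"
  unfolding form_def expv_nth
proof (rule has_derivative_sum)
  fix k
  have "((\<lambda>x. x $ k) has_derivative (\<lambda>v. v $ k)) (at x)"
    by (rule bounded_linear_imp_has_derivative[OF bounded_linear_vec_nth])
  moreover have "(exp has_derivative (\<lambda>h. exp z * h)) (at z)" for z :: complex
    using DERIV_exp by (simp add: has_field_derivative_def)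
  ultimately have "((\<lambda>x. exp (x $ k)) has_derivative (\<lambda>v. exp (x $ k) * v $ k)) (at x)"
    by (rule has_derivative_compose)
  from has_derivative_mult_right[OF this, of "of_real (a i k)"]
  show "((\<lambda>x. of_real (a i k) * exp (x $ k)) has_derivative (\<lambda>v. of_real (a i k) * exp (x $ k) * v $ k)) (at x)"
    by (simp add: mult.assoc)
qed

lemma dlog_has_derivative:
  assumes "form a i (expv x) \<noteq> 0"
  shows "(dlog i k has_derivative (\<lambda>v. dlog i k x * (v $ k - (\<Sum>l\<in>UNIV. dlog i l x * v $ l)))) (at x)"
proof -
  have "((\<lambda>x. x $ k) has_derivative (\<lambda>v. v $ k)) (at x)"
    by (rule bounded_linear_imp_has_derivative[OF bounded_linear_vec_nth])
  moreover have "(exp has_derivative (\<lambda>h. exp z * h)) (at z)" for z :: complex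
    using DERIV_exp by (simp add: has_field_derivative_def)
  ultimately have "((\<lambda>x. exp (x $ k)) has_derivative (\<lambda>v. exp (x $ k) * v $ k)) (at x)"
    by (rule has_derivative_compose)
  from has_derivative_mult_right[OF this, of "of_real (a i k)"]
  have num: "((\<lambda>x. of_real (a i k) * exp (x $ k)) has_derivative (\<lambda>v. of_real (a i k) * (exp (x $ k) * v $ k))) (at x)" .
  have "((\<lambda>x. of_real (a i k) * exp (x $ k) / form a i (expv x)) has_derivative
     (\<lambda>v. - (of_real (a i k) * exp (x $ k)) * (inverse (form a i (expv x)) *
       (\<Sum>k\<in>UNIV. of_real (a i k) * exp (x $ k) * v $ k) * inverse (form a i (expv x))) +
       of_real (a i k) * (exp (x $ k) * v $ k) / form a i (expv x))) (at x)"
    by (rule has_derivative_divide[OF num form_expv_has_derivative assms])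
  moreover have "(\<lambda>v. - (of_real (a i k) * exp (x $ k)) * (inverse (form a i (expv x)) *
       (\<Sum>k\<in>UNIV. of_real (a i k) * exp (x $ k) * v $ k) * inverse (form a i (expv x))) +
       of_real (a i k) * (exp (x $ k) * v $ k) / form a i (expv x)) =
     (\<lambda>v. dlog i k x * (v $ k - (\<Sum>l\<in>UNIV. dlog i l x * v $ l)))"
  proof
    fix v :: "(complex, 'k) vec"
    have "(\<Sum>l\<in>UNIV. dlog i l x * v $ l) = (\<Sum>k\<in>UNIV. of_real (a i k) * exp (x $ k) * v $ k) / form a i (expv x)"
      by (simp add: dlog_def sum_divide_distrib)
    then show "- (of_real (a i k) * exp (x $ k)) * (inverse (form a i (expv x)) *
       (\<Sum>k\<in>UNIV. of_real (a i k) * exp (x $ k) * v $ k) * inverse (form a i (expv x))) +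
       of_real (a i k) * (exp (x $ k) * v $ k) / form a i (expv x) =
       dlog i k x * (v $ k - (\<Sum>l\<in>UNIV. dlog i l x * v $ l))"
      by (simp only: dlog_def divide_inverse) (simp add: algebra_simps)
  qed
  ultimately show ?thesis
    by (simp add: dlog_def[abs_def])
qed

lemma Ln_tail_has_derivative:
  assumes "norm (tail i x) \<le> 1/2"
  shows "((\<lambda>x. Ln (1 + tail i x)) has_derivative (\<lambda>v. (\<Sum>k\<in>UNIV. dlog i k x * v $ k) - v $ lead i)) (at x)"
proof -
  note h = tail_half_imp[OF assms]
  have nz: "form a i (expv x) \<noteq> 0"
    using h(3) lead_nz[of i] by (simp add: form_expv)
  let ?c = "of_real (a i (lead i)) :: complex"
  have tail_eq: "1 + tail i x = form a i (expv x) * exp (- (x $ lead i)) / ?c" for x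
    using lead_nz[of i] by (simp add: form_expv exp_minus)
  have "((\<lambda>x. - (x $ lead i)) has_derivative (\<lambda>v. - (v $ lead i))) (at x)"
    by (intro has_derivative_minus bounded_linear_imp_has_derivative[OF bounded_linear_vec_nth])
  moreover have "(exp has_derivative (\<lambda>h. exp z * h)) (at z)" for z :: complex
    using DERIV_exp by (simp add: has_field_derivative_def)
  ultimately have e: "((\<lambda>x. exp (- (x $ lead i))) has_derivative (\<lambda>v. exp (- (x $ lead i)) * - (v $ lead i))) (at x)"
    by (rule has_derivative_compose)
  have "((\<lambda>x. 1 + tail i x) has_derivative (\<lambda>v. (1 + tail i x) * ((\<Sum>k\<in>UNIV. dlog i k x * v $ k) - v $ lead i))) (at x)"
  proof -
    have "((\<lambda>x. form a i (expv x) * exp (- (x $ lead i)) / ?c) has_derivative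
       (\<lambda>v. (form a i (expv x) * (exp (- (x $ lead i)) * - (v $ lead i)) +
         (\<Sum>k\<in>UNIV. of_real (a i k) * exp (x $ k) * v $ k) * exp (- (x $ lead i))) / ?c)) (at x)"
      by (rule bounded_linear.has_derivative[OF bounded_linear_divide has_derivative_mult[OF form_expv_has_derivative e]])
    moreover have "(\<lambda>v. (form a i (expv x) * (exp (- (x $ lead i)) * - (v $ lead i)) +
         (\<Sum>k\<in>UNIV. of_real (a i k) * exp (x $ k) * v $ k) * exp (- (x $ lead i))) / ?c) =
       (\<lambda>v. (1 + tail i x) * ((\<Sum>k\<in>UNIV. dlog i k x * v $ k) - v $ lead i))"
    proof
      fix v :: "(complex, 'k) vec"
      have "(\<Sum>k\<in>UNIV. dlog i k x * v $ k) = (\<Sum>k\<in>UNIV. of_real (a i k) * exp (x $ k) * v $ k) / form a i (expv x)"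
        by (simp add: dlog_def sum_divide_distrib)
      then show "(form a i (expv x) * (exp (- (x $ lead i)) * - (v $ lead i)) +
         (\<Sum>k\<in>UNIV. of_real (a i k) * exp (x $ k) * v $ k) * exp (- (x $ lead i))) / ?c =
         (1 + tail i x) * ((\<Sum>k\<in>UNIV. dlog i k x * v $ k) - v $ lead i)"
        using nz lead_nz[of i] by (simp add: tail_eq field_simps)
    qed
    ultimately show ?thesis by (simp add: tail_eq)
  qed
  moreover have "(Ln has_derivative (\<lambda>h. inverse (1 + tail i x) * h)) (at (1 + tail i x))"
    using has_field_derivative_Ln[OF h(2)] by (simp add: has_field_derivative_def)
  ultimately have "((\<lambda>x. Ln (1 + tail i x)) has_derivative
     (\<lambda>v. inverse (1 + tail i x) * ((1 + tail i x) * ((\<Sum>k\<in>UNIV. dlog i k x * v $ k) - v $ lead i)))) (at x)"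
    by (rule has_derivative_compose)
  then show ?thesis
    using h(3) by (simp add: mult.assoc[symmetric])
qed

end

section \<open>Deformed logarithmic coordinates\<close>

lemma det_map_of_real:
  fixes N :: "real ^ 'k ^ 'k"
  shows "det (\<chi> j k. complex_of_real (N $ j $ k)) = of_real (det N)"
  by (simp add: det_def)

lemma has_derivative_vecI:
  fixes f :: "'b::real_normed_vector \<Rightarrow> complex ^ 'k"
  assumes "\<And>j. ((\<lambda>x. f x $ j) has_derivative (\<lambda>v. f' v $ j)) (at x)"
  shows "(f has_derivative f') (at x)"
proof -
  have "((\<lambda>x. \<Sum>j\<in>UNIV. f x $ j *s axis j 1) has_derivative (\<lambda>v. \<Sum>j\<in>UNIV. f' v $ j *s axis j 1)) (at x)"
    by (intro has_derivative_sum bounded_linear.has_derivative[OF scalar_vec_bounded_linear] assms)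
  moreover have "(\<Sum>j\<in>UNIV. y $ j *s axis j 1) = y" for y :: "complex ^ 'k"
    by (rule basis_expansion)
  ultimately show ?thesis by simp
qed

locale nonsingular_chart = flag_chart a nn lead \<Omega> M0
  for a :: "'n::finite \<Rightarrow> 'k::{finite,wellorder} \<Rightarrow> real" and nn lead \<Omega> M0 +
  assumes detB: "det B \<noteq> 0"
begin

definition Binv :: "((real, 'k) vec, 'k) vec" where
  "Binv = (SOME C. B ** C = mat 1 \<and> C ** B = mat 1)"

lemma Binv_left: "Binv ** B = mat 1" and Binv_right: "B ** Binv = mat 1"
proof -
  have "\<exists>C. B ** C = mat 1 \<and> C ** B = mat 1"
    using detB invertible_det_nz[of B] by (simp add: invertible_def)
  from someI_ex[OF this] show "Binv ** B = mat 1" "B ** Binv = mat 1"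
    by (simp_all add: Binv_def)
qed

lemma B_Binv_sum: "(\<Sum>l\<in>UNIV. B $ j $ l * Binv $ l $ k) = (if j = k then 1 else 0)"
  and Binv_B_sum: "(\<Sum>l\<in>UNIV. Binv $ j $ l * B $ l $ k) = (if j = k then 1 else 0)"
  using Binv_right Binv_left by (auto simp: vec_eq_iff matrix_matrix_mult_def mat_def)

text \<open>The exponents of the forms after the \<open>p\<^sub>j\<close> have been combined by the inverse of \<open>B\<close>;
  the products of the leading terms then become the coordinates themselves (\<open>wt_lead\<close>).\<close>

definition wt :: "'k \<Rightarrow> 'n \<Rightarrow> real" where
  "wt j i = (\<Sum>l\<in>UNIV. Binv $ j $ l * of_int (nn i l))"

definition pert :: "(complex, 'k) vec \<Rightarrow> (complex, 'k) vec" where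
  "pert x = (\<chi> j. \<Sum>i\<in>UNIV. of_real (wt j i) * Ln (1 + tail i x))"

definition pert' :: "(complex, 'k) vec \<Rightarrow> (complex, 'k) vec \<Rightarrow> (complex, 'k) vec" where
  "pert' x v = (\<chi> j. \<Sum>i\<in>UNIV. of_real (wt j i) * ((\<Sum>k\<in>UNIV. dlog i k x * v $ k) - v $ lead i))"

text \<open>The deformed logarithmic coordinates: deep in the chamber \<open>R x\<close> is the image under the
  inverse of \<open>B\<close> of \<open>log (p (exp x)) - cst\<close>, for the branch of the logarithm that makes it
  close to \<open>x\<close>.\<close>

definition R :: "(complex, 'k) vec \<Rightarrow> (complex, 'k) vec" where
  "R x = x + pert x"

text \<open>The Jacobian matrix of \<open>R\<close> (\<open>R_component_derivative\<close>); up to the factor \<open>B\<close> it is the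
  logarithmic Jacobian of \<open>p\<close> (\<open>jac_eq_B_N\<close>).\<close>

definition N :: "(complex, 'k) vec \<Rightarrow> ((complex, 'k) vec, 'k) vec" where
  "N x = (\<chi> j k. \<Sum>i\<in>UNIV. of_real (wt j i) * dlog i k x)"

lemma B_wt: "(\<Sum>l\<in>UNIV. B $ j $ l * wt l i) = of_int (nn i j)"
proof -
  have "(\<Sum>l\<in>UNIV. B $ j $ l * wt l i) = (\<Sum>m\<in>UNIV. (\<Sum>l\<in>UNIV. B $ j $ l * Binv $ l $ m) * of_int (nn i m))"
    by (simp add: wt_def sum_distrib_left sum_distrib_right mult.assoc) (rule sum.swap)
  also have "\<dots> = of_int (nn i j)"
    by (simp add: B_Binv_sum if_distrib[of "\<lambda>c. c * _"] cong: if_cong)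
  finally show ?thesis .
qed

lemma wt_lead: "(\<Sum>i | lead i = k. wt j i) = (if j = k then 1 else 0)"
proof -
  have "(\<Sum>i | lead i = k. wt j i) = (\<Sum>l\<in>UNIV. Binv $ j $ l * B $ l $ k)"
    by (simp add: wt_def B_def sum_distrib_left) (rule sum.swap)
  then show ?thesis by (simp add: Binv_B_sum)
qed

lemma wt_lead_sum:
  fixes y :: "(complex, 'k) vec"
  shows "(\<Sum>i\<in>UNIV. of_real (wt j i) * y $ lead i) = y $ j"
proof -
  have "(\<Sum>i\<in>UNIV. of_real (wt j i) * y $ lead i) = (\<Sum>k\<in>UNIV. \<Sum>i | lead i = k. of_real (wt j i) * y $ lead i)"
    using sum.group[of "UNIV :: 'n set" "UNIV :: 'k set" lead "\<lambda>i. of_real (wt j i) * y $ lead i"] by simp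
  also have "\<dots> = (\<Sum>k\<in>UNIV. of_real (\<Sum>i | lead i = k. wt j i) * y $ k)"
    by (intro sum.cong refl) (simp add: sum_distrib_right)
  also have "\<dots> = y $ j"
    by (simp only: wt_lead) (simp add: if_distrib[of of_real] if_distrib[of "\<lambda>c. c * _"] cong: if_cong)
  finally show ?thesis .
qed

lemma R'_eq: "v + pert' x v = (\<chi> j. \<Sum>k\<in>UNIV. N x $ j $ k * v $ k)"
proof -
  have "(\<Sum>i\<in>UNIV. of_real (wt j i) * ((\<Sum>k\<in>UNIV. dlog i k x * v $ k) - v $ lead i)) =
      (\<Sum>k\<in>UNIV. N x $ j $ k * v $ k) - v $ j" for j
  proof -
    have "(\<Sum>i\<in>UNIV. of_real (wt j i) * (\<Sum>k\<in>UNIV. dlog i k x * v $ k)) = (\<Sum>k\<in>UNIV. N x $ j $ k * v $ k)"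
      by (simp add: N_def sum_distrib_left sum_distrib_right mult.assoc) (rule sum.swap)
    then show ?thesis
      by (simp add: right_diff_distrib sum_subtractf wt_lead_sum)
  qed
  then show ?thesis by (simp add: pert'_def vec_eq_iff)
qed

lemma jac_eq_B_N: "jac a nn (expv x) = (\<chi> j k. of_real (B $ j $ k)) ** N x"
proof -
  have "(\<Sum>l\<in>UNIV. of_real (B $ j $ l) * N x $ l $ k) = (\<Sum>i\<in>UNIV. of_int (nn i j) * dlog i k x)" for j k
  proof -
    have "(\<Sum>l\<in>UNIV. of_real (B $ j $ l) * N x $ l $ k) =
        (\<Sum>i\<in>UNIV. of_real (\<Sum>l\<in>UNIV. B $ j $ l * wt l i) * dlog i k x)"
      by (simp add: N_def sum_distrib_left sum_distrib_right mult.assoc) (rule sum.swap)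
    then show ?thesis by (simp only: B_wt of_real_of_int_eq)
  qed
  then show ?thesis
    by (simp add: jac_def dlog_def matrix_matrix_mult_def vec_eq_iff)
qed

lemma det_jac_N: "det (jac a nn (expv x)) = of_real (det B) * det (N x)"
  by (simp add: jac_eq_B_N det_mul det_map_of_real)

definition wt_sum :: real where
  "wt_sum = (\<Sum>j\<in>UNIV. \<Sum>i\<in>UNIV. \<bar>wt j i\<bar>)"

lemma wt_sum_nonneg: "wt_sum \<ge> 0"
  by (simp add: wt_sum_def sum_nonneg)

text \<open>The depth from which on the perturbation \<open>pert\<close> is a contraction with constant 1/2, of
  size at most 1/2.\<close>

definition small :: "real \<Rightarrow> bool" where
  "small M \<longleftrightarrow> M \<ge> M0 \<and> ratio_sum * exp (- M) < 1/2 \<and>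
     wt_sum * (real CARD('k) * (2 * (ratio_sum * exp (- M)))) \<le> 1/2"

lemma small_exists: "\<exists>M. small M"
proof -
  let ?C = "ratio_sum + wt_sum * (real CARD('k) * (2 * ratio_sum))"
  have "((\<lambda>M. ?C * exp (- M)) \<longlongrightarrow> ?C * 0) at_top"
    by (intro tendsto_mult tendsto_const filterlim_compose[OF exp_at_bot] filterlim_uminus_at_bot_at_top)
  then have "\<forall>\<^sub>F M in at_top. ?C * exp (- M) < 1/2"
    by (rule order_tendstoD) simp
  then have "\<forall>\<^sub>F M in at_top. ?C * exp (- M) < 1/2 \<and> M \<ge> M0"
    using eventually_ge_at_top by (rule eventually_conj)
  then obtain M where M: "?C * exp (- M) < 1/2" "M \<ge> M0"
    using eventually_happens'[OF trivial_limit_at_top_linorder] by blast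
  have "0 \<le> ratio_sum * exp (- M)" "0 \<le> wt_sum * (real CARD('k) * (2 * (ratio_sum * exp (- M))))"
    using ratio_sum_nonneg wt_sum_nonneg by simp_all
  moreover have "?C * exp (- M) = ratio_sum * exp (- M) + wt_sum * (real CARD('k) * (2 * (ratio_sum * exp (- M))))"
    by (simp add: algebra_simps)
  ultimately show ?thesis
    using M unfolding small_def by (intro exI[of _ M]) linarith
qed

lemma small_mono: "small M \<Longrightarrow> M \<le> M' \<Longrightarrow> small M'"
proof -
  assume M: "small M" "M \<le> M'"
  have "ratio_sum * exp (- M') \<le> ratio_sum * exp (- M)"
    using M(2) ratio_sum_nonneg by (intro mult_left_mono) auto
  moreover from this have "wt_sum * (real CARD('k) * (2 * (ratio_sum * exp (- M')))) \<le>
      wt_sum * (real CARD('k) * (2 * (ratio_sum * exp (- M))))"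
    by (intro mult_left_mono[OF _ wt_sum_nonneg]) simp
  ultimately show "small M'" using M unfolding small_def by linarith
qed

lemma tail_half: "small M \<Longrightarrow> x \<in> tube (deepset M) \<Longrightarrow> norm (tail i x) < 1/2"
  using tail_bound[of x M i] by (simp add: small_def)

lemma pert_has_derivative:
  assumes "small M" "x \<in> tube (deepset M)"
  shows "(pert has_derivative pert' x) (at x)"
proof -
  show ?thesis
  proof (rule has_derivative_vecI)
    fix j
    show "((\<lambda>x. pert x $ j) has_derivative (\<lambda>v. pert' x v $ j)) (at x)"
      unfolding pert_def pert'_def vec_lambda_beta
      by (intro has_derivative_sum has_derivative_mult_right Ln_tail_has_derivative
          less_imp_le[OF tail_half[OF assms]])
  qed
qed

lemma pert'_bound:
  assumes "small M" "x \<in> tube (deepset M)"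
  shows "norm (pert' x v) \<le> 1/2 * norm v"
proof -
  let ?e = "2 * (ratio_sum * exp (- M))"
  have M: "ratio_sum * exp (- M) \<le> 1/2" using assms(1) by (simp add: small_def)
  have e: "?e \<ge> 0" using ratio_sum_nonneg by simp
  have in1: "norm ((\<Sum>k\<in>UNIV. dlog i k x * v $ k) - v $ lead i) \<le> real CARD('k) * ?e * norm v" for i
  proof -
    have "(\<Sum>k\<in>UNIV. dlog i k x * v $ k) - v $ lead i =
        (\<Sum>k\<in>UNIV. (dlog i k x - (if k = lead i then 1 else 0)) * v $ k)"
      by (simp add: left_diff_distrib sum_subtractf if_distrib[of "\<lambda>c. c * _"] cong: if_cong)
    also have "norm \<dots> \<le> (\<Sum>k\<in>(UNIV :: 'k set). ?e * norm v)"
      by (intro order_trans[OF norm_sum sum_mono])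
         (simp only: norm_mult, intro mult_mono dlog_bound[OF assms(2) M] norm_nth_le_vec e norm_ge_zero)
    also have "\<dots> = real CARD('k) * ?e * norm v" by simp
    finally show ?thesis .
  qed
  have "norm (pert' x v) \<le> (\<Sum>j\<in>UNIV. norm (pert' x v $ j))" by (rule norm_vec_le_sum)
  also have "\<dots> \<le> (\<Sum>j\<in>UNIV. \<Sum>i\<in>UNIV. \<bar>wt j i\<bar> * (real CARD('k) * ?e * norm v))"
  proof (intro sum_mono)
    fix j
    show "norm (pert' x v $ j) \<le> (\<Sum>i\<in>UNIV. \<bar>wt j i\<bar> * (real CARD('k) * ?e * norm v))"
      unfolding pert'_def vec_lambda_beta
      by (intro order_trans[OF norm_sum sum_mono]) (simp only: norm_mult norm_of_real, intro mult_left_mono in1, simp)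
  qed
  also have "\<dots> = wt_sum * (real CARD('k) * ?e) * norm v"
    by (simp add: wt_sum_def sum_distrib_left mult_ac)
  also have "\<dots> \<le> 1/2 * norm v"
    using assms(1) by (intro mult_right_mono) (auto simp: small_def)
  finally show ?thesis .
qed

lemma pert_bound:
  assumes "small M" "x \<in> tube (deepset M)"
  shows "norm (pert x) \<le> 1/2"
proof -
  let ?e = "2 * (ratio_sum * exp (- M))"
  have ln: "norm (Ln (1 + tail i x)) \<le> ?e" for i
    using norm_Ln_le[of "tail i x"] tail_half[OF assms, of i] tail_bound[OF assms(2), of i] by linarith
  have "norm (pert x) \<le> (\<Sum>j\<in>UNIV. norm (pert x $ j))" by (rule norm_vec_le_sum)
  also have "\<dots> \<le> (\<Sum>j\<in>UNIV. \<Sum>i\<in>UNIV. \<bar>wt j i\<bar> * ?e)"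
  proof (intro sum_mono)
    fix j
    show "norm (pert x $ j) \<le> (\<Sum>i\<in>UNIV. \<bar>wt j i\<bar> * ?e)"
      unfolding pert_def vec_lambda_beta
      by (intro order_trans[OF norm_sum sum_mono]) (simp only: norm_mult norm_of_real, intro mult_left_mono ln, simp)
  qed
  also have "\<dots> = wt_sum * (1 * ?e)"
    by (simp add: wt_sum_def sum_distrib_left mult_ac)
  also have "\<dots> \<le> wt_sum * (real CARD('k) * ?e)"
    using wt_sum_nonneg ratio_sum_nonneg
    by (intro mult_left_mono mult_right_mono) (auto simp: Suc_le_eq)
  also have "\<dots> \<le> 1/2" using assms(1) by (simp add: small_def)
  finally show ?thesis .
qed

lemma tube_deepset_convex: "convex (tube (deepset M) :: (complex, 'k) vec set)"
proof -
  have "tube (deepset M) = re_vec -` (deepset M :: (real, 'k) vec set)" by (auto simp: tube_def)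
  then show ?thesis
    using convex_linear_vimage[OF bounded_linear.linear[OF linear_re_vec] deepset_convex] by metis
qed

lemma pert_contraction:
  assumes "small M" "x \<in> tube (deepset M)" "y \<in> tube (deepset M)"
  shows "norm (pert x - pert y) \<le> 1/2 * norm (x - y)"
proof (rule differentiable_bound[OF tube_deepset_convex])
  fix z :: "(complex, 'k) vec" assume z: "z \<in> tube (deepset M)"
  show "(pert has_derivative pert' z) (at z within tube (deepset M))"
    using pert_has_derivative[OF assms(1) z] has_derivative_at_withinI by blast
  show "onorm (pert' z) \<le> 1/2"
    by (rule onorm_bound) (use pert'_bound[OF assms(1) z] in auto)
qed (use assms in auto)

lemma tail_period: "tail i (x + cvec 0 (period m)) = tail i x"
proof -
  have e: "exp (Complex 0 (2 * pi * real_of_int j)) = 1" for j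
    unfolding exp_eq_1 by (auto intro!: exI[of _ j])
  show ?thesis
    by (simp add: tail_def exp_diff exp_add e)
qed

lemma pert_period: "pert (x + cvec 0 (period m)) = pert x"
  by (simp add: pert_def tail_period)

lemma R_period: "R (x + cvec 0 (period m)) = R x + cvec 0 (period m)"
  by (simp add: R_def pert_period)

lemma dlog_period: "dlog i k (x + cvec 0 (period m)) = dlog i k x"
  unfolding dlog_def expv_nth[symmetric] by simp

lemma R_inj:
  assumes M: "small M" and "x \<in> tube (deepset M)" "y \<in> tube (deepset M)" "R x = R y"
  shows "x = y"
proof -
  have "x - y = - (pert x - pert y)"
    using assms(4) by (simp add: R_def algebra_simps)
  then have "norm (x - y) \<le> 1/2 * norm (x - y)"
    using pert_contraction[OF assms(1-3)] by (metis norm_minus_cancel)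
  then show ?thesis by simp
qed

lemma deep_ball:
  fixes x y :: "(complex, 'k) vec"
  assumes "x \<in> tube (deepset (M + 2))" "norm (y - x) \<le> 1"
  shows "y \<in> tube (deepset M)"
proof -
  have "\<bar>re_vec y $ k - re_vec x $ k\<bar> \<le> 1" for k
    using abs_Re_le_cmod[of "(y - x) $ k"] norm_nth_le_vec[of "y - x" k] assms(2) by simp
  from deepset_perturb[OF _ this, of "M + 2"] assms(1) show ?thesis by (simp add: tube_def)
qed

text \<open>The solution is the fixed point of the contraction \<open>\<lambda>x. w - pert x\<close> on the ball of
  radius 1/2 around \<open>w\<close>; the margin 2 keeps this ball inside the domain.\<close>

lemma R_surj:
  assumes M: "small M" and w: "w \<in> tube (deepset (M + 2))"
  obtains x where "x \<in> tube (deepset M)" "R x = w" "norm (x - w) \<le> 1/2"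
proof -
  have sub: "x \<in> tube (deepset M)" if "x \<in> cball w (1/2)" for x
    using that by (intro deep_ball[OF w]) (auto simp: dist_norm norm_minus_commute)
  have "\<exists>!x\<in>cball w (1/2). w - pert x = x"
  proof (rule Banach_fix[where c = "1/2"])
    show "(\<lambda>x. w - pert x) ` cball w (1/2) \<subseteq> cball w (1/2)"
      using pert_bound[OF M sub] by (auto simp: dist_norm)
    show "dist (w - pert x) (w - pert y) \<le> 1/2 * dist x y"
      if "x \<in> cball w (1/2)" "y \<in> cball w (1/2)" for x y
      using pert_contraction[OF M sub[OF that(2)] sub[OF that(1)]] by (simp add: dist_norm norm_minus_commute)
  qed (auto intro: closed_cball compact_imp_complete)
  then obtain x where x: "x \<in> cball w (1/2)" "w - pert x = x" by blast
  show thesis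
  proof (rule that[OF sub[OF x(1)]])
    show "R x = w" using x(2) by (simp add: R_def) (metis diff_add_cancel)
    show "norm (x - w) \<le> 1/2" using x(1) by (simp add: dist_norm norm_minus_commute)
  qed
qed

definition S :: "real \<Rightarrow> (complex, 'k) vec \<Rightarrow> (complex, 'k) vec" where
  "S M w = (THE x. x \<in> tube (deepset M) \<and> R x = w)"

lemma S_props:
  assumes M: "small M" and w: "w \<in> tube (deepset (M + 2))"
  shows "S M w \<in> tube (deepset M)" "R (S M w) = w" "norm (S M w - w) \<le> 1/2"
proof -
  obtain x where x: "x \<in> tube (deepset M)" "R x = w" "norm (x - w) \<le> 1/2"
    using R_surj[OF assms] by blast
  have "S M w = x"
    unfolding S_def by (rule the_equality) (use x R_inj[OF M] in auto)
  then show "S M w \<in> tube (deepset M)" "R (S M w) = w" "norm (S M w - w) \<le> 1/2"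
    using x by auto
qed

lemma S_R:
  assumes "small M" "x \<in> tube (deepset M)"
  shows "S M (R x) = x"
  unfolding S_def by (rule the_equality) (use assms R_inj[OF assms(1)] in auto)

lemma S_period:
  assumes M: "small M" and w: "w \<in> tube (deepset (M + 2))"
  shows "S M (w + cvec 0 (period m)) = S M w + cvec 0 (period m)"
proof -
  have re: "re_vec (x + cvec 0 (period m)) = re_vec x" for x :: "(complex, 'k) vec"
    by (simp add: vec_eq_iff)
  have "S M w + cvec 0 (period m) \<in> tube (deepset M)"
    using S_props(1)[OF assms] by (simp add: tube_def re)
  from S_R[OF M this] show ?thesis by (simp add: R_period S_props(2)[OF assms])
qed

lemma pert'_scale_i: "pert' x (\<i> *s v) = \<i> *s pert' x v"
  by (simp add: pert'_def vec_eq_iff sum_distrib_left algebra_simps)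

text \<open>The inverse function theorem; the inverse of a complex linear derivative is complex
  linear.\<close>

lemma S_has_derivative:
  assumes M: "small M" and w: "w \<in> tube (deepset (M + 2))"
  obtains g where "(S M has_derivative g) (at w)" "\<And>v. g (\<i> *s v) = \<i> *s g v"
proof -
  let ?x = "S M w"
  let ?T = "tube (deepset (M + 2)) :: (complex, 'k) vec set"
  have x: "?x \<in> tube (deepset M)" by (rule S_props(1)[OF assms])
  have oT: "open ?T" by (intro open_tube deepset_open)
  define f' where "f' v = v + pert' ?x v" for v
  have dR: "(R has_derivative f') (at ?x)"
    unfolding R_def[abs_def] f'_def[abs_def]
    by (intro has_derivative_add has_derivative_ident pert_has_derivative[OF M x])
  have linf: "linear f'" by (rule has_derivative_linear[OF dR])
  have low: "norm v \<le> 2 * norm (f' v)" for v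
  proof -
    have "norm v \<le> norm (f' v) + norm (pert' ?x v)"
      unfolding f'_def by (metis add_diff_cancel_right' norm_triangle_ineq4)
    then show ?thesis using pert'_bound[OF M x, of v] by linarith
  qed
  have "inj f'"
    unfolding linear_injective_0[OF linf] using low by (metis mult_zero_right norm_le_zero_iff norm_zero)
  then obtain g where g: "linear g" "\<And>v. f' (g v) = v" "\<And>v. g (f' v) = v"
    using linear_injective_isomorphism[OF linf] by metis
  have lip: "dist (S M y) (S M w) \<le> 2 * dist y w" if "y \<in> ?T" for y
  proof -
    have "S M y - S M w = (y - w) - (pert (S M y) - pert (S M w))"
      using S_props(2)[OF M that] S_props(2)[OF assms] unfolding R_def by (simp add: algebra_simps)
    then have "norm (S M y - S M w) \<le> norm (y - w) + norm (pert (S M y) - pert (S M w))"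
      by (metis norm_triangle_ineq4)
    then show ?thesis
      using pert_contraction[OF M S_props(1)[OF M that] x] by (simp add: dist_norm)
  qed
  have cont: "continuous (at w) (S M)"
    unfolding continuous_at_eps_delta
  proof (intro allI impI)
    fix e :: real assume "e > 0"
    obtain d where d: "d > 0" "ball w d \<subseteq> ?T" using oT w open_contains_ball by blast
    show "\<exists>d>0. \<forall>x'. dist x' w < d \<longrightarrow> dist (S M x') (S M w) < e"
    proof (intro exI[of _ "min d (e / 2)"] conjI allI impI)
      fix y assume y: "dist y w < min d (e / 2)"
      then have "y \<in> ?T" using d(2) by (auto simp: dist_commute)
      then show "dist (S M y) (S M w) < e" using lip[of y] y by linarith
    qed (use d \<open>e > 0\<close> in auto)
  qed
  have der: "(S M has_derivative g) (at w)"
  proof (rule has_derivative_inverse_basic[where f = R and f' = f' and T = ?T])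
    show "bounded_linear g" using g(1) by (rule linear_conv_bounded_linear[THEN iffD1])
    show "g \<circ> f' = id" using g(3) by (simp add: fun_eq_iff)
  qed (use dR cont oT w S_props(2)[OF M] in auto)
  have "f' (\<i> *s v) = \<i> *s f' v" for v
    by (simp add: f'_def pert'_scale_i vec_eq_iff algebra_simps)
  then have "g (\<i> *s v) = \<i> *s g v" for v
    by (metis g(2,3))
  then show thesis by (rule that[OF der])
qed

end

section \<open>Operations on holomorphic functions, and the degree of the deformed coordinates\<close>

lemma vec_holo_const: "vec_holo (\<lambda>x. c) S"
  unfolding vec_holo_def by (intro ballI exI[of _ "\<lambda>v. 0"]) auto

lemma vec_holo_add:
  assumes "vec_holo f S" "vec_holo g S"
  shows "vec_holo (\<lambda>x. f x + g x) S"
  unfolding vec_holo_def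
proof
  fix x assume "x \<in> S"
  then obtain D E where *: "(f has_derivative D) (at x)" "\<And>v. D (\<i> *s v) = \<i> * D v"
    "(g has_derivative E) (at x)" "\<And>v. E (\<i> *s v) = \<i> * E v"
    using assms unfolding vec_holo_def by meson
  show "\<exists>D. ((\<lambda>x. f x + g x) has_derivative D) (at x) \<and> (\<forall>v. D (\<i> *s v) = \<i> * D v)"
    by (rule exI[of _ "\<lambda>v. D v + E v"]) (auto simp: * algebra_simps intro: has_derivative_add)
qed

lemma vec_holo_sum: "finite I \<Longrightarrow> (\<And>i. i \<in> I \<Longrightarrow> vec_holo (f i) S) \<Longrightarrow> vec_holo (\<lambda>x. \<Sum>i\<in>I. f i x) S"
  by (induction I rule: finite_induct) (auto intro: vec_holo_const vec_holo_add)

lemma vec_holo_prod: "finite I \<Longrightarrow> (\<And>i. i \<in> I \<Longrightarrow> vec_holo (f i) S) \<Longrightarrow> vec_holo (\<lambda>x. \<Prod>i\<in>I. f i x) S"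
  by (induction I rule: finite_induct) (auto intro: vec_holo_const vec_holo_mult)

lemma vec_holo_subset: "vec_holo f S \<Longrightarrow> T \<subseteq> S \<Longrightarrow> vec_holo f T"
  by (auto simp: vec_holo_def)

lemma vec_holo_det:
  assumes "\<And>j k. vec_holo (\<lambda>x. M x $ j $ k) S"
  shows "vec_holo (\<lambda>x. det (M x :: complex ^ 'k ^ 'k)) S"
  unfolding det_def by (intro vec_holo_sum vec_holo_mult vec_holo_const vec_holo_prod assms) (auto intro: finite_permutations)

lemma vec_holo_compose:
  fixes f :: "complex ^ 'k \<Rightarrow> complex" and g :: "complex ^ 'k \<Rightarrow> complex ^ 'k"
  assumes "vec_holo f T" "\<And>x. x \<in> S \<Longrightarrow> g x \<in> T"
    and "\<And>x. x \<in> S \<Longrightarrow> \<exists>D. (g has_derivative D) (at x) \<and> (\<forall>v. D (\<i> *s v) = \<i> *s D v)"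
  shows "vec_holo (\<lambda>x. f (g x)) S"
  unfolding vec_holo_def
proof
  fix x assume x: "x \<in> S"
  obtain D where D: "(g has_derivative D) (at x)" "\<And>v. D (\<i> *s v) = \<i> *s D v"
    using assms(3)[OF x] by blast
  obtain E where E: "(f has_derivative E) (at (g x))" "\<And>v. E (\<i> *s v) = \<i> * E v"
    using assms(1,2) x unfolding vec_holo_def by blast
  show "\<exists>D. ((\<lambda>x. f (g x)) has_derivative D) (at x) \<and> (\<forall>v. D (\<i> *s v) = \<i> * D v)"
    by (rule exI[of _ "\<lambda>v. E (D v)"]) (auto simp: D E intro: has_derivative_compose)
qed

lemma expv_has_derivative: "(expv has_derivative (\<lambda>v. \<chi> k. exp (x $ k) * v $ k)) (at x)"
proof (rule has_derivative_vecI)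
  fix k
  have "((\<lambda>x. x $ k) has_derivative (\<lambda>v. v $ k)) (at x)"
    by (rule bounded_linear_imp_has_derivative[OF bounded_linear_vec_nth])
  moreover have "(exp has_derivative (\<lambda>h. exp z * h)) (at z)" for z :: complex
    using DERIV_exp by (simp add: has_field_derivative_def)
  ultimately have "((\<lambda>x. exp (x $ k)) has_derivative (\<lambda>v. exp (x $ k) * v $ k)) (at x)"
    by (rule has_derivative_compose)
  then show "((\<lambda>x. expv x $ k) has_derivative (\<lambda>v. (\<chi> k. exp (x $ k) * v $ k) $ k)) (at x)"
    by simp
qed

lemma vec_holo_expv:
  assumes "vec_holo f (log_domain \<Omega>)"
  shows "vec_holo (\<lambda>x. f (expv x)) (tube \<Omega>)"
proof (rule vec_holo_compose[OF assms])
  fix x :: "complex ^ 'a"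
  show "\<exists>D. (expv has_derivative D) (at x) \<and> (\<forall>v. D (\<i> *s v) = \<i> *s D v)"
    by (intro exI conjI, rule expv_has_derivative) (simp add: vec_eq_iff algebra_simps)
qed simp

lemma per_on_expv: "per_on (\<lambda>x. f (expv x)) S"
  by (simp add: per_on_def)

lemma det_near_identity:
  assumes "\<epsilon> > 0"
  shows "\<exists>d>0. \<forall>N :: complex ^ 'k ^ 'k.
    (\<forall>j k. norm (N $ j $ k - (if j = k then 1 else 0)) \<le> d) \<longrightarrow> norm (det N - 1) < \<epsilon>"
proof -
  have nth: "continuous_on UNIV (\<lambda>N :: complex ^ 'k ^ 'k. N $ j $ k)" for j k
    by (rule continuous_on_component[OF continuous_on_component[OF continuous_on_id]])
  have "continuous_on UNIV (\<lambda>N :: complex ^ 'k ^ 'k. det N)"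
    unfolding det_def
    by (rule continuous_on_sum, rule continuous_on_mult, rule continuous_on_const,
        rule continuous_on_prod, rule nth)
  then have "isCont (det :: complex ^ 'k ^ 'k \<Rightarrow> complex) (mat 1)"
    by (simp add: continuous_on_eq_continuous_at)
  then have "\<forall>e>0. \<exists>d>0. \<forall>N :: complex ^ 'k ^ 'k. dist N (mat 1) < d \<longrightarrow> dist (det N) (det (mat 1 :: complex ^ 'k ^ 'k)) < e"
    by (simp only: continuous_at_eps_delta)
  from this[rule_format, OF assms]
  obtain d where d: "d > 0" "\<And>N :: complex ^ 'k ^ 'k. dist N (mat 1) < d \<Longrightarrow> dist (det N) (det (mat 1 :: complex ^ 'k ^ 'k)) < \<epsilon>"
    by auto
  let ?d = "d / (2 * (real CARD('k) * real CARD('k)))"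
  have "norm (det N - 1) < \<epsilon>" if N: "\<And>j k. norm (N $ j $ k - (if j = k then 1 else 0)) \<le> ?d" for N :: "complex ^ 'k ^ 'k"
  proof -
    have "norm (N - mat 1) \<le> (\<Sum>j\<in>UNIV. norm ((N - mat 1) $ j))"
      unfolding norm_vec_def[of "N - mat 1"] by (rule L2_set_le_sum) simp
    also have "\<dots> \<le> (\<Sum>j\<in>UNIV. \<Sum>k\<in>UNIV. norm ((N - mat 1) $ j $ k))"
      by (intro sum_mono norm_vec_le_sum)
    also have "\<dots> \<le> (\<Sum>j\<in>(UNIV::'k set). \<Sum>k\<in>(UNIV::'k set). ?d)"
      using N by (intro sum_mono) (simp add: mat_def)
    also have "\<dots> < d" using d(1) by simp
    finally show ?thesis using d(2)[of N] by (simp add: dist_norm)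
  qed
  then show ?thesis using d(1) by (intro exI[of _ ?d]) auto
qed

lemma slice_vector_derivative:
  fixes f :: "complex ^ 'k \<Rightarrow> complex"
  assumes "(f has_derivative D) (at (cvec \<eta> \<theta>))"
  shows "((\<lambda>t. f (cvec \<eta> (\<theta> + t *\<^sub>R axis b 1))) has_vector_derivative D (\<i> *s axis b 1)) (at 0)"
proof -
  let ?g = "\<lambda>t :: real. cvec \<eta> \<theta> + t *\<^sub>R (\<i> *s axis b 1)"
  have eq: "cvec \<eta> (\<theta> + t *\<^sub>R axis b 1) = ?g t" for t
    by (simp add: vec_eq_iff complex_eq_iff axis_def)
  have "(?g has_derivative (\<lambda>t. t *\<^sub>R (\<i> *s axis b 1))) (at 0)"
    by (auto intro!: derivative_eq_intros)
  moreover have "(f has_derivative D) (at (?g 0))" using assms by simp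
  ultimately have "((\<lambda>t. f (?g t)) has_derivative (\<lambda>t. D (t *\<^sub>R (\<i> *s axis b 1)))) (at 0)"
    by (rule has_derivative_compose)
  then show ?thesis
    using linear_scale[OF has_derivative_linear[OF assms]] by (simp add: has_vector_derivative_def eq)
qed

context nonsingular_chart
begin

definition fiber :: "(complex, 'k) vec \<Rightarrow> (complex, 'k) vec set" where
  "fiber y = {u \<in> log_domain \<Omega>. prod_map a nn u = y}"

definition Bc :: "(complex, 'k) vec \<Rightarrow> (complex, 'k) vec" where
  "Bc x = (\<chi> j. \<Sum>k\<in>UNIV. of_real (B $ j $ k) * x $ k)"

lemma vec_holo_dlog: "vec_holo (dlog i k) (tube \<Omega>)"
  unfolding vec_holo_def
proof (intro ballI exI conjI allI)
  fix x assume "x \<in> tube \<Omega>"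
  then have "form a i (expv x) \<noteq> 0" by (intro form_nz) simp
  then show "(dlog i k has_derivative (\<lambda>v. dlog i k x * (v $ k - (\<Sum>l\<in>UNIV. dlog i l x * v $ l)))) (at x)"
    by (rule dlog_has_derivative)
  show "dlog i k x * ((\<i> *s v) $ k - (\<Sum>l\<in>UNIV. dlog i l x * (\<i> *s v) $ l)) =
      \<i> * (dlog i k x * (v $ k - (\<Sum>l\<in>UNIV. dlog i l x * v $ l)))" for v
    by (simp add: algebra_simps sum_distrib_left)
qed

lemma vec_holo_N: "vec_holo (\<lambda>x. N x $ j $ k) (tube \<Omega>)"
  unfolding N_def vec_lambda_beta
  by (intro vec_holo_sum vec_holo_mult vec_holo_const vec_holo_dlog) auto

lemma N_period: "N (x + cvec 0 (period m)) = N x"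
  by (simp add: N_def dlog_period)

lemma N_near_identity:
  assumes "small M" "x \<in> tube (deepset M)"
  shows "norm (N x $ j $ k - (if j = k then 1 else 0)) \<le> wt_sum * (2 * (ratio_sum * exp (- M)))"
proof -
  have M: "ratio_sum * exp (- M) \<le> 1/2" using assms(1) by (simp add: small_def)
  have "N x $ j $ k - (if j = k then 1 else 0) =
      (\<Sum>i\<in>UNIV. of_real (wt j i) * (dlog i k x - (if k = lead i then 1 else 0)))"
  proof -
    have "(\<Sum>i\<in>UNIV. of_real (wt j i) * (if k = lead i then 1 else 0)) = (of_real (\<Sum>i | lead i = k. wt j i) :: complex)"
      by (simp add: if_distrib[of "\<lambda>c. _ * c"] sum.If_cases cong: if_cong) (auto intro: sum.cong)
    then show ?thesis
      by (simp add: N_def right_diff_distrib sum_subtractf wt_lead)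
  qed
  also have "norm \<dots> \<le> (\<Sum>i\<in>UNIV. \<bar>wt j i\<bar> * (2 * (ratio_sum * exp (- M))))"
    by (intro order_trans[OF norm_sum sum_mono])
       (simp only: norm_mult norm_of_real, intro mult_left_mono dlog_bound[OF assms(2) M], simp)
  also have "\<dots> = (\<Sum>i\<in>UNIV. \<bar>wt j i\<bar>) * (2 * (ratio_sum * exp (- M)))"
    by (simp only: sum_distrib_right)
  also have "(\<Sum>i\<in>UNIV. \<bar>wt j i\<bar>) \<le> wt_sum"
    unfolding wt_sum_def by (rule member_le_sum) (auto intro: sum_nonneg)
  finally show ?thesis using ratio_sum_nonneg by (simp add: mult_right_mono)
qed

lemma deepset_nonempty: "(\<chi> k. (M + 1) * real (card {l :: 'k. l < k})) \<in> deepset M" if "M \<ge> 0" for M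
  unfolding deepset_def
proof (intro CollectI allI impI)
  fix k l :: 'k assume "k < l"
  then have "{j. j < k} \<subset> {j. j < l}" by auto
  then have "card {j. j < k} < card {j. j < l}" by (intro psubset_card_mono) auto
  then have "1 \<le> real (card {j. j < l}) - real (card {j. j < k})" by linarith
  then have "(M + 1) * 1 \<le> (M + 1) * (real (card {j. j < l}) - real (card {j. j < k}))"
    using that by (intro mult_left_mono) auto
  then show "M < (\<chi> k. (M + 1) * real (card {l :: 'k. l < k})) $ l - (\<chi> k. (M + 1) * real (card {l :: 'k. l < k})) $ k"
    by (simp add: algebra_simps)
qed

text \<open>The integral does not depend on the depth, and \<open>N\<close> tends to the identity matrix as the
  depth tends to infinity.\<close>

lemma integral_det_N:
  assumes M: "small M" and \<eta>: "\<eta> \<in> deepset M"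
  shows "integral tcube (\<lambda>\<theta>. det (N (cvec \<eta> \<theta>))) = of_real ((2 * pi) ^ CARD('k))"
proof -
  let ?I = "\<lambda>\<eta>. integral tcube (\<lambda>\<theta>. det (N (cvec \<eta> \<theta>)))" and ?c = "of_real ((2 * pi) ^ CARD('k)) :: complex"
  have sub: "deepset M \<subseteq> \<Omega>" using M deepset_mono deep_\<Omega> unfolding small_def by blast
  have holo: "vec_holo (\<lambda>x. det (N x)) (tube (deepset M))"
    by (rule vec_holo_det, rule vec_holo_subset[OF vec_holo_N]) (use sub in \<open>auto simp: tube_def\<close>)
  have per: "per_on (\<lambda>x. det (N x)) (tube (deepset M))" by (simp add: per_on_def N_period)
  have "norm (?I \<eta> - ?c) \<le> \<epsilon> * (2 * pi) ^ CARD('k)" if \<epsilon>: "\<epsilon> > 0" for \<epsilon>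
  proof -
    obtain d where d: "d > 0" "\<And>N :: ((complex, 'k) vec, 'k) vec.
      (\<And>j k. norm (N $ j $ k - (if j = k then 1 else 0)) \<le> d) \<Longrightarrow> norm (det N - 1) < \<epsilon>"
      using det_near_identity[OF \<epsilon>] by blast
    have "((\<lambda>M. (wt_sum * (2 * ratio_sum)) * exp (- M)) \<longlongrightarrow> (wt_sum * (2 * ratio_sum)) * 0) at_top"
      by (intro tendsto_mult tendsto_const filterlim_compose[OF exp_at_bot] filterlim_uminus_at_bot_at_top)
    then have "\<forall>\<^sub>F M in at_top. (wt_sum * (2 * ratio_sum)) * exp (- M) < d"
      by (rule order_tendstoD) (simp add: d(1))
    then have "\<forall>\<^sub>F M' in at_top. (wt_sum * (2 * ratio_sum)) * exp (- M') < d \<and> M' \<ge> max M 0"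
      using eventually_ge_at_top by (rule eventually_conj)
    then obtain M' where M': "(wt_sum * (2 * ratio_sum)) * exp (- M') < d" "M' \<ge> max M 0"
      using eventually_happens'[OF trivial_limit_at_top_linorder] by blast
    define \<eta>' :: "(real, 'k) vec" where "\<eta>' = (\<chi> k. (M' + 1) * real (card {l :: 'k. l < k}))"
    have \<eta>': "\<eta>' \<in> deepset M'" unfolding \<eta>'_def by (rule deepset_nonempty) (use M' in auto)
    then have \<eta>'M: "\<eta>' \<in> deepset M" using deepset_mono[of M M'] M'(2) by auto
    have sM': "small M'" using small_mono[OF M] M'(2) by auto
    have close: "norm (det (N (cvec \<eta>' \<theta>)) - 1) < \<epsilon>" for \<theta>
    proof (rule d(2))
      fix j k
      show "norm (N (cvec \<eta>' \<theta>) $ j $ k - (if j = k then 1 else 0)) \<le> d"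
        using N_near_identity[OF sM', of "cvec \<eta>' \<theta>" j k] \<eta>' M'(1) by (simp add: mult_ac)
    qed
    have int: "(\<lambda>\<theta>. det (N (cvec \<eta>' \<theta>))) integrable_on tcube"
      by (intro continuous_tcube_integrable slice_continuous[OF vec_holo_continuous[OF holo] \<eta>'M])
    have one: "integral tcube (\<lambda>\<theta> :: (real, 'k) vec. 1 :: complex) = ?c"
      by (subst content_tcube[symmetric]) (simp add: tcube_def scaleR_conv_of_real)
    have int1: "(\<lambda>\<theta> :: (real, 'k) vec. 1 :: complex) integrable_on tcube"
      by (simp add: tcube_def integrable_const)
    have "?I \<eta> = ?I \<eta>'"
      by (rule torus_mean_independent[OF deepset_open deepset_convex holo per \<eta>'M \<eta>])
    then have "?I \<eta> - ?c = integral tcube (\<lambda>\<theta>. det (N (cvec \<eta>' \<theta>)) - 1)"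
      using Henstock_Kurzweil_Integration.integral_diff[OF int int1] by (simp add: one)
    also have "norm \<dots> \<le> integral tcube (\<lambda>\<theta> :: (real, 'k) vec. \<epsilon>)"
      using close by (intro integral_norm_bound_integral Henstock_Kurzweil_Integration.integrable_diff int int1)
        (auto simp: tcube_def integrable_const intro: less_imp_le)
    also have "\<dots> = \<epsilon> * (2 * pi) ^ CARD('k)"
      by (subst content_tcube[symmetric]) (simp add: tcube_def)
    finally show ?thesis .
  qed
  then have "norm (?I \<eta> - ?c) / (2 * pi) ^ CARD('k) \<le> \<epsilon>" if "\<epsilon> > 0" for \<epsilon>
    using that by (simp add: divide_le_eq)
  then have "norm (?I \<eta> - ?c) / (2 * pi) ^ CARD('k) \<le> 0"
    by (rule field_le_epsilon[of _ 0, simplified])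
  moreover have "0 < (2 * pi) ^ CARD('k)" by simp
  ultimately have "norm (?I \<eta> - ?c) \<le> 0 * (2 * pi) ^ CARD('k)"
    by (simp only: pos_divide_le_eq)
  then show ?thesis by simp
qed

lemma R_component_derivative:
  assumes "small M" "x \<in> tube (deepset M)"
  shows "((\<lambda>x. R x $ j) has_derivative (\<lambda>v. \<Sum>k\<in>UNIV. N x $ j $ k * v $ k)) (at x)"
proof -
  have "(R has_derivative (\<lambda>v. v + pert' x v)) (at x)"
    unfolding R_def[abs_def] by (intro has_derivative_add has_derivative_ident pert_has_derivative[OF assms])
  from bounded_linear.has_derivative[OF bounded_linear_vec_nth this, of j]
  show ?thesis unfolding R'_eq by simp
qed

text \<open>Since \<open>R\<close> commutes with the periods, \<open>exp (m\<bullet>R) dR\<close> is an exact periodic form.\<close>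

lemma integral_exp_R_det_N:
  assumes M: "small M" and \<eta>: "\<eta> \<in> deepset M" and m: "m \<noteq> 0"
  shows "integral tcube (\<lambda>\<theta>. exp (ndot m (R (cvec \<eta> \<theta>))) * det (N (cvec \<eta> \<theta>))) = 0"
proof -
  let ?x = "\<lambda>\<theta>. cvec \<eta> \<theta>"
  have x: "?x \<theta> \<in> tube (deepset M)" for \<theta> using \<eta> by simp
  have sub: "deepset M \<subseteq> \<Omega>" using M deepset_mono deep_\<Omega> unfolding small_def by blast
  have fz: "form a i (expv (?x \<theta>)) \<noteq> 0" for i \<theta>
    using \<eta> sub by (intro form_nz) auto
  define X where "X \<theta> = R (?x \<theta>)" for \<theta>
  define P where "P \<theta> = (\<chi> j k. \<i> * N (?x \<theta>) $ j $ k)" for \<theta>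
  define T where "T \<theta> j b c = (\<Sum>i\<in>UNIV. - (of_real (wt j i) * (dlog i b (?x \<theta>) * ((if b = c then 1 else 0) - dlog i c (?x \<theta>)))))" for \<theta> j b c
  have cd: "continuous_on UNIV (\<lambda>\<theta>. dlog i k (?x \<theta>))" for i k
    using \<eta> sub by (intro slice_continuous[OF vec_holo_continuous[OF vec_holo_dlog]]) auto
  have cN: "continuous_on UNIV (\<lambda>\<theta>. N (?x \<theta>) $ j $ k)" for j k
    unfolding N_def vec_lambda_beta by (intro continuous_intros cd)
  have "integral tcube (\<lambda>\<theta>. exp (ndot m (X \<theta>)) * det (P \<theta>)) = 0"
  proof (rule torus_exact_integral_zero[where T = T, OF _ _ _ _ _ _ _ _ _ m])
    show "((\<lambda>t. X (\<theta> + t *\<^sub>R axis b 1) $ j) has_vector_derivative P \<theta> $ j $ b) (at 0)" for \<theta> j b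
    proof -
      have "(\<Sum>k\<in>UNIV. N (?x \<theta>) $ j $ k * (\<i> *s axis b 1) $ k) = P \<theta> $ j $ b"
        by (simp add: P_def axis_def if_distrib[of "\<lambda>c. _ * c"] cong: if_cong)
      then show ?thesis
        unfolding X_def using slice_vector_derivative[OF R_component_derivative[OF M x[of \<theta>], of j], of b] by metis
    qed
    show "((\<lambda>t. P (\<theta> + t *\<^sub>R axis c 1) $ j $ b) has_vector_derivative T \<theta> j b c) (at 0)" for \<theta> j b c
    proof -
      have d: "((\<lambda>t. dlog i b (?x (\<theta> + t *\<^sub>R axis c 1))) has_vector_derivative
          dlog i b (?x \<theta>) * (\<i> * ((if b = c then 1 else 0) - dlog i c (?x \<theta>)))) (at 0)" for i
      proof -
        have "dlog i b (?x \<theta>) * ((\<i> *s axis c 1) $ b - (\<Sum>l\<in>UNIV. dlog i l (?x \<theta>) * (\<i> *s axis c 1) $ l)) =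
            dlog i b (?x \<theta>) * (\<i> * ((if b = c then 1 else 0) - dlog i c (?x \<theta>)))"
          by (auto simp: axis_def if_distrib[of "\<lambda>c. _ * c"] if_distrib[of "\<lambda>c. c * _"] algebra_simps cong: if_cong)
        then show ?thesis
          using slice_vector_derivative[OF dlog_has_derivative[OF fz[of i \<theta>], of b], of c] by metis
      qed
      have "((\<lambda>t. \<i> * (\<Sum>i\<in>UNIV. of_real (wt j i) * dlog i b (?x (\<theta> + t *\<^sub>R axis c 1)))) has_vector_derivative
          \<i> * (\<Sum>i\<in>UNIV. of_real (wt j i) * (dlog i b (?x \<theta>) * (\<i> * ((if b = c then 1 else 0) - dlog i c (?x \<theta>)))))) (at 0)"
        by (intro has_vector_derivative_mult_right has_vector_derivative_sum d)
      moreover have "\<i> * (\<Sum>i\<in>UNIV. of_real (wt j i) * (dlog i b (?x \<theta>) * (\<i> * ((if b = c then 1 else 0) - dlog i c (?x \<theta>))))) = T \<theta> j b c"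
        unfolding T_def sum_distrib_left by (rule sum.cong) (auto simp: algebra_simps)
      ultimately show ?thesis by (simp add: P_def N_def)
    qed
    show "T \<theta> j b c = T \<theta> j c b" for \<theta> j b c
      unfolding T_def by (rule sum.cong) (auto simp: algebra_simps)
    show "continuous_on UNIV (\<lambda>\<theta>. X \<theta> $ j)" for j
    proof -
      have "continuous_on (tube (deepset M)) (\<lambda>x. R x $ j)"
        by (intro continuous_at_imp_continuous_on ballI has_derivative_continuous[OF R_component_derivative[OF M]])
      then show ?thesis unfolding X_def by (rule slice_continuous[OF _ \<eta>])
    qed
    show "continuous_on UNIV (\<lambda>\<theta>. P \<theta> $ j $ k)" for j k
      unfolding P_def vec_lambda_beta by (intro continuous_intros cN)
    show "continuous_on UNIV (\<lambda>\<theta>. T \<theta> j b c)" for j b c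
      unfolding T_def by (cases "b = c"; simp only: if_True if_False; intro continuous_intros cd)
    have xp: "?x (\<theta> + period j) = ?x \<theta> + cvec 0 (period j)" for \<theta> j
      by (simp add: cvec_add)
    show "exp (ndot m (X (\<theta> + period j))) = exp (ndot m (X \<theta>))" for \<theta> j
      by (simp add: X_def xp R_period ndot_add exp_add ndot_period)
    show "P (\<theta> + period j) = P \<theta>" for \<theta> j
      by (simp add: P_def xp N_period)
    show "T (\<theta> + period j) = T \<theta>" for \<theta> j
      by (simp add: T_def xp dlog_period fun_eq_iff)
  qed
  moreover have "det (P \<theta>) = \<i> ^ CARD('k) * det (N (?x \<theta>))" for \<theta>
  proof -
    have "P \<theta> = (\<chi> j. \<i> *s (N (?x \<theta>) $ j))" by (simp add: P_def vec_eq_iff)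
    then show ?thesis using det_rows_mul[of "\<lambda>_. \<i>" "\<lambda>j. N (?x \<theta>) $ j"] by simp
  qed
  ultimately have "integral tcube (\<lambda>\<theta>. \<i> ^ CARD('k) * (exp (ndot m (R (?x \<theta>))) * det (N (?x \<theta>)))) = 0"
    by (simp add: X_def mult_ac)
  then show ?thesis by simp
qed

end

section \<open>The trace over a deep torus\<close>

lemma linear_image_integral:
  fixes B C :: "((real, 'k::{finite,wellorder}) vec, 'k) vec" and K :: "(real, 'k) vec \<Rightarrow> complex"
  assumes CB: "\<And>\<theta>. C *v (B *v \<theta>) = \<theta>" and BC: "\<And>\<theta>. B *v (C *v \<theta>) = \<theta>"
    and K: "continuous_on UNIV K"
  shows "integrable lborel (\<lambda>\<theta>. indicator fcube (C *v \<theta>) *\<^sub>R K (C *v \<theta>))"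
    and "(LINT \<theta>|lborel. indicator fcube (C *v \<theta>) *\<^sub>R K (C *v \<theta>)) = \<bar>det B\<bar> *\<^sub>R integral tcube K"
proof -
  let ?g = "\<lambda>\<theta>. B *v \<theta>" and ?f = "\<lambda>\<theta>. K (C *v \<theta>)"
  have lin: "linear ?g" "linear (\<lambda>\<theta>. C *v \<theta>)" by (simp_all add: matrix_vector_mul_linear)
  have contC: "continuous_on S (\<lambda>\<theta>. C *v \<theta>)" and contB: "continuous_on S ?g" for S
    by (simp_all add: linear_continuous_on linear_conv_bounded_linear[THEN iffD1] lin)
  have mem: "\<theta> \<in> ?g ` fcube \<longleftrightarrow> C *v \<theta> \<in> fcube" for \<theta>
    using CB BC by (metis image_iff)
  have ind: "indicator fcube (C *v \<theta>) = (indicator (?g ` fcube) \<theta> :: real)" for \<theta>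
    by (simp add: indicator_def mem)
  have f: "continuous_on S ?f" for S
    by (rule continuous_on_compose2[OF K contC]) auto
  have "compact (?g ` tcube)"
    by (rule compact_continuous_image[OF contB]) (simp add: tcube_def)
  then have i0: "set_integrable lborel (?g ` tcube) ?f"
    using f by (simp add: borel_integrable_compact set_integrable_def)
  have meas: "?g ` fcube \<in> sets borel"
  proof -
    have "?g ` fcube = (\<lambda>\<theta>. C *v \<theta>) -` fcube" using mem by blast
    moreover have "(\<lambda>\<theta>. C *v \<theta>) \<in> borel_measurable borel"
      by (rule borel_measurable_continuous_onI[OF contC])
    ultimately show ?thesis
      using measurable_sets[of "\<lambda>\<theta>. C *v \<theta>" borel borel fcube] fcube_borel by simp
  qed
  have i1: "set_integrable lborel (?g ` fcube) ?f"
    by (rule set_integrable_subset[OF i0]) (use meas fcube_subset in \<open>auto simp: image_mono\<close>)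
  then show i2: "integrable lborel (\<lambda>\<theta>. indicator fcube (C *v \<theta>) *\<^sub>R K (C *v \<theta>))"
    by (simp add: set_integrable_def ind)
  have ai: "?f absolutely_integrable_on ?g ` fcube"
    using i1 borel_measurable_integrable[of lborel]
    unfolding set_integrable_def by (subst integrable_completion) auto
  define J :: "complex \<Rightarrow> real ^ 2" where "J z = (\<chi> i. if i = 1 then Re z else Im z)" for z
  have J: "bounded_linear J"
    by (rule linear_conv_bounded_linear[THEN iffD1], rule linearI) (auto simp: J_def vec_eq_iff)
  have injJ: "J z = J w \<Longrightarrow> z = w" for z w
    by (auto simp: J_def vec_eq_iff complex_eq_iff) (metis exhaust_2 one_neq_zero)+
  have aJ: "(J \<circ> ?f) absolutely_integrable_on ?g ` fcube"
    by (rule absolutely_integrable_linear[OF ai J])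
  have "J (integral (?g ` fcube) ?f) = integral (?g ` fcube) (J \<circ> ?f)"
    using integral_linear[OF _ J] ai absolutely_integrable_on_def by metis
  also have "\<dots> = \<bar>det (matrix ?g)\<bar> *\<^sub>R integral fcube ((J \<circ> ?f) \<circ> ?g)"
    by (rule integral_change_of_variables_linear[OF lin(1)]) (use aJ in blast)
  also have "matrix ?g = B" by simp
  also have "(J \<circ> ?f) \<circ> ?g = J \<circ> K" using CB by (simp add: fun_eq_iff)
  also have "integral fcube (J \<circ> K) = J (integral fcube K)"
  proof (rule integral_linear[OF _ J])
    show "K integrable_on fcube"
      using set_borel_integral_eq_integral(1)[OF fcube_integral(2)] K continuous_on_subset by blast
  qed
  also have "\<bar>det B\<bar> *\<^sub>R J (integral fcube K) = J (\<bar>det B\<bar> *\<^sub>R integral fcube K)"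
    by (simp add: linear_scale[OF bounded_linear.linear[OF J]])
  finally have "integral (?g ` fcube) ?f = \<bar>det B\<bar> *\<^sub>R integral fcube K" by (rule injJ)
  moreover have "integral fcube K = integral tcube K"
  proof -
    have cK: "continuous_on tcube K" using K continuous_on_subset by blast
    show ?thesis
      using set_borel_integral_eq_integral(2)[OF fcube_integral(2)[OF cK]] fcube_integral(1)[OF cK]
      by (simp add: set_lebesgue_integral_def)
  qed
  moreover have "(LINT \<theta>|lborel. indicator fcube (C *v \<theta>) *\<^sub>R K (C *v \<theta>)) = integral (?g ` fcube) ?f"
    using set_borel_integral_eq_integral(2)[OF i1] by (simp add: set_lebesgue_integral_def ind)
  ultimately show "(LINT \<theta>|lborel. indicator fcube (C *v \<theta>) *\<^sub>R K (C *v \<theta>)) = \<bar>det B\<bar> *\<^sub>R integral tcube K"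
    by simp
qed

lemma period_inj: "period m = period m' \<Longrightarrow> m = m'"
  by (simp add: vec_eq_iff)

context nonsingular_chart
begin

text \<open>In the coordinates \<open>R\<close> the logarithm of \<open>p\<close> is exactly affine.\<close>

lemma prod_map_expv:
  assumes M: "small M" and x: "x \<in> tube (deepset M)"
  shows "prod_map a nn (expv x) = expv (cst + Bc (R x))"
proof -
  have "prod_map a nn (expv x) $ j = exp (cst $ j + Bc (R x) $ j)" for j
  proof -
    let ?l = "\<lambda>i. Ln (of_real (a i (lead i))) + x $ lead i + Ln (1 + tail i x)"
    have f: "form a i (expv x) = exp (?l i)" for i
      using lead_nz[of i] tail_half_imp(3)[OF less_imp_le[OF tail_half[OF assms]], of i]
      by (simp add: form_expv exp_add)
    have sw: "(\<Sum>i\<in>UNIV. of_int (nn i j) * y i) = (\<Sum>l\<in>UNIV. of_real (B $ j $ l) * (\<Sum>i\<in>UNIV. of_real (wt l i) * y i))"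
      for y :: "'n \<Rightarrow> complex"
    proof -
      have "(\<Sum>i\<in>UNIV. of_int (nn i j) * y i) = (\<Sum>i\<in>UNIV. of_real (\<Sum>l\<in>UNIV. B $ j $ l * wt l i) * y i)"
        by (simp only: B_wt of_real_of_int_eq)
      then show ?thesis
        by (simp add: sum_distrib_left sum_distrib_right mult.assoc) (rule sum.swap)
    qed
    have "prod_map a nn (expv x) $ j = (\<Prod>i\<in>UNIV. exp (of_int (nn i j) * ?l i))"
      by (simp only: prod_map_def vec_lambda_beta f exp_power_int)
    also have "\<dots> = exp (\<Sum>i\<in>UNIV. of_int (nn i j) * ?l i)" by (simp add: exp_sum)
    also have "(\<Sum>i\<in>UNIV. of_int (nn i j) * ?l i) = cst $ j +
        (\<Sum>i\<in>UNIV. of_int (nn i j) * (x $ lead i + Ln (1 + tail i x)))"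
      by (simp add: cst_def algebra_simps sum.distrib)
    also have "(\<Sum>i\<in>UNIV. of_int (nn i j) * (x $ lead i + Ln (1 + tail i x))) = Bc (R x) $ j"
      unfolding sw by (simp add: distrib_left sum.distrib wt_lead_sum Bc_def R_def pert_def)
    finally show ?thesis .
  qed
  then show ?thesis by (simp add: vec_eq_iff)
qed

lemma Bc_cvec: "Bc (cvec \<eta> \<theta>) = cvec (B *v \<eta>) (B *v \<theta>)"
  by (simp add: Bc_def vec_eq_iff complex_eq_iff matrix_vector_mult_def)

lemma Binv_B_vec: "Binv *v (B *v \<theta>) = \<theta>" and B_Binv_vec: "B *v (Binv *v \<theta>) = \<theta>"
  by (simp_all add: matrix_vector_mul_assoc Binv_left Binv_right)

lemma expv_cvec_period: "expv (cvec \<rho> (\<theta> + period m)) = expv (cvec \<rho> \<theta>)"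
proof -
  have "cvec \<rho> (\<theta> + period m) = cvec \<rho> \<theta> + cvec 0 (period m)" by (simp add: cvec_add)
  then show ?thesis by simp
qed

text \<open>In the coordinates \<open>R\<close> the equation \<open>p u = exp (\<rho> + \<i> \<theta>')\<close> becomes linear: the real
  part of \<open>R x\<close> is forced to be \<open>\<eta>\<close>, and its imaginary part \<open>\<theta>\<close> solves
  \<open>im_vec cst + B *v \<theta> = \<theta>'\<close> modulo the periods. The hypothesis \<open>deep\<close> ensures that no point
  of the fibre lies outside the range of these coordinates.\<close>

lemma fiber_bij:
  assumes M: "small M" and \<eta>: "\<eta> \<in> deepset (M + 2)" and \<rho>: "\<rho> = re_vec cst + B *v \<eta>"
    and deep: "\<And>u. u \<in> log_domain \<Omega> \<Longrightarrow> logv (prod_map a nn u) = \<rho> \<Longrightarrow> logv u \<in> deepset M"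
  shows "bij_betw (\<lambda>\<theta>. expv (S M (cvec \<eta> \<theta>))) {\<theta> \<in> fcube. \<exists>m. im_vec cst + B *v \<theta> = \<theta>' + period m}
    (fiber (expv (cvec \<rho> \<theta>')))"
proof (rule bij_betw_imageI)
  let ?E = "{\<theta> \<in> fcube. \<exists>m. im_vec cst + B *v \<theta> = \<theta>' + period m}"
  let ?f = "\<lambda>\<theta>. expv (S M (cvec \<eta> \<theta>))"
  have w: "cvec \<eta> \<theta> \<in> tube (deepset (M + 2))" for \<theta> using \<eta> by simp
  have sub: "deepset M \<subseteq> \<Omega>" using M deepset_mono deep_\<Omega> unfolding small_def by blast
  have pm: "prod_map a nn (expv x) = expv (cvec (re_vec cst + B *v re_vec (R x)) (im_vec cst + B *v im_vec (R x)))"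
    if "x \<in> tube (deepset M)" for x
  proof -
    have "Bc (R x) = cvec (B *v re_vec (R x)) (B *v im_vec (R x))"
      by (subst Bc_cvec[symmetric]) simp
    then have "cst + Bc (R x) = cvec (re_vec cst + B *v re_vec (R x)) (im_vec cst + B *v im_vec (R x))"
      by (metis cvec_add cvec_re_im)
    then show ?thesis using prod_map_expv[OF M that] by simp
  qed
  show "inj_on ?f ?E"
  proof (rule inj_onI)
    fix \<theta>1 \<theta>2 assume t: "\<theta>1 \<in> ?E" "\<theta>2 \<in> ?E" "?f \<theta>1 = ?f \<theta>2"
    obtain m where "S M (cvec \<eta> \<theta>1) = S M (cvec \<eta> \<theta>2) + cvec 0 (period m)"
      using expv_eq_imp_period[OF t(3)] by blast
    then have "R (S M (cvec \<eta> \<theta>1)) = R (S M (cvec \<eta> \<theta>2)) + cvec 0 (period m)"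
      by (simp add: R_period)
    then have "cvec \<eta> \<theta>1 = cvec \<eta> \<theta>2 + cvec 0 (period m)"
      by (simp add: S_props(2)[OF M w])
    then have eq: "\<theta>1 = \<theta>2 + period m"
      by (metis cvec_add im_cvec)
    have "\<theta>2 + period 0 = \<theta>2" by (simp add: vec_eq_iff)
    then have "m = 0"
      using period_cell_exists[of \<theta>2] t(1,2) eq by (metis (no_types, lifting) mem_Collect_eq)
    then show "\<theta>1 = \<theta>2" using eq \<open>\<theta>2 + period 0 = \<theta>2\<close> by simp
  qed
  show "?f ` ?E = fiber (expv (cvec \<rho> \<theta>'))"
  proof (intro equalityI subsetI)
    fix u assume "u \<in> ?f ` ?E"
    then obtain \<theta> m where \<theta>: "u = ?f \<theta>" "im_vec cst + B *v \<theta> = \<theta>' + period m" by auto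
    have "u \<in> log_domain \<Omega>"
      unfolding \<theta>(1) using S_props(1)[OF M w[of \<theta>]] sub by (auto simp: tube_def)
    moreover have "prod_map a nn u = expv (cvec \<rho> \<theta>')"
      unfolding \<theta>(1) pm[OF S_props(1)[OF M w[of \<theta>]]] S_props(2)[OF M w[of \<theta>]]
      by (simp add: \<theta>(2) \<rho> expv_cvec_period)
    ultimately show "u \<in> fiber (expv (cvec \<rho> \<theta>'))" by (simp add: fiber_def)
  next
    fix u assume u: "u \<in> fiber (expv (cvec \<rho> \<theta>'))"
    then have "logv (prod_map a nn u) = \<rho>" by (simp add: fiber_def)
    then have du: "logv u \<in> deepset M" using deep u by (simp add: fiber_def)
    have "\<And>k. u $ k \<noteq> 0" using u by (simp add: fiber_def log_domain_def)
    then obtain x0 where x0: "expv x0 = u" using expv_surj by blast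
    obtain m where m: "im_vec (R x0) + period m \<in> fcube" using period_cell_exists by blast
    define x where "x = x0 + cvec 0 (period m)"
    have ex: "expv x = u" using x0 by (simp add: x_def)
    then have xt: "x \<in> tube (deepset M)" using du by (metis logv_expv tube_def mem_Collect_eq)
    have Rx: "R x = R x0 + cvec 0 (period m)" by (simp add: x_def R_period)
    then have imf: "im_vec (R x) \<in> fcube" using m by (metis (no_types, lifting) cvec_add cvec_re_im im_cvec)
    have "expv (cvec (re_vec cst + B *v re_vec (R x)) (im_vec cst + B *v im_vec (R x))) = expv (cvec \<rho> \<theta>')"
      using pm[OF xt] u ex by (simp add: fiber_def)
    then obtain j where "cvec (re_vec cst + B *v re_vec (R x)) (im_vec cst + B *v im_vec (R x)) = cvec \<rho> \<theta>' + cvec 0 (period j)"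
      using expv_eq_imp_period by blast
    then have "re_vec cst + B *v re_vec (R x) = \<rho>" and im: "im_vec cst + B *v im_vec (R x) = \<theta>' + period j"
      by (metis add.right_neutral cvec_add re_cvec im_cvec)+
    then have "B *v re_vec (R x) = B *v \<eta>" using \<rho> by simp
    then have "re_vec (R x) = \<eta>" by (metis Binv_B_vec)
    then have "R x = cvec \<eta> (im_vec (R x))" by (metis cvec_re_im)
    then have "S M (cvec \<eta> (im_vec (R x))) = x" using S_R[OF M xt] by simp
    then show "u \<in> ?f ` ?E"
      using imf im ex by (intro image_eqI[of _ _ "im_vec (R x)"]) auto
  qed
qed

lemma vec_holo_S:
  assumes \<Phi>: "vec_holo \<Phi> (log_domain \<Omega>)" and M: "small M"
  shows "vec_holo (\<lambda>w. \<Phi> (expv (S M w))) (tube (deepset (M + 2)))"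
proof -
  have sub: "deepset M \<subseteq> \<Omega>" using M deepset_mono deep_\<Omega> unfolding small_def by blast
  show ?thesis
  proof (rule vec_holo_compose[where g = "S M", OF vec_holo_expv[OF \<Phi>]])
    fix w :: "(complex, 'k) vec" assume w: "w \<in> tube (deepset (M + 2))"
    show "S M w \<in> tube \<Omega>" using S_props(1)[OF M w] sub by (auto simp: tube_def)
    show "\<exists>D. (S M has_derivative D) (at w) \<and> (\<forall>v. D (\<i> *s v) = \<i> *s D v)"
      using S_has_derivative[OF M w] by metis
  qed
qed

lemma per_on_S:
  assumes M: "small M"
  shows "per_on (\<lambda>w. \<Phi> (expv (S M w))) (tube (deepset (M + 2)))"
  unfolding per_on_def
proof (intro allI ballI)
  fix m and w :: "(complex, 'k) vec" assume "w \<in> tube (deepset (M + 2))"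
  then show "\<Phi> (expv (S M (w + cvec 0 (period m)))) = \<Phi> (expv (S M w))"
    by (simp add: S_period[OF M])
qed

text \<open>Summing over the fibre and integrating over the torus unfolds to an integral over the
  image of one cell under the affine map \<open>\<theta> \<mapsto> im_vec cst + B *v \<theta>\<close>; the change of variables
  contributes the factor \<open>\<bar>det B\<bar>\<close>, the number of sheets of \<open>p\<close>.\<close>

lemma fiber_integral:
  assumes M: "small M" and \<eta>: "\<eta> \<in> deepset (M + 2)" and \<rho>: "\<rho> = re_vec cst + B *v \<eta>"
    and deep: "\<And>u. u \<in> log_domain \<Omega> \<Longrightarrow> logv (prod_map a nn u) = \<rho> \<Longrightarrow> logv u \<in> deepset M"
    and \<Phi>: "vec_holo \<Phi> (log_domain \<Omega>)"
    and cont: "continuous_on UNIV (\<lambda>\<theta>'. \<Sum>u\<in>fiber (expv (cvec \<rho> \<theta>')). \<Phi> u)"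
  shows "integral tcube (\<lambda>\<theta>'. \<Sum>u\<in>fiber (expv (cvec \<rho> \<theta>')). \<Phi> u) =
    \<bar>det B\<bar> *\<^sub>R integral tcube (\<lambda>\<theta>. \<Phi> (expv (S M (cvec \<eta> \<theta>))))"
proof -
  define K where "K \<theta> = \<Phi> (expv (S M (cvec \<eta> \<theta>)))" for \<theta>
  define F where "F \<theta>' = (\<Sum>u\<in>fiber (expv (cvec \<rho> \<theta>')). \<Phi> u)" for \<theta>'
  define t0 where "t0 = im_vec cst"
  have cK: "continuous_on UNIV K"
    unfolding K_def by (rule slice_continuous[OF vec_holo_continuous[OF vec_holo_S[OF \<Phi> M]] \<eta>])
  \<comment> \<open>the integrand, cut off to the cell and transported by the affine map\<close>
  define g0 where "g0 \<theta> = indicator fcube (Binv *v \<theta>) *\<^sub>R K (Binv *v \<theta>)" for \<theta>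
  define g where "g \<theta> = g0 (\<theta> - t0)" for \<theta>
  note li = linear_image_integral[of Binv B K, OF Binv_B_vec B_Binv_vec cK, folded g0_def]
  have d: "lborel = distr lborel borel ((+) t0)"
    by (rule lborel_distr_plus[symmetric])
  have mg0: "g0 \<in> borel_measurable borel"
    using borel_measurable_integrable[OF li(1)] by simp
  have mg: "g \<in> borel_measurable borel"
    unfolding g_def by (rule measurable_compose[OF _ mg0]) simp
  have ig: "integrable lborel g"
    by (subst d, subst integrable_distr_eq) (use li(1) mg in \<open>auto simp: g_def\<close>)
  have eg: "(LINT \<theta>|lborel. g \<theta>) = (LINT \<theta>|lborel. g0 \<theta>)"
    by (subst d, subst integral_distr) (use mg in \<open>auto simp: g_def\<close>)
  let ?L = "\<lambda>\<theta>. t0 + B *v \<theta>" and ?L' = "\<lambda>\<theta>. Binv *v (\<theta> - t0)"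
  let ?M = "{m. \<exists>\<theta>\<in>tcube. \<theta> + period m \<in> ?L ` tcube}"
  have "compact (?L ` tcube)"
    by (intro compact_continuous_image continuous_intros linear_continuous_on
        linear_conv_bounded_linear[THEN iffD1] matrix_vector_mul_linear) (simp add: tcube_def)
  then have fin: "finite ?M"
    by (intro bounded_period_finite compact_imp_bounded)
  have inM: "m \<in> ?M" if "\<theta>' \<in> fcube" "?L' (\<theta>' + period m) \<in> fcube" for \<theta>' m
  proof -
    have "\<theta>' + period m = ?L (?L' (\<theta>' + period m))" by (simp add: B_Binv_vec)
    then have "\<theta>' + period m \<in> ?L ` tcube" using that(2) fcube_subset by blast
    then show ?thesis using that(1) fcube_subset by blast
  qed
  have zero: "g (\<theta>' + period m) = 0" if "\<theta>' \<in> fcube" "m \<notin> ?M" for \<theta>' m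
    using inM[OF that(1), of m] that(2) by (auto simp: g_def g0_def indicator_def)
  have sum: "(\<Sum>m\<in>?M. g (\<theta>' + period m)) = F \<theta>'" if t: "\<theta>' \<in> fcube" for \<theta>'
  proof -
    let ?E = "{\<theta> \<in> fcube. \<exists>m. t0 + B *v \<theta> = \<theta>' + period m}"
    let ?M' = "{m \<in> ?M. ?L' (\<theta>' + period m) \<in> fcube}"
    have "F \<theta>' = (\<Sum>\<theta>\<in>?E. K \<theta>)"
      unfolding F_def K_def t0_def
      by (rule sum.reindex_bij_betw[OF fiber_bij[OF M \<eta> \<rho> deep], symmetric])
    also have "\<dots> = (\<Sum>m\<in>?M'. K (?L' (\<theta>' + period m)))"
    proof (rule sum.reindex_bij_betw[symmetric], rule bij_betw_imageI)
      show "inj_on (\<lambda>m. ?L' (\<theta>' + period m)) ?M'"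
      proof (rule inj_onI)
        fix m m' assume "?L' (\<theta>' + period m) = ?L' (\<theta>' + period m')"
        then have "B *v ?L' (\<theta>' + period m) = B *v ?L' (\<theta>' + period m')" by simp
        then have "period m = period m'" by (simp add: B_Binv_vec)
        then show "m = m'" by (rule period_inj)
      qed
      show "(\<lambda>m. ?L' (\<theta>' + period m)) ` ?M' = ?E"
      proof (intro equalityI subsetI)
        fix \<theta> assume "\<theta> \<in> (\<lambda>m. ?L' (\<theta>' + period m)) ` ?M'"
        then show "\<theta> \<in> ?E" by (auto simp: B_Binv_vec)
      next
        fix \<theta> assume "\<theta> \<in> ?E"
        then obtain m where m: "\<theta> \<in> fcube" "t0 + B *v \<theta> = \<theta>' + period m" by auto
        have "?L' (\<theta>' + period m) = \<theta>" by (simp add: m(2)[symmetric] Binv_B_vec)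
        then show "\<theta> \<in> (\<lambda>m. ?L' (\<theta>' + period m)) ` ?M'"
          using inM[OF t, of m] m(1) by (intro image_eqI[of _ _ m]) auto
      qed
    qed
    also have "\<dots> = (\<Sum>m\<in>?M. if ?L' (\<theta>' + period m) \<in> fcube then K (?L' (\<theta>' + period m)) else 0)"
      by (rule sum.inter_filter[OF fin])
    also have "\<dots> = (\<Sum>m\<in>?M. g (\<theta>' + period m))"
      by (rule sum.cong) (auto simp: g_def g0_def)
    finally show ?thesis by simp
  qed
  have "integral tcube F = (LINT \<theta>|lborel. indicator fcube \<theta> *\<^sub>R F \<theta>)"
    using fcube_integral(1)[of F] cont continuous_on_subset unfolding F_def by (metis subset_UNIV)
  also have "\<dots> = (LINT \<theta>|lborel. indicator fcube \<theta> *\<^sub>R (\<Sum>m\<in>?M. g (\<theta> + period m)))"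
  proof (rule Bochner_Integration.integral_cong[OF refl])
    fix \<theta>
    show "indicator fcube \<theta> *\<^sub>R F \<theta> = indicator fcube \<theta> *\<^sub>R (\<Sum>m\<in>?M. g (\<theta> + period m))"
      using sum[of \<theta>] by (cases "\<theta> \<in> fcube") simp_all
  qed
  also have "\<dots> = (LINT \<theta>|lborel. g \<theta>)"
    by (rule unfolding_integral[OF ig fin zero])
  also have "\<dots> = \<bar>det B\<bar> *\<^sub>R integral tcube K" by (simp add: eg li(2))
  finally show ?thesis by (simp add: F_def[abs_def] K_def[abs_def])
qed

text \<open>The straight torus and the torus on which \<open>R\<close> has constant real part are homologous.
  To see this without homology, \<open>\<Phi>\<close> is expanded in a Fourier series in the variable \<open>R x\<close>,
  and the series is integrated against \<open>det N\<close> over the straight torus: the nonconstant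
  terms integrate to zero (\<open>integral_exp_R_det_N\<close>), and the constant term gives the mean
  over the other torus (\<open>integral_det_N\<close>).\<close>

lemma deform_torus_integral:
  assumes M: "small M" and \<eta>: "\<eta> \<in> deepset (M + 4)" and \<Phi>: "vec_holo \<Phi> (log_domain \<Omega>)"
  shows "integral tcube (\<lambda>\<theta>. \<Phi> (expv (cvec \<eta> \<theta>)) * det (N (cvec \<eta> \<theta>))) =
    integral tcube (\<lambda>\<theta>. \<Phi> (expv (S M (cvec \<eta> \<theta>))))"
proof -
  let ?D = "deepset (M + 2) :: (real, 'k) vec set"
  define K where "K w = \<Phi> (expv (S M w))" for w
  have holo: "vec_holo K (tube ?D)" and per: "per_on K (tube ?D)"
    unfolding K_def using vec_holo_S[OF \<Phi> M] per_on_S[OF M] by auto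
  have \<eta>2: "\<eta> \<in> ?D" using \<eta> deepset_mono[of "M + 2" "M + 4"] by auto
  have \<eta>0: "\<eta> \<in> deepset M" using \<eta> deepset_mono[of M "M + 4"] by auto
  have box: "\<rho> \<in> ?D" if "\<And>k. \<bar>\<rho> $ k - \<eta> $ k\<bar> \<le> 2 * (1/2)" for \<rho>
    using deepset_perturb[OF \<eta>, of \<rho> 1] that by (simp add: add.commute)
  let ?x = "\<lambda>\<theta>. cvec \<eta> \<theta>"
  let ?A = "fcoeff K \<eta>"
  let ?t = "\<lambda>m \<theta>. ?A m * (exp (ndot m (R (?x \<theta>))) * det (N (?x \<theta>)))"
  have xt: "?x \<theta> \<in> tube (deepset M)" for \<theta> using \<eta>0 by simp
  \<comment> \<open>the straight torus stays within distance 1/2 of the slice on which the coefficients are computed; the margin 4 leaves room for the box required by \<open>fcoeff_decay\<close>\<close>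
  have near: "\<bar>re_vec (R (?x \<theta>)) $ k - \<eta> $ k\<bar> \<le> 1/2" for \<theta> k
  proof -
    have "\<bar>re_vec (R (?x \<theta>)) $ k - \<eta> $ k\<bar> = \<bar>Re (pert (?x \<theta>) $ k)\<bar>" by (simp add: R_def)
    also have "\<dots> \<le> norm (pert (?x \<theta>))" using abs_Re_le_cmod norm_nth_le_vec order_trans by blast
    also have "\<dots> \<le> 1/2" by (rule pert_bound[OF M xt])
    finally show ?thesis .
  qed
  have half_nonneg: "0 \<le> (1/2 :: real)" by simp
  obtain C where C: "\<And>m \<rho>. (\<And>k. \<bar>\<rho> $ k - \<eta> $ k\<bar> \<le> 1/2) \<Longrightarrow>
      norm (?A m) * exp (rdot m \<rho>) \<le> C * exp (- (1/2) * l1 m)"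
    using fcoeff_decay[where \<delta> = "1/2", OF deepset_open deepset_convex holo per \<eta>2 half_nonneg box] by blast
  have sub: "deepset M \<subseteq> \<Omega>" using M deepset_mono deep_\<Omega> unfolding small_def by blast
  have cN: "continuous_on UNIV (\<lambda>\<theta>. det (N (?x \<theta>)))"
    using \<eta>0 sub by (intro slice_continuous[OF vec_holo_continuous[OF vec_holo_det[OF vec_holo_N]]]) auto
  have cR: "continuous_on UNIV (\<lambda>\<theta>. R (?x \<theta>) $ j)" for j
  proof -
    have "continuous_on (tube (deepset M)) (\<lambda>x. R x $ j)"
      by (intro continuous_at_imp_continuous_on ballI has_derivative_continuous[OF R_component_derivative[OF M]])
    then show ?thesis by (rule slice_continuous[OF _ \<eta>0])
  qed
  have ct: "continuous_on UNIV (?t m)" for m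
    unfolding ndot_def by (intro continuous_intros cR cN)
  have "compact (tcube :: (real, 'k) vec set)" by (simp add: tcube_def)
  then have "bounded ((\<lambda>\<theta>. det (N (?x \<theta>))) ` tcube)"
    by (intro compact_imp_bounded compact_continuous_image continuous_on_subset[OF cN]) auto
  then obtain Q where Q: "Q > 0" "\<And>\<theta>. \<theta> \<in> tcube \<Longrightarrow> norm (det (N (?x \<theta>))) \<le> Q"
    unfolding bounded_pos by blast
  have bt: "norm (?t m \<theta>) \<le> C * Q * exp (- (1/2) * l1 m)" if "\<theta> \<in> tcube" for m \<theta>
  proof -
    have "norm (?t m \<theta>) = norm (?A m) * exp (rdot m (re_vec (R (?x \<theta>)))) * norm (det (N (?x \<theta>)))"
      by (simp add: norm_mult norm_exp_eq_Re ndot_def rdot_def)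
    also have "\<dots> \<le> C * exp (- (1/2) * l1 m) * Q"
    proof -
      have c: "norm (?A m) * exp (rdot m (re_vec (R (?x \<theta>)))) \<le> C * exp (- (1/2) * l1 m)"
        by (rule C) (rule near)
      moreover have "0 \<le> norm (?A m) * exp (rdot m (re_vec (R (?x \<theta>))))" by simp
      ultimately have "0 \<le> C * exp (- (1/2) * l1 m)" by linarith
      then show ?thesis by (rule mult_mono[OF c Q(2)[OF that]]) simp
    qed
    finally show ?thesis by (simp add: mult_ac)
  qed
  have hs: "((\<lambda>m. ?t m \<theta>) has_sum (\<Phi> (expv (?x \<theta>)) * det (N (?x \<theta>)))) UNIV" for \<theta>
  proof -
    have "\<bar>re_vec (R (?x \<theta>)) $ k - \<eta> $ k\<bar> \<le> 2 * (1/2)" for k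
      using near[of \<theta> k] by linarith
    then have "re_vec (R (?x \<theta>)) \<in> ?D" by (rule box)
    from fourier_expansion(2)[OF deepset_open deepset_convex holo per \<eta>2 this]
    have "((\<lambda>m. ?A m * exp (ndot m (R (?x \<theta>)))) has_sum \<Phi> (expv (?x \<theta>))) UNIV"
      by (simp add: K_def S_R[OF M xt])
    from has_sum_cmult_left[OF this, of "det (N (?x \<theta>))"] show ?thesis by (simp add: mult.assoc)
  qed
  have sB: "(\<lambda>m :: (int, 'k) vec. C * Q * exp (- (1/2) * l1 m)) summable_on UNIV"
    by (intro summable_on_cmult_right summable_exp_l1) simp
  have unif: "uniform_limit tcube (\<lambda>X \<theta>. \<Sum>m\<in>X. ?t m \<theta>) (\<lambda>\<theta>. \<Phi> (expv (?x \<theta>)) * det (N (?x \<theta>)))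
      (finite_subsets_at_top UNIV)"
    by (rule Weierstrass_m_test_general'[OF _ hs sB]) (use bt in auto)
  have cc: "continuous_on tcube (\<lambda>\<theta>. \<Sum>m\<in>X. ?t m \<theta>)" for X
    by (intro continuous_on_sum continuous_on_subset[OF ct]) auto
  obtain I J where IJ: "\<And>X. ((\<lambda>\<theta>. \<Sum>m\<in>X. ?t m \<theta>) has_integral I X) tcube"
      "((\<lambda>\<theta>. \<Phi> (expv (?x \<theta>)) * det (N (?x \<theta>))) has_integral J) tcube" "(I \<longlongrightarrow> J) (finite_subsets_at_top UNIV)"
    using uniform_limit_integral_cbox[OF unif[unfolded tcube_def] cc[unfolded tcube_def] finite_subsets_at_top_neq_bot]
    unfolding tcube_def by blast
  have tint: "integral tcube (?t m) = (if m = 0 then ?A 0 * of_real ((2 * pi) ^ CARD('k)) else 0)" for m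
    using integral_exp_R_det_N[OF M \<eta>0, of m] integral_det_N[OF M \<eta>0] by (auto simp: ndot_def)
  have "I X = ?A 0 * of_real ((2 * pi) ^ CARD('k))" if "finite X" "0 \<in> X" for X
  proof -
    have "I X = integral tcube (\<lambda>\<theta>. \<Sum>m\<in>X. ?t m \<theta>)" by (rule integral_unique[OF IJ(1), symmetric])
    also have "\<dots> = (\<Sum>m\<in>X. integral tcube (?t m))"
      by (rule Henstock_Kurzweil_Integration.integral_sum[OF that(1)]) (rule continuous_tcube_integrable[OF ct])
    finally show ?thesis using that by (simp only: tint) (simp add: sum.delta)
  qed
  then have "\<forall>\<^sub>F X in finite_subsets_at_top UNIV. I X = ?A 0 * of_real ((2 * pi) ^ CARD('k))"
    unfolding eventually_finite_subsets_at_top by (intro exI[of _ "{0}"]) auto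
  then have "J = ?A 0 * of_real ((2 * pi) ^ CARD('k))"
    by (rule tendsto_unique[OF finite_subsets_at_top_neq_bot IJ(3) tendsto_eventually])
  also have "\<dots> = integral tcube (\<lambda>\<theta>. K (?x \<theta>))"
    by (simp add: fcoeff_def ndot_def)
  finally show ?thesis
    using integral_unique[OF IJ(2)] by (simp add: K_def)
qed

text \<open>The absolute value of \<open>det B\<close> from the number of sheets meets \<open>det B\<close> from the
  Jacobian; only its sign remains.\<close>

theorem deep_torus_identity:
  assumes M: "small M" and \<eta>: "\<eta> \<in> deepset (M + 4)" and \<rho>: "\<rho> = re_vec cst + B *v \<eta>"
    and deep: "\<And>u. u \<in> log_domain \<Omega> \<Longrightarrow> logv (prod_map a nn u) = \<rho> \<Longrightarrow> logv u \<in> deepset M"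
    and \<Phi>: "vec_holo \<Phi> (log_domain \<Omega>)"
    and cont: "continuous_on UNIV (\<lambda>\<theta>'. \<Sum>u\<in>fiber (expv (cvec \<rho> \<theta>')). \<Phi> u)"
  shows "integral tcube (\<lambda>\<theta>'. \<Sum>u\<in>fiber (expv (cvec \<rho> \<theta>')). \<Phi> u) =
    of_real (sgn (det B)) *
      integral tcube (\<lambda>\<theta>. \<Phi> (expv (cvec \<eta> \<theta>)) * det (jac a nn (expv (cvec \<eta> \<theta>))))"
proof -
  have \<eta>2: "\<eta> \<in> deepset (M + 2)" using \<eta> deepset_mono[of "M + 2" "M + 4"] by auto
  have "integral tcube (\<lambda>\<theta>. \<Phi> (expv (cvec \<eta> \<theta>)) * det (jac a nn (expv (cvec \<eta> \<theta>)))) =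
      integral tcube (\<lambda>\<theta>. of_real (det B) * (\<Phi> (expv (cvec \<eta> \<theta>)) * det (N (cvec \<eta> \<theta>))))"
    by (simp add: det_jac_N mult_ac)
  also have "\<dots> = of_real (det B) * integral tcube (\<lambda>\<theta>. \<Phi> (expv (S M (cvec \<eta> \<theta>))))"
    by (simp only: integral_mult_right deform_torus_integral[OF M \<eta> \<Phi>])
  finally have eq: "integral tcube (\<lambda>\<theta>. \<Phi> (expv (cvec \<eta> \<theta>)) * det (jac a nn (expv (cvec \<eta> \<theta>)))) =
      of_real (det B) * integral tcube (\<lambda>\<theta>. \<Phi> (expv (S M (cvec \<eta> \<theta>))))" .
  have "\<bar>det B\<bar> = sgn (det B) * det B" by (simp only: abs_sgn mult.commute)
  then have "of_real \<bar>det B\<bar> = (of_real (sgn (det B)) * of_real (det B) :: complex)"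
    by (simp only: of_real_mult)
  then show ?thesis
    using fiber_integral[OF M \<eta>2 \<rho> deep \<Phi> cont] unfolding eq
    by (simp only: scaleR_conv_of_real mult.assoc)
qed

end

section \<open>Holomorphy and expansion of the trace\<close>

lemma form_linear: "bounded_linear (form a i :: complex ^ 'k \<Rightarrow> complex)"
  by (rule linear_conv_bounded_linear[THEN iffD1], rule linearI)
     (simp_all add: form_def sum.distrib algebra_simps scaleR_sum_right)

lemma form_scale: "form a i (c *s v) = c * form a i v"
  by (simp add: form_def sum_distrib_left algebra_simps)

lemma vec_holo_form: "vec_holo (form a i) S"
  unfolding vec_holo_def
  by (intro ballI exI conjI allI, rule bounded_linear_imp_has_derivative[OF form_linear], rule form_scale)

lemma vec_holo_powi:
  assumes "vec_holo f S" "\<And>x. x \<in> S \<Longrightarrow> f x \<noteq> 0"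
  shows "vec_holo (\<lambda>x. f x powi n) S"
  unfolding vec_holo_def
proof
  fix x assume x: "x \<in> S"
  then obtain D where D: "(f has_derivative D) (at x)" "\<And>v. D (\<i> *s v) = \<i> * D v"
    using assms(1) unfolding vec_holo_def by meson
  have "((\<lambda>z. z powi n) has_derivative (\<lambda>h. (of_int n * f x powi (n - 1)) * h)) (at (f x))"
    using DERIV_power_int[OF DERIV_ident, where x = "f x" and s = UNIV and n = n] assms(2)[OF x] by (simp add: has_field_derivative_def)
  with D(1) have "((\<lambda>x. f x powi n) has_derivative (\<lambda>v. (of_int n * f x powi (n - 1)) * D v)) (at x)"
    by (rule has_derivative_compose)
  then show "\<exists>D. ((\<lambda>x. f x powi n) has_derivative D) (at x) \<and> (\<forall>v. D (\<i> *s v) = \<i> * D v)"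
    by (intro exI conjI) (auto simp: D(2))
qed

lemma prod_map_has_derivative:
  assumes nz: "\<And>i. form a i u \<noteq> 0"
  shows "((\<lambda>u. prod_map a nn u $ j) has_derivative
    (\<lambda>v. prod_map a nn u $ j * (\<Sum>i\<in>UNIV. of_int (nn i j) * form a i v / form a i u))) (at u)"
proof -
  have pow: "((\<lambda>u. form a i u powi nn i j) has_derivative
      (\<lambda>v. (of_int (nn i j) * form a i u powi (nn i j - 1)) * form a i v)) (at u)" for i
  proof -
    have "((\<lambda>z. z powi nn i j) has_derivative (\<lambda>h. (of_int (nn i j) * form a i u powi (nn i j - 1)) * h)) (at (form a i u))"
      using DERIV_power_int[OF DERIV_ident, where x = "form a i u" and s = UNIV and n = "nn i j"] nz by (simp add: has_field_derivative_def)
    with bounded_linear_imp_has_derivative[OF form_linear[of a i]] show ?thesis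
      by (rule has_derivative_compose)
  qed
  have "((\<lambda>u. \<Prod>i\<in>UNIV. form a i u powi nn i j) has_derivative
      (\<lambda>v. \<Sum>i\<in>UNIV. ((of_int (nn i j) * form a i u powi (nn i j - 1)) * form a i v) *
         (\<Prod>l\<in>UNIV - {i}. form a l u powi nn l j))) (at u)"
    by (rule has_derivative_prod) (rule pow)
  moreover have "(\<Sum>i\<in>UNIV. ((of_int (nn i j) * form a i u powi (nn i j - 1)) * form a i v) *
         (\<Prod>l\<in>UNIV - {i}. form a l u powi nn l j)) =
      prod_map a nn u $ j * (\<Sum>i\<in>UNIV. of_int (nn i j) * form a i v / form a i u)" for v
    unfolding sum_distrib_left
  proof (rule sum.cong[OF refl])
    fix i
    have "prod_map a nn u $ j = form a i u powi nn i j * (\<Prod>l\<in>UNIV - {i}. form a l u powi nn l j)"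
      unfolding prod_map_def vec_lambda_beta by (rule prod.remove) auto
    moreover have "form a i u powi nn i j = form a i u powi (nn i j - 1) * form a i u"
      using nz[of i] by (simp add: power_int_diff)
    ultimately show "((of_int (nn i j) * form a i u powi (nn i j - 1)) * form a i v) *
         (\<Prod>l\<in>UNIV - {i}. form a l u powi nn l j) =
         prod_map a nn u $ j * (of_int (nn i j) * form a i v / form a i u)"
      using nz[of i] by simp
  qed
  ultimately show ?thesis by (simp add: prod_map_def)
qed

lemma finite_separation:
  fixes Y :: "'b::metric_space set"
  assumes "finite Y"
  obtains e where "e > 0" "\<And>x y. x \<in> Y \<Longrightarrow> y \<in> Y \<Longrightarrow> x \<noteq> y \<Longrightarrow> ball x e \<inter> ball y e = {}"
proof -
  obtain d where d: "d > 0" "\<And>x y. x \<in> Y \<Longrightarrow> y \<in> Y \<Longrightarrow> x \<noteq> y \<Longrightarrow> d \<le> dist x y"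
  proof (cases "\<exists>x\<in>Y. \<exists>y\<in>Y. x \<noteq> y")
    case True
    let ?S = "(\<lambda>(x, y). dist x y) ` {(x, y) \<in> Y \<times> Y. x \<noteq> y}"
    have f: "finite ?S" using assms by (auto intro: finite_subset[of _ "Y \<times> Y"])
    have ne: "?S \<noteq> {}" using True by auto
    have "Min ?S \<in> ?S" using f ne by (rule Min_in)
    then have "Min ?S > 0" by auto
    moreover have "Min ?S \<le> dist x y" if "x \<in> Y" "y \<in> Y" "x \<noteq> y" for x y
      by (rule Min_le[OF f]) (use that in auto)
    ultimately show ?thesis by (rule that)
  qed (use that[of 1] in auto)
  have "ball x (d/2) \<inter> ball y (d/2) = {}" if "x \<in> Y" "y \<in> Y" "x \<noteq> y" for x y
  proof (rule ccontr)
    assume "ball x (d/2) \<inter> ball y (d/2) \<noteq> {}"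
    then obtain z where "dist x z < d/2" "dist y z < d/2" by auto
    then have "dist x y < d" using dist_triangle_less_add[of x z "d/2" y "d/2"] by (simp add: dist_commute)
    then show False using d(2)[OF that] by simp
  qed
  then show thesis using d(1) by (intro that[of "d/2"]) auto
qed

lemma open_log_domain: "open \<Omega> \<Longrightarrow> open (log_domain \<Omega> :: (complex ^ 'k) set)"
proof -
  assume \<Omega>: "open \<Omega>"
  let ?Z = "{u :: complex ^ 'k. \<forall>k. u $ k \<noteq> 0}"
  have oZ: "open ?Z"
  proof -
    have "?Z = (\<Inter>k. {u. u $ k \<noteq> 0})" by auto
    moreover have "open {u :: complex ^ 'k. u $ k \<noteq> 0}" for k
      by (intro open_Collect_neq continuous_intros)
    ultimately show ?thesis by (simp add: open_INT)
  qed
  have "continuous_on ?Z logv"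
    unfolding logv_def by (auto intro!: continuous_intros)
  from continuous_open_preimage[OF this oZ \<Omega>] show ?thesis
    by (simp add: log_domain_def vimage_def Int_def conj_commute)
qed

text \<open>Over the real parts in \<open>D\<close> the map \<open>p\<close> is proper and a local biholomorphism, hence a
  finite covering.\<close>

locale proper_chart = nonsingular_chart a nn lead \<Omega> M0
  for a :: "'n::finite \<Rightarrow> 'k::{finite,wellorder} \<Rightarrow> real" and nn lead \<Omega> M0 +
  fixes D :: "(real, 'k) vec set"
  assumes jac_nz: "u \<in> log_domain \<Omega> \<Longrightarrow> det (jac a nn u) \<noteq> 0"
    and open_D: "open D" and convex_D: "convex D"
    and proper: "compact K \<Longrightarrow> K \<subseteq> D \<Longrightarrow> compact {u \<in> log_domain \<Omega>. logv (prod_map a nn u) \<in> K}"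
begin

abbreviation "W \<equiv> log_domain \<Omega>"

definition dprod :: "(complex, 'k) vec \<Rightarrow> (complex, 'k) vec \<Rightarrow> (complex, 'k) vec" where
  "dprod u v = (\<chi> j. prod_map a nn u $ j * (\<Sum>i\<in>UNIV. of_int (nn i j) * form a i v / form a i u))"

lemma open_W: "open W"
  by (rule open_log_domain[OF open_\<Omega>])

lemma dprod_derivative: "u \<in> W \<Longrightarrow> (prod_map a nn has_derivative dprod u) (at u)"
  by (rule has_derivative_vecI) (simp add: dprod_def prod_map_has_derivative form_nz)

lemma dprod_linear: "u \<in> W \<Longrightarrow> bounded_linear (dprod u)"
  using dprod_derivative has_derivative_bounded_linear by blast

lemma dprod_scale: "dprod u (c *s v) = c *s dprod u v"
  by (simp add: dprod_def form_scale vec_eq_iff sum_distrib_left algebra_simps)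

lemma prod_map_nz: "u \<in> W \<Longrightarrow> prod_map a nn u $ j \<noteq> 0"
  by (simp add: prod_map_def form_nz)

lemma dprod_inj:
  assumes u: "u \<in> W" and z: "dprod u v = 0"
  shows "v = 0"
proof -
  have uk: "u $ k \<noteq> 0" for k using u by (simp add: log_domain_def)
  define y where "y = (\<chi> k. v $ k / u $ k)"
  have "(\<Sum>k\<in>UNIV. jac a nn u $ j $ k * y $ k) = 0" for j
  proof -
    have "(\<Sum>k\<in>UNIV. jac a nn u $ j $ k * y $ k) = (\<Sum>k\<in>UNIV. \<Sum>i\<in>UNIV. of_int (nn i j) * (of_real (a i k) * v $ k / form a i u))"
    proof (rule sum.cong[OF refl])
      fix k
      show "jac a nn u $ j $ k * y $ k = (\<Sum>i\<in>UNIV. of_int (nn i j) * (of_real (a i k) * v $ k / form a i u))"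
        unfolding jac_def y_def vec_lambda_beta sum_distrib_right
        by (rule sum.cong) (use uk[of k] in auto)
    qed
    also have "\<dots> = (\<Sum>i\<in>UNIV. of_int (nn i j) * form a i v / form a i u)"
      by (subst sum.swap) (simp add: form_def sum_distrib_left sum_divide_distrib)
    also have "\<dots> = 0"
    proof -
      have "dprod u v $ j = 0" using z by simp
      then show ?thesis using prod_map_nz[OF u, of j] by (simp add: dprod_def)
    qed
    finally show ?thesis .
  qed
  then have "jac a nn u *v y = 0" by (simp add: matrix_vector_mult_def vec_eq_iff)
  moreover obtain C where "C ** jac a nn u = mat 1"
    using jac_nz[OF u] invertible_det_nz[of "jac a nn u"] by (auto simp: invertible_def)
  ultimately have "y = 0" by (metis matrix_vector_mul_assoc matrix_vector_mul_lid matrix_vector_mult_0_right)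
  then have "v $ k / u $ k = 0" for k by (simp add: y_def vec_eq_iff)
  then show ?thesis using uk by (simp add: vec_eq_iff)
qed

lemma cont_prod_map: "continuous_on W (prod_map a nn)"
  by (intro continuous_at_imp_continuous_on ballI has_derivative_continuous[OF dprod_derivative])

text \<open>The inverse function theorem together with the complex linearity of the derivative.\<close>

lemma local_inverse:
  assumes u: "u0 \<in> W"
  obtains U V g where "open U" "U \<subseteq> W" "u0 \<in> U" "open V" "prod_map a nn u0 \<in> V"
    "homeomorphism U V (prod_map a nn) g"
    "\<And>y. y \<in> V \<Longrightarrow> \<exists>g'. (g has_derivative g') (at y) \<and> (\<forall>v. g' (\<i> *s v) = \<i> *s g' v)"
proof -
  define f' where "f' u = Blinfun (dprod u)" for u
  have f': "blinfun_apply (f' u) = dprod u" if "u \<in> W" for u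
    using dprod_linear[OF that] by (simp add: f'_def bounded_linear_Blinfun_apply)
  have der: "(prod_map a nn has_derivative blinfun_apply (f' u)) (at u)" if "u \<in> W" for u
    using dprod_derivative[OF that] f'[OF that] by simp
  have cont: "continuous_on W f'"
  proof (rule continuous_on_blinfun_componentwise)
    fix b :: "(complex, 'k) vec" assume "b \<in> Basis"
    have "continuous_on W (\<lambda>u. dprod u b)"
      unfolding dprod_def
      by (intro continuous_intros continuous_on_component[OF cont_prod_map] bounded_linear.continuous_on[OF form_linear])
         (use form_nz in auto)
    then show "continuous_on W (\<lambda>u. blinfun_apply (f' u) b)"
      by (rule continuous_on_eq) (simp add: f')
  qed
  have lin: "linear (dprod u0)" using dprod_linear[OF u] by (rule bounded_linear.linear)
  have "inj (dprod u0)"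
    unfolding linear_injective_0[OF lin] using dprod_inj[OF u] by blast
  then obtain h where h: "linear h" "\<And>v. h (dprod u0 v) = v"
    using linear_injective_isomorphism[OF lin] by metis
  have hb: "bounded_linear h" using h(1) by (simp add: linear_conv_bounded_linear)
  have id: "Blinfun h o\<^sub>L f' u0 = id_blinfun"
    by (rule blinfun_eqI) (simp add: bounded_linear_Blinfun_apply[OF hb] f'[OF u] h(2))
  obtain U V g g' where *: "open U" "U \<subseteq> W" "u0 \<in> U" "open V" "prod_map a nn u0 \<in> V"
    "homeomorphism U V (prod_map a nn) g" "\<And>y. y \<in> V \<Longrightarrow> (g has_derivative (g' y)) (at y)"
    "\<And>y. y \<in> V \<Longrightarrow> g' y = inv (blinfun_apply (f' (g y)))"
    "\<And>y. y \<in> V \<Longrightarrow> bij (blinfun_apply (f' (g y)))"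
    using inverse_function_theorem[OF open_W der cont u id] by metis
  show thesis
  proof (rule that[OF *(1-6)])
    fix y assume y: "y \<in> V"
    have gy: "g y \<in> W" using *(2,6) y by (auto simp: homeomorphism_def)
    have b: "bij (dprod (g y))" "g' y = inv (dprod (g y))"
      using *(8,9)[OF y] by (simp_all add: f'[OF gy])
    have "g' y (\<i> *s v) = \<i> *s g' y v" for v
    proof -
      have "dprod (g y) (\<i> *s g' y v) = \<i> *s v"
        using b by (simp add: dprod_scale bij_is_surj surj_f_inv_f)
      then show ?thesis using b by (metis bij_inv_eq_iff)
    qed
    then show "\<exists>g'. (g has_derivative g') (at y) \<and> (\<forall>v. g' (\<i> *s v) = \<i> *s g' v)"
      using *(7)[OF y] by blast
  qed
qed

lemma fiber_compact:
  assumes "logv y \<in> D"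
  shows "compact (fiber y)"
proof -
  let ?C = "{u \<in> W. logv (prod_map a nn u) \<in> {logv y}}"
  have C: "compact ?C" by (rule proper) (use assms in auto)
  have "continuous_on ?C (prod_map a nn)"
    using cont_prod_map by (rule continuous_on_subset) auto
  then have "closedin (top_of_set ?C) (?C \<inter> prod_map a nn -` {y})"
    by (rule continuous_closedin_preimage) simp
  then have "compact (?C \<inter> prod_map a nn -` {y})" using C closedin_compact by blast
  moreover have "?C \<inter> prod_map a nn -` {y} = fiber y" by (auto simp: fiber_def)
  ultimately show ?thesis by simp
qed

text \<open>The fibre is compact by properness and discrete because \<open>p\<close> is locally injective.\<close>

lemma fiber_finite:
  assumes "logv y \<in> D"
  shows "finite (fiber y)"
proof -
  have "\<exists>U. open U \<and> u \<in> U \<and> U \<inter> fiber y \<subseteq> {u}" if u: "u \<in> fiber y" for u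
  proof -
    have "u \<in> W" using u by (simp add: fiber_def)
    then obtain U V g where *: "open U" "u \<in> U" "homeomorphism U V (prod_map a nn) g"
      using local_inverse by metis
    have "v = u" if "v \<in> U \<inter> fiber y" for v
    proof -
      have "v \<in> U" "prod_map a nn v = prod_map a nn u" using that u by (simp_all add: fiber_def)
      then show ?thesis using homeomorphism_apply1[OF *(3)] *(2) by metis
    qed
    then show ?thesis using * by blast
  qed
  then obtain U where U: "\<And>u. u \<in> fiber y \<Longrightarrow> open (U u) \<and> u \<in> U u \<and> U u \<inter> fiber y \<subseteq> {u}"
    by metis
  obtain T where T: "T \<subseteq> fiber y" "finite T" "fiber y \<subseteq> (\<Union>u\<in>T. U u)"
    using compactE_image[OF fiber_compact[OF assms], of "fiber y" U] U by blast
  have "fiber y \<subseteq> T"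
  proof
    fix v assume v: "v \<in> fiber y"
    then obtain u where "u \<in> T" "v \<in> U u" using T(3) by blast
    then show "v \<in> T" using U[of u] T(1) v by blast
  qed
  then show ?thesis using T(2) finite_subset by blast
qed

text \<open>Near a point \<open>y0\<close> the map \<open>p\<close> has one holomorphic inverse branch through each point of
  the finite fibre over \<open>y0\<close>. By properness the fibres over nearby points stay close to this
  one, so that they consist exactly of the values of the branches, and the trace is a finite
  sum of holomorphic functions.\<close>

theorem trace_holomorphic:
  assumes \<phi>: "vec_holo \<phi> W"
  shows "vec_holo (\<lambda>y. \<Sum>u\<in>fiber y. \<phi> u) (log_domain D)"
  unfolding vec_holo_def
proof
  let ?p = "prod_map a nn"
  fix y0 :: "(complex, 'k) vec" assume y0: "y0 \<in> log_domain D"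
  then have l0: "logv y0 \<in> D" by (simp add: log_domain_def)
  define Y where "Y = fiber y0"
  have finY: "finite Y" unfolding Y_def by (rule fiber_finite[OF l0])
  have YW: "u \<in> W" "?p u = y0" if "u \<in> Y" for u using that by (simp_all add: Y_def fiber_def)
  have "\<exists>U V g. open U \<and> U \<subseteq> W \<and> u \<in> U \<and> open V \<and> y0 \<in> V \<and> homeomorphism U V ?p g \<and>
      (\<forall>y\<in>V. \<exists>g'. (g has_derivative g') (at y) \<and> (\<forall>v. g' (\<i> *s v) = \<i> *s g' v))" if uY: "u \<in> Y" for u
  proof -
    obtain U V g where "open U" "U \<subseteq> W" "u \<in> U" "open V" "?p u \<in> V" "homeomorphism U V ?p g"
      "\<And>y. y \<in> V \<Longrightarrow> \<exists>g'. (g has_derivative g') (at y) \<and> (\<forall>v. g' (\<i> *s v) = \<i> *s g' v)"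
      using local_inverse[OF YW(1)[OF uY]] by blast
    then show ?thesis using YW(2)[OF uY] by blast
  qed
  then obtain U V g where UVg: "\<And>u. u \<in> Y \<Longrightarrow> open (U u) \<and> U u \<subseteq> W \<and> u \<in> U u \<and> open (V u) \<and> y0 \<in> V u \<and>
      homeomorphism (U u) (V u) ?p (g u) \<and>
      (\<forall>y\<in>V u. \<exists>g'. (g u has_derivative g') (at y) \<and> (\<forall>v. g' (\<i> *s v) = \<i> *s g' v))"
    by metis
  obtain e where e: "e > 0" "\<And>x y. x \<in> Y \<Longrightarrow> y \<in> Y \<Longrightarrow> x \<noteq> y \<Longrightarrow> ball x e \<inter> ball y e = {}"
    using finite_separation[OF finY] by blast
  define O' where "O' = (\<Union>u\<in>Y. U u \<inter> ball u e)"
  have oO: "open O'" unfolding O'_def using UVg by (intro open_UN ballI open_Int) auto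
  obtain r where r: "r > 0" "cball (logv y0) r \<subseteq> D"
    using open_D l0 open_contains_cball by blast
  define C where "C = {u \<in> W. logv (?p u) \<in> cball (logv y0) r}"
  have cC: "compact C" unfolding C_def using r(2) by (intro proper) auto
  have "compact (C - O')" using cC oO by (rule compact_diff)
  then have "compact (?p ` (C - O'))"
    by (intro compact_continuous_image[OF continuous_on_subset[OF cont_prod_map]]) (auto simp: C_def)
  then have cl: "closed (?p ` (C - O'))" by (rule compact_imp_closed)
  have y0n: "y0 \<notin> ?p ` (C - O')"
  proof
    assume "y0 \<in> ?p ` (C - O')"
    then obtain u where u: "u \<in> C" "u \<notin> O'" "?p u = y0" by auto
    then have "u \<in> Y" by (simp add: Y_def fiber_def C_def)
    then show False using u(2) UVg e(1) unfolding O'_def by force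
  qed
  \<comment> \<open>over \<open>G\<close> no point of the fibre lies outside the neighbourhood \<open>O'\<close> of the fibre \<open>Y\<close>\<close>
  define G where "G = log_domain (ball (logv y0) r) - ?p ` (C - O')"
  have oG: "open G" unfolding G_def by (intro open_Diff open_log_domain cl) simp
  have y0G: "y0 \<in> G" using y0n y0 r(1) by (simp add: G_def log_domain_def)
  define A where "A = G \<inter> (\<Inter>u\<in>Y. V u \<inter> g u -` ball u e)"
  have gY: "g u y0 = u" if "u \<in> Y" for u
    using UVg[OF that] YW(2)[OF that] by (metis homeomorphism_apply1)
  have oV: "open (V u \<inter> g u -` ball u e)" if "u \<in> Y" for u
    using UVg[OF that] by (intro continuous_open_preimage) (auto simp: homeomorphism_def)
  have oA: "open A" unfolding A_def using finY oV by (intro open_Int oG open_INT) auto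
  have y0A: "y0 \<in> A" using y0G UVg gY e(1) by (auto simp: A_def)
  have fib: "bij_betw (\<lambda>u. g u y) Y (fiber y)" if y: "y \<in> A" for y
  proof (rule bij_betw_imageI)
    have yV: "y \<in> V u" "g u y \<in> ball u e" if "u \<in> Y" for u using y that by (auto simp: A_def)
    show "inj_on (\<lambda>u. g u y) Y"
    proof (rule inj_onI)
      fix u u' assume "u \<in> Y" "u' \<in> Y" "g u y = g u' y"
      then have "g u y \<in> ball u e \<inter> ball u' e" using yV(2)[of u] yV(2)[of u'] by simp
      then show "u = u'" using e(2)[OF \<open>u \<in> Y\<close> \<open>u' \<in> Y\<close>] by blast
    qed
    show "(\<lambda>u. g u y) ` Y = fiber y"
    proof (intro equalityI subsetI)
      fix v assume "v \<in> (\<lambda>u. g u y) ` Y"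
      then obtain u where u: "u \<in> Y" "v = g u y" by auto
      have h: "homeomorphism (U u) (V u) ?p (g u)" "U u \<subseteq> W" using UVg[OF u(1)] by auto
      have "g u y \<in> U u" using h(1) yV(1)[OF u(1)] by (auto simp: homeomorphism_def)
      moreover have "?p (g u y) = y" using h(1) yV(1)[OF u(1)] by (rule homeomorphism_apply2)
      ultimately show "v \<in> fiber y" using h(2) u(2) by (auto simp: fiber_def)
    next
      fix v assume v: "v \<in> fiber y"
      then have vW: "v \<in> W" "?p v = y" by (simp_all add: fiber_def)
      have yG: "y \<in> G" using y by (simp add: A_def)
      then have "v \<in> C" using vW by (auto simp: C_def G_def log_domain_def intro: less_imp_le)
      then have "v \<in> O'" using yG vW(2) by (auto simp: G_def)
      then obtain u where u: "u \<in> Y" "v \<in> U u" by (auto simp: O'_def)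
      then have "g u (?p v) = v" using UVg[OF u(1)] by (metis homeomorphism_apply1)
      then show "v \<in> (\<lambda>u. g u y) ` Y" using u(1) vW(2) by force
    qed
  qed
  have eq: "(\<Sum>u\<in>Y. \<phi> (g u y)) = (\<Sum>u\<in>fiber y. \<phi> u)" if "y \<in> A" for y
    by (rule sum.reindex_bij_betw[OF fib[OF that]])
  have "\<exists>E. ((\<lambda>y. \<phi> (g u y)) has_derivative E) (at y0) \<and> (\<forall>v. E (\<i> *s v) = \<i> * E v)" if u: "u \<in> Y" for u
  proof -
    obtain g' where g': "(g u has_derivative g') (at y0)" "\<And>v. g' (\<i> *s v) = \<i> *s g' v"
      using UVg[OF u] by blast
    obtain E where E: "(\<phi> has_derivative E) (at (g u y0))" "\<And>v. E (\<i> *s v) = \<i> * E v"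
      using \<phi> YW(1)[OF u] gY[OF u] unfolding vec_holo_def by metis
    show ?thesis
      by (rule exI[of _ "\<lambda>v. E (g' v)"]) (auto simp: E g' intro: has_derivative_compose[OF g'(1)])
  qed
  then obtain E where E: "\<And>u. u \<in> Y \<Longrightarrow> ((\<lambda>y. \<phi> (g u y)) has_derivative E u) (at y0) \<and> (\<forall>v. E u (\<i> *s v) = \<i> * E u v)"
    by metis
  have "((\<lambda>y. \<Sum>u\<in>Y. \<phi> (g u y)) has_derivative (\<lambda>v. \<Sum>u\<in>Y. E u v)) (at y0)"
    using E by (intro has_derivative_sum) auto
  then have "((\<lambda>y. \<Sum>u\<in>fiber y. \<phi> u) has_derivative (\<lambda>v. \<Sum>u\<in>Y. E u v)) (at y0)"
    by (rule has_derivative_transform_within_open[OF _ oA y0A eq])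
  then show "\<exists>E. ((\<lambda>y. \<Sum>u\<in>fiber y. \<phi> u) has_derivative E) (at y0) \<and> (\<forall>v. E (\<i> *s v) = \<i> * E v)"
    using E by (intro exI conjI) (auto simp: sum_distrib_left)
qed

definition monomial :: "(int, 'k) vec \<Rightarrow> (complex, 'k) vec \<Rightarrow> complex" where
  "monomial m u = (\<Prod>j\<in>UNIV. (prod_map a nn u $ j) powi (- (m $ j)))"

lemma vec_holo_monomial: "vec_holo (monomial m) W"
  unfolding monomial_def prod_map_def vec_lambda_beta
  by (intro vec_holo_prod vec_holo_powi vec_holo_form) (auto simp: form_nz)

lemma vec_holo_jac: "vec_holo (\<lambda>x. det (jac a nn (expv x))) (tube \<Omega>)"
  unfolding det_jac_N by (intro vec_holo_mult vec_holo_const vec_holo_det vec_holo_N)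

lemma monomial_fiber:
  assumes "u \<in> fiber (expv w)"
  shows "monomial m u = exp (- ndot m w)"
proof -
  have "monomial m u = (\<Prod>j\<in>UNIV. exp (- of_int (m $ j) * w $ j))"
    using assms by (simp add: monomial_def fiber_def exp_power_int)
  then show ?thesis by (simp add: exp_sum[symmetric] ndot_def sum_negf)
qed

text \<open>The trace is a periodic holomorphic function of \<open>w\<close>, and its Fourier coefficients may
  be computed on any slice. On a slice over which the fibres are deep they are integrals
  over a torus in the chamber by \<open>deep_torus_identity\<close>; the integrand is holomorphic on the
  whole chamber, so this torus may then be moved to the prescribed radii \<open>\<epsilon>\<close>.\<close>

theorem trace_expansion:
  assumes \<phi>: "vec_holo \<phi> W" and \<epsilon>: "\<epsilon> \<in> \<Omega>" and w: "re_vec w \<in> D"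
    and deep: "\<And>M. \<exists>\<eta>\<in>deepset M. re_vec cst + B *v \<eta> \<in> D \<and>
      (\<forall>u\<in>W. logv (prod_map a nn u) = re_vec cst + B *v \<eta> \<longrightarrow> logv u \<in> deepset M)"
  defines "c m \<equiv> of_real (sgn (det B)) / of_real (2 * pi) ^ CARD('k) *
    integral tcube (\<lambda>\<theta>. \<phi> (expv (cvec \<epsilon> \<theta>)) * monomial m (expv (cvec \<epsilon> \<theta>)) * det (jac a nn (expv (cvec \<epsilon> \<theta>))))"
  shows "finite (fiber (expv w))"
    and "(\<lambda>m. norm (c m * exp (ndot m w))) summable_on UNIV"
    and "((\<lambda>m. c m * exp (ndot m w)) has_sum (\<Sum>u\<in>fiber (expv w). \<phi> u)) UNIV"
proof -
  show "finite (fiber (expv w))" using w by (intro fiber_finite) simp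
  define F where "F w = (\<Sum>u\<in>fiber (expv w). \<phi> u)" for w
  have F: "vec_holo F (tube D)" "per_on F (tube D)"
    unfolding F_def using vec_holo_expv[OF trace_holomorphic[OF \<phi>]] per_on_expv[of "\<lambda>y. \<Sum>u\<in>fiber y. \<phi> u"] by simp_all
  obtain M where M: "small M" using small_exists by blast
  obtain \<eta> where \<eta>: "\<eta> \<in> deepset (M + 4)" "re_vec cst + B *v \<eta> \<in> D"
      "\<And>u. u \<in> W \<Longrightarrow> logv (prod_map a nn u) = re_vec cst + B *v \<eta> \<Longrightarrow> logv u \<in> deepset (M + 4)"
    using deep[of "M + 4"] by blast
  define \<rho> where "\<rho> = re_vec cst + B *v \<eta>"
  have \<rho>: "\<rho> \<in> D" using \<eta>(2) by (simp add: \<rho>_def)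
  have dM: "deepset (M + 4) \<subseteq> deepset M" by (rule deepset_mono) simp
  have d: "logv u \<in> deepset M" if "u \<in> W" "logv (prod_map a nn u) = \<rho>" for u
    using \<eta>(3)[OF that(1)] that(2) dM unfolding \<rho>_def by auto
  have \<eta>\<Omega>: "\<eta> \<in> \<Omega>"
    using \<eta>(1) dM M deepset_mono deep_\<Omega> unfolding small_def by blast
  have "fcoeff F \<rho> m = c m" for m
  proof -
    define \<Phi> where "\<Phi> u = \<phi> u * monomial m u" for u
    have \<Phi>: "vec_holo \<Phi> W" unfolding \<Phi>_def by (rule vec_holo_mult[OF \<phi> vec_holo_monomial])
    have eq: "F (cvec \<rho> \<theta>) * exp (- ndot m (cvec \<rho> \<theta>)) = (\<Sum>u\<in>fiber (expv (cvec \<rho> \<theta>)). \<Phi> u)" for \<theta>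
      unfolding F_def \<Phi>_def sum_distrib_right by (rule sum.cong) (auto simp: monomial_fiber)
    have cont: "continuous_on UNIV (\<lambda>\<theta>. \<Sum>u\<in>fiber (expv (cvec \<rho> \<theta>)). \<Phi> u)"
      by (rule slice_continuous[OF vec_holo_continuous[OF vec_holo_expv[OF trace_holomorphic[OF \<Phi>]]] \<rho>])
    have "integral tcube (\<lambda>\<theta>. F (cvec \<rho> \<theta>) * exp (- ndot m (cvec \<rho> \<theta>))) =
      of_real (sgn (det B)) * integral tcube (\<lambda>\<theta>. \<Phi> (expv (cvec \<eta> \<theta>)) * det (jac a nn (expv (cvec \<eta> \<theta>))))"
      unfolding eq by (rule deep_torus_identity[OF M \<eta>(1) \<rho>_def d \<Phi> cont])
    also have "integral tcube (\<lambda>\<theta>. \<Phi> (expv (cvec \<eta> \<theta>)) * det (jac a nn (expv (cvec \<eta> \<theta>)))) =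
      integral tcube (\<lambda>\<theta>. \<Phi> (expv (cvec \<epsilon> \<theta>)) * det (jac a nn (expv (cvec \<epsilon> \<theta>))))"
    proof (rule torus_mean_independent[OF open_\<Omega> convex_\<Omega> _ _ \<epsilon> \<eta>\<Omega>])
      show "vec_holo (\<lambda>x. \<Phi> (expv x) * det (jac a nn (expv x))) (tube \<Omega>)"
        by (rule vec_holo_mult[OF vec_holo_expv[OF \<Phi>] vec_holo_jac])
      show "per_on (\<lambda>x. \<Phi> (expv x) * det (jac a nn (expv x))) (tube \<Omega>)"
        by (simp add: per_on_def)
    qed
    finally show ?thesis by (simp add: fcoeff_def c_def \<Phi>_def)
  qed
  then have "fcoeff F \<rho> = c" by (rule ext)
  then show "(\<lambda>m. norm (c m * exp (ndot m w))) summable_on UNIV"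
    "((\<lambda>m. c m * exp (ndot m w)) has_sum (\<Sum>u\<in>fiber (expv w). \<phi> u)) UNIV"
    using fourier_expansion[OF open_D convex_D F \<rho> w] by (simp_all add: F_def)
qed

end

section \<open>Regular vectors and proper flags\<close>

text \<open>The vectors outside \<open>P\<close> are taken with both signs, which makes the set a finitely
  generated convex cone.\<close>

lemma closed_generated_cone_euclidean:
  fixes w :: "'i \<Rightarrow> 'a::euclidean_space"
  assumes "finite I"
  shows "closed {\<Sum>i\<in>I. c i *\<^sub>R w i | c. \<forall>i\<in>P. 0 \<le> c i}" (is "closed ?S")
proof -
  let ?G = "w ` I \<union> (\<lambda>i. - w i) ` (I - P)"
  have "?S = convex_cone hull ?G"
  proof (intro equalityI subsetI)
    fix x assume "x \<in> ?S"
    then obtain c where c: "x = (\<Sum>i\<in>I. c i *\<^sub>R w i)" "\<forall>i\<in>P. 0 \<le> c i" by blast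
    have gen: "c i *\<^sub>R w i \<in> convex_cone hull ?G" if "i \<in> I" for i
    proof (cases "0 \<le> c i")
      case True
      have "w i \<in> convex_cone hull ?G" using that by (intro hull_inc) auto
      then show ?thesis using True by (rule_tac convex_cone_scaleR[OF convex_cone_convex_cone_hull])
    next
      case False
      then have "- w i \<in> convex_cone hull ?G" using that c(2) by (intro hull_inc) auto
      then have "(- c i) *\<^sub>R (- w i) \<in> convex_cone hull ?G"
        using False by (intro convex_cone_scaleR[OF convex_cone_convex_cone_hull]) auto
      then show ?thesis by simp
    qed
    have "(\<Sum>i\<in>J. c i *\<^sub>R w i) \<in> convex_cone hull ?G" if "finite J" "J \<subseteq> I" for J
      using that
    proof (induction J)
      case empty
      show ?case by (simp add: convex_cone_hull_contains_0)
    next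
      case (insert i J)
      then show ?case using gen by (simp add: convex_cone_add[OF convex_cone_convex_cone_hull])
    qed
    then show "x \<in> convex_cone hull ?G" using assms c(1) by blast
  next
    have single: "\<exists>c. s *\<^sub>R w i = (\<Sum>j\<in>I. c j *\<^sub>R w j) \<and> (\<forall>j\<in>P. 0 \<le> c j)"
      if "i \<in> I" "i \<in> P \<Longrightarrow> 0 \<le> s" for i s
      using that assms
      by (intro exI[of _ "\<lambda>j. if j = i then s else 0"]) (simp add: if_distrib[of "\<lambda>c. c *\<^sub>R _"] cong: if_cong)
    have "convex_cone hull ?G \<subseteq> ?S"
    proof (rule hull_minimal)
      show "?G \<subseteq> ?S"
        using single[of _ 1] single[of _ "-1"] by auto
      show "convex_cone ?S"
        unfolding convex_cone_iff
      proof (intro conjI ballI allI impI)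
        show "0 \<in> ?S" by (auto intro!: exI[of _ "\<lambda>_. 0"])
        fix x assume "x \<in> ?S"
        then obtain c where c: "x = (\<Sum>i\<in>I. c i *\<^sub>R w i)" "\<forall>i\<in>P. 0 \<le> c i" by blast
        show "s *\<^sub>R x \<in> ?S" if "0 \<le> s" for s
          using c that by (auto intro!: exI[of _ "\<lambda>i. s * c i"] simp: scaleR_sum_right)
        fix y assume "y \<in> ?S"
        then obtain d where d: "y = (\<Sum>i\<in>I. d i *\<^sub>R w i)" "\<forall>i\<in>P. 0 \<le> d i" by blast
        show "x + y \<in> ?S"
          using c d by (auto intro!: exI[of _ "\<lambda>i. c i + d i"] simp: scaleR_left_distrib sum.distrib)
      qed
    qed
    then show "x \<in> ?S" if "x \<in> convex_cone hull ?G" for x using that by blast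
  qed
  then show ?thesis using assms by (simp add: closed_convex_cone_hull)
qed

text \<open>The Riesz isomorphism, which carries the closedness of finitely generated cones over
  to the dual space.\<close>

definition riesz :: "'a::euclidean_space dual \<Rightarrow> 'a" where
  "riesz \<gamma> = (\<Sum>b\<in>Basis. \<gamma> b *\<^sub>R b)"

lemma riesz_inner: "riesz \<gamma> \<bullet> x = \<gamma> x"
proof -
  have "\<gamma> x = \<gamma> (\<Sum>b\<in>Basis. (x \<bullet> b) *\<^sub>R b)" by (simp add: euclidean_representation)
  also have "\<dots> = (\<Sum>b\<in>Basis. (x \<bullet> b) * \<gamma> b)" by (simp add: blinfun.sum_right blinfun.scaleR_right)
  also have "\<dots> = (\<Sum>b\<in>Basis. \<gamma> b * (b \<bullet> x))" by (simp add: inner_commute mult.commute)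
  finally show ?thesis by (simp add: riesz_def inner_sum_left)
qed

lemma riesz_linear: "linear riesz"
  by (rule linearI) (simp_all add: riesz_def blinfun.add_left blinfun.scaleR_left scaleR_left_distrib sum.distrib scaleR_sum_right)

lemma riesz_inj: "riesz \<gamma> = riesz \<gamma>' \<Longrightarrow> \<gamma> = \<gamma>'"
  by (metis blinfun_eqI riesz_inner)

lemma continuous_on_riesz: "continuous_on S riesz"
  unfolding riesz_def[abs_def] by (intro continuous_intros)

lemma closed_generated_cone:
  fixes w :: "'i \<Rightarrow> 'a::euclidean_space dual"
  assumes "finite I"
  shows "closed {\<Sum>i\<in>I. c i *\<^sub>R w i | c. \<forall>i\<in>P. 0 \<le> c i}" (is "closed ?S")
proof -
  let ?T = "{\<Sum>i\<in>I. c i *\<^sub>R riesz (w i) | c. \<forall>i\<in>P. 0 \<le> c i}"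
  have r: "riesz (\<Sum>i\<in>I. c i *\<^sub>R w i) = (\<Sum>i\<in>I. c i *\<^sub>R riesz (w i))" for c
    by (simp add: linear_sum[OF riesz_linear] linear_scale[OF riesz_linear])
  have "?S = riesz -` ?T"
  proof (intro equalityI subsetI)
    fix x assume "x \<in> riesz -` ?T"
    then obtain c where "riesz x = (\<Sum>i\<in>I. c i *\<^sub>R riesz (w i))" "\<forall>i\<in>P. 0 \<le> c i" by auto
    then have "x = (\<Sum>i\<in>I. c i *\<^sub>R w i)" by (intro riesz_inj) (simp add: r)
    then show "x \<in> ?S" using \<open>\<forall>i\<in>P. 0 \<le> c i\<close> by blast
  qed (use r in auto)
  moreover have "closed (riesz -` ?T)"
    by (intro closed_vimage closed_generated_cone_euclidean assms continuous_on_riesz)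
  ultimately show ?thesis by simp
qed

lemma family_independent:
  fixes v :: "'i \<Rightarrow> 'v::real_vector"
  assumes I: "finite I"
  shows "inj_on v I \<and> independent (v ` I) \<longleftrightarrow> (\<forall>c. (\<Sum>i\<in>I. c i *\<^sub>R v i) = 0 \<longrightarrow> (\<forall>i\<in>I. c i = 0))"
proof (intro iffI allI impI ballI)
  fix c i assume a: "inj_on v I \<and> independent (v ` I)" "(\<Sum>i\<in>I. c i *\<^sub>R v i) = 0" "i \<in> I"
  have "(\<Sum>x\<in>v ` I. c (the_inv_into I v x) *\<^sub>R x) = (\<Sum>i\<in>I. c i *\<^sub>R v i)"
    using a(1) by (simp add: sum.reindex the_inv_into_f_f)
  then have "c (the_inv_into I v (v i)) = 0"
    using a independentD[of "v ` I" "v ` I" "\<lambda>x. c (the_inv_into I v x)" "v i"] I by auto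
  then show "c i = 0" using a by (simp add: the_inv_into_f_f)
next
  assume a: "\<forall>c. (\<Sum>i\<in>I. c i *\<^sub>R v i) = 0 \<longrightarrow> (\<forall>i\<in>I. c i = 0)"
  have inj: "inj_on v I"
  proof (rule inj_onI)
    fix i j assume ij: "i \<in> I" "j \<in> I" "v i = v j"
    show "i = j"
    proof (rule ccontr)
      assume "i \<noteq> j"
      let ?c = "\<lambda>k. if k = i then 1 else if k = j then -1 else (0::real)"
      have "(\<Sum>k\<in>I. ?c k *\<^sub>R v k) = (\<Sum>k\<in>I. (if k = i then v i else 0) + (if k = j then - v j else 0))"
        by (rule sum.cong) (use \<open>i \<noteq> j\<close> in auto)
      also have "\<dots> = v i - v j" using ij I by (simp add: sum.distrib)
      finally have "(\<Sum>k\<in>I. ?c k *\<^sub>R v k) = 0" using ij by simp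
      then have "?c i = 0" using a[rule_format, of ?c i] ij(1) by blast
      then show False by simp
    qed
  qed
  moreover have "independent (v ` I)"
  proof
    assume "dependent (v ` I)"
    then obtain u where u: "\<exists>x\<in>v ` I. u x \<noteq> 0" "(\<Sum>x\<in>v ` I. u x *\<^sub>R x) = 0"
      using dependent_finite[of "v ` I"] I by auto
    have "(\<Sum>i\<in>I. u (v i) *\<^sub>R v i) = 0" using u(2) inj by (simp add: sum.reindex)
    then show False using a u(1) by auto
  qed
  ultimately show "inj_on v I \<and> independent (v ` I)" by blast
qed

text \<open>A flag is determined by the sets of indices of the forms contained in its members,
  since these forms span them.\<close>

lemma finite_flags: "finite (flags (A :: 'n::finite \<Rightarrow> 'b::euclidean_space dual))"
proof -
  let ?r = "DIM('b)"
  let ?f = "\<lambda>F :: nat \<Rightarrow> 'b dual set. \<lambda>j\<in>{0..?r}. {i. A i \<in> F j}"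
  have "?f ` flags A \<subseteq> {0..?r} \<rightarrow>\<^sub>E UNIV" by auto
  then have fin: "finite (?f ` flags A)"
    by (rule finite_subset) (auto intro!: finite_PiE)
  have "inj_on ?f (flags A)"
  proof (rule inj_onI)
    fix F G assume FG: "F \<in> flags A" "G \<in> flags A" "?f F = ?f G"
    show "F = G"
    proof (rule extensionalityI[of _ "{0..?r}"])
      show "F \<in> extensional {0..?r}" "G \<in> extensional {0..?r}" using FG by (auto simp: flags_def)
      fix j assume j: "j \<in> {0..?r}"
      have "{i. A i \<in> F j} = {i. A i \<in> G j}"
        using fun_cong[OF FG(3), of j] j by simp
      then have "range A \<inter> F j = range A \<inter> G j" by blast
      moreover have "span (range A \<inter> F j) = F j" "span (range A \<inter> G j) = G j"
        using FG j by (auto simp: flags_def)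
      ultimately show "F j = G j" by metis
    qed
  qed
  then show ?thesis using fin finite_imageD by blast
qed

lemma kappa_top: "F \<in> flags A \<Longrightarrow> kappa (A :: 'n::finite \<Rightarrow> 'a::euclidean_space dual) F DIM('a) = kappa_all A"
  by (simp add: kappa_def kappa_all_def flags_def)

lemma sum_split_top:
  fixes f :: "nat \<Rightarrow> 'v::comm_monoid_add"
  assumes "r \<ge> 1"
  shows "(\<Sum>j\<in>{1..r}. f j) = (\<Sum>j\<in>{1..<r}. f j) + f r"
proof -
  have "{1..r} = insert r {1..<r}" using assms by auto
  then show ?thesis by (simp add: add.commute)
qed

text \<open>The last of the \<open>\<kappa>\<^sub>j\<close> is \<open>kappa_all A\<close>, so the two parts of the sum merge into one
  combination whose last coefficient is free.\<close>

lemma flags_at_iff: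
  fixes A :: "'n::finite \<Rightarrow> 'a::euclidean_space dual"
  shows "F \<in> flags_at A \<xi> \<longleftrightarrow> F \<in> flags A \<and>
    \<xi> \<in> {\<Sum>j\<in>{1..DIM('a)}. m j *\<^sub>R kappa A F j | m. \<forall>j\<in>{1..<DIM('a)}. 0 \<le> m j}"
proof (cases "F \<in> flags A")
  case F: True
  have r: "DIM('a) \<ge> 1" by (simp add: Suc_leI)
  show ?thesis
  proof
    assume "F \<in> flags_at A \<xi>"
    then obtain m t where m: "\<forall>j\<in>{1..<DIM('a)}. m j \<ge> 0"
      "\<xi> = (\<Sum>j\<in>{1..<DIM('a)}. m j *\<^sub>R kappa A F j) + t *\<^sub>R kappa_all A"
      unfolding flags_at_def by blast
    have "(\<Sum>j\<in>{1..DIM('a)}. (m(DIM('a) := t)) j *\<^sub>R kappa A F j) = \<xi>"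
      unfolding sum_split_top[OF r] m(2) kappa_top[OF F, symmetric] by simp
    then show "F \<in> flags A \<and> \<xi> \<in> {\<Sum>j\<in>{1..DIM('a)}. m j *\<^sub>R kappa A F j | m. \<forall>j\<in>{1..<DIM('a)}. 0 \<le> m j}"
      using F m(1) by (auto intro!: exI[of _ "m(DIM('a) := t)"])
  next
    assume "F \<in> flags A \<and> \<xi> \<in> {\<Sum>j\<in>{1..DIM('a)}. m j *\<^sub>R kappa A F j | m. \<forall>j\<in>{1..<DIM('a)}. 0 \<le> m j}"
    then obtain m where "\<xi> = (\<Sum>j\<in>{1..DIM('a)}. m j *\<^sub>R kappa A F j)" "\<forall>j\<in>{1..<DIM('a)}. 0 \<le> m j" by blast
    then show "F \<in> flags_at A \<xi>"
      using F sum_split_top[OF r, of "\<lambda>j. m j *\<^sub>R kappa A F j"] unfolding flags_at_def kappa_top[OF F]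
      by (intro CollectI conjI exI[of _ m] exI[of _ "m DIM('a)"]) auto
  qed
qed (simp add: flags_at_def)

lemma tau_regularD:
  fixes A :: "'n::finite \<Rightarrow> 'a::euclidean_space dual"
  assumes "tau_regular A \<tau> \<xi>" "F \<in> flags_at A \<xi>"
    "\<xi> = (\<Sum>j\<in>{1..DIM('a)}. m j *\<^sub>R kappa A F j)" "j \<in> {1..<DIM('a)}"
  shows "m j > \<tau>"
  using bspec[OF mp[OF spec[OF bspec[OF assms(1)[unfolded tau_regular_def] assms(2)]] assms(3)] assms(4)] .

text \<open>A vector is not regular if and only if it belongs to one of finitely many closed sets:
  the cone of a flag, intersected with the set of combinations that have a coefficient
  \<open>m\<^sub>k \<le> \<tau>\<close>. The latter is a finitely generated cone translated by \<open>\<tau> *\<^sub>R \<kappa>\<^sub>k\<close>.\<close>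

lemma tau_regular_open: "open {\<xi>. tau_regular (A :: 'n::finite \<Rightarrow> 'a::euclidean_space dual) \<tau> \<xi>}"
proof -
  let ?r = "DIM('a)"
  let ?C = "\<lambda>F. {\<Sum>j\<in>{1..?r}. m j *\<^sub>R kappa A F j | m. \<forall>j\<in>{1..<?r}. 0 \<le> m j}"
  let ?N = "\<lambda>F k. {\<Sum>j\<in>{1..?r}. m j *\<^sub>R (if j = k then - kappa A F j else kappa A F j) | m. \<forall>j\<in>{k}. 0 \<le> m j}"
  let ?B = "\<lambda>F k. (\<lambda>x. \<tau> *\<^sub>R kappa A F k + x) ` ?N F k"
  have Bad: "\<xi> \<in> ?B F k \<longleftrightarrow> (\<exists>m. \<xi> = (\<Sum>j\<in>{1..?r}. m j *\<^sub>R kappa A F j) \<and> m k \<le> \<tau>)"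
    if k: "k \<in> {1..<?r}" for \<xi> F k
  proof
    have split: "(\<Sum>j\<in>{1..?r}. f j) = f k + (\<Sum>j\<in>{1..?r} - {k}. f j)" for f :: "nat \<Rightarrow> 'a dual"
      using k by (intro sum.remove) auto
    assume "\<xi> \<in> ?B F k"
    then obtain m where m: "\<xi> = \<tau> *\<^sub>R kappa A F k + (\<Sum>j\<in>{1..?r}. m j *\<^sub>R (if j = k then - kappa A F j else kappa A F j))" "0 \<le> m k"
      by auto
    have "\<xi> = (\<Sum>j\<in>{1..?r}. (if j = k then \<tau> - m k else m j) *\<^sub>R kappa A F j)"
      unfolding m(1) split by (simp add: algebra_simps)
    then show "\<exists>m. \<xi> = (\<Sum>j\<in>{1..?r}. m j *\<^sub>R kappa A F j) \<and> m k \<le> \<tau>"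
      using m(2) by (intro exI[of _ "\<lambda>j. if j = k then \<tau> - m k else m j"]) simp
  next
    have split: "(\<Sum>j\<in>{1..?r}. f j) = f k + (\<Sum>j\<in>{1..?r} - {k}. f j)" for f :: "nat \<Rightarrow> 'a dual"
      using k by (intro sum.remove) auto
    assume "\<exists>m. \<xi> = (\<Sum>j\<in>{1..?r}. m j *\<^sub>R kappa A F j) \<and> m k \<le> \<tau>"
    then obtain m where m: "\<xi> = (\<Sum>j\<in>{1..?r}. m j *\<^sub>R kappa A F j)" "m k \<le> \<tau>" by blast
    let ?m = "\<lambda>j. if j = k then \<tau> - m k else m j"
    have "\<xi> = \<tau> *\<^sub>R kappa A F k + (\<Sum>j\<in>{1..?r}. ?m j *\<^sub>R (if j = k then - kappa A F j else kappa A F j))"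
      unfolding m(1) split by (simp add: algebra_simps)
    then show "\<xi> \<in> ?B F k"
      using m(2) by (intro image_eqI[of _ _ "\<Sum>j\<in>{1..?r}. ?m j *\<^sub>R (if j = k then - kappa A F j else kappa A F j)"])
        (auto intro!: exI[of _ ?m])
  qed
  have "- {\<xi>. tau_regular A \<tau> \<xi>} = (\<Union>F\<in>flags A. \<Union>k\<in>{1..<?r}. ?C F \<inter> ?B F k)"
  proof (rule set_eqI)
    fix \<xi>
    have "\<xi> \<in> - {\<xi>. tau_regular A \<tau> \<xi>} \<longleftrightarrow>
        (\<exists>F\<in>flags A. \<exists>k\<in>{1..<?r}. \<xi> \<in> ?C F \<and> (\<exists>m. \<xi> = (\<Sum>j\<in>{1..?r}. m j *\<^sub>R kappa A F j) \<and> m k \<le> \<tau>))"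
    proof -
      define C where "C = ?C"
      have fa: "F \<in> flags_at A \<xi> \<longleftrightarrow> F \<in> flags A \<and> \<xi> \<in> C F" for F
        unfolding C_def by (rule flags_at_iff)
      have "\<not> tau_regular A \<tau> \<xi> \<longleftrightarrow> (\<exists>F. F \<in> flags_at A \<xi> \<and>
          (\<exists>m. \<xi> = (\<Sum>j\<in>{1..?r}. m j *\<^sub>R kappa A F j) \<and> (\<exists>k\<in>{1..<?r}. m k \<le> \<tau>)))"
      proof
        assume nr: "\<not> tau_regular A \<tau> \<xi>"
        show "\<exists>F. F \<in> flags_at A \<xi> \<and> (\<exists>m. \<xi> = (\<Sum>j\<in>{1..?r}. m j *\<^sub>R kappa A F j) \<and> (\<exists>k\<in>{1..<?r}. m k \<le> \<tau>))"
        proof (rule ccontr)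
          assume no: "\<nexists>F. F \<in> flags_at A \<xi> \<and> (\<exists>m. \<xi> = (\<Sum>j\<in>{1..?r}. m j *\<^sub>R kappa A F j) \<and> (\<exists>k\<in>{1..<?r}. m k \<le> \<tau>))"
          have "tau_regular A \<tau> \<xi>"
            unfolding tau_regular_def using no by (intro ballI allI impI) (metis not_le)
          then show False using nr by blast
        qed
      next
        assume "\<exists>F. F \<in> flags_at A \<xi> \<and> (\<exists>m. \<xi> = (\<Sum>j\<in>{1..?r}. m j *\<^sub>R kappa A F j) \<and> (\<exists>k\<in>{1..<?r}. m k \<le> \<tau>))"
        then obtain F m k where *: "F \<in> flags_at A \<xi>" "\<xi> = (\<Sum>j\<in>{1..?r}. m j *\<^sub>R kappa A F j)" "k \<in> {1..<?r}" "m k \<le> \<tau>"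
          by blast
        show "\<not> tau_regular A \<tau> \<xi>"
        proof
          assume "tau_regular A \<tau> \<xi>"
          from tau_regularD[OF this *(1-3)] *(4) show False by linarith
        qed
      qed
      then have "\<not> tau_regular A \<tau> \<xi> \<longleftrightarrow> (\<exists>F\<in>flags A. \<exists>k\<in>{1..<?r}. \<xi> \<in> C F \<and>
          (\<exists>m. \<xi> = (\<Sum>j\<in>{1..?r}. m j *\<^sub>R kappa A F j) \<and> m k \<le> \<tau>))"
        unfolding fa by blast
      then show ?thesis by (simp only: C_def Compl_iff mem_Collect_eq)
    qed
    also have "\<dots> \<longleftrightarrow> \<xi> \<in> (\<Union>F\<in>flags A. \<Union>k\<in>{1..<?r}. ?C F \<inter> ?B F k)"
      unfolding UN_iff Int_iff by (intro bex_cong refl conj_cong) (rule Bad[symmetric])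
    finally show "\<xi> \<in> - {\<xi>. tau_regular A \<tau> \<xi>} \<longleftrightarrow> \<xi> \<in> (\<Union>F\<in>flags A. \<Union>k\<in>{1..<?r}. ?C F \<inter> ?B F k)" .
  qed
  moreover have "closed (\<Union>F\<in>flags A. \<Union>k\<in>{1..<?r}. ?C F \<inter> ?B F k)"
    by (intro closed_UN finite_flags ballI closed_Int closed_translation closed_generated_cone) auto
  ultimately have "closed (- {\<xi>. tau_regular A \<tau> \<xi>})" by (simp only:)
  then show ?thesis by (simp only: open_closed)
qed

lemma flags_at_scale:
  assumes "c > 0" "F \<in> flags_at A (c *\<^sub>R \<xi>)"
  shows "F \<in> flags_at A \<xi>"
proof -
  obtain m t where F: "F \<in> flags A" and m: "\<forall>j\<in>{1..<DIM('a)}. m j \<ge> 0"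
      "c *\<^sub>R \<xi> = (\<Sum>j\<in>{1..<DIM('a)}. m j *\<^sub>R kappa A F j) + t *\<^sub>R kappa_all A"
    using assms(2) unfolding flags_at_def by blast
  have "\<xi> = (1 / c) *\<^sub>R (c *\<^sub>R \<xi>)" using assms(1) by simp
  also have "\<dots> = (\<Sum>j\<in>{1..<DIM('a)}. (m j / c) *\<^sub>R kappa A F j) + (t / c) *\<^sub>R kappa_all A"
    unfolding m(2) by (simp add: scaleR_add_right scaleR_sum_right)
  finally show ?thesis
    unfolding flags_at_def using F m(1) assms(1) by (auto intro!: exI[of _ "\<lambda>j. m j / c"] exI[of _ "t / c"])
qed

text \<open>Scaling a vector scales the coefficients of all its expressions and does not change
  the cones that contain it.\<close>

lemma tau_regular_scale:
  assumes "tau_regular (A :: 'n::finite \<Rightarrow> 'a::euclidean_space dual) \<tau> \<xi>" "c \<ge> 1" "\<tau> > 0"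
  shows "tau_regular A \<tau> (c *\<^sub>R \<xi>)"
  unfolding tau_regular_def
proof (intro ballI allI impI)
  fix F m j assume F: "F \<in> flags_at A (c *\<^sub>R \<xi>)" and m: "c *\<^sub>R \<xi> = (\<Sum>j\<in>{1..DIM('a)}. m j *\<^sub>R kappa A F j)"
    and j: "j \<in> {1..<DIM('a)}"
  have "F \<in> flags_at A \<xi>" using flags_at_scale[OF _ F] assms(2) by simp
  moreover have "\<xi> = (\<Sum>j\<in>{1..DIM('a)}. (m j / c) *\<^sub>R kappa A F j)"
  proof -
    have "\<xi> = (1 / c) *\<^sub>R (c *\<^sub>R \<xi>)" using assms(2) by simp
    then show ?thesis unfolding m by (simp add: scaleR_sum_right)
  qed
  ultimately have "m j / c > \<tau>"
    by (rule tau_regularD[OF assms(1) _ _ j])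
  then have "m j > \<tau> * c" using assms(2) by (simp add: pos_less_divide_eq)
  moreover have "\<tau> * c \<ge> \<tau> * 1" using assms(2,3) by (intro mult_left_mono) auto
  ultimately show "m j > \<tau>" by linarith
qed

text \<open>A linear relation among the \<open>\<kappa>\<^sub>j\<close> with a nonzero coefficient at some \<open>k < r\<close> could be
  added to an expression of \<open>\<xi>\<close> so as to make \<open>m\<^sub>k\<close> equal to \<open>\<tau>\<close>, against regularity. The
  only relation left would be \<open>\<kappa>\<^sub>r = 0\<close>, which contradicts projectivity.\<close>

lemma regular_flag_proper:
  fixes A :: "'n::finite \<Rightarrow> 'a::euclidean_space dual"
  assumes "projective A" "tau_regular A \<tau> \<xi>" "F \<in> flags_at A \<xi>"
  shows "proper_flag A F"
proof -
  let ?r = "DIM('a)"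
  have F: "F \<in> flags A" using assms(3) by (simp add: flags_at_def)
  obtain m where m: "\<xi> = (\<Sum>j\<in>{1..?r}. m j *\<^sub>R kappa A F j)" using assms(3) unfolding flags_at_iff by blast
  have r: "?r \<ge> 1" by (simp add: Suc_leI)
  have low: "c k = 0" if z: "(\<Sum>j\<in>{1..?r}. c j *\<^sub>R kappa A F j) = 0" and k: "k \<in> {1..<?r}" for c k
  proof (rule ccontr)
    assume ck: "c k \<noteq> 0"
    let ?s = "(\<tau> - m k) / c k"
    have "\<xi> = (\<Sum>j\<in>{1..?r}. m j *\<^sub>R kappa A F j) + ?s *\<^sub>R (\<Sum>j\<in>{1..?r}. c j *\<^sub>R kappa A F j)"
      unfolding z using m by simp
    also have "\<dots> = (\<Sum>j\<in>{1..?r}. (m j + ?s * c j) *\<^sub>R kappa A F j)"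
      by (simp add: scaleR_sum_right sum.distrib scaleR_left_distrib)
    finally have "m k + ?s * c k > \<tau>"
      by (rule tau_regularD[OF assms(2,3) _ k])
    then show False using ck by simp
  qed
  have "\<forall>i\<in>{1..?r}. c i = 0" if z: "(\<Sum>j\<in>{1..?r}. c j *\<^sub>R kappa A F j) = 0" for c
  proof -
    have "(\<Sum>j\<in>{1..<?r}. c j *\<^sub>R kappa A F j) = 0" using low[OF z] by (intro sum.neutral) auto
    then have "c ?r *\<^sub>R kappa_all A = 0"
      using z unfolding sum_split_top[OF r] kappa_top[OF F] by simp
    moreover have "kappa_all A \<noteq> 0"
    proof -
      obtain x where x: "\<And>i. A i x > 0" using assms(1) unfolding projective_def by blast
      have "UNIV \<noteq> ({} :: 'n set)" by simp
      then have "(\<Sum>i\<in>UNIV. A i x) > 0" using x by (intro sum_pos) auto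
      then show ?thesis unfolding kappa_all_def by (metis blinfun.sum_left less_irrefl zero_blinfun.rep_eq)
    qed
    ultimately have "c ?r = 0" by simp
    then show ?thesis using low[OF z] r by (metis atLeastAtMost_iff atLeastLessThan_iff le_neq_implies_less)
  qed
  then show ?thesis unfolding proper_flag_def using family_independent[of "{1..?r}" "kappa A F"] by blast
qed

section \<open>The greedy flag of a point\<close>

lemma cpair_sum: "cpair (\<Sum>i\<in>I. c i *\<^sub>R \<gamma> i) u = (\<Sum>i\<in>I. of_real (c i) * cpair (\<gamma> i) u)"
  by (simp add: cpair_def complex_eq_iff blinfun.sum_left blinfun.scaleR_left)

definition lsize :: "('n \<Rightarrow> 'a::euclidean_space dual) \<Rightarrow> 'a cplx \<Rightarrow> 'n \<Rightarrow> real" where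
  "lsize A u i = ln (norm (cpair (A i) u))"

definition flag_of :: "('n \<Rightarrow> 'a::euclidean_space dual) \<Rightarrow> (nat \<Rightarrow> 'n) \<Rightarrow> nat \<Rightarrow> 'a dual set" where
  "flag_of A sel = (\<lambda>j\<in>{0..DIM('a)}. span (A ` sel ` {1..j}))"

text \<open>The greedy algorithm for a basis of minimal weight: each form is one of least size at
  \<open>u\<close> outside the span of its predecessors. The flag spanned by these forms orders the
  arrangement by size at \<open>u\<close>.\<close>

definition greedy :: "('n::finite \<Rightarrow> 'a::euclidean_space dual) \<Rightarrow> 'a cplx \<Rightarrow> (nat \<Rightarrow> 'n) \<Rightarrow> nat \<Rightarrow> bool" where
  "greedy A u sel n \<longleftrightarrow> inj_on (A \<circ> sel) {1..n} \<and> independent (A ` sel ` {1..n}) \<and>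
     (\<forall>j\<in>{1..n}. \<forall>i. A i \<notin> span (A ` sel ` {1..<j}) \<longrightarrow> lsize A u (sel j) \<le> lsize A u i)"

lemma dual_basis_card:
  fixes A :: "'n::finite \<Rightarrow> 'a::euclidean_space dual" and S :: "'a dual set"
  assumes "F \<in> flags A" "flag_basis lam F \<gamma>" "independent S"
  shows "finite S \<and> card S \<le> DIM('a)" and "span S = UNIV \<longleftrightarrow> card S = DIM('a)"
proof -
  let ?b = "\<gamma> ` {1..DIM('a)}"
  note fb = assms(2)[unfolded flag_basis_def]
  have "F DIM('a) = span ?b"
    by (rule fb[THEN conjunct2, THEN conjunct2, THEN conjunct1, rule_format, OF order_refl])
  moreover have "F DIM('a) = UNIV" using assms(1) by (simp add: flags_def)
  moreover have "inj_on \<gamma> {1..DIM('a)}" "independent ?b"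
    by (rule fb[THEN conjunct1], rule fb[THEN conjunct2, THEN conjunct1])
  ultimately have b: "inj_on \<gamma> {1..DIM('a)}" "independent ?b" "span ?b = UNIV" by simp_all
  have cb: "card ?b = DIM('a)" using b(1) by (simp add: card_image)
  show fS: "finite S \<and> card S \<le> DIM('a)"
    using independent_span_bound[of ?b S] assms(3) b cb by auto
  show "span S = UNIV \<longleftrightarrow> card S = DIM('a)"
  proof
    assume "span S = UNIV"
    then show "card S = DIM('a)"
      using independent_span_bound[of S ?b] fS b cb by auto
  next
    assume c: "card S = DIM('a)"
    show "span S = UNIV"
    proof (rule ccontr)
      assume "span S \<noteq> UNIV"
      then obtain x where x: "x \<notin> span S" by blast
      then have "independent (insert x S)" using assms(3) by (simp add: independent_insert)
      then have "card (insert x S) \<le> DIM('a)"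
        using independent_span_bound[of ?b "insert x S"] b cb by auto
      moreover have "x \<notin> S" using x span_base by blast
      ultimately show False using c fS by simp
    qed
  qed
qed

lemma greedy_exists:
  fixes A :: "'n::finite \<Rightarrow> 'a::euclidean_space dual"
  assumes F: "F \<in> flags A" "flag_basis lam F \<gamma>" and "n \<le> DIM('a)"
  shows "\<exists>sel. greedy A u sel n"
  using assms(3)
proof (induction n)
  case 0
  show ?case by (simp add: greedy_def independent_empty)
next
  case (Suc n)
  then obtain sel where sel: "greedy A u sel n" by auto
  let ?S = "A ` sel ` {1..n}"
  have S: "inj_on (A \<circ> sel) {1..n}" "independent ?S" using sel by (simp_all add: greedy_def)
  have "card ?S = n" using card_image[OF S(1)] by (simp add: image_comp)
  then have "span ?S \<noteq> UNIV"
    using dual_basis_card(2)[OF F S(2)] Suc.prems by simp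
  moreover have "span (range A) = UNIV" using F(1) by (auto simp: flags_def)
  ultimately have ne: "{i. A i \<notin> span ?S} \<noteq> {}"
    by (metis (mono_tags, lifting) UNIV_eq_I empty_Collect_eq image_subset_iff span_subspace subspace_span span_mono top.extremum_uniqueI span_span)
  obtain i0 where i0: "A i0 \<notin> span ?S" "\<And>i. A i \<notin> span ?S \<Longrightarrow> lsize A u i0 \<le> lsize A u i"
    using ex_min_if_finite[of "lsize A u ` {i. A i \<notin> span ?S}"] ne
    by (metis (mono_tags, lifting) finite finite_imageI arg_min_if_finite(1) arg_min_least mem_Collect_eq)
  let ?sel = "sel(Suc n := i0)"
  have eq: "?sel ` {1..<j} = sel ` {1..<j}" if "j \<le> Suc n" for j
    using that by (intro image_cong) auto
  have img: "?sel ` {1..Suc n} = insert i0 (sel ` {1..n})"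
  proof -
    have "{1..Suc n} = insert (Suc n) {1..n}" by auto
    moreover have "?sel ` {1..n} = sel ` {1..n}" by (intro image_cong) auto
    ultimately show ?thesis by (simp only: image_insert fun_upd_same)
  qed
  have "greedy A u ?sel (Suc n)"
    unfolding greedy_def
  proof (intro conjI ballI allI impI)
    have "inj_on (A \<circ> ?sel) (insert (Suc n) {1..n})"
    proof -
      have "inj_on (A \<circ> ?sel) {1..n}"
      proof -
        have "inj_on (A \<circ> ?sel) {1..n} \<longleftrightarrow> inj_on (A \<circ> sel) {1..n}" by (rule inj_on_cong) auto
        then show ?thesis using S(1) by blast
      qed
      moreover have "(A \<circ> ?sel) (Suc n) \<notin> (A \<circ> ?sel) ` ({1..n} - {Suc n})"
      proof
        assume "(A \<circ> ?sel) (Suc n) \<in> (A \<circ> ?sel) ` ({1..n} - {Suc n})"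
        then obtain l where l: "l \<in> {1..n} - {Suc n}" "(A \<circ> ?sel) (Suc n) = (A \<circ> ?sel) l" by (rule imageE)
        then have "A i0 = A (sel l)" by simp
        then have "A i0 \<in> ?S" using l(1) by blast
        then have "A i0 \<in> span ?S" by (rule span_base)
        then show False using i0(1) by contradiction
      qed
      ultimately show ?thesis by (simp add: inj_on_insert)
    qed
    moreover have "{1..Suc n} = insert (Suc n) {1..n}" by auto
    ultimately show "inj_on (A \<circ> ?sel) {1..Suc n}" by simp
    show "independent (A ` ?sel ` {1..Suc n})"
      unfolding img using S(2) i0(1) by (simp add: independent_insert)
    fix j i assume j: "j \<in> {1..Suc n}" and i: "A i \<notin> span (A ` ?sel ` {1..<j})"
    show "lsize A u (?sel j) \<le> lsize A u i"
    proof (cases "j = Suc n")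
      case True
      then have "{1..<j} = {1..n}" by auto
      then have "A i \<notin> span ?S" using i eq[of j] True by simp
      then show ?thesis using i0(2) True by simp
    next
      case False
      then have "j \<in> {1..n}" using j by auto
      moreover have "A i \<notin> span (A ` sel ` {1..<j})" using i eq[of j] j by (simp only: atLeastAtMost_iff) simp
      ultimately show ?thesis using sel False by (simp add: greedy_def)
    qed
  qed
  then show ?case by blast
qed

lemma flag_of_flag:
  fixes A :: "'n::finite \<Rightarrow> 'a::euclidean_space dual"
  assumes F: "F \<in> flags A" "flag_basis lam F \<gamma>"
    and inj: "inj_on (A \<circ> sel) {1..DIM('a)}" and ind: "independent (A ` sel ` {1..DIM('a)})"
  shows "flag_of A sel \<in> flags A"
proof -
  let ?r = "DIM('a)"
  have indj: "independent (A ` sel ` {1..j})" if "j \<le> ?r" for j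
    by (rule independent_mono[OF ind]) (use that in auto)
  have cardj: "card (A ` sel ` {1..j}) = j" if "j \<le> ?r" for j
    using card_image[OF inj_on_subset[OF inj, of "{1..j}"]] that by (simp add: image_comp)
  have dimj: "dim (span (A ` sel ` {1..j})) = j" if "j \<le> ?r" for j
    using cardj[OF that] dim_span_eq_card_independent[OF indj[OF that]] by simp
  have lt: "span (A ` sel ` {1..j}) \<subset> span (A ` sel ` {1..Suc j})" if "j < ?r" for j
  proof -
    have "span (A ` sel ` {1..j}) \<subseteq> span (A ` sel ` {1..Suc j})" by (intro span_mono image_mono) auto
    moreover have "span (A ` sel ` {1..j}) \<noteq> span (A ` sel ` {1..Suc j})"
    proof
      assume "span (A ` sel ` {1..j}) = span (A ` sel ` {1..Suc j})"
      then have "j = Suc j" using dimj[of j] dimj[of "Suc j"] that by simp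
      then show False by simp
    qed
    ultimately show ?thesis by blast
  qed
  have gen: "span (range A \<inter> span (A ` sel ` {1..j})) = span (A ` sel ` {1..j})" for j
  proof (rule span_unique)
    show "range A \<inter> span (A ` sel ` {1..j}) \<subseteq> span (A ` sel ` {1..j})" by blast
    show "span (A ` sel ` {1..j}) \<subseteq> T" if "range A \<inter> span (A ` sel ` {1..j}) \<subseteq> T" "subspace T" for T
      using that span_superset[of "A ` sel ` {1..j}"] by (intro span_minimal) auto
  qed (rule subspace_span)
  have full: "span (A ` sel ` {1..?r}) = UNIV"
    using dual_basis_card(2)[OF F ind] cardj[of ?r] by simp
  show ?thesis
    unfolding flags_def flag_of_def
    using lt dimj gen full by (auto simp: subspace_span)
qed

text \<open>Abel summation over the levels of the flag.\<close>

lemma flag_telescope: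
  fixes A :: "'n::finite \<Rightarrow> 'a::euclidean_space dual" and t :: "nat \<Rightarrow> real" and lev :: "'n \<Rightarrow> nat"
  assumes lev: "\<And>i. lev i \<in> {1..DIM('a)}" "\<And>i j. j \<in> {1..DIM('a)} \<Longrightarrow> A i \<in> G j \<longleftrightarrow> lev i \<le> j"
  shows "(\<Sum>i\<in>UNIV. t (lev i) *\<^sub>R A i) =
    t DIM('a) *\<^sub>R kappa_all A - (\<Sum>j\<in>{1..<DIM('a)}. (t (Suc j) - t j) *\<^sub>R kappa A G j)"
proof -
  let ?r = "DIM('a)"
  have tl: "t (lev i) = t ?r - (\<Sum>j\<in>{1..<?r}. if A i \<in> G j then t (Suc j) - t j else 0)" for i
  proof -
    have "(\<Sum>j\<in>{1..<?r}. if A i \<in> G j then t (Suc j) - t j else 0) = (\<Sum>j\<in>{1..<?r}. if lev i \<le> j then t (Suc j) - t j else 0)"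
      using lev(2) by (intro sum.cong) auto
    also have "\<dots> = (\<Sum>j\<in>{j \<in> {1..<?r}. lev i \<le> j}. t (Suc j) - t j)"
      by (rule sum.inter_filter[symmetric]) simp
    also have "{j \<in> {1..<?r}. lev i \<le> j} = {lev i..<?r}" using lev(1)[of i] by auto
    also have "(\<Sum>j\<in>{lev i..<?r}. t (Suc j) - t j) = t ?r - t (lev i)"
      using lev(1)[of i] by (intro sum_Suc_diff') auto
    finally show ?thesis by simp
  qed
  have "(\<Sum>i\<in>UNIV. t (lev i) *\<^sub>R A i) =
      (\<Sum>i\<in>UNIV. t ?r *\<^sub>R A i - (\<Sum>j\<in>{1..<?r}. (if A i \<in> G j then t (Suc j) - t j else 0) *\<^sub>R A i))"
    by (subst tl) (simp only: scaleR_left_diff_distrib scaleR_left.sum)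
  also have "\<dots> = t ?r *\<^sub>R kappa_all A - (\<Sum>j\<in>{1..<?r}. \<Sum>i\<in>UNIV. (if A i \<in> G j then t (Suc j) - t j else 0) *\<^sub>R A i)"
    by (simp only: sum_subtractf kappa_all_def scaleR_sum_right sum.swap[of _ "{1..<?r}"])
  also have "(\<Sum>j\<in>{1..<?r}. \<Sum>i\<in>UNIV. (if A i \<in> G j then t (Suc j) - t j else 0) *\<^sub>R A i) =
      (\<Sum>j\<in>{1..<?r}. (t (Suc j) - t j) *\<^sub>R kappa A G j)"
    by (intro sum.cong refl) (simp add: kappa_def scaleR_sum_right if_distrib[of "\<lambda>c. c *\<^sub>R _"] sum.If_cases cong: if_cong)
  finally show ?thesis .
qed

lemma finite_bound_uniform:
  fixes P :: "'x \<Rightarrow> real \<Rightarrow> bool"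
  assumes "finite X" "\<And>x. x \<in> X \<Longrightarrow> \<exists>T. P x T" "\<And>x T T'. P x T \<Longrightarrow> T \<le> T' \<Longrightarrow> P x T'"
  shows "\<exists>T. \<forall>x\<in>X. P x T"
proof -
  obtain f where f: "\<And>x. x \<in> X \<Longrightarrow> P x (f x)" using assms(2) by metis
  have "P x (\<Sum>x\<in>X. \<bar>f x\<bar>)" if "x \<in> X" for x
  proof (rule assms(3)[OF f[OF that]])
    have "f x \<le> \<bar>f x\<bar>" by simp
    also have "\<dots> \<le> (\<Sum>x\<in>X. \<bar>f x\<bar>)" by (rule member_le_sum[OF that]) (use assms(1) in auto)
    finally show "f x \<le> (\<Sum>x\<in>X. \<bar>f x\<bar>)" .
  qed
  then show ?thesis by blast
qed

lemma cpair_nonzero: "A i \<noteq> 0 \<Longrightarrow> u \<in> U_set A \<Longrightarrow> norm (cpair (A i) u) > 0"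
  by (simp add: U_set_def)

text \<open>For the greedy flag at \<open>u\<close>, a form of level \<open>j\<close> has the size of the \<open>j\<close>-th chosen form
  up to a bounded factor: it is not smaller by the greedy choice, and not essentially larger
  because it is a combination of the first \<open>j\<close> chosen forms, whose sizes increase. Replacing
  \<open>log \<bar>\<alpha>\<^sub>i(u)\<bar>\<close> by the logarithmic size of the chosen form of the same level changes \<open>\<Psi>(u)\<close>
  by a bounded amount, and what remains is summed by \<open>flag_telescope\<close>.\<close>

lemma greedy_flag_estimate:
  fixes A :: "'n::finite \<Rightarrow> 'a::euclidean_space dual"
  assumes F: "F \<in> flags A" "flag_basis lam F \<gamma>" and pr: "projective A"
  shows "\<exists>R. \<forall>u\<in>U_set A. \<forall>sel. greedy A u sel DIM('a) \<longrightarrow>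
    norm (Psi A u - ((\<Sum>j\<in>{1..<DIM('a)}. (lsize A u (sel (Suc j)) - lsize A u (sel j)) *\<^sub>R kappa A (flag_of A sel) j)
       - lsize A u (sel DIM('a)) *\<^sub>R kappa_all A)) \<le> R"
proof -
  let ?r = "DIM('a)"
  let ?rep = "\<lambda>sel i j. representation (A ` sel ` {1..?r}) (A i) (A (sel j))"
  \<comment> \<open>a bound for the coefficients of all forms in all bases chosen among the forms, hence independent of \<open>u\<close>\<close>
  define C where "C = 1 + (\<Sum>sel\<in>{1..?r} \<rightarrow>\<^sub>E UNIV. \<Sum>i\<in>UNIV. \<Sum>j\<in>{1..?r}. \<bar>?rep sel i j\<bar>)"
  have Cge: "(\<Sum>j\<in>{1..?r}. \<bar>?rep sel i j\<bar>) \<le> C" for sel i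
  proof -
    let ?s = "restrict sel {1..?r}"
    have im: "?s ` {1..?r} = sel ` {1..?r}" by auto
    have "(\<Sum>j\<in>{1..?r}. \<bar>?rep sel i j\<bar>) = (\<Sum>j\<in>{1..?r}. \<bar>?rep ?s i j\<bar>)"
      unfolding im by (intro sum.cong) auto
    also have "\<dots> \<le> (\<Sum>i\<in>UNIV. \<Sum>j\<in>{1..?r}. \<bar>?rep ?s i j\<bar>)"
      by (rule member_le_sum) (auto intro: sum_nonneg)
    also have "\<dots> \<le> (\<Sum>sel\<in>{1..?r} \<rightarrow>\<^sub>E UNIV. \<Sum>i\<in>UNIV. \<Sum>j\<in>{1..?r}. \<bar>?rep sel i j\<bar>)"
      by (rule member_le_sum[of ?s]) (auto intro!: sum_nonneg finite_PiE)
    finally show ?thesis by (simp add: C_def)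
  qed
  have C1: "C \<ge> 1" by (simp add: C_def sum_nonneg)
  have A0: "A i \<noteq> 0" for i
    using pr unfolding projective_def by (metis less_irrefl zero_blinfun.rep_eq)
  let ?R = "ln C * (\<Sum>i\<in>UNIV. norm (A i))"
  show ?thesis
  proof (intro exI[of _ ?R] ballI allI impI)
    fix u sel assume u: "u \<in> U_set A" and g: "greedy A u sel ?r"
    define G where "G = flag_of A sel"
    have inj: "inj_on (A \<circ> sel) {1..?r}" and ind: "independent (A ` sel ` {1..?r})"
      using g by (simp_all add: greedy_def)
    have GF: "G \<in> flags A" unfolding G_def by (rule flag_of_flag[OF F inj ind])
    have Gj: "G j = span (A ` sel ` {1..j})" if "j \<le> ?r" for j using that by (simp add: G_def flag_of_def)
    have Gr: "G ?r = UNIV" and G0: "G 0 = {0}" using GF by (simp_all add: flags_def)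
    define lev where "lev i = (LEAST j. A i \<in> G j)" for i
    have levG: "A i \<in> G (lev i)" for i
      unfolding lev_def by (rule LeastI[of _ ?r]) (simp add: Gr)
    have lev_le: "lev i \<le> ?r" for i unfolding lev_def by (rule Least_le) (simp add: Gr)
    have lev1: "lev i \<ge> 1" for i
      using levG[of i] G0 A0[of i] by (cases "lev i") auto
    have mono: "G j \<subseteq> G k" if "j \<le> k" "k \<le> ?r" for j k
      using that by (simp add: Gj) (intro span_mono image_mono, auto)
    have lev: "A i \<in> G j \<longleftrightarrow> lev i \<le> j" if "j \<in> {1..?r}" for i j
      using mono[of "lev i" j] levG[of i] that unfolding lev_def by (auto intro: Least_le)
    have notprev: "A i \<notin> span (A ` sel ` {1..<lev i})" for i
    proof
      assume "A i \<in> span (A ` sel ` {1..<lev i})"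
      moreover have "{1..<lev i} = {1..lev i - 1}" using lev1[of i] by auto
      ultimately have "A i \<in> G (lev i - 1)" using lev_le[of i] by (simp add: Gj)
      then have "lev i \<le> lev i - 1" unfolding lev_def by (rule Least_le)
      then show False using lev1[of i] by simp
    qed
    have low: "lsize A u (sel (lev i)) \<le> lsize A u i" for i
      using g notprev[of i] lev1[of i] lev_le[of i] by (simp add: greedy_def)
    have selnot: "A (sel k) \<notin> span (A ` sel ` {1..<j})" if "j \<le> k" "k \<in> {1..?r}" for j k
    proof
      assume "A (sel k) \<in> span (A ` sel ` {1..<j})"
      moreover have "A ` sel ` {1..<j} \<subseteq> A ` sel ` {1..?r} - {A (sel k)}"
      proof
        fix x assume "x \<in> A ` sel ` {1..<j}"
        then obtain l where l: "l \<in> {1..<j}" "x = (A \<circ> sel) l" by auto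
        then have lr: "l \<in> {1..?r}" "l \<noteq> k" using that by auto
        then have "x \<noteq> (A \<circ> sel) k" using inj_onD[OF inj _ lr(1) that(2)] l(2) lr(2) by metis
        then show "x \<in> A ` sel ` {1..?r} - {A (sel k)}" using l(2) lr(1) by auto
      qed
      ultimately have "A (sel k) \<in> span (A ` sel ` {1..?r} - {A (sel k)})" using span_mono by blast
      then show False using ind that(2) unfolding dependent_def by blast
    qed
    have tmono: "lsize A u (sel j) \<le> lsize A u (sel k)" if "j \<le> k" "j \<in> {1..?r}" "k \<in> {1..?r}" for j k
      using g selnot[of j k] that by (simp add: greedy_def)
    have pos: "norm (cpair (A i) u) > 0" for i by (rule cpair_nonzero[OF A0 u])
    have up: "lsize A u i \<le> lsize A u (sel (lev i)) + ln C" for i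
    proof -
      let ?S = "A ` sel ` {1..?r}"
      let ?c = "\<lambda>j. ?rep sel i j"
      have Asum: "A i = (\<Sum>j\<in>{1..?r}. ?c j *\<^sub>R A (sel j))"
      proof -
        have "A i \<in> span ?S" using Gj[of ?r] Gr by simp
        then have "A i = (\<Sum>b\<in>?S. representation ?S (A i) b *\<^sub>R b)"
          using sum_representation_eq[OF ind, of "A i" ?S] by simp
        also have "\<dots> = (\<Sum>j\<in>{1..?r}. ?c j *\<^sub>R A (sel j))"
          using sum.reindex[OF inj, of "\<lambda>b. representation ?S (A i) b *\<^sub>R b"] by (simp add: image_comp o_def)
        finally show ?thesis .
      qed
      have c0: "?c j = 0" if "j \<in> {1..?r}" "lev i < j" for j
      proof -
        have sub: "A ` sel ` {1..lev i} \<subseteq> ?S" using lev_le by (intro image_mono) auto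
        have "A i \<in> span (A ` sel ` {1..lev i})" using levG Gj lev_le by metis
        then have "representation ?S (A i) = representation (A ` sel ` {1..lev i}) (A i)"
          by (rule representation_extend[OF ind _ sub])
        moreover have "A (sel j) \<notin> A ` sel ` {1..lev i}"
        proof
          assume "A (sel j) \<in> A ` sel ` {1..lev i}"
          then obtain l where l: "l \<in> {1..lev i}" "(A \<circ> sel) j = (A \<circ> sel) l" by auto
          then have "j = l" using lev_le[of i] that by (intro inj_onD[OF inj l(2)]) auto
          then show False using l(1) that(2) by simp
        qed
        ultimately show ?thesis by (metis representation_ne_zero)
      qed
      have "norm (cpair (A i) u) = norm (\<Sum>j\<in>{1..?r}. of_real (?c j) * cpair (A (sel j)) u)"
        by (subst Asum) (simp only: cpair_sum)
      also have "\<dots> \<le> (\<Sum>j\<in>{1..?r}. \<bar>?c j\<bar> * norm (cpair (A (sel (lev i))) u))"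
      proof (rule order_trans[OF norm_sum sum_mono])
        fix j assume j: "j \<in> {1..?r}"
        show "norm (of_real (?c j) * cpair (A (sel j)) u) \<le> \<bar>?c j\<bar> * norm (cpair (A (sel (lev i))) u)"
        proof (cases "lev i < j")
          case False
          then have "lsize A u (sel j) \<le> lsize A u (sel (lev i))"
            using tmono j lev1 lev_le by simp
          then have "norm (cpair (A (sel j)) u) \<le> norm (cpair (A (sel (lev i))) u)"
            using pos by (simp add: lsize_def)
          then show ?thesis by (simp add: norm_mult mult_left_mono)
        qed (use c0 j in simp)
      qed
      also have "\<dots> \<le> C * norm (cpair (A (sel (lev i))) u)"
        unfolding sum_distrib_right[symmetric] by (intro mult_right_mono Cge) simp
      finally have "ln (norm (cpair (A i) u)) \<le> ln (C * norm (cpair (A (sel (lev i))) u))"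
        using pos C1 by (subst ln_le_cancel_iff) auto
      then show ?thesis using pos C1 by (simp add: lsize_def ln_mult)
    qed
    define t where "t j = lsize A u (sel j)" for j
    have "Psi A u = - (\<Sum>i\<in>UNIV. t (lev i) *\<^sub>R A i) - (\<Sum>i\<in>UNIV. (lsize A u i - t (lev i)) *\<^sub>R A i)"
      by (simp add: Psi_def lsize_def scaleR_left_diff_distrib sum_subtractf)
    also have "(\<Sum>i\<in>UNIV. t (lev i) *\<^sub>R A i) =
        t ?r *\<^sub>R kappa_all A - (\<Sum>j\<in>{1..<?r}. (t (Suc j) - t j) *\<^sub>R kappa A G j)"
      by (rule flag_telescope) (use lev1 lev_le lev in auto)
    finally have "Psi A u - ((\<Sum>j\<in>{1..<?r}. (t (Suc j) - t j) *\<^sub>R kappa A G j) - t ?r *\<^sub>R kappa_all A) =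
        - (\<Sum>i\<in>UNIV. (lsize A u i - t (lev i)) *\<^sub>R A i)" by simp
    also have "norm \<dots> \<le> (\<Sum>i\<in>UNIV. ln C * norm (A i))"
      unfolding norm_minus_cancel
    proof (rule order_trans[OF norm_sum sum_mono])
      fix i
      have "\<bar>lsize A u i - t (lev i)\<bar> \<le> ln C" using low[of i] up[of i] by (simp add: t_def)
      then show "norm ((lsize A u i - t (lev i)) *\<^sub>R A i) \<le> ln C * norm (A i)"
        by (simp add: mult_right_mono)
    qed
    finally show "norm (Psi A u - ((\<Sum>j\<in>{1..<?r}. (lsize A u (sel (Suc j)) - lsize A u (sel j)) *\<^sub>R kappa A (flag_of A sel) j)
       - lsize A u (sel ?r) *\<^sub>R kappa_all A)) \<le> ?R"
      by (simp add: t_def G_def sum_distrib_left)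
  qed
qed

section \<open>Fibres far out on a regular ray\<close>

lemma flag_basis_facts:
  fixes \<gamma> :: "nat \<Rightarrow> 'a::euclidean_space dual"
  assumes "flag_basis lam F \<gamma>"
  shows "inj_on \<gamma> {1..DIM('a)}" "independent (\<gamma> ` {1..DIM('a)})"
    "\<And>j. j \<le> DIM('a) \<Longrightarrow> F j = span (\<gamma> ` {1..j})"
proof -
  note fb = assms[unfolded flag_basis_def]
  show "inj_on \<gamma> {1..DIM('a)}" "independent (\<gamma> ` {1..DIM('a)})"
    using fb by blast+
  show "F j = span (\<gamma> ` {1..j})" if "j \<le> DIM('a)" for j
    using fb[THEN conjunct2, THEN conjunct2, THEN conjunct1] that by blast
qed

lemma indexed_basis_expansion:
  fixes v :: "nat \<Rightarrow> 'v::real_vector"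
  assumes inj: "inj_on v {1..r}" and ind: "independent (v ` {1..r})" and j: "j \<le> r"
    and x: "x \<in> span (v ` {1..j})"
  shows "x = (\<Sum>k\<in>{1..r}. representation (v ` {1..r}) x (v k) *\<^sub>R v k)"
    and "\<And>k. k \<in> {1..r} \<Longrightarrow> j < k \<Longrightarrow> representation (v ` {1..r}) x (v k) = 0"
proof -
  let ?S = "v ` {1..r}"
  have sub: "v ` {1..j} \<subseteq> ?S" using j by (intro image_mono) auto
  have xs: "x \<in> span ?S" using x span_mono[OF sub] by blast
  have "x = (\<Sum>b\<in>?S. representation ?S x b *\<^sub>R b)"
    using sum_representation_eq[OF ind xs, of ?S] by simp
  then show "x = (\<Sum>k\<in>{1..r}. representation ?S x (v k) *\<^sub>R v k)"
    using sum.reindex[OF inj, of "\<lambda>b. representation ?S x b *\<^sub>R b"] by (simp add: o_def)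
  fix k assume k: "k \<in> {1..r}" "j < k"
  have "representation ?S x = representation (v ` {1..j}) x"
    by (rule representation_extend[OF ind x sub])
  moreover have "v k \<notin> v ` {1..j}"
  proof
    assume "v k \<in> v ` {1..j}"
    then obtain l where "l \<in> {1..j}" "v k = v l" by auto
    then have "k = l" using j k by (intro inj_onD[OF inj]) auto
    then show False using \<open>l \<in> {1..j}\<close> k by simp
  qed
  ultimately show "representation ?S x (v k) = 0" by (metis representation_ne_zero)
qed

lemma greedy_restrict:
  assumes "greedy A u sel n"
  shows "greedy A u (restrict sel {1..n}) n"
proof -
  let ?s = "restrict sel {1..n}"
  have im: "?s ` {1..<j} = sel ` {1..<j}" if "j \<in> {1..n}" for j
    using that by (intro image_cong) auto
  have im2: "?s ` {1..n} = sel ` {1..n}" by auto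
  have "inj_on (A \<circ> ?s) {1..n} \<longleftrightarrow> inj_on (A \<circ> sel) {1..n}" by (rule inj_on_cong) auto
  then show ?thesis using assms im unfolding greedy_def im2 by simp
qed

lemma greedy_increasing:
  assumes g: "greedy A u sel r" and j: "j \<in> {1..<r}"
  shows "lsize A u (sel j) \<le> lsize A u (sel (Suc j))"
proof -
  have inj: "inj_on (A \<circ> sel) {1..r}" and ind: "independent (A ` sel ` {1..r})"
    using g by (simp_all add: greedy_def)
  have "A (sel (Suc j)) \<notin> span (A ` sel ` {1..<j})"
  proof
    assume "A (sel (Suc j)) \<in> span (A ` sel ` {1..<j})"
    moreover have "A ` sel ` {1..<j} \<subseteq> A ` sel ` {1..r} - {A (sel (Suc j))}"
    proof
      fix x assume "x \<in> A ` sel ` {1..<j}"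
      then obtain l where l: "l \<in> {1..<j}" "x = (A \<circ> sel) l" by auto
      then have lr: "l \<in> {1..r}" "l \<noteq> Suc j" using j by auto
      then have "x \<noteq> (A \<circ> sel) (Suc j)" using inj_onD[OF inj _ lr(1), of "Suc j"] l(2) j lr(2) by fastforce
      then show "x \<in> A ` sel ` {1..r} - {A (sel (Suc j))}" using l(2) lr(1) by auto
    qed
    ultimately have "A (sel (Suc j)) \<in> span (A ` sel ` {1..r} - {A (sel (Suc j))})" using span_mono by blast
    moreover have "A (sel (Suc j)) \<in> A ` sel ` {1..r}" using j by auto
    ultimately show False using ind unfolding dependent_def by blast
  qed
  then show ?thesis using g j by (simp add: greedy_def)
qed

text \<open>The basis adapted to the flag is triangular in the chosen forms, with nonzero diagonal
  entries. When the chosen forms are well separated at \<open>u\<close>, the diagonal terms dominate.\<close>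

lemma large_gaps_imp_chamber:
  fixes A :: "'n::finite \<Rightarrow> 'a::euclidean_space dual"
  assumes \<gamma>: "flag_basis lam G \<gamma>" and pr: "projective A" and G: "G = flag_of A sel"
    and inj: "inj_on (A \<circ> sel) {1..DIM('a)}" and ind: "independent (A ` sel ` {1..DIM('a)})"
    and X: "X \<ge> 0"
  shows "\<exists>T. \<forall>u\<in>U_set A. (\<forall>j\<in>{1..<DIM('a)}. T \<le> lsize A u (sel (Suc j)) - lsize A u (sel j)) \<longrightarrow>
    (\<forall>j\<in>{1..DIM('a)}. cpair (\<gamma> j) u \<noteq> 0) \<and>
    (\<forall>j\<in>{1..<DIM('a)}. X * norm (cpair (\<gamma> j) u) < norm (cpair (\<gamma> (Suc j)) u))"
proof -
  let ?r = "DIM('a)"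
  let ?v = "A \<circ> sel"
  have ind': "independent (?v ` {1..?r})" using ind by (simp add: image_comp)
  have Gj: "G j = span (?v ` {1..j})" if "j \<le> ?r" for j
    using that by (simp add: G flag_of_def image_comp)
  note fb = flag_basis_facts[OF \<gamma>]
  define d where "d j k = representation (?v ` {1..?r}) (\<gamma> j) (?v k)" for j k
  have mem: "\<gamma> j \<in> span (?v ` {1..j})" if "j \<in> {1..?r}" for j
  proof -
    have "\<gamma> j \<in> span (\<gamma> ` {1..j})" using that by (intro span_base) auto
    then show ?thesis using fb(3)[of j] Gj[of j] that by simp
  qed
  have exp: "\<gamma> j = (\<Sum>k\<in>{1..?r}. d j k *\<^sub>R ?v k)" if "j \<in> {1..?r}" for j
    unfolding d_def by (rule indexed_basis_expansion(1)[OF inj ind' _ mem[OF that]]) (use that in auto)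
  have d0: "d j k = 0" if "j \<in> {1..?r}" "k \<in> {1..?r}" "j < k" for j k
    unfolding d_def by (rule indexed_basis_expansion(2)[OF inj ind' _ mem[OF that(1)] that(2,3)]) (use that in auto)
  have dj: "d j j \<noteq> 0" if j: "j \<in> {1..?r}" for j
  proof
    assume z: "d j j = 0"
    have "\<gamma> j \<in> span (?v ` {1..j - 1})"
      unfolding exp[OF j]
    proof (rule span_sum)
      fix k assume k: "k \<in> {1..?r}"
      show "d j k *\<^sub>R ?v k \<in> span (?v ` {1..j - 1})"
      proof (cases "k < j")
        case True
        then show ?thesis using k by (intro span_scale span_base) auto
      next
        case False
        then have "d j k = 0" using z d0[OF j k] by (cases "k = j") auto
        then show ?thesis by (simp add: span_zero)
      qed
    qed
    moreover have "j - 1 \<le> ?r" using j by auto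
    ultimately have "\<gamma> j \<in> span (\<gamma> ` {1..j - 1})" using fb(3) Gj by metis
    moreover have "\<gamma> ` {1..j - 1} \<subseteq> \<gamma> ` {1..?r} - {\<gamma> j}"
    proof
      fix x assume "x \<in> \<gamma> ` {1..j - 1}"
      then obtain l where l: "l \<in> {1..j - 1}" "x = \<gamma> l" by auto
      then have lr: "l \<in> {1..?r}" "l \<noteq> j" using j by auto
      then have "\<gamma> l \<noteq> \<gamma> j" using inj_onD[OF fb(1) _ lr(1) j] by blast
      then show "x \<in> \<gamma> ` {1..?r} - {\<gamma> j}" using l(2) lr(1) by auto
    qed
    ultimately have "\<gamma> j \<in> span (\<gamma> ` {1..?r} - {\<gamma> j})" using span_mono by blast
    then show False using fb(2) j unfolding dependent_def by blast
  qed
  define D where "D = 1 + (\<Sum>j\<in>{1..?r}. \<Sum>k\<in>{1..?r}. \<bar>d j k\<bar>)"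
  have Dj: "(\<Sum>k\<in>{1..?r}. \<bar>d j k\<bar>) \<le> D" if "j \<in> {1..?r}" for j
    using member_le_sum[OF that, of "\<lambda>j. \<Sum>k\<in>{1..?r}. \<bar>d j k\<bar>"] by (simp add: D_def sum_nonneg)
  have D1: "D \<ge> 1" by (simp add: D_def sum_nonneg)
  define \<delta> where "\<delta> = Min ((\<lambda>j. \<bar>d j j\<bar>) ` {1..?r})"
  have r1: "?r \<ge> 1" by (simp add: Suc_leI)
  have \<delta>: "\<delta> > 0" "\<And>j. j \<in> {1..?r} \<Longrightarrow> \<delta> \<le> \<bar>d j j\<bar>"
  proof -
    have "\<delta> \<in> (\<lambda>j. \<bar>d j j\<bar>) ` {1..?r}" unfolding \<delta>_def using r1 by (intro Min_in) auto
    then show "\<delta> > 0" using dj by auto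
  qed (simp add: \<delta>_def)
  have "((\<lambda>T. (max X 1 * D) * exp (- T)) \<longlongrightarrow> (max X 1 * D) * 0) at_top"
    by (intro tendsto_mult tendsto_const filterlim_compose[OF exp_at_bot] filterlim_uminus_at_bot_at_top)
  then have "\<forall>\<^sub>F T in at_top. (max X 1 * D) * exp (- T) < \<delta> / 2"
    by (rule order_tendstoD) (use \<delta>(1) in simp)
  then have "\<forall>\<^sub>F T in at_top. (max X 1 * D) * exp (- T) < \<delta> / 2 \<and> T \<ge> 0"
    using eventually_ge_at_top by (rule eventually_conj)
  then obtain T where T: "(max X 1 * D) * exp (- T) < \<delta> / 2" "T \<ge> 0"
    using eventually_happens'[OF trivial_limit_at_top_linorder] by blast
  have "X * D * exp (- T) \<le> (max X 1 * D) * exp (- T)" "1 * D * exp (- T) \<le> (max X 1 * D) * exp (- T)"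
    using D1 by (intro mult_right_mono; simp)+
  then have T12: "X * D * exp (- T) < \<delta> / 2" "D * exp (- T) < \<delta> / 2" using T(1) by linarith+
  have A0: "A i \<noteq> 0" for i
    using pr unfolding projective_def by (metis less_irrefl zero_blinfun.rep_eq)
  show ?thesis
  proof (intro exI[of _ T] ballI impI)
    fix u assume u: "u \<in> U_set A" and gaps: "\<forall>j\<in>{1..<?r}. T \<le> lsize A u (sel (Suc j)) - lsize A u (sel j)"
    define s where "s k = norm (cpair (A (sel k)) u)" for k
    have s0: "s k > 0" for k unfolding s_def by (rule cpair_nonzero[OF A0 u])
    have step: "s j \<le> exp (- T) * s (Suc j)" if "j \<in> {1..<?r}" for j
    proof -
      have "ln (s j) \<le> - T + ln (s (Suc j))" using gaps that by (force simp: lsize_def s_def)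
      then have "exp (ln (s j)) \<le> exp (- T + ln (s (Suc j)))" by simp
      also have "\<dots> = exp (- T) * s (Suc j)" using s0[of "Suc j"] by (simp only: exp_add exp_ln)
      finally show ?thesis using s0[of j] by simp
    qed
    have e1: "exp (- T) \<le> 1" using T(2) by simp
    have mono: "s k \<le> s j" if "k \<le> j" "k \<in> {1..?r}" "j \<in> {1..?r}" for k j
      using that
    proof (induction j rule: dec_induct)
      case (step n)
      have "s n \<le> exp (- T) * s (Suc n)" by (rule \<open>\<And>j. j \<in> {1..<?r} \<Longrightarrow> s j \<le> exp (- T) * s (Suc j)\<close>) (use step in auto)
      also have "\<dots> \<le> 1 * s (Suc n)" using e1 s0[of "Suc n"] by (intro mult_right_mono) auto
      finally show ?case using step by simp
    qed simp
    have lower: "s k \<le> exp (- T) * s j" if kj: "k < j" "k \<in> {1..?r}" "j \<in> {1..?r}" for k j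
    proof -
      have "s k \<le> s (j - 1)" using kj by (intro mono) auto
      also have "\<dots> \<le> exp (- T) * s (Suc (j - 1))" using kj by (intro step) auto
      finally show ?thesis using kj by simp
    qed
    have ex: "cpair (\<gamma> j) u = (\<Sum>k\<in>{1..?r}. of_real (d j k) * cpair (A (sel k)) u)" if "j \<in> {1..?r}" for j
      by (subst exp[OF that]) (simp add: cpair_sum)
    have upper: "norm (cpair (\<gamma> j) u) \<le> D * s j" if j: "j \<in> {1..?r}" for j
    proof -
      have "norm (cpair (\<gamma> j) u) \<le> (\<Sum>k\<in>{1..?r}. \<bar>d j k\<bar> * s j)"
        unfolding ex[OF j]
      proof (rule order_trans[OF norm_sum sum_mono])
        fix k assume k: "k \<in> {1..?r}"
        show "norm (of_real (d j k) * cpair (A (sel k)) u) \<le> \<bar>d j k\<bar> * s j"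
        proof (cases "j < k")
          case True
          then show ?thesis using d0[OF j k] by simp
        next
          case False
          then have "s k \<le> s j" using k j by (intro mono) auto
          then show ?thesis by (simp add: norm_mult s_def mult_left_mono)
        qed
      qed
      also have "\<dots> \<le> D * s j"
        unfolding sum_distrib_right[symmetric] using s0[of j] by (intro mult_right_mono Dj j) auto
      finally show ?thesis .
    qed
    have low: "\<delta> / 2 * s j < norm (cpair (\<gamma> j) u)" if j: "j \<in> {1..?r}" for j
    proof -
      have split: "cpair (\<gamma> j) u = of_real (d j j) * cpair (A (sel j)) u +
          (\<Sum>k\<in>{1..?r} - {j}. of_real (d j k) * cpair (A (sel k)) u)"
        unfolding ex[OF j] using j by (intro sum.remove) auto
      have "norm (\<Sum>k\<in>{1..?r} - {j}. of_real (d j k) * cpair (A (sel k)) u) \<le> (\<Sum>k\<in>{1..?r} - {j}. \<bar>d j k\<bar> * (exp (- T) * s j))"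
      proof (rule order_trans[OF norm_sum sum_mono])
        fix k assume k: "k \<in> {1..?r} - {j}"
        show "norm (of_real (d j k) * cpair (A (sel k)) u) \<le> \<bar>d j k\<bar> * (exp (- T) * s j)"
        proof (cases "j < k")
          case True
          then show ?thesis using d0[OF j, of k] k by simp
        next
          case False
          then have "s k \<le> exp (- T) * s j" using k j by (intro lower) auto
          then show ?thesis unfolding norm_mult norm_of_real s_def by (rule mult_left_mono) simp
        qed
      qed
      also have "\<dots> \<le> (\<Sum>k\<in>{1..?r}. \<bar>d j k\<bar> * (exp (- T) * s j))"
        using s0[of j] by (intro sum_mono2) auto
      also have "\<dots> \<le> D * (exp (- T) * s j)"
        unfolding sum_distrib_right[symmetric] using s0[of j] by (intro mult_right_mono Dj j) auto
      also have "\<dots> < \<delta> / 2 * s j"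
        using T12(2) s0[of j] mult_strict_right_mono[of "D * exp (- T)" "\<delta> / 2" "s j"] by simp
      finally have rest: "norm (\<Sum>k\<in>{1..?r} - {j}. of_real (d j k) * cpair (A (sel k)) u) < \<delta> / 2 * s j" .
      have "\<delta> * s j \<le> norm (of_real (d j j) * cpair (A (sel j)) u)"
        using \<delta>(2)[OF j] s0[of j] by (simp add: norm_mult s_def mult_right_mono)
      then show ?thesis
        using rest norm_diff_ineq[of "of_real (d j j) * cpair (A (sel j)) u"
            "\<Sum>k\<in>{1..?r} - {j}. of_real (d j k) * cpair (A (sel k)) u"]
        unfolding split by linarith
    qed
    show "(\<forall>j\<in>{1..?r}. cpair (\<gamma> j) u \<noteq> 0) \<and>
      (\<forall>j\<in>{1..<?r}. X * norm (cpair (\<gamma> j) u) < norm (cpair (\<gamma> (Suc j)) u))"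
    proof (intro conjI ballI)
      fix j assume j: "j \<in> {1..?r}"
      have "0 < \<delta> / 2 * s j" using \<delta>(1) s0[of j] by simp
      then show "cpair (\<gamma> j) u \<noteq> 0" using low[OF j] by auto
    next
      fix j assume j: "j \<in> {1..<?r}"
      have "X * norm (cpair (\<gamma> j) u) \<le> X * (D * s j)" using upper[of j] j X by (intro mult_left_mono) auto
      also have "\<dots> \<le> X * (D * (exp (- T) * s (Suc j)))" using step[OF j] X D1 by (intro mult_left_mono) auto
      also have "\<dots> \<le> \<delta> / 2 * s (Suc j)"
        using T12(1) s0[of "Suc j"] mult_right_mono[of "X * D * exp (- T)" "\<delta> / 2" "s (Suc j)"] by (simp add: mult.assoc)
      also have "\<dots> < norm (cpair (\<gamma> (Suc j)) u)" using j by (intro low) auto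
      finally show "X * norm (cpair (\<gamma> j) u) < norm (cpair (\<gamma> (Suc j)) u)" .
    qed
  qed
qed

text \<open>Let \<open>G\<close> be the greedy flag at \<open>u\<close>. By \<open>greedy_flag_estimate\<close> the vector \<open>\<xi> = \<Psi>(u)/c\<close>
  is within \<open>R/c\<close> of a combination of the \<open>\<kappa>\<^sup>G\<^sub>j\<close> whose coefficients are the gaps between
  the sizes of the chosen forms, divided by \<open>c\<close>. For large \<open>c\<close> this combination is itself
  regular, since regularity is an open condition, so that the gaps exceed \<open>c * \<tau>\<close>. Hence \<open>u\<close>
  lies deep in the chamber of \<open>G\<close>; as the chambers are disjoint and \<open>u\<close> lies in that of \<open>F\<close>,
  the flags coincide.\<close>

lemma deep_fibers:
  fixes A :: "'n::finite \<Rightarrow> 'a::euclidean_space dual"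
  assumes basis: "\<And>G. G \<in> flags A \<Longrightarrow> flag_basis lam G (\<gamma> G)" and pr: "projective A" and \<tau>: "\<tau> > 0" and N: "N > 0"
    and disj: "\<And>G. G \<in> flags A \<Longrightarrow> F \<noteq> G \<Longrightarrow> UFN (\<gamma> F) N \<inter> UFN (\<gamma> G) N = {}"
    and F: "F \<in> flags A" and reg: "tau_regular A \<tau> \<xi>"
  shows "\<exists>c0. \<forall>c\<ge>c0. \<forall>u\<in>U_set A \<inter> UFN (\<gamma> F) N. Psi A u = c *\<^sub>R \<xi> \<longrightarrow>
    (\<forall>j\<in>{1..<DIM('a)}. X * norm (cpair (\<gamma> F j) u) < norm (cpair (\<gamma> F (Suc j)) u))"
proof -
  let ?r = "DIM('a)"
  have r1: "?r \<ge> 1" by (simp add: Suc_leI)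
  \<comment> \<open>at least \<open>N\<close>, so that the separation obtained for \<open>G\<close> places \<open>u\<close> in the chamber of \<open>G\<close>\<close>
  define X' where "X' = max 0 (max X N)"
  obtain e where e: "e > 0" "\<And>\<xi>'. dist \<xi>' \<xi> < e \<Longrightarrow> tau_regular A \<tau> \<xi>'"
    using tau_regular_open[of A \<tau>] reg unfolding open_dist by blast
  obtain R where R: "\<And>u sel. u \<in> U_set A \<Longrightarrow> greedy A u sel ?r \<Longrightarrow>
    norm (Psi A u - ((\<Sum>j\<in>{1..<?r}. (lsize A u (sel (Suc j)) - lsize A u (sel j)) *\<^sub>R kappa A (flag_of A sel) j)
       - lsize A u (sel ?r) *\<^sub>R kappa_all A)) \<le> R"
    using greedy_flag_estimate[OF F basis[OF F] pr] by blast
  let ?P = "\<lambda>sel T. inj_on (A \<circ> sel) {1..?r} \<and> independent (A ` sel ` {1..?r}) \<longrightarrow>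
    (\<forall>u\<in>U_set A. (\<forall>j\<in>{1..<?r}. T \<le> lsize A u (sel (Suc j)) - lsize A u (sel j)) \<longrightarrow>
      (\<forall>j\<in>{1..?r}. cpair (\<gamma> (flag_of A sel) j) u \<noteq> 0) \<and>
      (\<forall>j\<in>{1..<?r}. X' * norm (cpair (\<gamma> (flag_of A sel) j) u) < norm (cpair (\<gamma> (flag_of A sel) (Suc j)) u)))"
  have "\<exists>T. \<forall>sel\<in>{1..?r} \<rightarrow>\<^sub>E UNIV. ?P sel T"
  proof (rule finite_bound_uniform)
    show "finite ({1..?r} \<rightarrow>\<^sub>E (UNIV :: 'n set))" by (intro finite_PiE) auto
    show "\<exists>T. ?P sel T" for sel
    proof (cases "inj_on (A \<circ> sel) {1..?r} \<and> independent (A ` sel ` {1..?r})")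
      case True
      have "flag_of A sel \<in> flags A" using True by (intro flag_of_flag[OF F basis[OF F]]) auto
      from large_gaps_imp_chamber[OF basis[OF this] pr refl, of X'] True
      show ?thesis by (simp add: X'_def)
    qed blast
    show "?P sel T'" if "?P sel T" "T \<le> T'" for sel T T'
    proof (intro impI ballI)
      fix u
      assume a: "inj_on (A \<circ> sel) {1..?r} \<and> independent (A ` sel ` {1..?r})" "u \<in> U_set A"
        "\<forall>j\<in>{1..<?r}. T' \<le> lsize A u (sel (Suc j)) - lsize A u (sel j)"
      have "\<forall>j\<in>{1..<?r}. T \<le> lsize A u (sel (Suc j)) - lsize A u (sel j)"
        using a(3) that(2) by force
      then show "(\<forall>j\<in>{1..?r}. cpair (\<gamma> (flag_of A sel) j) u \<noteq> 0) \<and>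
        (\<forall>j\<in>{1..<?r}. X' * norm (cpair (\<gamma> (flag_of A sel) j) u) < norm (cpair (\<gamma> (flag_of A sel) (Suc j)) u))"
        by (rule mp[OF bspec[OF mp[OF that(1) a(1)] a(2)]])
    qed
  qed
  then obtain T where T: "\<forall>sel\<in>{1..?r} \<rightarrow>\<^sub>E UNIV. ?P sel T" by (rule exE)
  define c0 where "c0 = max 1 (max (\<bar>R\<bar> / e + 1) (T / \<tau>))"
  show ?thesis
  proof (intro exI[of _ c0] allI impI ballI)
    fix c u j assume c: "c0 \<le> c" and u: "u \<in> U_set A \<inter> UFN (\<gamma> F) N" and Psi: "Psi A u = c *\<^sub>R \<xi>" and j: "j \<in> {1..<?r}"
    have c1: "c \<ge> 1" "\<bar>R\<bar> / e < c" "T / \<tau> \<le> c" using c by (auto simp: c0_def)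
    obtain sel0 where "greedy A u sel0 ?r" using greedy_exists[OF F basis[OF F] order_refl] by blast
    then have g: "greedy A u (restrict sel0 {1..?r}) ?r" by (rule greedy_restrict)
    define sel where "sel = restrict sel0 {1..?r}"
    have sel: "sel \<in> {1..?r} \<rightarrow>\<^sub>E UNIV" and g: "greedy A u sel ?r" using g by (auto simp: sel_def)
    have inj: "inj_on (A \<circ> sel) {1..?r}" and ind: "independent (A ` sel ` {1..?r})"
      using g by (simp_all add: greedy_def)
    define G where "G = flag_of A sel"
    have G: "G \<in> flags A" unfolding G_def by (rule flag_of_flag[OF F basis[OF F] inj ind])
    let ?gap = "\<lambda>j. lsize A u (sel (Suc j)) - lsize A u (sel j)"
    let ?\<eta> = "(\<Sum>j\<in>{1..<?r}. ?gap j *\<^sub>R kappa A G j) - lsize A u (sel ?r) *\<^sub>R kappa_all A"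
    let ?m = "\<lambda>j. if j = ?r then - lsize A u (sel ?r) / c else ?gap j / c"
    have \<eta>m: "(1 / c) *\<^sub>R ?\<eta> = (\<Sum>j\<in>{1..?r}. ?m j *\<^sub>R kappa A G j)"
      unfolding sum_split_top[OF r1] kappa_top[OF G]
      by (simp add: scaleR_diff_right scaleR_sum_right divide_inverse mult.commute)
    have "c *\<^sub>R (\<xi> - (1 / c) *\<^sub>R ?\<eta>) = Psi A u - ?\<eta>"
      using c1(1) Psi by (simp add: scaleR_diff_right)
    then have "norm (c *\<^sub>R (\<xi> - (1 / c) *\<^sub>R ?\<eta>)) \<le> R"
      using R[OF _ g] u by (simp add: G_def)
    then have "c * dist \<xi> ((1 / c) *\<^sub>R ?\<eta>) \<le> \<bar>R\<bar>" using c1(1) by (simp add: dist_norm)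
    moreover have "\<bar>R\<bar> < c * e" using c1(2) e(1) by (simp add: divide_less_eq)
    ultimately have "c * dist \<xi> ((1 / c) *\<^sub>R ?\<eta>) < c * e" by linarith
    then have "dist ((1 / c) *\<^sub>R ?\<eta>) \<xi> < e" using c1(1) by (simp add: dist_commute)
    then have reg': "tau_regular A \<tau> ((1 / c) *\<^sub>R ?\<eta>)" by (rule e(2))
    have at: "G \<in> flags_at A ((1 / c) *\<^sub>R ?\<eta>)"
      unfolding flags_at_iff \<eta>m using G greedy_increasing[OF g] c1(1)
      by (intro conjI CollectI exI[of _ ?m]) auto
    have gapT: "T \<le> ?gap k" if k: "k \<in> {1..<?r}" for k
    proof -
      have "?m k > \<tau>" by (rule tau_regularD[OF reg' at \<eta>m k])
      then have "\<tau> * c < ?gap k" using k c1(1) by (simp add: pos_less_divide_eq)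
      moreover have "T \<le> \<tau> * c" using c1(3) \<tau> by (simp add: divide_le_eq mult.commute)
      ultimately show ?thesis by linarith
    qed
    have res: "(\<forall>j\<in>{1..?r}. cpair (\<gamma> G j) u \<noteq> 0) \<and>
      (\<forall>j\<in>{1..<?r}. X' * norm (cpair (\<gamma> G j) u) < norm (cpair (\<gamma> G (Suc j)) u))"
      unfolding G_def
      by (rule mp[OF bspec[OF mp[OF bspec[OF T sel] conjI[OF inj ind]] IntD1[OF u]]]) (intro ballI gapT)
    have le: "Y * norm (cpair (\<gamma> G k) u) < norm (cpair (\<gamma> G (Suc k)) u)" if "k \<in> {1..<?r}" "Y \<le> X'" for k Y
      using mult_right_mono[OF that(2), of "norm (cpair (\<gamma> G k) u)"] res that(1) by fastforce
    have "u \<in> UFN (\<gamma> G) N"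
      unfolding UFN_def using res le[of _ N] N by (auto simp: X'_def)
    then have "G = F" using disj[OF G] u by blast
    then show "X * norm (cpair (\<gamma> F j) u) < norm (cpair (\<gamma> F (Suc j)) u)"
      using le[OF j, of X] by (simp add: X'_def)
  qed
qed

section \<open>Coordinates indexed by the dimension\<close>

text \<open>A linearly ordered type with as many elements as the dimension, so that coordinate
  systems become vectors and square matrices and \<open>wedge\<close> becomes a determinant.\<close>

typedef (overloaded) 'a idx = "{1..DIM('a::euclidean_space)}" morphisms nt mk
  by (rule exI[of _ 1]) (simp add: Suc_leI)

instantiation idx :: (euclidean_space) linorder
begin
definition less_eq_idx :: "'a idx \<Rightarrow> 'a idx \<Rightarrow> bool" where "less_eq_idx k l \<longleftrightarrow> nt k \<le> nt l"
definition less_idx :: "'a idx \<Rightarrow> 'a idx \<Rightarrow> bool" where "less_idx k l \<longleftrightarrow> nt k < nt l"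
instance
  by standard (auto simp: less_eq_idx_def less_idx_def nt_inject)
end

lemma bij_nt: "bij_betw nt (UNIV :: 'a::euclidean_space idx set) {1..DIM('a)}"
proof (rule bij_betwI[where g = mk])
  show "nt \<in> (UNIV :: 'a idx set) \<rightarrow> {1..DIM('a)}" by (rule Pi_I) (rule nt)
  show "mk (nt k) = k" for k :: "'a idx" by (rule nt_inverse)
  show "nt (mk j :: 'a idx) = j" if "j \<in> {1..DIM('a)}" for j using that by (rule mk_inverse)
qed simp

instance idx :: (euclidean_space) finite
proof
  show "finite (UNIV :: 'a idx set)"
    using bij_betw_finite[OF bij_nt[where 'a = 'a]] by simp
qed

instance idx :: (euclidean_space) wellorder
proof
  fix P :: "'a idx \<Rightarrow> bool" and k
  assume step: "\<And>k. (\<And>l. l < k \<Longrightarrow> P l) \<Longrightarrow> P k"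
  have "\<forall>k. nt k = n \<longrightarrow> P k" for n
  proof (induction n rule: less_induct)
    case (less n)
    show ?case
    proof (intro allI impI)
      fix k :: "'a idx" assume k: "nt k = n"
      show "P k"
      proof (rule step)
        fix l :: "'a idx" assume "l < k"
        then have "nt l < n" using k by (simp add: less_idx_def)
        from less[rule_format, OF this refl] show "P l" .
      qed
    qed
  qed
  then show "P k" by blast
qed

lemma card_idx: "CARD('a::euclidean_space idx) = DIM('a)"
  using bij_betw_same_card[OF bij_nt[where 'a = 'a]] by simp

lemma nt_range: "nt (k :: 'a::euclidean_space idx) \<in> {1..DIM('a)}"
  by (rule nt)

lemma nt_mk: "j \<in> {1..DIM('a)} \<Longrightarrow> nt (mk j :: 'a::euclidean_space idx) = j"
  by (rule mk_inverse)

lemma sum_nt: "(\<Sum>k\<in>(UNIV :: 'a::euclidean_space idx set). f (nt k)) = (\<Sum>j\<in>{1..DIM('a)}. f j)"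
  by (rule sum.reindex_bij_betw[OF bij_nt])

lemma prod_nt: "(\<Prod>k\<in>(UNIV :: 'a::euclidean_space idx set). f (nt k)) = (\<Prod>j\<in>{1..DIM('a)}. f j)"
  by (rule prod.reindex_bij_betw[OF bij_nt])

lemma wedge_det:
  fixes \<eta> :: "nat \<Rightarrow> 'v \<Rightarrow> 'c::comm_ring_1"
  shows "wedge DIM('a::euclidean_space) \<eta> v = det ((\<chi> k l. \<eta> (nt k) (v (nt l))) :: 'c ^ 'a idx ^ 'a idx)"
proof -
  let ?U = "UNIV :: 'a idx set"
  let ?M = "map_permutation ?U (nt :: 'a idx \<Rightarrow> nat)"
  have inj: "inj (nt :: 'a idx \<Rightarrow> nat)" and im: "range (nt :: 'a idx \<Rightarrow> nat) = {1..DIM('a)}"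
    using bij_nt[where 'a = 'a] by (auto simp: bij_betw_def)
  have ap: "?M p (nt k) = nt (p k)" for p and k :: "'a idx"
    by (simp add: map_permutation_def restrict_id_def inv_into_f_f[OF inj])
  have bij: "bij_betw ?M {p. p permutes ?U} {q. q permutes {1..DIM('a)}}"
  proof (rule bij_betwI')
    fix p q :: "'a idx \<Rightarrow> 'a idx"
    show "?M p = ?M q \<longleftrightarrow> p = q"
    proof
      assume "?M p = ?M q"
      then have "nt (p k) = nt (q k)" for k using ap by metis
      then show "p = q" by (simp add: fun_eq_iff nt_inject)
    qed simp
  next
    fix p :: "'a idx \<Rightarrow> 'a idx" assume "p \<in> {p. p permutes ?U}"
    then show "?M p \<in> {q. q permutes {1..DIM('a)}}"
      using map_permutation_permutes[OF bij_nt[where 'a = 'a], of p] by simp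
  next
    fix q assume q: "q \<in> {q. q permutes {1..DIM('a)}}"
    let ?p = "\<lambda>k :: 'a idx. mk (q (nt k)) :: 'a idx"
    have ntp: "nt (?p k) = q (nt k)" for k
    proof (rule nt_mk)
      show "q (nt k) \<in> {1..DIM('a)}"
        using q nt_range[of k] permutes_in_image[of q "{1..DIM('a)}" "nt k"] by blast
    qed
    have "inj ?p"
    proof (rule injI)
      fix k l assume "?p k = ?p l"
      then have "q (nt k) = q (nt l)" using ntp by metis
      then show "k = l" using q permutes_inj nt_inject by (metis injD mem_Collect_eq)
    qed
    then have "bij ?p" by (simp add: bij_def finite_UNIV_inj_surj)
    then have "?p permutes ?U" by (rule bij_imp_permutes) auto
    moreover have "q = ?M ?p"
    proof
      fix j
      show "q j = ?M ?p j"
      proof (cases "j \<in> {1..DIM('a)}")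
        case True
        then obtain k :: "'a idx" where "j = nt k" using im True by (metis rangeE)
        then show ?thesis by (simp add: ap ntp)
      next
        case False
        then have "q j = j" using q permutes_not_in[of q "{1..DIM('a)}" j] by simp
        moreover have "j \<notin> range (nt :: 'a idx \<Rightarrow> nat)" using False im by simp
        ultimately show ?thesis by (simp only: map_permutation_def restrict_id_def if_False)
      qed
    qed
    ultimately show "\<exists>p\<in>{p. p permutes ?U}. q = ?M p" by blast
  qed
  have "wedge DIM('a) \<eta> v = (\<Sum>p | p permutes ?U. of_int (sign (?M p)) * (\<Prod>j\<in>{1..DIM('a)}. \<eta> j (v (?M p j))))"
    unfolding wedge_def by (rule sum.reindex_bij_betw[OF bij, symmetric])
  also have "\<dots> = (\<Sum>p | p permutes ?U. of_int (sign p) * (\<Prod>k\<in>?U. \<eta> (nt k) (v (nt (p k)))))"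
  proof (rule sum.cong[OF refl])
    fix p assume p: "p \<in> {p. p permutes ?U}"
    have "sign (?M p) = sign p" using p inj by (intro sign_map_permutation) auto
    moreover have "(\<Prod>j\<in>{1..DIM('a)}. \<eta> j (v (?M p j))) = (\<Prod>k\<in>?U. \<eta> (nt k) (v (nt (p k))))"
      using prod_nt[where 'a = 'a, of "\<lambda>j. \<eta> j (v (?M p j))"] by (simp add: ap)
    ultimately show "of_int (sign (?M p)) * (\<Prod>j\<in>{1..DIM('a)}. \<eta> j (v (?M p j))) =
      of_int (sign p) * (\<Prod>k\<in>?U. \<eta> (nt k) (v (nt (p k))))" by simp
  qed
  finally show ?thesis by (simp add: det_def)
qed

lemma measurable_idx:
  "(\<lambda>\<theta>. (\<chi> k. \<theta> (nt k)) :: real ^ 'a::euclidean_space idx) \<in>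
    measurable (Pi\<^sub>M {1..DIM('a)} (\<lambda>_. lborel)) borel"
proof -
  let ?P = "Pi\<^sub>M {1..DIM('a)} (\<lambda>_. lborel) :: (nat \<Rightarrow> real) measure"
  have "(\<lambda>\<theta>. \<theta> (nt k)) \<in> borel_measurable ?P" for k :: "'a idx"
    using measurable_component_singleton[OF nt_range[of k], of "\<lambda>_. lborel"] by simp
  then have "(\<lambda>\<theta>. \<Sum>k\<in>UNIV. \<theta> (nt k) *\<^sub>R axis k 1 :: real ^ 'a idx) \<in> borel_measurable ?P"
    by (intro borel_measurable_sum borel_measurable_scaleR borel_measurable_const)
  moreover have "(\<lambda>\<theta>. \<Sum>k\<in>UNIV. \<theta> (nt k) *\<^sub>R axis k 1 :: real ^ 'a idx) = (\<lambda>\<theta>. \<chi> k. \<theta> (nt k))"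
    by (simp add: fun_eq_iff vec_eq_iff axis_def if_distrib[of "\<lambda>c. _ * c"] cong: if_cong)
  ultimately show ?thesis by simp
qed

lemma lborel_idx:
  "(lborel :: (real ^ 'a::euclidean_space idx) measure) =
    distr (Pi\<^sub>M {1..DIM('a)} (\<lambda>_. lborel)) borel (\<lambda>\<theta>. \<chi> k. \<theta> (nt k))"
proof (rule lborel_eqI)
  let ?P = "Pi\<^sub>M {1..DIM('a)} (\<lambda>_. lborel) :: (nat \<Rightarrow> real) measure"
  let ?f = "\<lambda>\<theta> :: nat \<Rightarrow> real. (\<chi> k. \<theta> (nt k)) :: real ^ 'a idx"
  interpret product_sigma_finite "\<lambda>_ :: nat. lborel :: real measure" by standard
  have meas: "?f \<in> measurable ?P borel" by (rule measurable_idx)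
  fix l u :: "real ^ 'a idx"
  assume le: "\<And>b. b \<in> Basis \<Longrightarrow> l \<bullet> b \<le> u \<bullet> b"
  have lek: "l $ k \<le> u $ k" for k using le[of "axis k 1"] by (simp add: inner_axis axis_in_Basis_iff)
  have "?f -` box l u \<inter> space ?P = ({1..DIM('a)} \<rightarrow>\<^sub>E UNIV) \<inter> {\<theta>. \<forall>k. \<theta> (nt k) \<in> {l $ k<..<u $ k}}"
    by (auto simp: space_PiM mem_box_cart)
  also have "\<dots> = (\<Pi>\<^sub>E j\<in>{1..DIM('a)}. {l $ mk j<..<u $ mk j})"
  proof (intro equalityI subsetI)
    fix \<theta> assume t: "\<theta> \<in> ({1..DIM('a)} \<rightarrow>\<^sub>E UNIV) \<inter> {\<theta>. \<forall>k. \<theta> (nt k) \<in> {l $ k<..<u $ k}}"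
    have "\<theta> j \<in> {l $ mk j<..<u $ mk j}" if "j \<in> {1..DIM('a)}" for j
      using t nt_mk[OF that] by (metis (mono_tags, lifting) IntD2 mem_Collect_eq)
    then show "\<theta> \<in> (\<Pi>\<^sub>E j\<in>{1..DIM('a)}. {l $ mk j<..<u $ mk j})" using t by (auto simp: PiE_iff)
  next
    fix \<theta> assume t: "\<theta> \<in> (\<Pi>\<^sub>E j\<in>{1..DIM('a)}. {l $ mk j<..<u $ mk j})"
    have "\<theta> (nt k) \<in> {l $ k<..<u $ k}" for k
      using PiE_mem[OF t nt_range[of k]] by (simp only: nt_inverse)
    then show "\<theta> \<in> ({1..DIM('a)} \<rightarrow>\<^sub>E UNIV) \<inter> {\<theta>. \<forall>k. \<theta> (nt k) \<in> {l $ k<..<u $ k}}"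
      using t by (auto simp: PiE_iff)
  qed
  finally have "emeasure (distr ?P borel ?f) (box l u) = emeasure ?P (\<Pi>\<^sub>E j\<in>{1..DIM('a)}. {l $ mk j<..<u $ mk j})"
    by (subst emeasure_distr[OF meas]) auto
  also have "\<dots> = (\<Prod>j\<in>{1..DIM('a)}. emeasure lborel {l $ mk j<..<u $ mk j})"
    by (rule emeasure_PiM) auto
  also have "\<dots> = (\<Prod>j\<in>{1..DIM('a)}. ennreal (u $ mk j - l $ mk j))"
    using lek by (intro prod.cong) auto
  also have "\<dots> = (\<Prod>k\<in>(UNIV :: 'a idx set). ennreal (u $ k - l $ k))"
    using prod_nt[where 'a = 'a, of "\<lambda>j. ennreal (u $ mk j - l $ mk j)"] by (simp add: nt_inverse)
  also have "\<dots> = ennreal (\<Prod>k\<in>(UNIV :: 'a idx set). u $ k - l $ k)"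
    using lek by (intro prod_ennreal) auto
  also have "(\<Prod>k\<in>(UNIV :: 'a idx set). u $ k - l $ k) = (\<Prod>b\<in>Basis. (u - l) \<bullet> b)"
    by (simp add: Basis_vec_def UNION_singleton_eq_range prod.reindex inj_on_def axis_eq_axis inner_axis)
  finally show "emeasure (distr ?P borel ?f) (box l u) = ennreal (\<Prod>b\<in>Basis. (u - l) \<bullet> b)" .
qed simp

text \<open>Reindexing the coordinates carries the product measure to Lebesgue measure on
  vectors.\<close>

lemma PiM_torus_integral:
  fixes h :: "real ^ 'a::euclidean_space idx \<Rightarrow> complex"
  assumes cont: "continuous_on UNIV h"
    and f: "\<And>\<theta>. \<theta> \<in> {1..DIM('a)} \<rightarrow>\<^sub>E {0..2*pi} \<Longrightarrow> f \<theta> = h (\<chi> k. \<theta> (nt k))"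
  shows "(LINT \<theta>:({1..DIM('a)} \<rightarrow>\<^sub>E {0..2*pi})|(Pi\<^sub>M {1..DIM('a)} (\<lambda>_. lborel)). f \<theta>) = integral tcube h"
proof -
  let ?P = "Pi\<^sub>M {1..DIM('a)} (\<lambda>_. lborel) :: (nat \<Rightarrow> real) measure"
  let ?f = "\<lambda>\<theta> :: nat \<Rightarrow> real. (\<chi> k. \<theta> (nt k)) :: real ^ 'a idx"
  have meas: "?f \<in> measurable ?P borel" by (rule measurable_idx)
  have hm [measurable]: "h \<in> borel_measurable borel" using cont by (rule borel_measurable_continuous_onI)
  have tm: "(tcube :: (real ^ 'a idx) set) \<in> sets borel" by (simp add: tcube_def)
  have mem: "\<theta> \<in> {1..DIM('a)} \<rightarrow>\<^sub>E {0..2*pi} \<longleftrightarrow> ?f \<theta> \<in> tcube" if "\<theta> \<in> space ?P" for \<theta>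
  proof
    assume t: "\<theta> \<in> {1..DIM('a)} \<rightarrow>\<^sub>E {0..2*pi}"
    have "\<theta> (nt k) \<in> {0..2*pi}" for k :: "'a idx" using PiE_mem[OF t nt_range[of k]] .
    then show "?f \<theta> \<in> tcube" by (simp add: tcube_def mem_box_cart)
  next
    assume t: "?f \<theta> \<in> tcube"
    have "\<theta> j \<in> {0..2*pi}" if "j \<in> {1..DIM('a)}" for j
    proof -
      have "0 \<le> ?f \<theta> $ mk j \<and> ?f \<theta> $ mk j \<le> 2 * pi" using t by (simp add: tcube_def mem_box_cart)
      then show ?thesis by (simp add: nt_mk[OF that])
    qed
    then show "\<theta> \<in> {1..DIM('a)} \<rightarrow>\<^sub>E {0..2*pi}" using that by (auto simp: space_PiM PiE_iff)
  qed
  have "(LINT \<theta>:({1..DIM('a)} \<rightarrow>\<^sub>E {0..2*pi})|?P. f \<theta>) = (LINT \<theta>|?P. indicator tcube (?f \<theta>) *\<^sub>R h (?f \<theta>))"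
    unfolding set_lebesgue_integral_def
  proof (rule Bochner_Integration.integral_cong[OF refl])
    fix \<theta> assume t: "\<theta> \<in> space ?P"
    show "indicator ({1..DIM('a)} \<rightarrow>\<^sub>E {0..2*pi}) \<theta> *\<^sub>R f \<theta> = indicator tcube (?f \<theta>) *\<^sub>R h (?f \<theta>)"
      using mem[OF t] f[of \<theta>] by (cases "\<theta> \<in> {1..DIM('a)} \<rightarrow>\<^sub>E {0..2*pi}") simp_all
  qed
  also have "\<dots> = (LINT \<theta>|distr ?P borel ?f. indicator tcube \<theta> *\<^sub>R h \<theta>)"
    by (rule integral_distr[OF meas, symmetric]) (use tm in measurable)
  also have "\<dots> = (LINT \<theta>:tcube|lborel. h \<theta>)"
    by (simp only: lborel_idx set_lebesgue_integral_def)
  also have "\<dots> = integral tcube h"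
  proof (rule set_borel_integral_eq_integral(2))
    show "set_integrable lborel tcube h"
      unfolding set_integrable_def using cont
      by (intro borel_integrable_compact continuous_on_subset[OF cont]) (auto simp: tcube_def)
  qed
  finally show ?thesis .
qed

section \<open>The chamber of a proper flag in adapted coordinates\<close>

text \<open>One proper flag \<open>F\<close> with its adapted basis \<open>g\<close>. In the coordinates \<open>CC\<close> given by \<open>g\<close>,
  the forms have the coefficients \<open>cf\<close>, their levels in the flag are \<open>ld\<close>, the exponents of
  the \<open>p\<^sub>j\<close> are \<open>ne\<close>, and the chamber \<open>UFN g NN\<close> is the Reinhardt domain with logarithmic
  image \<open>Om\<close> (\<open>chamber_iff\<close>).\<close>

locale flag_data =
  fixes A :: "'n::finite \<Rightarrow> 'a::euclidean_space dual" and lam :: "nat \<Rightarrow> 'a" and g :: "nat \<Rightarrow> 'a dual"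
    and F :: "nat \<Rightarrow> 'a dual set" and NN :: real
  assumes A_nz: "A i \<noteq> 0" and flag: "F \<in> flags A" and basis: "flag_basis lam F g"
    and integral_lam: "j \<in> {1..DIM('a)} \<Longrightarrow> A i (lam j) \<in> \<int>"
    and NN: "NN > 0" and UFN_sub: "UFN g NN \<subseteq> U_set A"
    and nonsing: "u \<in> UFN g NN \<Longrightarrow>
      bij_betw (\<lambda>v. \<lambda>j\<in>{1..DIM('a)}. dp A (lam j) u v) UNIV ({1..DIM('a)} \<rightarrow>\<^sub>E UNIV)"
    and proper: "proper_flag A F"
begin

definition cf :: "'n \<Rightarrow> 'a idx \<Rightarrow> real" where
  "cf i k = representation (g ` {1..DIM('a)}) (A i) (g (nt k))"

definition ld :: "'n \<Rightarrow> 'a idx" where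
  "ld i = Max {k. cf i k \<noteq> 0}"

definition ne :: "'n \<Rightarrow> 'a idx \<Rightarrow> int" where
  "ne i j = \<lfloor>A i (lam (nt j))\<rfloor>"

definition Om :: "(real, 'a idx) vec set" where
  "Om = {\<eta>. \<forall>k l. nt l = Suc (nt k) \<longrightarrow> ln NN < \<eta> $ l - \<eta> $ k}"

definition Co :: "'a \<Rightarrow> (real, 'a idx) vec" where
  "Co x = (\<chi> k. g (nt k) x)"

definition CC :: "'a cplx \<Rightarrow> (complex, 'a idx) vec" where
  "CC u = (\<chi> k. cpair (g (nt k)) u)"

lemma g_facts: "inj_on g {1..DIM('a)}" "independent (g ` {1..DIM('a)})" "j \<le> DIM('a) \<Longrightarrow> F j = span (g ` {1..j})"
  using flag_basis_facts[OF basis] by auto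

lemma span_g: "span (g ` {1..DIM('a)}) = UNIV"
  using g_facts(3)[of "DIM('a)"] flag by (simp add: flags_def)

lemma dual_expansion: "\<gamma> = (\<Sum>k\<in>UNIV. representation (g ` {1..DIM('a)}) \<gamma> (g (nt (k :: 'a idx))) *\<^sub>R g (nt k))"
  using indexed_basis_expansion(1)[OF g_facts(1,2) order_refl, of \<gamma>, unfolded span_g, OF UNIV_I]
    sum_nt[where 'a = 'a, of "\<lambda>j. representation (g ` {1..DIM('a)}) \<gamma> (g j) *\<^sub>R g j"] by (simp add: span_g)

lemma A_expansion: "A i = (\<Sum>k\<in>UNIV. cf i k *\<^sub>R g (nt k))"
  unfolding cf_def by (rule dual_expansion)

lemma ld_props: "cf i (ld i) \<noteq> 0" "ld i < k \<Longrightarrow> cf i k = 0"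
proof -
  have "{k. cf i k \<noteq> 0} \<noteq> {}"
  proof
    assume "{k. cf i k \<noteq> 0} = {}"
    then have "\<And>k. cf i k = 0" by auto
    then have "A i = 0" by (subst A_expansion) simp
    then show False using A_nz by simp
  qed
  then have "ld i \<in> {k. cf i k \<noteq> 0}" unfolding ld_def by (intro Max_in) auto
  then show "cf i (ld i) \<noteq> 0" by simp
  show "ld i < k \<Longrightarrow> cf i k = 0"
  proof (rule ccontr)
    assume "ld i < k" "cf i k \<noteq> 0"
    then have "k \<le> ld i" unfolding ld_def by (intro Max_ge) auto
    then show False using \<open>ld i < k\<close> by simp
  qed
qed

lemma A_mem_flag: "A i \<in> F (nt k) \<longleftrightarrow> ld i \<le> k"
proof
  have Fk: "F (nt k) = span (g ` {1..nt k})" using g_facts(3) nt_range[of k] by simp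
  assume "A i \<in> F (nt k)"
  then have m: "A i \<in> span (g ` {1..nt k})" using Fk by simp
  show "ld i \<le> k"
  proof (rule ccontr)
    assume "\<not> ld i \<le> k"
    then have "nt k < nt (ld i)" by (simp add: not_le less_idx_def)
    then have "cf i (ld i) = 0"
      unfolding cf_def using indexed_basis_expansion(2)[OF g_facts(1,2) _ m nt_range[of "ld i"]] nt_range[of k] by simp
    then show False using ld_props(1) by simp
  qed
next
  have Fk: "F (nt k) = span (g ` {1..nt k})" using g_facts(3) nt_range[of k] by simp
  assume le: "ld i \<le> k"
  show "A i \<in> F (nt k)"
    unfolding Fk
  proof (subst A_expansion, rule span_sum)
    fix l :: "'a idx"
    show "cf i l *\<^sub>R g (nt l) \<in> span (g ` {1..nt k})"
    proof (cases "ld i < l")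
      case True
      then show ?thesis by (simp add: ld_props(2) span_zero)
    next
      case False
      then have "nt l \<le> nt k" using le by (simp add: not_less less_eq_idx_def)
      then show ?thesis using nt_range[of l] by (intro span_scale span_base) auto
    qed
  qed
qed

lemma form_CC: "form cf i (CC u) = cpair (A i) u"
  by (subst A_expansion) (simp add: form_def CC_def cpair_sum)

lemma CC_nth [simp]: "CC u $ k = cpair (g (nt k)) u"
  by (simp add: CC_def)

lemma CC_cvec: "CC u = cvec (Co (fst u)) (Co (snd u))"
  by (simp add: vec_eq_iff Co_def cpair_def)

lemma Co_linear: "linear Co"
  by (rule linearI) (simp_all add: Co_def vec_eq_iff blinfun.add_right blinfun.scaleR_right)

lemma Co_inj: "inj Co"
  unfolding linear_injective_0[OF Co_linear]
proof (intro allI impI)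
  fix x assume x: "Co x = 0"
  have z: "g (nt k) x = 0" for k :: "'a idx"
  proof -
    have "Co x $ k = 0" using x by simp
    then show ?thesis by (simp add: Co_def)
  qed
  have "blinfun_inner_right x x = 0"
    by (subst dual_expansion[of "blinfun_inner_right x"]) (simp only: blinfun.sum_left blinfun.scaleR_left z scaleR_zero_right sum.neutral_const)
  then show "x = 0" by simp
qed

lemma Co_surj: "surj Co"
proof -
  have "dim (range Co) = dim (UNIV :: 'a set)"
    by (rule dim_image_eq[OF Co_linear]) (use Co_inj in simp)
  also have "\<dots> = DIM((real, 'a idx) vec)" by (simp add: card_idx)
  finally have "span (range Co) = UNIV" by (simp only: dim_eq_full)
  moreover have "span (range Co) = range Co"
    by (simp only: span_eq_iff linear_subspace_image[OF Co_linear subspace_UNIV])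
  ultimately show ?thesis by simp
qed

definition Ci :: "(real, 'a idx) vec \<Rightarrow> 'a" where
  "Ci = inv Co"

lemma Co_Ci [simp]: "Co (Ci y) = y" and Ci_Co [simp]: "Ci (Co x) = x"
  using Co_inj Co_surj by (simp_all add: Ci_def surj_f_inv_f)

lemma Ci_linear: "linear Ci"
proof (rule linearI)
  show "Ci (x + y) = Ci x + Ci y" for x y
    by (rule injD[OF Co_inj]) (simp add: linear_add[OF Co_linear])
  show "Ci (c *\<^sub>R x) = c *\<^sub>R Ci x" for c x
    by (rule injD[OF Co_inj]) (simp add: linear_scale[OF Co_linear])
qed

definition CCi :: "(complex, 'a idx) vec \<Rightarrow> 'a cplx" where
  "CCi x = (Ci (re_vec x), Ci (im_vec x))"

lemma CC_CCi [simp]: "CC (CCi x) = x" and CCi_CC [simp]: "CCi (CC u) = u"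
  by (simp_all add: CC_cvec CCi_def)

lemma CC_bounded_linear: "bounded_linear CC"
  by (rule linear_conv_bounded_linear[THEN iffD1], rule linearI)
     (simp_all add: vec_eq_iff complex_eq_iff cpair_def blinfun.add_right blinfun.scaleR_right)

lemma CCi_bounded_linear: "bounded_linear CCi"
proof (rule linear_conv_bounded_linear[THEN iffD1], rule linearI)
  have inj: "u = v" if "CC u = CC v" for u v using that by (metis CCi_CC)
  show "CCi (x + y) = CCi x + CCi y" for x y
    by (rule inj) (simp add: linear_add[OF bounded_linear.linear[OF CC_bounded_linear]] del: CC_nth)
  show "CCi (c *\<^sub>R x) = c *\<^sub>R CCi x" for c x
    by (rule inj) (simp add: linear_scale[OF bounded_linear.linear[OF CC_bounded_linear]] del: CC_nth)
qed

lemma CCi_mult_i: "CCi (\<i> *s x) = mult_i (CCi x)"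
proof -
  have "re_vec (\<i> *s x) = - im_vec x" "im_vec (\<i> *s x) = re_vec x" by (simp_all add: vec_eq_iff)
  then show ?thesis by (simp add: CCi_def mult_i_def linear_neg[OF Ci_linear])
qed

lemma Om_open: "open Om"
proof -
  have "Om = (\<Inter>k. \<Inter>l. {\<eta>. nt l = Suc (nt k) \<longrightarrow> ln NN < \<eta> $ l - \<eta> $ k})"
    by (auto simp: Om_def)
  also have "open \<dots>"
    by (intro open_INT ballI finite_UNIV open_Collect_imp open_Collect_less continuous_intros) auto
  finally show ?thesis .
qed

lemma Om_convex: "convex Om"
proof (rule convexI)
  fix x y :: "(real, 'a idx) vec" and s t :: real
  assume *: "x \<in> Om" "y \<in> Om" "0 \<le> s" "0 \<le> t" "s + t = 1"
  show "s *\<^sub>R x + t *\<^sub>R y \<in> Om"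
    unfolding Om_def
  proof (intro CollectI allI impI)
    fix k l :: "'a idx" assume "nt l = Suc (nt k)"
    then have "ln NN < x $ l - x $ k" "ln NN < y $ l - y $ k" using * by (auto simp: Om_def)
    then have "ln NN < s * (x $ l - x $ k) + t * (y $ l - y $ k)"
      using *(3-5) convex_bound_lt[of "- (x $ l - x $ k)" "- ln NN" "- (y $ l - y $ k)" s t] by linarith
    then show "ln NN < (s *\<^sub>R x + t *\<^sub>R y) $ l - (s *\<^sub>R x + t *\<^sub>R y) $ k"
      by (simp add: algebra_simps)
  qed
qed

lemma chamber_iff: "CC u \<in> log_domain Om \<longleftrightarrow> u \<in> UFN g NN"
proof -
  have key: "ln NN < ln (norm b) - ln (norm a) \<longleftrightarrow> NN * norm a < norm b" if "a \<noteq> 0" "b \<noteq> 0" for a b :: complex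
  proof -
    have "ln NN < ln (norm b) - ln (norm a) \<longleftrightarrow> ln (NN * norm a) < ln (norm b)"
      using NN that by (simp add: ln_mult less_diff_eq)
    then show ?thesis using NN that by simp
  qed
  show ?thesis
  proof
    assume u: "CC u \<in> log_domain Om"
    have nz: "cpair (g j) u \<noteq> 0" if "j \<in> {1..DIM('a)}" for j
      using u nt_mk[OF that] by (simp add: log_domain_def) metis
    have "NN * norm (cpair (g j) u) < norm (cpair (g (Suc j)) u)" if j: "j \<in> {1..<DIM('a)}" for j
    proof -
      have j1: "j \<in> {1..DIM('a)}" "Suc j \<in> {1..DIM('a)}" using j by auto
      have "ln NN < logv (CC u) $ mk (Suc j) - logv (CC u) $ mk j"
        using u nt_mk[OF j1(1)] nt_mk[OF j1(2)] by (simp add: log_domain_def Om_def)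
      then show ?thesis using key nz j1 by (simp add: logv_def nt_mk)
    qed
    then show "u \<in> UFN g NN" using nz NN by (simp add: UFN_def)
  next
    assume u: "u \<in> UFN g NN"
    have nz: "cpair (g (nt k)) u \<noteq> 0" for k :: "'a idx" using u nt_range[of k] by (simp add: UFN_def)
    have "ln NN < logv (CC u) $ l - logv (CC u) $ k" if "nt l = Suc (nt k)" for k l
    proof -
      have "nt k \<in> {1..<DIM('a)}" using nt_range[of k] nt_range[of l] that by simp
      then have "NN * norm (cpair (g (nt k)) u) < norm (cpair (g (nt l)) u)" using u that by (simp add: UFN_def)
      then show ?thesis using key nz by (simp add: logv_def)
    qed
    then show "CC u \<in> log_domain Om" using nz by (simp add: log_domain_def Om_def)
  qed
qed

lemma form_nz_chamber: "x \<in> log_domain Om \<Longrightarrow> form cf i x \<noteq> 0"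
proof -
  assume "x \<in> log_domain Om"
  then have "CCi x \<in> UFN g NN" by (metis CC_CCi chamber_iff)
  then have "cpair (A i) (CCi x) \<noteq> 0" using UFN_sub by (auto simp: U_set_def)
  then show ?thesis by (metis form_CC CC_CCi)
qed

lemma flag_chart: "flag_chart cf ld Om (ln NN)"
proof
  show "deepset (ln NN) \<subseteq> Om" by (auto simp: deepset_def Om_def less_idx_def)
qed (use ld_props Om_open Om_convex form_nz_chamber in auto)

lemma p_fun_eq: "p_fun A (lam (nt j)) u = prod_map cf ne (CC u) $ j"
  by (simp add: p_fun_def prod_map_def form_CC ne_def)

lemma dp_eq:
  assumes "u \<in> U_set A"
  shows "dp A (lam (nt j)) u v =
    prod_map cf ne (CC u) $ j * (\<Sum>i\<in>UNIV. of_int (ne i j) * form cf i (CC v) / form cf i (CC u))"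
proof -
  have nz: "form cf i (CC u) \<noteq> 0" for i using assms by (simp add: form_CC U_set_def)
  have "((\<lambda>u. prod_map cf ne (CC u) $ j) has_derivative
    (\<lambda>v. prod_map cf ne (CC u) $ j * (\<Sum>i\<in>UNIV. of_int (ne i j) * form cf i (CC v) / form cf i (CC u)))) (at u)"
    using has_derivative_compose[OF bounded_linear_imp_has_derivative[OF CC_bounded_linear] prod_map_has_derivative[OF nz, where j = j]] by simp
  then have "frechet_derivative (\<lambda>u. prod_map cf ne (CC u) $ j) (at u) =
    (\<lambda>v. prod_map cf ne (CC u) $ j * (\<Sum>i\<in>UNIV. of_int (ne i j) * form cf i (CC v) / form cf i (CC u)))"
    by (rule frechet_derivative_at[symmetric])
  moreover have "p_fun A (lam (nt j)) = (\<lambda>u. prod_map cf ne (CC u) $ j)" by (simp add: fun_eq_iff p_fun_eq)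
  ultimately show ?thesis by (simp add: dp_def)
qed

lemma p_nz: "u \<in> U_set A \<Longrightarrow> prod_map cf ne (CC u) $ j \<noteq> 0"
  by (simp add: prod_map_def form_CC U_set_def)

lemma dlog_surj:
  assumes u: "u \<in> UFN g NN"
  obtains v where "\<And>j. (\<Sum>i\<in>UNIV. of_int (ne i j) * form cf i (CC v) / form cf i (CC u)) = y j"
proof -
  have uU: "u \<in> U_set A" using u UFN_sub by blast
  let ?z = "\<lambda>j\<in>{1..DIM('a)}. prod_map cf ne (CC u) $ (mk j) * y (mk j)"
  have "?z \<in> {1..DIM('a)} \<rightarrow>\<^sub>E UNIV" by auto
  then obtain v where v: "(\<lambda>j\<in>{1..DIM('a)}. dp A (lam j) u v) = ?z"
    using nonsing[OF u] unfolding bij_betw_def by (metis (no_types, lifting) imageE)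
  have "(\<Sum>i\<in>UNIV. of_int (ne i j) * form cf i (CC v) / form cf i (CC u)) = y j" for j
  proof -
    have "dp A (lam (nt j)) u v = prod_map cf ne (CC u) $ j * y j"
      using fun_cong[OF v, of "nt j"] nt_range[of j] by (simp add: nt_inverse)
    then show ?thesis using p_nz[OF uU, of j] by (simp add: dp_eq[OF uU])
  qed
  then show thesis by (rule that)
qed

lemma UFN_nonempty: "\<exists>u. u \<in> UFN g NN"
proof -
  define \<eta> :: "(real, 'a idx) vec" where "\<eta> = (\<chi> k. (\<bar>ln NN\<bar> + 1) * real (nt k))"
  have "\<eta> \<in> Om" by (auto simp: Om_def \<eta>_def algebra_simps)
  then have "expv (cvec \<eta> 0) \<in> log_domain Om" by simp
  then have "CCi (expv (cvec \<eta> 0)) \<in> UFN g NN" by (metis CC_CCi chamber_iff)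
  then show ?thesis by blast
qed

lemma of_int_ne: "of_int (ne i j) = A i (lam (nt j))"
  using integral_lam[OF nt_range[of j], of i] by (auto simp: ne_def elim: Ints_cases)

text \<open>A relation among the \<open>\<lambda>\<^sub>j\<close> would be a relation among the forms \<open>dp\<^sub>j/p\<^sub>j\<close> at each
  point of the chamber, where these are independent.\<close>

lemma lam_relation:
  assumes "(\<Sum>k\<in>UNIV. c k *\<^sub>R lam (nt (k :: 'a idx))) = 0"
  shows "c k0 = 0"
proof -
  obtain u where u: "u \<in> UFN g NN" using UFN_nonempty by blast
  obtain v where v: "\<And>j. (\<Sum>i\<in>UNIV. of_int (ne i j) * form cf i (CC v) / form cf i (CC u)) = (if j = k0 then 1 else 0)"
    using dlog_surj[OF u, of "\<lambda>j. if j = k0 then 1 else 0"] by blast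
  have z: "(\<Sum>k\<in>UNIV. of_real (c k) * of_int (ne i k)) = (0 :: complex)" for i
  proof -
    have "(\<Sum>k\<in>UNIV. of_real (c k) * of_int (ne i k)) = (of_real (\<Sum>k\<in>UNIV. c k * of_int (ne i k)) :: complex)" by simp
    also have "(\<Sum>k\<in>UNIV. c k * of_int (ne i k)) = A i (\<Sum>k\<in>UNIV. c k *\<^sub>R lam (nt k))"
      by (simp add: of_int_ne blinfun.sum_right blinfun.scaleR_right)
    finally show ?thesis using assms by simp
  qed
  have "of_real (c k0) = (\<Sum>j\<in>UNIV. of_real (c j) * (\<Sum>i\<in>UNIV. of_int (ne i j) * form cf i (CC v) / form cf i (CC u)))"
    unfolding v by (simp add: if_distrib[of "\<lambda>x. _ * x"] cong: if_cong)
  also have "\<dots> = (\<Sum>i\<in>UNIV. (\<Sum>j\<in>UNIV. of_real (c j) * of_int (ne i j)) * (form cf i (CC v) / form cf i (CC u)))"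
    unfolding sum_distrib_left sum_distrib_right by (subst sum.swap) (simp add: mult_ac)
  also have "\<dots> = 0" by (simp only: z mult_zero_left sum.neutral_const)
  finally show ?thesis by simp
qed

lemma lam_independent: "inj_on lam {1..DIM('a)} \<and> independent (lam ` {1..DIM('a)})"
  unfolding family_independent[OF finite_atLeastAtMost]
proof (intro allI impI ballI)
  fix c j assume c: "(\<Sum>i\<in>{1..DIM('a)}. c i *\<^sub>R lam i) = 0" and j: "j \<in> {1..DIM('a)}"
  have "(\<Sum>k\<in>UNIV. c (nt (k :: 'a idx)) *\<^sub>R lam (nt k)) = 0"
    using c sum_nt[where 'a = 'a, of "\<lambda>i. c i *\<^sub>R lam i"] by simp
  from lam_relation[of "\<lambda>k. c (nt k)", OF this, of "mk j"] show "c j = 0" by (simp add: nt_mk[OF j])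
qed

lemma lam_span: "span (lam ` {1..DIM('a)}) = UNIV"
proof -
  have "card (lam ` {1..DIM('a)}) = DIM('a)" using lam_independent by (simp add: card_image)
  then have "dim (lam ` {1..DIM('a)}) = DIM('a)" using lam_independent dim_eq_card_independent by metis
  then show ?thesis by (simp only: dim_eq_full)
qed

lemma lam_expansion: "x = (\<Sum>k\<in>UNIV. representation (lam ` {1..DIM('a)}) x (lam (nt (k :: 'a idx))) *\<^sub>R lam (nt k))"
  using indexed_basis_expansion(1)[of lam "DIM('a)" "DIM('a)" x] lam_independent lam_span
    sum_nt[where 'a = 'a, of "\<lambda>j. representation (lam ` {1..DIM('a)}) x (lam j) *\<^sub>R lam j"] by simp

text \<open>The pairing of the \<open>\<kappa>\<^sub>k\<close> of the flag with the lattice basis; the sign of its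
  determinant is \<open>\<nu>(F)\<close>.\<close>

definition Km :: "((real, 'a idx) vec, 'a idx) vec" where
  "Km = (\<chi> j k. kappa A F (nt k) (lam (nt j)))"

lemma det_Km: "det Km \<noteq> 0"
proof
  assume "det Km = 0"
  then have "\<not> invertible Km" by (simp add: invertible_det_nz)
  then obtain c where c: "Km *v c = 0" "c \<noteq> 0"
    using matrix_left_invertible_ker[of Km] invertible_left_inverse by blast
  let ?\<gamma> = "\<Sum>k\<in>UNIV. c $ k *\<^sub>R kappa A F (nt k)"
  have "?\<gamma> (lam (nt j)) = 0" for j :: "'a idx"
  proof -
    have "(Km *v c) $ j = 0" using c(1) by simp
    then show ?thesis by (simp add: Km_def matrix_vector_mult_def blinfun.sum_left blinfun.scaleR_left mult.commute)
  qed
  then have "?\<gamma> x = 0" for x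
    by (subst lam_expansion[of x]) (simp only: blinfun.sum_right blinfun.scaleR_right scaleR_zero_right sum.neutral_const)
  then have "?\<gamma> = 0" by (intro blinfun_eqI) simp
  then have "(\<Sum>j\<in>{1..DIM('a)}. c $ mk j *\<^sub>R kappa A F j) = 0"
    using sum_nt[where 'a = 'a, of "\<lambda>j. c $ mk j *\<^sub>R kappa A F j"] by (simp add: nt_inverse)
  moreover have "\<forall>c. (\<Sum>j\<in>{1..DIM('a)}. c j *\<^sub>R kappa A F j) = 0 \<longrightarrow> (\<forall>j\<in>{1..DIM('a)}. c j = 0)"
    using proper family_independent[of "{1..DIM('a)}" "kappa A F"] unfolding proper_flag_def by simp
  ultimately have "\<forall>j\<in>{1..DIM('a)}. c $ mk j = 0" by (auto dest: spec[of _ "\<lambda>j. c $ mk j"])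
  then have "c $ k = 0" for k using nt_range[of k] nt_inverse[of k] by metis
  then show False using c(2) by (simp add: vec_eq_iff)
qed

lemma B_eq: "flag_chart.B ne ld = (\<chi> j k. \<Sum>i | ld i = k. of_int (ne i j))"
  by (rule flag_chart.B_def[OF flag_chart])

definition Up :: "((real, 'a idx) vec, 'a idx) vec" where
  "Up = (\<chi> l k. if l \<le> k then 1 else 0)"

text \<open>The vector \<open>\<kappa>\<^sub>k\<close> is the sum of the forms of level at most \<open>k\<close>, whereas the \<open>k\<close>-th
  column of \<open>B\<close> collects the forms of level exactly \<open>k\<close>.\<close>

lemma Km_eq: "Km = flag_chart.B ne ld ** Up"
proof -
  have "kappa A F (nt k) (lam (nt j)) = (\<Sum>l\<in>UNIV. (\<Sum>i | ld i = l. of_int (ne i j)) * (if l \<le> k then 1 else 0))" for j k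
  proof -
    have "kappa A F (nt k) (lam (nt j)) = (\<Sum>i | ld i \<le> k. of_int (ne i j))"
      by (simp add: kappa_def blinfun.sum_left of_int_ne A_mem_flag)
    also have "\<dots> = (\<Sum>i\<in>UNIV. if ld i \<le> k then of_int (ne i j) else 0)"
      by (simp add: sum.If_cases)
    also have "\<dots> = (\<Sum>l\<in>UNIV. \<Sum>i | ld i = l. if ld i \<le> k then of_int (ne i j) else 0)"
      using sum.group[of "UNIV :: 'n set" "UNIV :: 'a idx set" ld "\<lambda>i. if ld i \<le> k then of_int (ne i j) else (0 :: real)"] by simp
    also have "\<dots> = (\<Sum>l\<in>UNIV. (\<Sum>i | ld i = l. of_int (ne i j)) * (if l \<le> k then 1 else 0))"
      by (intro sum.cong refl) auto
    finally show ?thesis .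
  qed
  then show ?thesis by (simp add: Km_def Up_def B_eq matrix_matrix_mult_def)
qed

lemma det_Up: "det Up = 1"
  by (subst det_upperdiagonal) (auto simp: Up_def)

lemma det_B: "det (flag_chart.B ne ld) = det Km"
  by (simp add: Km_eq det_mul det_Up)

lemma nonsingular_chart: "nonsingular_chart cf ne ld Om (ln NN)"
proof -
  interpret flag_chart cf ne ld Om "ln NN" by (rule flag_chart)
  show ?thesis by unfold_locales (use det_B det_Km in simp)
qed

text \<open>The wedge product of the \<open>\<kappa>\<^sub>k\<close> is \<open>det Km\<close> times the volume form of the lattice basis,
  and \<open>det Km = det B\<close> because the triangular matrix \<open>Up\<close> has determinant 1.\<close>

lemma nu_eq: "of_int (nu A lam F) = sgn (det (flag_chart.B ne ld))"
proof -
  let ?rep = "\<lambda>x. representation (lam ` {1..DIM('a)}) x"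
  have d: "dvol lam v = det (\<chi> k l. ?rep (v (nt l)) (lam (nt (k :: 'a idx))))" for v
    unfolding dvol_def by (rule wedge_det)
  have w: "wedge DIM('a) (\<lambda>j. blinfun_apply (kappa A F j)) v = det Km * dvol lam v" for v
  proof -
    have "wedge DIM('a) (\<lambda>j. blinfun_apply (kappa A F j)) v = det (\<chi> k l. kappa A F (nt (k :: 'a idx)) (v (nt l)))"
      by (rule wedge_det)
    also have "(\<chi> k l. kappa A F (nt (k :: 'a idx)) (v (nt (l :: 'a idx)))) =
        Finite_Cartesian_Product.transpose Km ** (\<chi> k l. ?rep (v (nt (l :: 'a idx))) (lam (nt (k :: 'a idx))))"
    proof -
      have "kappa A F (nt k) (v (nt l)) = (\<Sum>j\<in>UNIV. kappa A F (nt k) (lam (nt (j :: 'a idx))) * ?rep (v (nt l)) (lam (nt j)))"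
        for k l :: "'a idx"
        by (subst lam_expansion[of "v (nt l)"]) (simp only: blinfun.sum_right blinfun.scaleR_right real_scaleR_def mult.commute)
      then show ?thesis
        by (simp add: vec_eq_iff matrix_matrix_mult_def Finite_Cartesian_Product.transpose_def Km_def)
    qed
    finally show ?thesis by (simp only: det_mul det_transpose d)
  qed
  have one: "dvol lam lam = 1"
  proof -
    have "?rep (lam (nt l)) (lam (nt k)) = (if k = l then 1 else 0)" for k l :: "'a idx"
    proof -
      have "lam (nt k) = lam (nt l) \<longleftrightarrow> k = l"
        using inj_on_eq_iff[OF conjunct1[OF lam_independent] nt_range[of k] nt_range[of l]] by (simp only: nt_inject)
      then show ?thesis
        using representation_basis[OF conjunct2[OF lam_independent] imageI[OF nt_range[of l]]] by auto
    qed
    then have "(\<chi> k l. ?rep (lam (nt l)) (lam (nt (k :: 'a idx)))) = mat 1"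
      by (simp add: mat_def vec_eq_iff)
    then show ?thesis by (simp add: d)
  qed
  have "pos_oriented lam (kappa A F) \<longleftrightarrow> det Km > 0"
  proof
    assume "pos_oriented lam (kappa A F)"
    then obtain c where "c > 0" "\<forall>v. det Km * dvol lam v = c * dvol lam v" unfolding pos_oriented_def w by blast
    then show "det Km > 0" using one by (metis mult.right_neutral)
  next
    assume "det Km > 0"
    then show "pos_oriented lam (kappa A F)" unfolding pos_oriented_def w by blast
  qed
  then show ?thesis using det_Km by (auto simp: nu_def det_B sgn_if)
qed

lemma jac_mult: "(\<Sum>l\<in>UNIV. jac cf ne x $ j $ l * y $ l) = (\<Sum>i\<in>UNIV. of_int (ne i j) * form cf i (\<chi> l. x $ l * y $ l) / form cf i x)"
proof -
  have "(\<Sum>l\<in>UNIV. jac cf ne x $ j $ l * y $ l) = (\<Sum>l\<in>UNIV. \<Sum>i\<in>UNIV. of_int (ne i j) * (of_real (cf i l) * (x $ l * y $ l)) / form cf i x)"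
    by (intro sum.cong refl) (simp add: jac_def sum_distrib_right mult.assoc)
  then show ?thesis
    by (subst (asm) sum.swap) (simp add: form_def sum_distrib_left sum_divide_distrib)
qed

text \<open>A kernel vector of the Jacobian matrix would be a tangent vector on which all \<open>dp\<^sub>j\<close>
  vanish, as does the zero vector.\<close>

lemma jac_nz:
  assumes x: "x \<in> log_domain Om"
  shows "det (jac cf ne x) \<noteq> 0"
proof
  assume "det (jac cf ne x) = 0"
  then have "\<not> invertible (jac cf ne x)" by (simp add: invertible_det_nz)
  then obtain y where y: "jac cf ne x *v y = 0" "y \<noteq> 0"
    using matrix_left_invertible_ker[of "jac cf ne x"] invertible_left_inverse by blast
  define u where "u = CCi x"
  have CCu: "CC u = x" by (simp add: u_def)
  have u: "u \<in> UFN g NN" using x CCu by (simp add: chamber_iff[symmetric] del: CC_nth)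
  then have uU: "u \<in> U_set A" using UFN_sub by blast
  define v where "v = CCi (\<chi> l. x $ l * y $ l)"
  have "dp A (lam (nt j)) u v = 0" for j :: "'a idx"
  proof -
    have "(jac cf ne x *v y) $ j = 0" using y(1) by simp
    then have "(\<Sum>i\<in>UNIV. of_int (ne i j) * form cf i (\<chi> l. x $ l * y $ l) / form cf i x) = 0"
      by (simp add: matrix_vector_mult_def jac_mult)
    then show ?thesis by (simp add: dp_eq[OF uU] CCu v_def)
  qed
  moreover have "dp A (lam (nt j)) u 0 = 0" for j :: "'a idx"
    by (simp add: dp_eq[OF uU] linear_0[OF bounded_linear.linear[OF CC_bounded_linear]] form_def del: CC_nth)
  ultimately have "dp A (lam j) u v = dp A (lam j) u 0" if "j \<in> {1..DIM('a)}" for j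
    using nt_mk[OF that] by metis
  then have "(\<lambda>j\<in>{1..DIM('a)}. dp A (lam j) u v) = (\<lambda>j\<in>{1..DIM('a)}. dp A (lam j) u 0)"
    by (intro restrict_ext) auto
  then have "v = 0" by (rule injD[OF bij_betw_imp_inj_on[OF nonsing[OF u]]])
  then have "(\<chi> l. x $ l * y $ l) = 0"
    by (metis CC_CCi v_def linear_0[OF bounded_linear.linear[OF CC_bounded_linear]])
  then have "x $ l * y $ l = 0" for l by (simp add: vec_eq_iff)
  moreover have "x $ l \<noteq> 0" for l using x by (simp add: log_domain_def)
  ultimately show False using y(2) by (simp add: vec_eq_iff)
qed

text \<open>Varying the \<open>l\<close>-th angle multiplies the \<open>l\<close>-th coordinate by a phase, so that each
  tangent vector contributes a factor \<open>\<i>\<close> and selects one column of the logarithmic Jacobian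
  matrix.\<close>

lemma dlog_form_eq:
  assumes u: "u \<in> U_set A" and v: "\<And>l :: 'a idx. CC (v (nt l)) = (\<i> * CC u $ l) *s axis l 1"
  shows "dlog_form A lam u v = \<i> ^ DIM('a) * det (jac cf ne (CC u))"
proof -
  have "dlog_form A lam u v = det (\<chi> k l. dp A (lam (nt (k :: 'a idx))) u (v (nt l)) / p_fun A (lam (nt k)) u)"
    unfolding dlog_form_def by (rule wedge_det)
  also have "(\<chi> k l. dp A (lam (nt (k :: 'a idx))) u (v (nt (l :: 'a idx))) / p_fun A (lam (nt k)) u) = (\<chi> k. \<i> *s (jac cf ne (CC u) $ k))"
  proof -
    have "dp A (lam (nt k)) u (v (nt l)) / p_fun A (lam (nt k)) u = \<i> * jac cf ne (CC u) $ k $ l" for k l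
    proof -
      have f: "form cf i (CC (v (nt l))) = \<i> * (of_real (cf i l) * CC u $ l)" for i
        unfolding v form_scale by (simp add: form_def axis_def if_distrib[of "\<lambda>x. _ * x"] cong: if_cong)
      have "dp A (lam (nt k)) u (v (nt l)) / p_fun A (lam (nt k)) u =
          (\<Sum>i\<in>UNIV. of_int (ne i k) * form cf i (CC (v (nt l))) / form cf i (CC u))"
        using p_nz[OF u, of k] by (simp add: dp_eq[OF u] p_fun_eq)
      then show ?thesis
        unfolding f by (simp add: jac_def sum_distrib_left mult_ac del: CC_nth)
    qed
    then show ?thesis by (simp add: vec_eq_iff)
  qed
  also have "det \<dots> = \<i> ^ DIM('a) * det (\<chi> k. jac cf ne (CC u) $ k)"
    using det_rows_mul[of "\<lambda>_. \<i>" "\<lambda>k. jac cf ne (CC u) $ k"] by (simp add: card_idx)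
  finally show ?thesis by simp
qed

lemma torus_point_eq:
  assumes "\<And>j. j \<in> {1..DIM('a)} \<Longrightarrow> \<epsilon> j > 0"
  shows "torus_point g \<epsilon> \<theta> = CCi (expv (cvec (\<chi> k. ln (\<epsilon> (nt k))) (\<chi> k. \<theta> (nt k))))"
  unfolding torus_point_def
proof (rule the_equality)
  let ?x = "expv (cvec (\<chi> k. ln (\<epsilon> (nt k))) (\<chi> k. \<theta> (nt k))) :: (complex, 'a idx) vec"
  have xk: "?x $ k = of_real (\<epsilon> (nt k)) * cis (\<theta> (nt k))" for k
    using assms[OF nt_range[of k]] by (simp add: Complex_eq exp_add cis_conv_exp exp_of_real)
  have c: "cpair (g j) u = CC u $ mk j" if "j \<in> {1..DIM('a)}" for j u by (simp add: nt_mk[OF that])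
  show "\<forall>j\<in>{1..DIM('a)}. cpair (g j) (CCi ?x) = of_real (\<epsilon> j) * cis (\<theta> j)"
    using xk by (simp add: c nt_mk del: CC_nth expv_nth)
  fix u assume u: "\<forall>j\<in>{1..DIM('a)}. cpair (g j) u = of_real (\<epsilon> j) * cis (\<theta> j)"
  have "CC u = ?x"
    unfolding vec_eq_iff xk CC_nth using u nt_range[where 'a = 'a] by blast
  then show "u = CCi ?x" by (metis CCi_CC)
qed

lemma torus_tangent:
  fixes l :: "'a idx"
  assumes "\<And>j. j \<in> {1..DIM('a)} \<Longrightarrow> \<epsilon> j > 0"
  shows "CC (vector_derivative (\<lambda>t. torus_point g \<epsilon> (\<theta>(nt l := t))) (at (\<theta> (nt l)))) =
    (\<i> * CC (torus_point g \<epsilon> \<theta>) $ l) *s axis l 1"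
proof -
  let ?\<rho> = "(\<chi> k. ln (\<epsilon> (nt k))) :: (real, 'a idx) vec" and ?\<theta> = "(\<chi> k. \<theta> (nt k)) :: (real, 'a idx) vec"
  let ?w = "\<i> *s axis l 1 :: (complex, 'a idx) vec"
  have tp: "torus_point g \<epsilon> \<theta>' = CCi (expv (cvec ?\<rho> (\<chi> k. \<theta>' (nt k))))" for \<theta>'
    by (rule torus_point_eq) (rule assms)
  have upd: "cvec ?\<rho> (\<chi> k. (\<theta>(nt l := t)) (nt k)) = cvec ?\<rho> ?\<theta> + (t - \<theta> (nt l)) *\<^sub>R ?w" for t
    by (auto simp: vec_eq_iff complex_eq_iff axis_def nt_inject)
  let ?E = "\<lambda>v. \<chi> k. exp (cvec ?\<rho> ?\<theta> $ k) * v $ k"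
  have "((\<lambda>t. cvec ?\<rho> ?\<theta> + (t - \<theta> (nt l)) *\<^sub>R ?w) has_derivative (\<lambda>t. t *\<^sub>R ?w)) (at (\<theta> (nt l)))"
    by (auto intro!: derivative_eq_intros)
  moreover have "(expv has_derivative ?E) (at (cvec ?\<rho> ?\<theta> + (\<theta> (nt l) - \<theta> (nt l)) *\<^sub>R ?w))"
    using expv_has_derivative[of "cvec ?\<rho> ?\<theta>"] by simp
  ultimately have "((\<lambda>t. expv (cvec ?\<rho> ?\<theta> + (t - \<theta> (nt l)) *\<^sub>R ?w)) has_derivative (\<lambda>t. ?E (t *\<^sub>R ?w))) (at (\<theta> (nt l)))"
    by (rule has_derivative_compose)
  from bounded_linear.has_derivative[OF CCi_bounded_linear this]
  have "((\<lambda>t. torus_point g \<epsilon> (\<theta>(nt l := t))) has_derivative (\<lambda>t. CCi (?E (t *\<^sub>R ?w)))) (at (\<theta> (nt l)))"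
    unfolding tp upd by simp
  moreover have "CCi (?E (t *\<^sub>R ?w)) = t *\<^sub>R CCi (?E ?w)" for t
  proof -
    have "?E (t *\<^sub>R ?w) = t *\<^sub>R ?E ?w" by (simp add: vec_eq_iff)
    then show ?thesis by (simp only: linear_scale[OF bounded_linear.linear[OF CCi_bounded_linear]])
  qed
  ultimately have "((\<lambda>t. torus_point g \<epsilon> (\<theta>(nt l := t))) has_vector_derivative CCi (?E ?w)) (at (\<theta> (nt l)))"
    by (simp add: has_vector_derivative_def)
  then have "vector_derivative (\<lambda>t. torus_point g \<epsilon> (\<theta>(nt l := t))) (at (\<theta> (nt l))) = CCi (?E ?w)"
    by (rule vector_derivative_at)
  moreover have "?E ?w = (\<i> * CC (torus_point g \<epsilon> \<theta>) $ l) *s axis l 1"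
    unfolding tp CC_CCi by (auto simp: vec_eq_iff axis_def)
  ultimately show ?thesis by simp
qed

end

section \<open>Lattice exponents, torus coefficients and regular rays\<close>

lemma powi_sum:
  fixes x :: "'x::field"
  assumes "x \<noteq> 0" "finite I"
  shows "x powi (\<Sum>i\<in>I. f i) = (\<Prod>i\<in>I. x powi f i)"
  using assms(2) by induction (simp_all add: power_int_add assms(1))

lemma powi_prod:
  fixes f :: "'i \<Rightarrow> 'x::field"
  assumes "finite I"
  shows "(\<Prod>i\<in>I. f i) powi n = (\<Prod>i\<in>I. f i powi n)"
  using assms by induction (simp_all add: power_int_mult_distrib)

lemma prod_powi_sum:
  fixes x :: "'n::finite \<Rightarrow> complex" and n :: "'n \<Rightarrow> 'k::finite \<Rightarrow> int"
  assumes "\<And>i. x i \<noteq> 0"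
  shows "(\<Prod>i\<in>UNIV. x i powi (\<Sum>k\<in>UNIV. m k * n i k)) = (\<Prod>k\<in>UNIV. (\<Prod>i\<in>UNIV. x i powi n i k) powi m k)"
proof -
  have "(\<Prod>i\<in>UNIV. x i powi (\<Sum>k\<in>UNIV. m k * n i k)) = (\<Prod>i\<in>UNIV. \<Prod>k\<in>UNIV. (x i powi n i k) powi m k)"
    by (intro prod.cong refl) (simp add: powi_sum assms mult.commute flip: power_int_mult)
  also have "\<dots> = (\<Prod>k\<in>UNIV. \<Prod>i\<in>UNIV. (x i powi n i k) powi m k)" by (rule prod.swap)
  finally show ?thesis by (simp add: powi_prod)
qed

lemma ln_norm_powi: "x \<noteq> 0 \<Longrightarrow> ln (norm ((x :: complex) powi n)) = of_int n * ln (norm x)"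
  by (simp add: norm_power_int ln_powr flip: powr_real_of_int')

lemma cpair_bounded_linear: "bounded_linear (cpair (\<gamma> :: 'a::euclidean_space dual))"
  by (rule linear_conv_bounded_linear[THEN iffD1], rule linearI)
     (simp_all add: complex_eq_iff cpair_def blinfun.add_right blinfun.scaleR_right)

lemma UFN_open: "open (UFN (g :: nat \<Rightarrow> 'a::euclidean_space dual) N)"
proof -
  have c [continuous_intros]: "continuous_on S (cpair \<gamma>)" for S and \<gamma> :: "'a dual"
    using cpair_bounded_linear linear_continuous_on by blast
  have "UFN g N = (\<Inter>j\<in>{1..DIM('a)}. {u. cpair (g j) u \<noteq> 0}) \<inter>
    (\<Inter>j\<in>{1..<DIM('a)}. {u. 0 < N * norm (cpair (g j) u)} \<inter> {u. N * norm (cpair (g j) u) < norm (cpair (g (Suc j)) u)})"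
    by (auto simp: UFN_def)
  also have "open \<dots>"
    by (intro open_Int open_INT ballI finite_atLeastAtMost finite_atLeastLessThan open_Collect_neq open_Collect_less continuous_intros)
  finally show ?thesis .
qed

context flag_data
begin

definition lv :: "(int, 'a idx) vec \<Rightarrow> 'a" where
  "lv m = (\<Sum>k\<in>UNIV. of_int (m $ k) *\<^sub>R lam (nt k))"

text \<open>The values of \<open>\<xi>\<close> on the lattice basis, with the sign for which \<open>ev (Psi A u)\<close> is the
  real part of \<open>log (p u)\<close> (\<open>logv_prod_map\<close>).\<close>

definition ev :: "'a dual \<Rightarrow> (real, 'a idx) vec" where
  "ev \<xi> = (\<chi> j. - \<xi> (lam (nt j)))"

text \<open>The inverse of \<open>ev\<close>, written in the basis of the \<open>\<kappa>\<^sub>k\<close>.\<close>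

definition dv :: "(real, 'a idx) vec \<Rightarrow> 'a dual" where
  "dv \<rho> = (\<Sum>k\<in>UNIV. (- (matrix_inv Km *v \<rho>) $ k) *\<^sub>R kappa A F (nt k))"

lemma ev_scale: "ev (c *\<^sub>R \<xi>) = c *\<^sub>R ev \<xi>"
  by (simp add: ev_def vec_eq_iff blinfun.scaleR_left)

lemma ev_kappa_sum: "ev (\<Sum>k\<in>UNIV. c k *\<^sub>R kappa A F (nt (k :: 'a idx))) = - (Km *v (\<chi> k. c k))"
  by (simp add: vec_eq_iff ev_def Km_def matrix_vector_mult_def blinfun.sum_left blinfun.scaleR_left mult.commute)

lemma ev_inject: "ev \<xi> = ev \<xi>' \<longleftrightarrow> \<xi> = \<xi>'"
proof
  assume e: "ev \<xi> = ev \<xi>'"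
  have l: "\<xi> (lam (nt j)) = \<xi>' (lam (nt j))" for j :: "'a idx"
  proof -
    have "ev \<xi> $ j = ev \<xi>' $ j" using e by simp
    then show ?thesis by (simp add: ev_def)
  qed
  show "\<xi> = \<xi>'"
  proof (rule blinfun_eqI)
    fix x show "\<xi> x = \<xi>' x"
      by (subst (1 2) lam_expansion[of x]) (simp only: blinfun.sum_right blinfun.scaleR_right l)
  qed
qed simp

lemma ev_dv [simp]: "ev (dv \<rho>) = \<rho>"
proof -
  have "ev (dv \<rho>) = Km *v (matrix_inv Km *v \<rho>)"
    unfolding dv_def ev_kappa_sum by (simp add: vec_eq_iff matrix_vector_mult_def sum_negf)
  moreover have "Km ** matrix_inv Km = mat 1"
    using someI_ex[of "\<lambda>C. Km ** C = mat 1 \<and> C ** Km = mat 1"] det_Km invertible_det_nz[of Km]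
    unfolding invertible_def matrix_inv_def by blast
  ultimately show ?thesis by (simp add: matrix_vector_mul_assoc)
qed

lemma dv_ev [simp]: "dv (ev \<xi>) = \<xi>"
  by (simp add: ev_inject[symmetric])

lemma dv_continuous: "continuous_on S dv"
proof -
  have "continuous_on S ((*v) (matrix_inv Km))"
    by (intro linear_continuous_on linear_linear[THEN iffD2] matrix_vector_mul_linear)
  then show ?thesis unfolding dv_def by (intro continuous_intros)
qed

lemma floor_lv: "\<lfloor>A i (lv m)\<rfloor> = (\<Sum>k\<in>UNIV. m $ k * ne i k)"
proof -
  have "A i (lv m) = of_int (\<Sum>k\<in>UNIV. m $ k * ne i k)"
    by (simp add: lv_def blinfun.sum_right blinfun.scaleR_right of_int_ne)
  then show ?thesis by (simp only: floor_of_int)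
qed

lemma lv_unit: "lv (\<chi> k. if k = j then 1 else 0) = lam (nt j)"
  by (simp add: lv_def if_distrib[of "\<lambda>x. of_int x *\<^sub>R _"] if_distrib[of of_int] if_distrib[of "\<lambda>x. x *\<^sub>R _"] cong: if_cong)

lemma p_fun_lv: "u \<in> U_set A \<Longrightarrow> p_fun A (lv m) u = (\<Prod>k\<in>UNIV. (prod_map cf ne (CC u) $ k) powi (m $ k))"
  unfolding p_fun_def floor_lv
  by (subst prod_powi_sum) (auto simp: U_set_def prod_map_def form_CC)

lemma z_pow_lv: "(\<And>i. z $ i \<noteq> 0) \<Longrightarrow> z_pow A z (lv m) = (\<Prod>k\<in>UNIV. z_pow A z (lam (nt k)) powi (m $ k))"
  unfolding z_pow_def floor_lv
  by (subst prod_powi_sum) (auto simp: ne_def)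

lemma ln_norm_prod:
  assumes "\<And>i. x i \<noteq> 0"
  shows "ln (norm (\<Prod>i\<in>UNIV. x i powi ne i j)) = ev (- (\<Sum>i\<in>UNIV. ln (norm (x i :: complex)) *\<^sub>R A i)) $ j"
proof -
  have "ln (norm (\<Prod>i\<in>UNIV. x i powi ne i j)) = (\<Sum>i\<in>UNIV. of_int (ne i j) * ln (norm (x i)))"
    by (simp add: prod_norm[symmetric] ln_prod assms ln_norm_powi)
  then show ?thesis
    by (simp add: ev_def blinfun.minus_left blinfun.sum_left blinfun.scaleR_left of_int_ne mult.commute)
qed

lemma logv_prod_map: "u \<in> U_set A \<Longrightarrow> logv (prod_map cf ne (CC u)) = ev (Psi A u)"
  unfolding vec_eq_iff Psi_def logv_def prod_map_def form_CC vec_lambda_beta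
  by (intro allI ln_norm_prod) (simp add: U_set_def)

lemma ln_z_pow: "(\<And>i. z $ i \<noteq> 0) \<Longrightarrow> ln (norm (z_pow A z (lam (nt j)))) = ev (psi A z) $ j"
  unfolding psi_def z_pow_def ne_def[symmetric] by (rule ln_norm_prod)

lemma vec_holo_CCi:
  assumes "holomorphic_cplx \<phi> (UFN g NN)"
  shows "vec_holo (\<lambda>x. \<phi> (CCi x)) (log_domain Om)"
  unfolding vec_holo_def
proof
  fix x assume "x \<in> log_domain Om"
  then have "CCi x \<in> UFN g NN" by (metis CC_CCi chamber_iff)
  then obtain D where D: "(\<phi> has_derivative D) (at (CCi x))" "\<And>v. D (mult_i v) = \<i> * D v"
    using assms by (auto simp: holomorphic_cplx_def)
  have "((\<lambda>x. \<phi> (CCi x)) has_derivative (\<lambda>v. D (CCi v))) (at x)"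
    by (rule has_derivative_compose[OF bounded_linear_imp_has_derivative[OF CCi_bounded_linear] D(1)])
  then show "\<exists>D. ((\<lambda>x. \<phi> (CCi x)) has_derivative D) (at x) \<and> (\<forall>v. D (\<i> *s v) = \<i> * D v)"
    using D(2) by (intro exI[of _ "\<lambda>v. D (CCi v)"]) (simp add: CCi_mult_i)
qed

lemma radii_Om:
  assumes "radii DIM('a) NN \<epsilon>"
  shows "(\<chi> k. ln (\<epsilon> (nt k))) \<in> Om"
  unfolding Om_def
proof (intro CollectI allI impI)
  fix k l :: "'a idx" assume kl: "nt l = Suc (nt k)"
  have k: "nt k \<in> {1..<DIM('a)}" using nt_range[of k] nt_range[of l] kl by simp
  have pos: "\<epsilon> (nt k) > 0" "\<epsilon> (nt l) > 0" using assms nt_range unfolding radii_def by blast+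
  have "NN * \<epsilon> (nt k) < \<epsilon> (nt l)" using assms k kl by (simp add: radii_def)
  then have "ln (NN * \<epsilon> (nt k)) < ln (\<epsilon> (nt l))" using NN pos by simp
  then show "ln NN < (\<chi> k. ln (\<epsilon> (nt k))) $ l - (\<chi> k. ln (\<epsilon> (nt k))) $ k"
    using NN pos by (simp add: ln_mult)
qed

lemma torus_coeff_eq:
  assumes \<phi>: "holomorphic_cplx \<phi> (UFN g NN)" and \<epsilon>: "radii DIM('a) NN \<epsilon>"
  defines "X \<equiv> \<lambda>\<theta>. expv (cvec (\<chi> k. ln (\<epsilon> (nt k))) \<theta>) :: (complex, 'a idx) vec"
  shows "torus_coeff A lam g \<epsilon> \<phi> (lv m) = \<i> ^ DIM('a) * integral tcube (\<lambda>\<theta>. \<phi> (CCi (X \<theta>)) *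
    (\<Prod>j\<in>UNIV. (prod_map cf ne (X \<theta>) $ j) powi (- (m $ j))) * det (jac cf ne (X \<theta>)))"
proof -
  let ?E = "(\<chi> k. ln (\<epsilon> (nt k))) :: (real, 'a idx) vec"
  let ?h = "\<lambda>\<theta>. \<phi> (CCi (X \<theta>)) * (\<Prod>j\<in>UNIV. (prod_map cf ne (X \<theta>) $ j) powi (- (m $ j))) * det (jac cf ne (X \<theta>))"
  have E: "?E \<in> Om" by (rule radii_Om[OF \<epsilon>])
  interpret nonsingular_chart cf ne ld Om "ln NN" by (rule nonsingular_chart)
  interpret proper_chart cf ne ld Om "ln NN" "{}"
    by unfold_locales (use jac_nz in auto)
  have "vec_holo (\<lambda>x. \<phi> (CCi (expv x)) * monomial m (expv x) * det (jac cf ne (expv x))) (tube Om)"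
    by (intro vec_holo_mult vec_holo_jac vec_holo_expv[OF vec_holo_CCi[OF \<phi>]] vec_holo_expv[OF vec_holo_monomial])
  from slice_continuous[OF vec_holo_continuous[OF this] E]
  have cont: "continuous_on UNIV ?h" by (simp add: X_def monomial_def)
  have pos: "\<epsilon> j > 0" if "j \<in> {1..DIM('a)}" for j using \<epsilon> that by (auto simp: radii_def)
  have "torus_coeff A lam g \<epsilon> \<phi> (lv m) = integral tcube (\<lambda>\<theta>. \<i> ^ DIM('a) * ?h \<theta>)"
    unfolding torus_coeff_def torus_integral_def
  proof (rule PiM_torus_integral)
    show "continuous_on UNIV (\<lambda>\<theta>. \<i> ^ DIM('a) * ?h \<theta>)" by (intro continuous_on_mult continuous_on_const cont)
    fix \<theta> :: "nat \<Rightarrow> real"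
    let ?u = "torus_point g \<epsilon> \<theta>" and ?v = "\<lambda>k. vector_derivative (\<lambda>t. torus_point g \<epsilon> (\<theta>(k := t))) (at (\<theta> k))"
    have u: "?u = CCi (X (\<chi> k. \<theta> (nt k)))" unfolding X_def by (rule torus_point_eq) (rule pos)
    have CCu: "CC ?u = X (\<chi> k. \<theta> (nt k))" unfolding u by (rule CC_CCi)
    have "CC ?u \<in> log_domain Om" unfolding CCu X_def using E by simp
    then have uU: "?u \<in> U_set A" using chamber_iff UFN_sub by blast
    have "dlog_form A lam ?u ?v = \<i> ^ DIM('a) * det (jac cf ne (CC ?u))"
      by (rule dlog_form_eq[OF uU]) (rule torus_tangent, rule pos)
    then show "\<phi> ?u / p_fun A (lv m) ?u * dlog_form A lam ?u ?v = \<i> ^ DIM('a) * ?h (\<chi> k. \<theta> (nt k))"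
      unfolding p_fun_lv[OF uU] CCu unfolding u
      by (simp add: power_int_minus prod_inversef[unfolded comp_def, symmetric] divide_inverse mult_ac del: CC_nth)
  qed
  then show ?thesis by simp
qed

text \<open>Both \<open>p\<^sub>\<lambda>\<close> and \<open>z\<^sup>\<lambda>\<close> are multiplicative in \<open>\<lambda>\<close>, so it is enough to compare them on the
  lattice basis.\<close>

lemma O_set_chamber:
  assumes L: "L = range lv" and z: "\<And>i. z $ i \<noteq> 0"
  shows "O_set A L z \<inter> UFN g NN =
    CCi ` {x \<in> log_domain Om. prod_map cf ne x = (\<chi> j. z_pow A z (lam (nt j)))}" (is "_ = CCi ` ?X")
proof (intro equalityI subsetI)
  fix u assume u: "u \<in> O_set A L z \<inter> UFN g NN"
  have "prod_map cf ne (CC u) $ j = z_pow A z (lam (nt j))" for j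
  proof -
    have "lam (nt j) \<in> L" unfolding L using lv_unit[of j] by (metis rangeI)
    then show ?thesis using u by (auto simp: O_set_def p_fun_eq)
  qed
  moreover have "CC u \<in> log_domain Om" using u chamber_iff by blast
  ultimately have "CC u \<in> ?X" by (simp add: vec_eq_iff del: CC_nth)
  then show "u \<in> CCi ` ?X" by (intro image_eqI[where x = "CC u"] CCi_CC[symmetric])
next
  fix u assume "u \<in> CCi ` ?X"
  then obtain x where x: "u = CCi x" "x \<in> log_domain Om" "prod_map cf ne x = (\<chi> j. z_pow A z (lam (nt j)))" by blast
  have CCu: "CC u = x" by (simp add: x(1))
  have u: "u \<in> UFN g NN" using x(2) unfolding CCu[symmetric] chamber_iff .
  then have uU: "u \<in> U_set A" using UFN_sub by blast
  have "p_fun A (lv m) u = z_pow A z (lv m)" for m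
    unfolding p_fun_lv[OF uU] CCu x(3) by (simp add: z_pow_lv z)
  then show "u \<in> O_set A L z \<inter> UFN g NN" using u uU by (auto simp: O_set_def L)
qed

lemma CCi_inj: "inj CCi"
  by (metis CC_CCi injI)

lemma lv_bij:
  assumes "int_basis DIM('a) lam L"
  shows "bij_betw lv UNIV L"
proof -
  let ?f = "\<lambda>m :: (int, 'a idx) vec. \<lambda>j\<in>{1..DIM('a)}. m $ mk j"
  have "bij_betw ?f UNIV ({1..DIM('a)} \<rightarrow>\<^sub>E UNIV)"
  proof (rule bij_betw_byWitness[where f' = "\<lambda>f. \<chi> k. f (nt k)"])
    show "\<forall>m\<in>UNIV. (\<chi> k. ?f m (nt k)) = m"
      using nt_range[where 'a = 'a] by (simp add: vec_eq_iff nt_inverse)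
    show "\<forall>f\<in>{1..DIM('a)} \<rightarrow>\<^sub>E UNIV. ?f (\<chi> k. f (nt k)) = f"
      by (auto simp: fun_eq_iff nt_mk PiE_def extensional_def)
  qed auto
  from bij_betw_trans[OF this assms[unfolded int_basis_def]]
  have "bij_betw (\<lambda>m. \<Sum>j\<in>{1..DIM('a)}. of_int (?f m j) *\<^sub>R lam j) UNIV L" by (simp add: comp_def)
  moreover have "(\<Sum>j\<in>{1..DIM('a)}. of_int (?f m j) *\<^sub>R lam j) = lv m" for m
  proof -
    have "(\<Sum>j\<in>{1..DIM('a)}. of_int (?f m j) *\<^sub>R lam j) = (\<Sum>j\<in>{1..DIM('a)}. of_int (m $ mk j) *\<^sub>R lam j)"
      by (rule sum.cong) auto
    also have "\<dots> = lv m"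
      unfolding lv_def sum_nt[symmetric, where 'a = 'a] by (simp add: nt_inverse)
    finally show ?thesis .
  qed
  ultimately show ?thesis by (simp only:)
qed

text \<open>Properness is inherited from \<open>\<Psi>\<close>, which is the real part of \<open>log p\<close> up to the linear
  isomorphism \<open>ev\<close>.\<close>

lemma proper_chart:
  assumes comp: "\<And>K. compact K \<Longrightarrow> K \<subseteq> {\<xi>. tau_regular A \<tau> \<xi>} \<Longrightarrow> compact ({u \<in> U_set A. Psi A u \<in> K} \<inter> UFN g NN)"
    and D: "open D" "convex D" "\<And>\<rho>. \<rho> \<in> D \<Longrightarrow> tau_regular A \<tau> (dv \<rho>)"
  shows "proper_chart cf ne ld Om (ln NN) D"
proof -
  interpret nonsingular_chart cf ne ld Om "ln NN" by (rule nonsingular_chart)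
  show ?thesis
  proof
    fix K assume K: "compact K" "K \<subseteq> D"
    have eq: "{x \<in> log_domain Om. logv (prod_map cf ne x) \<in> K} =
      CC ` ({u \<in> U_set A. Psi A u \<in> dv ` K} \<inter> UFN g NN)" (is "?L = CC ` ?R")
    proof (intro equalityI subsetI)
      fix x assume x: "x \<in> ?L"
      let ?u = "CCi x"
      have u: "?u \<in> UFN g NN" using x chamber_iff[of ?u] unfolding CC_CCi by blast
      then have uU: "?u \<in> U_set A" using UFN_sub by blast
      have "ev (Psi A ?u) \<in> K" using logv_prod_map[OF uU] x unfolding CC_CCi by simp
      then have "Psi A ?u \<in> dv ` K" by (metis dv_ev imageI)
      then have "?u \<in> ?R" using u uU by blast
      then show "x \<in> CC ` ?R" by (intro image_eqI[where x = "CCi x"] CC_CCi[symmetric])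
    next
      fix x assume "x \<in> CC ` ?R"
      then obtain u where u: "x = CC u" "u \<in> U_set A" "Psi A u \<in> dv ` K" "u \<in> UFN g NN" by blast
      have "ev (Psi A u) \<in> K" using u(3) by auto
      then show "x \<in> ?L" using u chamber_iff[of u] logv_prod_map[OF u(2)] by simp
    qed
    have comp_R: "compact ?R"
    proof (rule comp)
      show "compact (dv ` K)" by (rule compact_continuous_image[OF dv_continuous K(1)])
      show "dv ` K \<subseteq> {\<xi>. tau_regular A \<tau> \<xi>}" using K(2) D(3) by auto
    qed
    show "compact ?L"
      unfolding eq by (rule compact_continuous_image[OF linear_continuous_on[OF CC_bounded_linear] comp_R])
  qed (use jac_nz D(1,2) in auto)
qed

text \<open>If \<open>\<xi> = (\<Sum>k. m\<^sub>k *\<^sub>R \<kappa>\<^sub>k)\<close>, the solution of \<open>B *v q = ev \<xi>\<close> has the entries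
  \<open>q\<^sub>l = - (\<Sum>k\<ge>l. m\<^sub>k)\<close>. Its increments are the coefficients \<open>m\<^sub>k\<close>, which exceed \<open>\<tau>\<close> by
  regularity; so the affine part of \<open>log p\<close> maps a ray leading deep into the chamber to the
  ray of \<open>\<xi>\<close>.\<close>

lemma deep_direction:
  assumes reg: "tau_regular A \<tau> \<xi>" and at: "F \<in> flags_at A \<xi>" and \<tau>: "\<tau> > 0"
  obtains q where "flag_chart.B ne ld *v q = ev \<xi>" "q \<in> deepset \<tau>"
proof -
  obtain m where m: "\<xi> = (\<Sum>j\<in>{1..DIM('a)}. m j *\<^sub>R kappa A F j)" using at unfolding flags_at_iff by blast
  have big: "m j > \<tau>" if "j \<in> {1..<DIM('a)}" for j by (rule tau_regularD[OF reg at m that])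
  define q where "q = - (Up *v (\<chi> k. m (nt k)))"
  have "flag_chart.B ne ld *v q = - (Km *v (\<chi> k. m (nt k)))"
    unfolding q_def Km_eq matrix_vector_mul_assoc[symmetric] by (simp add: vec_eq_iff matrix_vector_mult_def sum_negf)
  also have "\<dots> = ev (\<Sum>k\<in>UNIV. m (nt k) *\<^sub>R kappa A F (nt (k :: 'a idx)))" by (simp only: ev_kappa_sum)
  also have "(\<Sum>k\<in>UNIV. m (nt k) *\<^sub>R kappa A F (nt (k :: 'a idx))) = \<xi>"
    using m sum_nt[where 'a = 'a, of "\<lambda>j. m j *\<^sub>R kappa A F j"] by simp
  finally have 1: "flag_chart.B ne ld *v q = ev \<xi>" .
  have qk: "q $ k = - (\<Sum>j | k \<le> j. m (nt j))" for k
    by (simp add: q_def Up_def matrix_vector_mult_def if_distrib[of "\<lambda>x. x * _"] sum.If_cases cong: if_cong)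
  have "\<tau> < q $ l - q $ k" if kl: "k < l" for k l
  proof -
    have "{j. k \<le> j} = {j. l \<le> j} \<union> {j. k \<le> j \<and> j < l}" using kl by auto
    then have "(\<Sum>j | k \<le> j. m (nt j)) = (\<Sum>j | l \<le> j. m (nt j)) + (\<Sum>j | k \<le> j \<and> j < l. m (nt j))"
      by (simp only:) (rule sum.union_disjoint, auto)
    moreover have mem: "nt j \<in> {1..<DIM('a)}" if "j < l" for j
      using that nt_range[of j] nt_range[of l] by (simp add: less_idx_def)
    have "m (nt k) \<le> (\<Sum>j | k \<le> j \<and> j < l. m (nt j))"
      by (rule member_le_sum) (use kl big mem \<tau> in \<open>auto simp: less_imp_le intro!: less_imp_le order.strict_trans[OF \<tau>]\<close>)
    moreover have "m (nt k) > \<tau>" by (rule big[OF mem[OF kl]])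
    ultimately show ?thesis by (simp add: qk)
  qed
  then have "q \<in> deepset \<tau>" by (simp add: deepset_def)
  with 1 show thesis by (rule that)
qed

lemma deep_of_steps:
  assumes x: "x \<in> log_domain Om"
    and step: "\<And>j. j \<in> {1..<DIM('a)} \<Longrightarrow> exp M * norm (cpair (g j) (CCi x)) < norm (cpair (g (Suc j)) (CCi x))"
    and M: "M \<ge> 0"
  shows "logv x \<in> deepset M"
proof -
  let ?s = "\<lambda>j. ln (norm (cpair (g j) (CCi x)))"
  have "CCi x \<in> UFN g NN" using x chamber_iff[of "CCi x"] unfolding CC_CCi by blast
  then have nz: "cpair (g j) (CCi x) \<noteq> 0" if "j \<in> {1..DIM('a)}" for j using that by (simp add: UFN_def)
  have s: "M < ?s (Suc j) - ?s j" if j: "j \<in> {1..<DIM('a)}" for j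
  proof -
    have "cpair (g j) (CCi x) \<noteq> 0" "cpair (g (Suc j)) (CCi x) \<noteq> 0" using nz j by auto
    then have "ln (exp M * norm (cpair (g j) (CCi x))) < ?s (Suc j)" using step[OF j] by simp
    then show ?thesis using \<open>cpair (g j) (CCi x) \<noteq> 0\<close> by (simp add: ln_mult)
  qed
  have "M < ?s j - ?s i" if "1 \<le> i" "i < j" "j \<le> DIM('a)" for i j
    using that(2,3)
  proof (induction j)
    case (Suc j)
    have j: "M < ?s (Suc j) - ?s j" using s that(1) Suc.prems by simp
    show ?case
    proof (cases "i = j")
      case False
      then have "M < ?s j - ?s i" using Suc by simp
      then show ?thesis using j M by linarith
    qed (use j in simp)
  qed simp
  moreover have "logv x $ k = ?s (nt k)" for k
  proof -
    have "cpair (g (nt k)) (CCi x) = x $ k" using CC_nth[of "CCi x" k] unfolding CC_CCi by (rule sym)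
    then show ?thesis by (simp add: logv_def)
  qed
  ultimately show ?thesis
    using nt_range[where 'a = 'a] by (simp add: deepset_def less_idx_def)
qed

text \<open>The slices that \<open>trace_expansion\<close> asks for lie on the ray through \<open>ev \<xi>\<close>: the point
  \<open>c *\<^sub>R ev \<xi>\<close> is the image of \<open>\<eta> = c *\<^sub>R q - b\<close>, where \<open>b\<close> absorbs the constant \<open>cst\<close>, and
  for large \<open>c\<close> both \<open>\<eta>\<close> and all points of the fibre are deep.\<close>

lemma deep_slice:
  assumes reg: "tau_regular A \<tau> \<xi>" and at: "F \<in> flags_at A \<xi>" and \<tau>: "\<tau> > 0"
    and fibers: "\<And>X. \<exists>c0. \<forall>c\<ge>c0. \<forall>u\<in>U_set A \<inter> UFN g NN. Psi A u = c *\<^sub>R \<xi> \<longrightarrow>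
      (\<forall>j\<in>{1..<DIM('a)}. X * norm (cpair (g j) u) < norm (cpair (g (Suc j)) u))"
    and cone: "\<And>c. c \<ge> 1 \<Longrightarrow> c *\<^sub>R ev \<xi> \<in> D"
  shows "\<exists>\<eta>\<in>deepset M. re_vec (flag_chart.cst cf ne ld) + flag_chart.B ne ld *v \<eta> \<in> D \<and>
    (\<forall>x\<in>log_domain Om. logv (prod_map cf ne x) = re_vec (flag_chart.cst cf ne ld) + flag_chart.B ne ld *v \<eta> \<longrightarrow> logv x \<in> deepset M)"
proof -
  interpret nonsingular_chart cf ne ld Om "ln NN" by (rule nonsingular_chart)
  obtain q where q: "B *v q = ev \<xi>" "q \<in> deepset \<tau>" by (rule deep_direction[OF reg at \<tau>])
  define b where "b = Binv *v re_vec cst"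
  define M' where "M' = max M 0"
  obtain c0 where c0: "\<And>c u j. c \<ge> c0 \<Longrightarrow> u \<in> U_set A \<inter> UFN g NN \<Longrightarrow> Psi A u = c *\<^sub>R \<xi> \<Longrightarrow> j \<in> {1..<DIM('a)} \<Longrightarrow>
      exp M' * norm (cpair (g j) u) < norm (cpair (g (Suc j)) u)"
    using fibers[of "exp M'"] by blast
  define c where "c = max (max 1 c0) ((M + 2 * norm b) / \<tau>)"
  have c: "c \<ge> 1" "c \<ge> c0" "c * \<tau> \<ge> M + 2 * norm b"
  proof -
    show "c \<ge> 1" "c \<ge> c0" by (auto simp: c_def)
    have "(M + 2 * norm b) / \<tau> \<le> c" by (simp add: c_def)
    then show "c * \<tau> \<ge> M + 2 * norm b" using \<tau> by (simp add: field_simps)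
  qed
  define \<eta> where "\<eta> = c *\<^sub>R q - b"
  have "c *\<^sub>R q \<in> deepset (c * \<tau>)"
    using q(2) c(1) by (auto simp: deepset_def right_diff_distrib[symmetric])
  moreover have "\<bar>\<eta> $ k - (c *\<^sub>R q) $ k\<bar> \<le> norm b" for k
    using component_le_norm_cart[of b k] by (simp add: \<eta>_def)
  ultimately have "\<eta> \<in> deepset (c * \<tau> - 2 * norm b)" by (rule deepset_perturb)
  moreover have "deepset (c * \<tau> - 2 * norm b) \<subseteq> deepset M" using c(3) by (intro deepset_mono) simp
  ultimately have \<eta>: "\<eta> \<in> deepset M" by blast
  have B\<eta>: "re_vec cst + B *v \<eta> = c *\<^sub>R ev \<xi>"
    by (simp add: \<eta>_def b_def matrix_vector_mult_diff_distrib B_Binv_vec matrix_vector_mult_scaleR q(1))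
  have "logv x \<in> deepset M" if x: "x \<in> log_domain Om" "logv (prod_map cf ne x) = c *\<^sub>R ev \<xi>" for x
  proof -
    have u: "CCi x \<in> UFN g NN" using x(1) chamber_iff[of "CCi x"] unfolding CC_CCi by blast
    then have uU: "CCi x \<in> U_set A" using UFN_sub by blast
    have "ev (Psi A (CCi x)) = ev (c *\<^sub>R \<xi>)"
      using logv_prod_map[OF uU] x(2) unfolding CC_CCi ev_scale by simp
    then have P: "Psi A (CCi x) = c *\<^sub>R \<xi>" by (simp only: ev_inject)
    have "logv x \<in> deepset M'"
      by (rule deep_of_steps[OF x(1)]) (use c0[OF c(2) _ P] u uU in \<open>auto simp: M'_def\<close>)
    moreover have "deepset M' \<subseteq> deepset M" by (rule deepset_mono) (simp add: M'_def)
    ultimately show ?thesis by blast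
  qed
  then show ?thesis using \<eta> cone[OF c(1)] unfolding B\<eta>[symmetric] by blast
qed

end

section \<open>The expansion over the lattice\<close>

lemma open_scaled_ball:
  fixes x :: "'v::real_normed_vector"
  shows "open (\<Union>c\<in>{1..}. (\<lambda>y. c *\<^sub>R y) ` ball x \<delta>)"
  by (intro open_UN ballI open_scaling) auto

text \<open>A convex combination \<open>s c y + t d y'\<close> is the multiple by \<open>s c + t d \<ge> 1\<close> of a convex
  combination of \<open>y\<close> and \<open>y'\<close>.\<close>

lemma convex_scaled_ball:
  fixes x :: "'v::real_normed_vector"
  shows "convex (\<Union>c\<in>{1..}. (\<lambda>y. c *\<^sub>R y) ` ball x \<delta>)"
proof (rule convexI)
  let ?D = "\<Union>c\<in>{1..}. (\<lambda>y. c *\<^sub>R y) ` ball x \<delta>"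
  fix u v :: 'v and s t :: real
  assume "u \<in> ?D" "v \<in> ?D" and st: "0 \<le> s" "0 \<le> t" "s + t = 1"
  then obtain c d y y' where cd: "c \<ge> 1" "d \<ge> 1" "y \<in> ball x \<delta>" "y' \<in> ball x \<delta>" "u = c *\<^sub>R y" "v = d *\<^sub>R y'" by auto
  define e where "e = s * c + t * d"
  have e: "e \<ge> 1" using convex_bound_le[of "- c" "-1" "- d" s t] cd(1,2) st by (simp add: e_def)
  have "(s * c / e) *\<^sub>R y + (t * d / e) *\<^sub>R y' \<in> ball x \<delta>"
  proof (rule convexD[OF convex_ball cd(3,4)])
    have "s * c / e + t * d / e = e / e" by (simp only: e_def add_divide_distrib)
    then show "s * c / e + t * d / e = 1" using e by simp
  qed (use st cd e in auto)
  moreover have "s *\<^sub>R u + t *\<^sub>R v = e *\<^sub>R ((s * c / e) *\<^sub>R y + (t * d / e) *\<^sub>R y')"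
    using e by (simp add: cd scaleR_add_right)
  ultimately show "s *\<^sub>R u + t *\<^sub>R v \<in> ?D"
    using e by (intro UN_I[of e]) (auto simp only: atLeast_iff intro: imageI)
qed

theorem proposition2p8:
  fixes \<iota> :: "'a::euclidean_space \<Rightarrow> real ^ 'n"
    and pr :: "real ^ 'n \<Rightarrow> 't::real_vector"
    and A :: "'n \<Rightarrow> 'a dual"
    and lam :: "nat \<Rightarrow> 'a"
    and \<gamma> :: "(nat \<Rightarrow> 'a dual set) \<Rightarrow> nat \<Rightarrow> 'a dual"
    and N \<tau> :: real
    and z :: "complex ^ 'n"
    and F :: "nat \<Rightarrow> 'a dual set"
    and \<phi> :: "'a cplx \<Rightarrow> complex"
    and \<epsilon> :: "nat \<Rightarrow> real"
  assumes "short_exact \<iota> pr"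
    and "full_rank_lattice (pr ` std_lattice)"
    and "\<And>i x. A i x = \<iota> x $ i"
    and "projective A"
    and "int_basis DIM('a) lam (sublattice \<iota>)"
    and "\<And>G. G \<in> flags A \<Longrightarrow> flag_basis lam G (\<gamma> G)"
    and "sufficient_pair A lam \<gamma> N \<tau>"
    and "\<And>i. z $ i \<noteq> 0"
    and "tau_regular A \<tau> (psi A z)"
    and "F \<in> flags_at A (psi A z)"
    and "holomorphic_cplx \<phi> (UFN (\<gamma> F) N)"
    and "radii DIM('a) N \<epsilon>"
  shows "finite (O_set A (sublattice \<iota>) z \<inter> UFN (\<gamma> F) N) \<and>
    (\<lambda>l. norm (torus_coeff A lam (\<gamma> F) \<epsilon> \<phi> l * z_pow A z l)) summable_on sublattice \<iota> \<and>
    (\<Sum>u \<in> O_set A (sublattice \<iota>) z \<inter> UFN (\<gamma> F) N. \<phi> u) =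
      of_int (nu A lam F) / (2 * of_real pi * \<i>) ^ DIM('a) *
        (\<Sum>\<^sub>\<infinity>l\<in>sublattice \<iota>. torus_coeff A lam (\<gamma> F) \<epsilon> \<phi> l * z_pow A z l)"
proof -
  let ?r = "DIM('a)" and ?g = "\<gamma> F" and ?L = "sublattice \<iota>" and ?\<xi> = "psi A z"
  note A = assms(3) and pr = assms(4) and ib = assms(5) and basis = assms(6) and suff = assms(7)
    and z = assms(8) and reg = assms(9) and at = assms(10) and \<phi> = assms(11) and \<epsilon> = assms(12)
  have F: "F \<in> flags A" using at by (simp add: flags_at_def)
  have proper: "proper_flag A F" by (rule regular_flag_proper[OF pr reg at])
  note s = suff[unfolded sufficient_pair_def]
  note s2 = conjunct2[OF s] note s3 = conjunct2[OF s2] note s4 = conjunct2[OF s3]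
  note s5 = conjunct2[OF s4] note s6 = conjunct2[OF s5]
  have N: "N > 0" by (rule conjunct1[OF s])
  have \<tau>: "\<tau> > 0" by (rule conjunct1[OF s2])
  have disj: "UFN (\<gamma> G) N \<inter> UFN (\<gamma> H) N = {}" if "G \<in> flags A" "H \<in> flags A" "G \<noteq> H" for G H
    using bspec[OF bspec[OF conjunct1[OF s3] that(1)] that(2)] that(3) by (rule mp)
  have sub: "UFN (\<gamma> G) N \<subseteq> U_set A" if "G \<in> flags A" for G
    by (rule conjunct1[OF bspec[OF conjunct1[OF s4] that]])
  have nonsing: "bij_betw (\<lambda>v. \<lambda>j\<in>{1..?r}. dp A (lam j) u v) UNIV ({1..?r} \<rightarrow>\<^sub>E UNIV)" if "u \<in> UFN ?g N" for u
    by (rule bspec[OF mp[OF bspec[OF conjunct1[OF s5] F] proper] that])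
  have comp: "compact {u \<in> U_set A. Psi A u \<in> K}" if "compact K" "K \<subseteq> {\<xi>. tau_regular A \<tau> \<xi>}" for K
    by (rule mp[OF spec[OF conjunct1[OF s6]] conjI[OF that]])
  have cover: "{u \<in> U_set A. Psi A u = \<xi>} \<subseteq> (\<Union>G\<in>flags_at A \<xi>. UFN (\<gamma> G) N)" if "tau_regular A \<tau> \<xi>" for \<xi>
    by (rule mp[OF spec[OF conjunct2[OF s6]] that])
  have lam_L: "lam j \<in> ?L" if j: "j \<in> {1..?r}" for j
  proof -
    let ?m = "\<lambda>k\<in>{1..?r}. if k = j then 1 else 0 :: int"
    have "(\<Sum>k\<in>{1..?r}. of_int (?m k) *\<^sub>R lam k) = (\<Sum>k\<in>{1..?r}. if k = j then lam k else 0)"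
      by (rule sum.cong) auto
    also have "\<dots> = lam j" using j by simp
    finally have "lam j = (\<Sum>k\<in>{1..?r}. of_int (?m k) *\<^sub>R lam k)" ..
    moreover have "?m \<in> {1..?r} \<rightarrow>\<^sub>E UNIV" by auto
    ultimately show ?thesis using ib unfolding int_basis_def bij_betw_def by blast
  qed
  interpret fd: flag_data A lam ?g F N
  proof
    obtain x where "\<And>i. A i x > 0" using pr unfolding projective_def by blast
    then show "A i \<noteq> 0" for i by (metis blinfun.zero_left less_irrefl)
    show "A i (lam j) \<in> \<int>" if "j \<in> {1..?r}" for i j
      using lam_L[OF that] by (simp add: A sublattice_def std_lattice_def)
  qed (use F basis[OF F] N sub[OF F] nonsing proper in auto)
  \<comment> \<open>the other chambers are open and cover the rest of the compact set, which leaves a compact part in the chamber of \<open>F\<close>\<close>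
  have comp_F: "compact ({u \<in> U_set A. Psi A u \<in> K} \<inter> UFN ?g N)"
    if K: "compact K" "K \<subseteq> {\<xi>. tau_regular A \<tau> \<xi>}" for K
  proof -
    let ?S = "{u \<in> U_set A. Psi A u \<in> K}" and ?O = "\<Union>G\<in>flags A - {F}. UFN (\<gamma> G) N"
    have S: "?S \<inter> UFN ?g N = ?S - ?O"
    proof (intro equalityI subsetI)
      fix u assume "u \<in> ?S - ?O"
      moreover from this have "u \<in> (\<Union>G\<in>flags_at A (Psi A u). UFN (\<gamma> G) N)"
        using cover[of "Psi A u"] K(2) by blast
      moreover have "flags_at A (Psi A u) \<subseteq> flags A" by (auto simp: flags_at_def)
      ultimately show "u \<in> ?S \<inter> UFN ?g N" by blast
    qed (use disj[OF F] in blast)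
    show ?thesis
      unfolding S by (intro compact_diff comp[OF K] open_UN ballI UFN_open)
  qed
  define \<rho> where "\<rho> = fd.ev ?\<xi>"
  have "open (fd.dv -` {\<xi>. tau_regular A \<tau> \<xi>})"
    by (rule open_vimage[OF tau_regular_open fd.dv_continuous])
  moreover have "\<rho> \<in> fd.dv -` {\<xi>. tau_regular A \<tau> \<xi>}" using reg by (simp add: \<rho>_def)
  ultimately obtain \<delta> where \<delta>: "\<delta> > 0" "\<And>y. y \<in> ball \<rho> \<delta> \<Longrightarrow> tau_regular A \<tau> (fd.dv y)"
    unfolding open_contains_ball by blast
  \<comment> \<open>a convex open set of regular directions that contains all multiples \<open>c *\<^sub>R \<rho>\<close> with \<open>c \<ge> 1\<close>\<close>
  define D where "D = (\<Union>c\<in>{1..}. (\<lambda>y. c *\<^sub>R y) ` ball \<rho> \<delta>)"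
  have cone: "c *\<^sub>R \<rho> \<in> D" if "c \<ge> 1" for c
    unfolding D_def using that \<delta>(1) by (intro UN_I[of c] imageI) auto
  have D_reg: "tau_regular A \<tau> (fd.dv y)" if y: "y \<in> D" for y
  proof -
    obtain c x where cx: "c \<in> {1..}" "x \<in> ball \<rho> \<delta>" "y = c *\<^sub>R x" using y unfolding D_def by blast
    have "fd.dv y = c *\<^sub>R fd.dv x" by (simp add: fd.ev_inject[symmetric] fd.ev_scale cx(3))
    then show ?thesis using tau_regular_scale[OF \<delta>(2)[OF cx(2)] _ \<tau>] cx(1) by simp
  qed
  interpret pc: proper_chart fd.cf fd.ne fd.ld fd.Om "ln N" D
    by (rule fd.proper_chart[OF comp_F _ _ D_reg]) (simp_all add: D_def open_scaled_ball convex_scaled_ball)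
  define w :: "(complex, 'a idx) vec" where "w = (\<chi> j. Ln (z_pow A z (lam (nt j))))"
  define E :: "(real, 'a idx) vec" where "E = (\<chi> k. ln (\<epsilon> (nt k)))"
  have z_nz: "z_pow A z l \<noteq> 0" for l using z by (simp add: z_pow_def)
  have expw: "expv w = (\<chi> j. z_pow A z (lam (nt j)))" using z_nz by (simp add: w_def vec_eq_iff)
  have "re_vec w = \<rho>" unfolding \<rho>_def vec_eq_iff fd.ln_z_pow[OF z, symmetric] using z_nz by (simp add: w_def)
  then have w: "re_vec w \<in> D" using cone[of 1] by simp
  have deep: "\<exists>\<eta>\<in>deepset M. re_vec pc.cst + pc.B *v \<eta> \<in> D \<and>
      (\<forall>u\<in>pc.W. logv (prod_map fd.cf fd.ne u) = re_vec pc.cst + pc.B *v \<eta> \<longrightarrow> logv u \<in> deepset M)" for M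
  proof (rule fd.deep_slice[OF reg at \<tau>])
    show "\<exists>c0. \<forall>c\<ge>c0. \<forall>u\<in>U_set A \<inter> UFN ?g N. Psi A u = c *\<^sub>R ?\<xi> \<longrightarrow>
        (\<forall>j\<in>{1..<?r}. X * norm (cpair (?g j) u) < norm (cpair (?g (Suc j)) u))" for X
      by (rule deep_fibers[OF basis pr \<tau> N _ F reg]) (use disj[OF F] in auto)
    show "c *\<^sub>R fd.ev ?\<xi> \<in> D" if "c \<ge> 1" for c using cone[OF that] by (simp add: \<rho>_def)
  qed
  define C :: complex where "C = of_int (nu A lam F) / (2 * of_real pi * \<i>) ^ ?r"
  define T where "T m = torus_coeff A lam ?g \<epsilon> \<phi> (fd.lv m) * z_pow A z (fd.lv m)" for m
  have C: "C \<noteq> 0" by (auto simp: C_def nu_def)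
  have E: "E \<in> fd.Om" unfolding E_def by (rule fd.radii_Om[OF \<epsilon>])
  have zexp: "exp (ndot m w) = z_pow A z (fd.lv m)" for m
    using z_nz by (simp add: fd.z_pow_lv[OF z] ndot_def exp_sum w_def exp_power_int[symmetric])
  \<comment> \<open>the factor \<open>\<i> ^ r\<close> contained in the torus coefficient turns \<open>(2 \<pi>) ^ r\<close> into \<open>(2 \<pi> \<i>) ^ r\<close>\<close>
  have coeff: "of_real (sgn (det pc.B)) / of_real (2 * pi) ^ CARD('a idx) *
      integral tcube (\<lambda>\<theta>. \<phi> (fd.CCi (expv (cvec E \<theta>))) * pc.monomial m (expv (cvec E \<theta>)) *
        det (jac fd.cf fd.ne (expv (cvec E \<theta>)))) * exp (ndot m w) = C * T m" for m
  proof -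
    have "of_real (sgn (det pc.B)) = (of_int (nu A lam F) :: complex)"
      unfolding fd.nu_eq[symmetric] by simp
    then show ?thesis
      unfolding T_def C_def zexp fd.torus_coeff_eq[OF \<phi> \<epsilon>] E_def pc.monomial_def card_idx
      by (simp add: power_mult_distrib)
  qed
  note expansion = pc.trace_expansion[OF fd.vec_holo_CCi[OF \<phi>] E w deep, unfolded coeff]
  have O: "O_set A ?L z \<inter> UFN ?g N = fd.CCi ` pc.fiber (expv w)"
    unfolding pc.fiber_def expw
    by (rule fd.O_set_chamber) (use fd.lv_bij[OF ib] z in \<open>auto simp: bij_betw_def\<close>)
  have summ: "(\<lambda>m. norm (T m)) summable_on UNIV"
  proof -
    have "(\<lambda>m. norm C * norm (T m)) summable_on UNIV" using expansion(2) by (simp only: norm_mult)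
    then show ?thesis using summable_on_cmult_right'[of "norm C" "\<lambda>m. norm (T m)"] C by simp
  qed
  have "(\<Sum>u\<in>O_set A ?L z \<inter> UFN ?g N. \<phi> u) = (\<Sum>x\<in>pc.fiber (expv w). \<phi> (fd.CCi x))"
    unfolding O by (rule sum.reindex_cong[OF inj_on_subset[OF fd.CCi_inj subset_UNIV]]) auto
  also have "\<dots> = (\<Sum>\<^sub>\<infinity>m. C * T m)" using infsumI[OF expansion(3)] by simp
  also have "\<dots> = C * (\<Sum>\<^sub>\<infinity>m. T m)" by (rule infsum_cmult_right')
  also have "(\<Sum>\<^sub>\<infinity>m. T m) = (\<Sum>\<^sub>\<infinity>l\<in>?L. torus_coeff A lam ?g \<epsilon> \<phi> l * z_pow A z l)"
    unfolding T_def by (rule infsum_reindex_bij_betw[OF fd.lv_bij[OF ib]])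
  finally have "(\<Sum>u\<in>O_set A ?L z \<inter> UFN ?g N. \<phi> u) = C * (\<Sum>\<^sub>\<infinity>l\<in>?L. torus_coeff A lam ?g \<epsilon> \<phi> l * z_pow A z l)" .
  moreover have "(\<lambda>l. norm (torus_coeff A lam ?g \<epsilon> \<phi> l * z_pow A z l)) summable_on ?L"
    using summ summable_on_reindex_bij_betw[OF fd.lv_bij[OF ib], of "\<lambda>l. norm (torus_coeff A lam ?g \<epsilon> \<phi> l * z_pow A z l)"]
    unfolding T_def by simp
  moreover have "finite (O_set A ?L z \<inter> UFN ?g N)" unfolding O using expansion(1) by simp
  ultimately show ?thesis by (simp add: C_def)
qed

end
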